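(* Let $1<p<\infty$ and let $p<q<\infty$ be such that $q<\frac{Np}{N-p}$ if $p<N$. Let $\Omega\subseteq\mathbb{R}^N$ be an open set such that $\lambda_p(\Omega)>0$. Let $u\in W^{1,p}_0(\Omega)$ be a non-negative weak subsolution of \[ -\Delta_p u=\lambda\,u^{q-1}\qquad\text{in }\Omega, \] for some $\lambda>0$. Then there exist a constant $a>0$ depending only on $p,q$ and $\lambda_p(\Omega)$, and a constant $C>0$ depending on $N,p,q,\lambda,\lambda_p(\Omega)$ and $u$, such that \[ |u(x)|\le C\,\|u\|_{L^q(\Omega)}\,e^{-a|x|},\qquad\text{for a.e. }x\in\mathbb{R}^N . \]
   Context: $W^{1,p}_0(\Omega)$ is the closure of $C^\infty_0(\Omega)$ in $W^{1,p}(\Omega)$; its elements are extended by $0$ outside $\Omega$. $\lambda_p(\Omega)=\inf\{\int_\Omega|\nabla\varphi|^p\,dx:\ \varphi\in C^\infty_0(\Omega),\ \|\varphi\|_{L^p(\Omega)}=1\}$. A non-negative $u\in W^{1,p}_0(\Omega)$ is a weak subsolution of $-\Delta_p u=\lambda u^{q-1}$ in $\Omega$ if $\int_\Omega\langle|\nabla u|^{p-2}\nabla u,\nabla\varphi\rangle\,dx\le\lambda\int_\Omega u^{q-1}\varphi\,dx$ for every non-negative $\varphi\in C^\infty_0(\Omega)$. (Under the hypotheses, $W^{1,p}_0(\Omega)$ is continuously embedded in $L^q(\Omega)$, so $u\in L^q(\Omega)$.) *)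

theory Defs
  imports "HOL-Analysis.Analysis"
begin

text \<open>
  The decay rate in the theorem does not depend on the dimension, so the dimension has to be
  quantified inside the formula and cannot be a type.  The points of \<open>\<real>\<^sup>N\<close> are the elements of
  the extensional function space \<open>{..<N} \<rightarrow>\<^sub>E UNIV\<close>, which is both the carrier of the product
  topology and the space of the product measure.  Functions on \<open>\<real>\<^sup>N\<close> have type
  \<open>point \<Rightarrow> real\<close>; their values outside that carrier play no role.
\<close>

type_synonym point = "nat \<Rightarrow> real"

abbreviation RN :: "nat \<Rightarrow> point topology" where
  "RN N \<equiv> powertop_real {..<N}"

definition lebesgue_RN :: "nat \<Rightarrow> point measure" where
  "lebesgue_RN N = completion (Pi\<^sub>M {..<N} (\<lambda>_. lborel))"

definition enorm :: "nat \<Rightarrow> (nat \<Rightarrow> real) \<Rightarrow> real" where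
  "enorm N v = L2_set v {..<N}"

definition einner :: "nat \<Rightarrow> (nat \<Rightarrow> real) \<Rightarrow> (nat \<Rightarrow> real) \<Rightarrow> real" where
  "einner N v w = (\<Sum>i<N. v i * w i)"


subsection \<open>Test functions\<close>

definition partial :: "nat \<Rightarrow> (point \<Rightarrow> real) \<Rightarrow> point \<Rightarrow> real" where
  "partial i \<phi> x = deriv (\<lambda>t. \<phi> (x(i := t))) (x i)"

definition gradient :: "(point \<Rightarrow> real) \<Rightarrow> point \<Rightarrow> nat \<Rightarrow> real" where
  "gradient \<phi> x = (\<lambda>i. partial i \<phi> x)"

text \<open>
  \<open>\<phi>\<close> is smooth iff its iterated partial derivatives of all orders exist and are continuous;
  \<open>foldr partial is \<phi>\<close> is the iterated derivative along the list of directions \<open>is\<close>.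
  The existence clause is needed because \<open>deriv\<close> is total.
\<close>

definition smooth_RN :: "nat \<Rightarrow> (point \<Rightarrow> real) \<Rightarrow> bool" where
  "smooth_RN N \<phi> \<longleftrightarrow>
    (\<forall>is \<in> lists {..<N}.
       continuous_map (RN N) euclideanreal (foldr partial is \<phi>) \<and>
       (\<forall>i<N. \<forall>x \<in> topspace (RN N).
          (\<lambda>t. foldr partial is \<phi> (x(i := t))) differentiable at (x i)))"

definition supp_RN :: "nat \<Rightarrow> (point \<Rightarrow> real) \<Rightarrow> point set" where
  "supp_RN N \<phi> = (RN N) closure_of {x \<in> topspace (RN N). \<phi> x \<noteq> 0}"

definition test_functions :: "nat \<Rightarrow> point set \<Rightarrow> (point \<Rightarrow> real) set" where
  "test_functions N \<Omega> =
    {\<phi>. smooth_RN N \<phi> \<and> compactin (RN N) (supp_RN N \<phi>) \<and> supp_RN N \<phi> \<subseteq> \<Omega>}"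


subsection \<open>Lebesgue and Sobolev spaces\<close>

definition Lp :: "nat \<Rightarrow> real \<Rightarrow> point set \<Rightarrow> (point \<Rightarrow> real) set" where
  "Lp N p \<Omega> =
    {f. set_borel_measurable (lebesgue_RN N) \<Omega> f \<and>
        set_integrable (lebesgue_RN N) \<Omega> (\<lambda>x. \<bar>f x\<bar> powr p)}"

definition Lp_norm :: "nat \<Rightarrow> real \<Rightarrow> point set \<Rightarrow> (point \<Rightarrow> real) \<Rightarrow> real" where
  "Lp_norm N p \<Omega> f = (LINT x:\<Omega>|lebesgue_RN N. \<bar>f x\<bar> powr p) powr (1 / p)"

definition locally_integrable :: "nat \<Rightarrow> point set \<Rightarrow> (point \<Rightarrow> real) \<Rightarrow> bool" where
  "locally_integrable N \<Omega> f \<longleftrightarrow>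
    (\<forall>K. compactin (RN N) K \<and> K \<subseteq> \<Omega> \<longrightarrow> set_integrable (lebesgue_RN N) K f)"

definition has_weak_gradient ::
    "nat \<Rightarrow> point set \<Rightarrow> (point \<Rightarrow> real) \<Rightarrow> (point \<Rightarrow> nat \<Rightarrow> real) \<Rightarrow> bool" where
  "has_weak_gradient N \<Omega> u g \<longleftrightarrow>
    locally_integrable N \<Omega> u \<and>
    (\<forall>i<N. locally_integrable N \<Omega> (\<lambda>x. g x i) \<and>
       (\<forall>\<phi> \<in> test_functions N \<Omega>.
          (LINT x:\<Omega>|lebesgue_RN N. u x * partial i \<phi> x) =
          - (LINT x:\<Omega>|lebesgue_RN N. g x i * \<phi> x)))"

definition weak_gradient ::
    "nat \<Rightarrow> point set \<Rightarrow> (point \<Rightarrow> real) \<Rightarrow> point \<Rightarrow> nat \<Rightarrow> real" where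
  "weak_gradient N \<Omega> u = (SOME g. has_weak_gradient N \<Omega> u g)"

definition W1p :: "nat \<Rightarrow> real \<Rightarrow> point set \<Rightarrow> (point \<Rightarrow> real) set" where
  "W1p N p \<Omega> =
    {u \<in> Lp N p \<Omega>. (\<exists>g. has_weak_gradient N \<Omega> u g) \<and>
       (\<forall>i<N. (\<lambda>x. weak_gradient N \<Omega> u x i) \<in> Lp N p \<Omega>)}"

definition W1p_norm :: "nat \<Rightarrow> real \<Rightarrow> point set \<Rightarrow> (point \<Rightarrow> real) \<Rightarrow> real" where
  "W1p_norm N p \<Omega> u =
    ((LINT x:\<Omega>|lebesgue_RN N. \<bar>u x\<bar> powr p) +
     (LINT x:\<Omega>|lebesgue_RN N. enorm N (weak_gradient N \<Omega> u x) powr p)) powr (1 / p)"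

text \<open>
  The last clause is the convention that elements of the closure are extended by \<open>0\<close>
  outside \<open>\<Omega>\<close>.
\<close>

definition W1p_zero :: "nat \<Rightarrow> real \<Rightarrow> point set \<Rightarrow> (point \<Rightarrow> real) set" where
  "W1p_zero N p \<Omega> =
    {u \<in> W1p N p \<Omega>.
       (\<forall>\<epsilon>>0. \<exists>\<phi> \<in> test_functions N \<Omega>. W1p_norm N p \<Omega> (\<lambda>x. u x - \<phi> x) < \<epsilon>) \<and>
       (AE x in lebesgue_RN N. x \<notin> \<Omega> \<longrightarrow> u x = 0)}"


subsection \<open>The first eigenvalue and subsolutions\<close>

text \<open>Taking values in \<open>ennreal\<close> makes the infimum over the empty set (case \<open>\<Omega> = {}\<close>) equal to \<open>\<infinity>\<close>.\<close>

definition lambda_p :: "nat \<Rightarrow> real \<Rightarrow> point set \<Rightarrow> ennreal" where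
  "lambda_p N p \<Omega> =
    (INF \<phi> \<in> {\<phi> \<in> test_functions N \<Omega>. Lp_norm N p \<Omega> \<phi> = 1}.
       \<integral>\<^sup>+x\<in>\<Omega>. ennreal (enorm N (gradient \<phi> x) powr p) \<partial>lebesgue_RN N)"

text \<open>
  Where the weak gradient vanishes and \<open>p < 2\<close>, the factor \<open>\<bar>\<nabla>u\<bar>\<^sup>p\<^sup>-\<^sup>2\<close> is \<open>0 powr (p - 2) = 0\<close>, so
  the field \<open>\<bar>\<nabla>u\<bar>\<^sup>p\<^sup>-\<^sup>2 \<nabla>u\<close> is \<open>0\<close> there, as it should be.
\<close>

definition weak_subsolution ::
    "nat \<Rightarrow> real \<Rightarrow> real \<Rightarrow> real \<Rightarrow> point set \<Rightarrow> (point \<Rightarrow> real) \<Rightarrow> bool" where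
  "weak_subsolution N p q lam \<Omega> u \<longleftrightarrow>
    u \<in> W1p_zero N p \<Omega> \<and>
    (AE x in lebesgue_RN N. 0 \<le> u x) \<and>
    (\<forall>\<phi> \<in> test_functions N \<Omega>. (\<forall>x \<in> topspace (RN N). 0 \<le> \<phi> x) \<longrightarrow>
       (LINT x:\<Omega>|lebesgue_RN N.
          einner N (\<lambda>i. enorm N (weak_gradient N \<Omega> u x) powr (p - 2) * weak_gradient N \<Omega> u x i)
                   (gradient \<phi> x))
       \<le> lam * (LINT x:\<Omega>|lebesgue_RN N. u x powr (q - 1) * \<phi> x))"

end

theory Submission
  imports Defs "HOL-Real_Asymp.Real_Asymp"
begin

text \<open>
  Weak derivatives enter only through approximation: the pairs \<open>(v, g)\<close> that are limits of
  \<open>(\<phi>, \<nabla>\<phi>)\<close> with test functions \<open>\<phi>\<close> are closed under multiplication by smooth weights and under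
  truncation \<open>max (v - k) 0\<close>.  Averaging \<open>\<bar>v (x + h) - v x\<bar>\<close> over a cube twice as large as the support
  of \<open>v\<close> gives a Faber-Krahn inequality; applied to truncations at dyadic levels it improves the
  decay exponent of \<open>\<bar>{v > 2 ^ j}\<bar>\<close> step by step, which yields the embedding into \<open>L\<^sup>q\<close> for every
  subcritical \<open>q\<close>.

  For a weight with \<open>\<bar>\<nabla>\<psi>\<bar> \<le> a \<psi>\<close>, testing the equation with \<open>\<psi> powr (p - 1) * max (\<psi> u - k) 0\<close> gives a
  Caccioppoli estimate for \<open>w = \<psi> u\<close>.  With \<open>\<psi> = 1\<close> it drives a De Giorgi iteration, so \<open>u \<le> U\<close>; then
  \<open>u\<^sup>q\<^sup>-\<^sup>1 \<le> U\<^sup>q\<^sup>-\<^sup>p u\<^sup>p\<^sup>-\<^sup>1\<close>, and the same iteration bounds the supremum of \<open>w\<close> by its \<open>L\<^sup>p\<close> norm with a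
  constant independent of \<open>\<psi>\<close>.  Weights concentrated far from the origin show that \<open>u\<close> tends to \<open>0\<close>
  at infinity.  Hence, in the estimate with \<open>k = 0\<close>, the nonlinear term is absorbed outside a ball by
  the Poincare inequality, and for \<open>a\<close> small in terms of \<open>p\<close> and \<open>\<lambda>\<^sub>p\<close> the \<open>L\<^sup>p\<close> norm of \<open>w\<close> is bounded
  uniformly over bounded weights increasing to \<open>exp (a \<langle>x\<rangle>)\<close>.
\<close>

subsection \<open>Smooth functions\<close>

text \<open>The rate \<open>a\<close> must not see the dimension, whereas the embedding and the
  iteration do. So \<open>a\<close> obeys two smallness conditions only:
  \<open>p * a \<le> 1 / 2\<close> absorbs the derivative of the weight in the Caccioppoli estimate,
  and \<open>16 * p * (8 powr p / l) * a \<le> 1\<close> absorbs the remaining terms with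
  \<open>a\<close> through the Poincare inequality. Whatever depends on \<open>N\<close> ends up in
  \<open>C\<close>. A term may be absorbed only if it is finite, and integrability of
  \<open>\<psi> u\<close> is not known in advance for an exponential weight. This forces bounded
  weights, estimates that never mention their bound, and a limit at the very end. The iteration runs
  twice because \<open>q > p\<close> makes the equation superlinear. Without a bound on
  \<open>u\<close>, the initial smallness comes from the tail of the integral of
  \<open>u powr q\<close>; once \<open>u \<le> U\<close>, all terms are homogeneous of degree
  \<open>p\<close> in \<open>w\<close>, and the estimate scales with the height \<open>M\<close>.
  Weak gradients are given up to null sets of the completed measure, while Fubini and translations
  are used on the product measure; Borel representatives, zero outside \<open>\<Omega>\<close>,
  connect the two.\<close>

lemma topspace_RN [simp]: "topspace (RN N) = {..<N} \<rightarrow>\<^sub>E UNIV"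
  by simp

lemma fun_upd_in_RN: "x \<in> {..<N} \<rightarrow>\<^sub>E UNIV \<Longrightarrow> i < N \<Longrightarrow> x(i := t) \<in> {..<N} \<rightarrow>\<^sub>E UNIV"
  by (auto simp: PiE_iff extensional_def)

lemma partial_eqI:
  "((\<lambda>t. \<phi> (x(i := t))) has_real_derivative D) (at (x i)) \<Longrightarrow> partial i \<phi> x = D"
  by (simp add: partial_def DERIV_imp_deriv)

lemma partial_cong_RN:
  assumes "\<And>y. y \<in> {..<N} \<rightarrow>\<^sub>E UNIV \<Longrightarrow> \<phi> y = \<psi> y" "x \<in> {..<N} \<rightarrow>\<^sub>E UNIV" "i < N"
  shows "partial i \<phi> x = partial i \<psi> x"
  unfolding partial_def using assms fun_upd_in_RN[of x N i] by simp

text \<open>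
  On the carrier, each partial derivative of a member agrees with a member, so all members are smooth.
  This avoids formulas for the higher derivatives of products and composites.
\<close>

inductive smooth_algebra :: "nat \<Rightarrow> (point \<Rightarrow> real) \<Rightarrow> bool" for N where
  base: "smooth_RN N \<phi> \<Longrightarrow> smooth_algebra N \<phi>"
| const: "smooth_algebra N (\<lambda>x. c)"
| coord: "i < N \<Longrightarrow> smooth_algebra N (\<lambda>x. x i)"
| add: "smooth_algebra N \<phi> \<Longrightarrow> smooth_algebra N \<psi> \<Longrightarrow> smooth_algebra N (\<lambda>x. \<phi> x + \<psi> x)"
| mult: "smooth_algebra N \<phi> \<Longrightarrow> smooth_algebra N \<psi> \<Longrightarrow> smooth_algebra N (\<lambda>x. \<phi> x * \<psi> x)"
| comp: "open U \<Longrightarrow> (\<And>n t. t \<in> U \<Longrightarrow> (F n has_real_derivative F (Suc n) t) (at t)) \<Longrightarrow>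
    smooth_algebra N \<phi> \<Longrightarrow> (\<And>x. x \<in> {..<N} \<rightarrow>\<^sub>E UNIV \<Longrightarrow> \<phi> x \<in> U) \<Longrightarrow>
    smooth_algebra N (\<lambda>x. F n (\<phi> x))"

lemma smooth_continuous: "smooth_RN N \<phi> \<Longrightarrow> continuous_map (RN N) euclideanreal \<phi>"
  unfolding smooth_RN_def by (drule bspec[of _ _ "[]"]) auto

lemma smooth_has_partial:
  assumes "smooth_RN N \<phi>" "i < N" "x \<in> {..<N} \<rightarrow>\<^sub>E UNIV"
  shows "((\<lambda>t. \<phi> (x(i := t))) has_real_derivative partial i \<phi> x) (at (x i))"
proof -
  have "(\<lambda>t. \<phi> (x(i := t))) differentiable at (x i)"
    using assms unfolding smooth_RN_def by (elim ballE[of _ _ "[]"]) auto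
  then show ?thesis
    unfolding partial_def by (simp add: DERIV_deriv_iff_real_differentiable)
qed

lemma smooth_partial:
  assumes "smooth_RN N \<phi>" "i < N"
  shows "smooth_RN N (partial i \<phi>)"
  unfolding smooth_RN_def
proof
  fix js assume "js \<in> lists {..<N}"
  \<comment> \<open>\<open>foldr\<close> applies the last entry first, so appending \<open>i\<close>
    puts the derivative in direction \<open>i\<close> innermost.\<close>
  then have "js @ [i] \<in> lists {..<N}" using assms by auto
  with assms(1) show "continuous_map (RN N) euclideanreal (foldr partial js (partial i \<phi>)) \<and>
       (\<forall>j<N. \<forall>x\<in>topspace (RN N).
           (\<lambda>t. foldr partial js (partial i \<phi>) (x(j := t))) differentiable at (x j))"
    unfolding smooth_RN_def by (elim ballE[of _ _ "js @ [i]"]) auto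
qed

text \<open>The chain rule turns \<open>F n\<close> into \<open>F (Suc n)\<close>; carrying the
  whole sequence of derivatives is what keeps composites inside the algebra. The derivative is
  produced as a witness \<open>\<psi>\<close>, since a value of \<open>deriv\<close> alone would not
  certify that it exists.\<close>

lemma smooth_algebra_step:
  assumes "smooth_algebra N \<phi>"
  shows "continuous_map (RN N) euclideanreal \<phi> \<and>
    (\<forall>i<N. \<exists>\<psi>. smooth_algebra N \<psi> \<and>
      (\<forall>x \<in> {..<N} \<rightarrow>\<^sub>E UNIV. ((\<lambda>t. \<phi> (x(i := t))) has_real_derivative \<psi> x) (at (x i))))"
  using assms
proof (induction rule: smooth_algebra.induct)
  case (base \<phi>)
  have "\<exists>\<psi>. smooth_algebra N \<psi> \<and>
      (\<forall>x \<in> {..<N} \<rightarrow>\<^sub>E UNIV. ((\<lambda>t. \<phi> (x(i := t))) has_real_derivative \<psi> x) (at (x i)))" if "i < N" for i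
    using smooth_has_partial[OF base that] smooth_algebra.base[OF smooth_partial[OF base that]]
    by (intro exI[of _ "partial i \<phi>"]) simp
  with smooth_continuous[OF base] show ?case by blast
next
  case (const c)
  have "\<exists>\<psi>. smooth_algebra N \<psi> \<and>
      (\<forall>x \<in> {..<N} \<rightarrow>\<^sub>E UNIV. ((\<lambda>t. c) has_real_derivative \<psi> x) (at (x i)))" for i
    by (rule exI[of _ "\<lambda>x. 0"]) (simp add: smooth_algebra.const)
  then show ?case by simp
next
  case (coord j)
  have "\<exists>\<psi>. smooth_algebra N \<psi> \<and>
      (\<forall>x \<in> {..<N} \<rightarrow>\<^sub>E UNIV. ((\<lambda>t. (x(i := t)) j) has_real_derivative \<psi> x) (at (x i)))" if "i < N" for i
    by (cases "i = j"; rule exI[of _ "\<lambda>x. if i = j then 1 else 0"]) (simp_all add: smooth_algebra.const)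
  moreover have "continuous_map (RN N) euclideanreal (\<lambda>x. x j)"
    using coord by (intro continuous_map_product_projection) auto
  ultimately show ?case by blast
next
  case (add \<phi> \<psi>)
  have "\<exists>\<rho>. smooth_algebra N \<rho> \<and>
      (\<forall>x \<in> {..<N} \<rightarrow>\<^sub>E UNIV. ((\<lambda>t. \<phi> (x(i := t)) + \<psi> (x(i := t))) has_real_derivative \<rho> x) (at (x i)))"
    if "i < N" for i
  proof -
    from add.IH(1) that obtain \<phi>' where "smooth_algebra N \<phi>'"
      "\<And>x. x \<in> {..<N} \<rightarrow>\<^sub>E UNIV \<Longrightarrow> ((\<lambda>t. \<phi> (x(i := t))) has_real_derivative \<phi>' x) (at (x i))"
      by blast
    moreover from add.IH(2) that obtain \<psi>' where "smooth_algebra N \<psi>'"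
      "\<And>x. x \<in> {..<N} \<rightarrow>\<^sub>E UNIV \<Longrightarrow> ((\<lambda>t. \<psi> (x(i := t))) has_real_derivative \<psi>' x) (at (x i))"
      by blast
    ultimately show ?thesis
      by (intro exI[of _ "\<lambda>x. \<phi>' x + \<psi>' x"] conjI ballI smooth_algebra.add DERIV_add)
  qed
  moreover have "continuous_map (RN N) euclideanreal (\<lambda>x. \<phi> x + \<psi> x)"
    using add.IH by (intro continuous_map_add) auto
  ultimately show ?case by blast
next
  case (mult \<phi> \<psi>)
  have "\<exists>\<rho>. smooth_algebra N \<rho> \<and>
      (\<forall>x \<in> {..<N} \<rightarrow>\<^sub>E UNIV. ((\<lambda>t. \<phi> (x(i := t)) * \<psi> (x(i := t))) has_real_derivative \<rho> x) (at (x i)))"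
    if "i < N" for i
  proof -
    from mult.IH(1) that obtain \<phi>' where "smooth_algebra N \<phi>'"
      "\<And>x. x \<in> {..<N} \<rightarrow>\<^sub>E UNIV \<Longrightarrow> ((\<lambda>t. \<phi> (x(i := t))) has_real_derivative \<phi>' x) (at (x i))"
      by blast
    moreover from mult.IH(2) that obtain \<psi>' where "smooth_algebra N \<psi>'"
      "\<And>x. x \<in> {..<N} \<rightarrow>\<^sub>E UNIV \<Longrightarrow> ((\<lambda>t. \<psi> (x(i := t))) has_real_derivative \<psi>' x) (at (x i))"
      by blast
    ultimately show ?thesis
      using mult.hyps
      by (intro exI[of _ "\<lambda>x. \<phi>' x * \<psi> x + \<psi>' x * \<phi> x"] conjI ballI
          smooth_algebra.add smooth_algebra.mult DERIV_mult[THEN DERIV_cong]) auto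
  qed
  moreover have "continuous_map (RN N) euclideanreal (\<lambda>x. \<phi> x * \<psi> x)"
    using mult.IH by (intro continuous_map_real_mult) auto
  ultimately show ?case by blast
next
  case (comp U F \<phi> n)
  have "\<exists>\<rho>. smooth_algebra N \<rho> \<and>
      (\<forall>x \<in> {..<N} \<rightarrow>\<^sub>E UNIV. ((\<lambda>t. F n (\<phi> (x(i := t)))) has_real_derivative \<rho> x) (at (x i)))"
    if "i < N" for i
  proof -
    from comp.IH that obtain \<phi>' where "smooth_algebra N \<phi>'"
      "\<And>x. x \<in> {..<N} \<rightarrow>\<^sub>E UNIV \<Longrightarrow> ((\<lambda>t. \<phi> (x(i := t))) has_real_derivative \<phi>' x) (at (x i))"
      by blast
    then show ?thesis
      using comp.hyps
      by (intro exI[of _ "\<lambda>x. F (Suc n) (\<phi> x) * \<phi>' x"] conjI ballI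
        smooth_algebra.comp[of U F] smooth_algebra.mult DERIV_chain2[of "F n"]) auto
  qed
  moreover have "continuous_map (RN N) euclideanreal (\<lambda>x. F n (\<phi> x))"
  proof -
    have "continuous_on U (F n)"
      using comp.hyps by (meson DERIV_continuous_on has_field_derivative_at_within)
    then have "continuous_map (top_of_set U) euclideanreal (F n)" by simp
    moreover have "continuous_map (RN N) (top_of_set U) \<phi>"
      using comp by (auto simp: continuous_map_in_subtopology)
    ultimately show ?thesis
      using continuous_map_compose[of "RN N" "top_of_set U" \<phi> euclideanreal "F n"] by (simp add: o_def)
  qed
  ultimately show ?case by blast
qed

text \<open>Iterated derivatives agree with a member of the algebra on the carrier only, but this
  suffices: a coordinate line through a carrier point stays in the carrier, so the agreement
  survives each further derivative.\<close>

lemma smooth_algebra_imp_smooth: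
  assumes "smooth_algebra N \<phi>"
  shows "smooth_RN N \<phi>"
proof -
  have *: "\<exists>\<psi>. smooth_algebra N \<psi> \<and> (\<forall>x \<in> {..<N} \<rightarrow>\<^sub>E UNIV. foldr partial is \<phi> x = \<psi> x)"
    if "is \<in> lists {..<N}" for "is"
    using that
  proof (induction rule: lists.induct)
    case Nil
    then show ?case using assms by auto
  next
    case (Cons i "is")
    then obtain \<psi> where \<psi>: "smooth_algebra N \<psi>" "\<And>x. x \<in> {..<N} \<rightarrow>\<^sub>E UNIV \<Longrightarrow> foldr partial is \<phi> x = \<psi> x"
      by blast
    have "i < N" using Cons.hyps by auto
    with smooth_algebra_step[OF \<psi>(1)] obtain \<psi>' where \<psi>': "smooth_algebra N \<psi>'"
      "\<And>x. x \<in> {..<N} \<rightarrow>\<^sub>E UNIV \<Longrightarrow> ((\<lambda>t. \<psi> (x(i := t))) has_real_derivative \<psi>' x) (at (x i))"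
      by blast
    have "foldr partial (i # is) \<phi> x = \<psi>' x" if "x \<in> {..<N} \<rightarrow>\<^sub>E UNIV" for x
      using partial_cong_RN[of N "foldr partial is \<phi>" \<psi> x i] \<psi>(2) that \<open>i < N\<close> partial_eqI[OF \<psi>'(2)[OF that]]
      by simp
    with \<psi>'(1) show ?case by blast
  qed
  show ?thesis
    unfolding smooth_RN_def
  proof
    fix "is" assume "is \<in> lists {..<N}"
    from *[OF this] obtain \<psi> where \<psi>: "smooth_algebra N \<psi>"
      "\<And>x. x \<in> {..<N} \<rightarrow>\<^sub>E UNIV \<Longrightarrow> foldr partial is \<phi> x = \<psi> x"
      by auto
    note st = smooth_algebra_step[OF \<psi>(1)]
    have "continuous_map (RN N) euclideanreal (foldr partial is \<phi>)"
      using st \<psi>(2) continuous_map_eq[of "RN N" euclideanreal \<psi> "foldr partial is \<phi>"] by auto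
    moreover have "(\<lambda>t. foldr partial is \<phi> (x(i := t))) differentiable at (x i)"
      if "i < N" "x \<in> topspace (RN N)" for i x
    proof -
      have "(\<lambda>t. foldr partial is \<phi> (x(i := t))) = (\<lambda>t. \<psi> (x(i := t)))"
        using that by (intro ext \<psi>(2) fun_upd_in_RN) auto
      then show ?thesis
        using st that unfolding real_differentiable_def by (metis topspace_RN)
    qed
    ultimately show "continuous_map (RN N) euclideanreal (foldr partial is \<phi>) \<and>
       (\<forall>i<N. \<forall>x\<in>topspace (RN N). (\<lambda>t. foldr partial is \<phi> (x(i := t))) differentiable at (x i))"
      by blast
  qed
qed

lemma smooth_const: "smooth_RN N (\<lambda>x. c)"
  by (rule smooth_algebra_imp_smooth, rule smooth_algebra.const)

lemma smooth_coord: "i < N \<Longrightarrow> smooth_RN N (\<lambda>x. x i)"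
  by (rule smooth_algebra_imp_smooth, rule smooth_algebra.coord) assumption

lemma smooth_add: "smooth_RN N \<phi> \<Longrightarrow> smooth_RN N \<psi> \<Longrightarrow> smooth_RN N (\<lambda>x. \<phi> x + \<psi> x)"
  by (rule smooth_algebra_imp_smooth, rule smooth_algebra.add) (rule smooth_algebra.base, assumption)+

lemma smooth_mult: "smooth_RN N \<phi> \<Longrightarrow> smooth_RN N \<psi> \<Longrightarrow> smooth_RN N (\<lambda>x. \<phi> x * \<psi> x)"
  by (rule smooth_algebra_imp_smooth, rule smooth_algebra.mult) (rule smooth_algebra.base, assumption)+

lemma smooth_comp:
  assumes "open U" "\<And>n t. t \<in> U \<Longrightarrow> (F n has_real_derivative F (Suc n) t) (at t)"
    "smooth_RN N \<phi>" "\<And>x. x \<in> {..<N} \<rightarrow>\<^sub>E UNIV \<Longrightarrow> \<phi> x \<in> U"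
  shows "smooth_RN N (\<lambda>x. F n (\<phi> x))"
  by (rule smooth_algebra_imp_smooth, rule smooth_algebra.comp[of U F])
    (use assms in \<open>auto intro: smooth_algebra.base\<close>)

lemma smooth_diff: "smooth_RN N \<phi> \<Longrightarrow> smooth_RN N \<psi> \<Longrightarrow> smooth_RN N (\<lambda>x. \<phi> x - \<psi> x)"
  using smooth_add[of N \<phi> "\<lambda>x. (-1) * \<psi> x"] smooth_mult[OF smooth_const, of N \<psi> "-1"] by simp

lemma smooth_sum:
  "finite J \<Longrightarrow> (\<And>i. i \<in> J \<Longrightarrow> smooth_RN N (f i)) \<Longrightarrow> smooth_RN N (\<lambda>x. \<Sum>i\<in>J. f i x)"
  by (induction rule: finite_induct) (auto intro: smooth_const smooth_add)

lemma smooth_prod: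
  "finite J \<Longrightarrow> (\<And>i. i \<in> J \<Longrightarrow> smooth_RN N (f i)) \<Longrightarrow> smooth_RN N (\<lambda>x. \<Prod>i\<in>J. f i x)"
  by (induction rule: finite_induct) (auto intro: smooth_const smooth_mult)

lemma smooth_exp: "smooth_RN N \<phi> \<Longrightarrow> smooth_RN N (\<lambda>x. exp (\<phi> x))"
  by (rule smooth_comp[of UNIV "\<lambda>_. exp"]) auto

lemma smooth_powr:
  assumes "smooth_RN N \<phi>" "\<And>x. x \<in> {..<N} \<rightarrow>\<^sub>E UNIV \<Longrightarrow> 0 < \<phi> x"
  shows "smooth_RN N (\<lambda>x. \<phi> x powr s)"
proof -
  \<comment> \<open>The \<open>n\<close>-th derivative of \<open>t powr s\<close>; the product is
    the falling factorial.\<close>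
  define F where "F n t = (\<Prod>j<n. s - real j) * t powr (s - real n)" for n t
  have "(F n has_real_derivative F (Suc n) t) (at t)" if "0 < t" for n t
    unfolding F_def
    using DERIV_cmult[OF has_real_derivative_powr[OF that, of "s - real n"], of "\<Prod>j<n. s - real j"]
    by (simp add: algebra_simps)
  then have "smooth_RN N (\<lambda>x. F 0 (\<phi> x))"
    by (intro smooth_comp[of "{0<..}" F]) (use assms in auto)
  then show ?thesis by (simp add: F_def)
qed

text \<open>The classical smooth function that vanishes to infinite order at 0. It yields bump
  functions for boxes as well as smooth substitutes for the positive part.\<close>

definition flat :: "real \<Rightarrow> real" where
  "flat t = (if 0 < t then exp (- 1 / t) else 0)"

text \<open>With \<open>s = 1 / h\<close> this covers the difference quotient at 0 of
  \<open>poly P (1 / t) * exp (- 1 / t)\<close>. The power \<open>s ^ k\<close> is carried along so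
  that the induction can move one factor \<open>s\<close> out of \<open>pCons a P\<close>.\<close>

lemma tendsto_power_mult_poly_div_exp: "((\<lambda>s. s ^ k * poly P s / exp s) \<longlongrightarrow> (0::real)) at_top"
proof (induction P arbitrary: k)
  case 0
  then show ?case by simp
next
  case (pCons a P)
  have "((\<lambda>s. a * (s ^ k / exp s) + s ^ Suc k * poly P s / exp s) \<longlongrightarrow> a * 0 + 0) at_top"
    by (intro tendsto_intros tendsto_power_div_exp_0 pCons.IH)
  then show ?case by (simp add: field_simps)
qed

lemma smooth_flat:
  assumes "smooth_RN N \<phi>"
  shows "smooth_RN N (\<lambda>x. flat (\<phi> x))"
proof -
  \<comment> \<open>For \<open>t > 0\<close> the \<open>n\<close>-th derivative of
    \<open>flat\<close> is \<open>P n\<close> at \<open>s = 1 / t\<close> times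
    \<open>exp (- s)\<close>; differentiating once more produces
    \<open>s\<^sup>2 (P - P')\<close>.\<close>
  define P :: "nat \<Rightarrow> real poly" where "P = rec_nat 1 (\<lambda>_ Q. [:0, 0, 1:] * (Q - pderiv Q))"
  define F where "F n t = (if 0 < t then poly (P n) (1 / t) * exp (- 1 / t) else 0)" for n and t :: real
  have P: "P 0 = 1" "P (Suc n) = [:0, 0, 1:] * (P n - pderiv (P n))" for n
    by (simp_all add: P_def)
  have "(F n has_real_derivative F (Suc n) t) (at t)" for n t
  proof (cases "t = 0")
    case False
    have "((\<lambda>t. if t \<in> {0<..} then poly (P n) (1 / t) * exp (- 1 / t) else 0) has_real_derivative F (Suc n) t) (at t)"
    proof (cases "0 < t")
      case True
      have inv: "((\<lambda>t. 1 / t) has_real_derivative - (1 / t)\<^sup>2) (at t)"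
        using True by (auto intro!: derivative_eq_intros simp: power2_eq_square)
      have minv: "((\<lambda>t. - 1 / t) has_real_derivative (1 / t)\<^sup>2) (at t)"
        using True by (auto intro!: derivative_eq_intros simp: power2_eq_square)
      have "((\<lambda>t. poly (P n) (1 / t) * exp (- 1 / t)) has_real_derivative
        poly (pderiv (P n)) (1 / t) * (- (1 / t)\<^sup>2) * exp (- 1 / t) +
        exp (- 1 / t) * (1 / t)\<^sup>2 * poly (P n) (1 / t)) (at t)"
        by (intro DERIV_mult DERIV_chain2[OF poly_DERIV inv] DERIV_chain2[OF DERIV_exp minv])
      also have "poly (pderiv (P n)) (1 / t) * (- (1 / t)\<^sup>2) * exp (- 1 / t) +
        exp (- 1 / t) * (1 / t)\<^sup>2 * poly (P n) (1 / t) = F (Suc n) t"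
        unfolding F_def P using True by (simp add: algebra_simps power2_eq_square)
      finally have "((\<lambda>t. poly (P n) (1 / t) * exp (- 1 / t)) has_real_derivative F (Suc n) t) (at t)" .
      then show ?thesis
        by (rule has_field_derivative_transform_within_open[of _ _ _ "{0<..}"]) (use True in auto)
    next
      case neg: False
      have "((\<lambda>t. 0) has_real_derivative F (Suc n) t) (at t)"
        using neg by (simp add: F_def)
      then show ?thesis
        by (rule has_field_derivative_transform_within_open[of _ _ _ "{..<0}"]) (use neg False in auto)
    qed
    then show ?thesis by (simp add: F_def[abs_def])
  next
    case True
    have "((\<lambda>h. F n h / h) \<longlongrightarrow> 0) (at_right 0)"
    proof -
      have "((\<lambda>s. s ^ 1 * poly (P n) s / exp s) \<longlongrightarrow> 0) at_top"
        by (rule tendsto_power_mult_poly_div_exp)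
      then have "((\<lambda>h. (inverse h) ^ 1 * poly (P n) (inverse h) / exp (inverse h)) \<longlongrightarrow> 0) (at_right 0)"
        by (rule filterlim_compose) (rule filterlim_inverse_at_top_right)
      then show ?thesis
        by (rule Lim_transform_eventually)
          (auto simp: F_def eventually_at_right_field exp_minus field_simps intro!: exI[of _ 1])
    qed
    moreover have "((\<lambda>h. F n h / h) \<longlongrightarrow> 0) (at_left 0)"
      by (rule tendsto_eventually) (auto simp: F_def eventually_at_left_field intro!: exI[of _ "-1"])
    ultimately have "((\<lambda>h. F n h / h) \<longlongrightarrow> 0) (at 0)"
      by (simp add: filterlim_split_at)
    then show ?thesis
      using True by (simp add: has_field_derivative_iff F_def)
  qed
  then have "smooth_RN N (\<lambda>x. F 0 (\<phi> x))"
    by (intro smooth_comp[of UNIV F]) (use assms in auto)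
  moreover have "F 0 = flat" by (auto simp: F_def flat_def P)
  ultimately show ?thesis by simp
qed

subsection \<open>Lebesgue measure on the carrier\<close>

abbreviation PM :: "nat \<Rightarrow> point measure" where
  "PM N \<equiv> Pi\<^sub>M {..<N} (\<lambda>_. lborel)"

lemma space_PM: "space (PM N) = {..<N} \<rightarrow>\<^sub>E UNIV"
  by (simp add: space_PiM)

text \<open>\<open>restrict\<close> retracts the whole type \<open>point\<close> onto the carrier,
  so continuity and openness in \<open>RN N\<close> can be pulled back to the topology of the type,
  where Borel sets are available.\<close>

lemma continuous_map_restrict_RN:
  "continuous_map euclidean (RN N) (\<lambda>x. restrict x {..<N})"
proof -
  have "continuous_map euclidean euclideanreal (\<lambda>x. x k)" for k :: nat
    by (simp add: continuous_on_product_coordinates)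
  then show ?thesis
    by (auto simp: continuous_map_componentwise)
qed

text \<open>Coordinates beyond \<open>N\<close> are constantly \<open>undefined\<close> on the
  carrier, so every coordinate of the inclusion is measurable.\<close>

lemma measurable_PM_borel: "(\<lambda>x. x) \<in> measurable (PM N) (borel :: point measure)"
proof -
  have "(\<lambda>x. x i) \<in> borel_measurable (PM N)" for i
  proof (cases "i < N")
    case True
    then show ?thesis by (simp add: measurable_component_singleton)
  next
    case False
    then have "(\<lambda>x. x i) \<in> borel_measurable (PM N) \<longleftrightarrow> (\<lambda>x. undefined :: real) \<in> borel_measurable (PM N)"
      by (intro measurable_cong) (auto simp: space_PM PiE_iff extensional_def)
    then show ?thesis by simp
  qed
  then have "(\<lambda>x. x) \<in> measurable (PM N) (Pi\<^sub>M UNIV (\<lambda>_. borel))"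
    by (intro measurable_PiM_single') (auto simp: space_PiM)
  then show ?thesis
    using measurable_cong_sets[OF refl sets_PiM_equal_borel] by blast
qed

lemma continuous_measurable_PM:
  assumes "continuous_map (RN N) euclideanreal f"
  shows "f \<in> borel_measurable (PM N)"
proof -
  have "continuous_map euclidean euclideanreal (f \<circ> (\<lambda>x. restrict x {..<N}))"
    using continuous_map_restrict_RN assms by (rule continuous_map_compose)
  then have "continuous_on UNIV (f \<circ> (\<lambda>x. restrict x {..<N}))" by simp
  then have "f \<circ> (\<lambda>x. restrict x {..<N}) \<in> borel_measurable borel"
    by (rule borel_measurable_continuous_onI)
  from measurable_compose[OF measurable_PM_borel this]
  have "(\<lambda>x. f (restrict x {..<N})) \<in> borel_measurable (PM N)"
    by (simp add: o_def)
  then show ?thesis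
    by (subst measurable_cong[where g="\<lambda>x. f (restrict x {..<N})"]) (auto simp: space_PM PiE_restrict)
qed

lemma openin_sets_PM:
  assumes "openin (RN N) \<Omega>"
  shows "\<Omega> \<in> sets (PM N)"
proof -
  have "open ((\<lambda>x. restrict x {..<N}) -` \<Omega>)"
    using openin_continuous_map_preimage[OF continuous_map_restrict_RN assms]
    by (simp add: vimage_def)
  then have "(\<lambda>x. x) -` ((\<lambda>x. restrict x {..<N}) -` \<Omega>) \<inter> space (PM N) \<in> sets (PM N)"
    by (intro measurable_sets[OF measurable_PM_borel]) auto
  moreover have "(\<lambda>x. x) -` ((\<lambda>x. restrict x {..<N}) -` \<Omega>) \<inter> space (PM N) = \<Omega>"
    using openin_subset[OF assms] by (auto simp: space_PM PiE_restrict subset_iff)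
  ultimately show ?thesis by simp
qed

lemma compactin_RN_bounded:
  assumes "compactin (RN N) K"
  obtains R where "0 < R" "\<And>x i. x \<in> K \<Longrightarrow> i < N \<Longrightarrow> \<bar>x i\<bar> \<le> R"
proof -
  have "\<exists>r. \<forall>x\<in>K. \<bar>x i\<bar> \<le> r" if "i < N" for i
  proof -
    have "continuous_map (RN N) euclideanreal (\<lambda>x. x i)"
      using that by (intro continuous_map_product_projection) auto
    then have "compact ((\<lambda>x. x i) ` K)"
      using image_compactin[OF assms, of euclideanreal "\<lambda>x. x i"] by simp
    then show ?thesis
      using compact_imp_bounded bounded_iff[of "(\<lambda>x. x i) ` K"] by auto
  qed
  then obtain r where r: "\<And>i x. i < N \<Longrightarrow> x \<in> K \<Longrightarrow> \<bar>x i\<bar> \<le> r i" by metis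
  have "\<bar>x i\<bar> \<le> 1 + (\<Sum>i<N. \<bar>r i\<bar>)" if "x \<in> K" "i < N" for x i
  proof -
    have "\<bar>x i\<bar> \<le> r i" using r that by simp
    also have "\<dots> \<le> \<bar>r i\<bar>" by simp
    also have "\<dots> \<le> (\<Sum>i<N. \<bar>r i\<bar>)" using that by (intro member_le_sum) auto
    finally show ?thesis by simp
  qed
  moreover have "0 < 1 + (\<Sum>i<N. \<bar>r i\<bar>)"
    by (smt (verit) sum_nonneg abs_ge_zero)
  ultimately show ?thesis by (rule that[rotated])
qed

section \<open>Boxes and translations under the product measure\<close>

interpretation lborel_product: product_sigma_finite "\<lambda>_::nat. lborel :: real measure"
  by standard

lemma sigma_finite_PM: "sigma_finite_measure (PM N)"
  by (intro lborel_product.sigma_finite) auto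

lemma emeasure_PM_box:
  assumes "\<And>i. i < N \<Longrightarrow> a i \<le> b i"
  shows "emeasure (PM N) (Pi\<^sub>E {..<N} (\<lambda>i. {a i..b i})) = ennreal (\<Prod>i<N. b i - a i)"
proof -
  have "emeasure (PM N) (Pi\<^sub>E {..<N} (\<lambda>i. {a i..b i})) = (\<Prod>i<N. emeasure lborel {a i..b i})"
    by (intro lborel_product.emeasure_PiM) auto
  also have "\<dots> = (\<Prod>i<N. ennreal (b i - a i))"
    using assms by (intro prod.cong) auto
  also have "\<dots> = ennreal (\<Prod>i<N. b i - a i)"
    using assms by (intro prod_ennreal) auto
  finally show ?thesis .
qed

definition box_RN :: "nat \<Rightarrow> real \<Rightarrow> point set" where
  "box_RN N R = Pi\<^sub>E {..<N} (\<lambda>_. {-R..R})"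

lemma box_RN_sets [measurable]: "box_RN N R \<in> sets (PM N)"
  unfolding box_RN_def by (intro sets_PiM_I_finite) auto

lemma emeasure_box_RN_finite: "emeasure (PM N) (box_RN N R) < \<infinity>"
proof (cases "0 \<le> R")
  case True
  then show ?thesis
    unfolding box_RN_def by (subst emeasure_PM_box) auto
next
  case False
  show ?thesis
  \<comment> \<open>For \<open>N = 0\<close> the box is a single point even when \<open>R\<close> is
    negative; only for \<open>N > 0\<close> is it empty.\<close>
  proof (cases "N = 0")
    case True
    then show ?thesis
      unfolding box_RN_def using emeasure_PM_box[of 0 "\<lambda>_. 0" "\<lambda>_. 0"] by simp
  next
    case nz: False
    with False have "box_RN N R = {}"
      by (auto simp: box_RN_def PiE_eq_empty_iff)
    then show ?thesis by simp
  qed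
qed

lemma integrable_box:
  fixes f :: "point \<Rightarrow> real"
  assumes "f \<in> borel_measurable (PM N)" "\<And>x. x \<in> space (PM N) \<Longrightarrow> \<bar>f x\<bar> \<le> B"
    "\<And>x. x \<in> space (PM N) \<Longrightarrow> f x \<noteq> 0 \<Longrightarrow> x \<in> box_RN N R"
  shows "integrable (PM N) f"
proof (rule Bochner_Integration.integrable_bound[where f="\<lambda>x. B * indicator (box_RN N R) x"])
  show "integrable (PM N) (\<lambda>x. B * indicator (box_RN N R) x)"
    using emeasure_box_RN_finite by (intro integrable_mult_right integrable_real_indicator) auto
  show "AE x in PM N. norm (f x) \<le> norm (B * indicator (box_RN N R) x)"
  proof (rule AE_I2)
    fix x assume x: "x \<in> space (PM N)"
    show "norm (f x) \<le> norm (B * indicator (box_RN N R) x)"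
    proof (cases "f x = 0")
      case False
      then show ?thesis using assms(2)[OF x] assms(3)[OF x] by simp
    qed simp
  qed
qed (use assms in auto)

definition shift_RN :: "nat \<Rightarrow> point \<Rightarrow> point \<Rightarrow> point" where
  "shift_RN N h x = (\<lambda>i\<in>{..<N}. x i + h i)"

lemma shift_RN_measurable [measurable]: "shift_RN N h \<in> measurable (PM N) (PM N)"
  unfolding shift_RN_def by measurable

lemma distr_lborel_plus: "distr lborel lborel (\<lambda>y. y + (c::real)) = lborel"
  using lborel_distr_plus[of c] by (simp add: add.commute distr_cong[of lborel lborel borel lborel])

text \<open>Both measures agree on products of measurable sets, by translation invariance in each
  coordinate, and these products determine the product measure.\<close>

lemma distr_shift_RN: "distr (PM N) (PM N) (shift_RN N h) = PM N"
proof (rule lborel_product.PiM_eqI)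
  fix A :: "nat \<Rightarrow> real set" assume A: "\<And>i. i \<in> {..<N} \<Longrightarrow> A i \<in> sets lborel"
  have "emeasure (distr (PM N) (PM N) (shift_RN N h)) (Pi\<^sub>E {..<N} A) =
      emeasure (PM N) (shift_RN N h -` Pi\<^sub>E {..<N} A \<inter> space (PM N))"
    using A by (intro emeasure_distr) auto
  also have "shift_RN N h -` Pi\<^sub>E {..<N} A \<inter> space (PM N) =
      Pi\<^sub>E {..<N} (\<lambda>i. (\<lambda>y. y + h i) -` A i)"
    by (auto simp: shift_RN_def space_PM PiE_iff)
  also have "emeasure (PM N) \<dots> = (\<Prod>i<N. emeasure lborel ((\<lambda>y. y + h i) -` A i))"
  proof (intro lborel_product.emeasure_PiM)
    fix i assume "i \<in> {..<N}"
    then show "(\<lambda>y. y + h i) -` A i \<in> sets lborel"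
      using A[of i] measurable_sets[of "\<lambda>y. y + h i" borel borel "A i"] by auto
  qed simp
  also have "\<dots> = (\<Prod>i<N. emeasure lborel (A i))"
  proof (intro prod.cong refl)
    fix i assume "i \<in> {..<N}"
    then have "emeasure (distr lborel lborel (\<lambda>y. y + h i)) (A i) = emeasure lborel ((\<lambda>y. y + h i) -` A i)"
      using A[of i] by (subst emeasure_distr) auto
    then show "emeasure lborel ((\<lambda>y. y + h i) -` A i) = emeasure lborel (A i)"
      by (simp add: distr_lborel_plus)
  qed
  finally show "emeasure (distr (PM N) (PM N) (shift_RN N h)) (Pi\<^sub>E {..<N} A) =
    (\<Prod>i\<in>{..<N}. emeasure lborel (A i))" .
qed auto

lemma nn_integral_shift_RN:
  assumes [measurable]: "f \<in> borel_measurable (PM N)"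
  shows "(\<integral>\<^sup>+x. f (shift_RN N h x) \<partial>PM N) = (\<integral>\<^sup>+x. f x \<partial>PM N)"
proof -
  have "(\<integral>\<^sup>+x. f x \<partial>PM N) = (\<integral>\<^sup>+x. f x \<partial>distr (PM N) (PM N) (shift_RN N h))"
    by (simp add: distr_shift_RN)
  also have "\<dots> = (\<integral>\<^sup>+x. f (shift_RN N h x) \<partial>PM N)"
    by (rule nn_integral_distr) auto
  finally show ?thesis by simp
qed

text \<open>Singles out one coordinate: estimates on lines are lifted to the whole space in this
  way.\<close>

lemma nn_integral_PM_coord:
  assumes [measurable]: "f \<in> borel_measurable (PM N)" and "i < N"
  shows "(\<integral>\<^sup>+x. f x \<partial>PM N) =
    (\<integral>\<^sup>+x. \<integral>\<^sup>+y. f (x(i := y)) \<partial>lborel \<partial>Pi\<^sub>M ({..<N} - {i}) (\<lambda>_. lborel))"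
proof -
  have eq: "insert i ({..<N} - {i}) = {..<N}" using assms by auto
  show ?thesis
    using lborel_product.product_nn_integral_insert[of "{..<N} - {i}" i f, unfolded eq] assms by simp
qed

lemma upd_space_PM:
  "x \<in> space (Pi\<^sub>M ({..<N} - {i}) (\<lambda>_. lborel :: real measure)) \<Longrightarrow> i < N \<Longrightarrow> x(i := y) \<in> {..<N} \<rightarrow>\<^sub>E UNIV"
  by (auto simp: space_PiM PiE_iff extensional_def)

subsection \<open>Test functions and integration by parts\<close>

lemma continuous_map_line:
  assumes "x \<in> {..<N} \<rightarrow>\<^sub>E UNIV" "i < N"
  shows "continuous_map euclideanreal (RN N) (\<lambda>t. x(i := t))"
proof -
  have "continuous_map euclideanreal euclideanreal (\<lambda>t. (x(i := t)) k)" for k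
    by (cases "k = i") auto
  moreover have "(\<lambda>t. x(i := t)) ` UNIV \<subseteq> extensional {..<N}"
    using fun_upd_in_RN[OF assms] by (auto simp: PiE_iff)
  ultimately show ?thesis
    unfolding continuous_map_componentwise by simp
qed

lemma continuous_on_line:
  assumes "continuous_map (RN N) euclideanreal f" "x \<in> {..<N} \<rightarrow>\<^sub>E UNIV" "i < N"
  shows "continuous_on UNIV (\<lambda>t. f (x(i := t)))"
  using continuous_map_compose[OF continuous_map_line[OF assms(2,3)] assms(1)] by (simp add: o_def)

lemma smooth_has_partial_line:
  assumes "smooth_RN N \<phi>" "i < N" "x \<in> {..<N} \<rightarrow>\<^sub>E UNIV"
  shows "((\<lambda>t. \<phi> (x(i := t))) has_real_derivative partial i \<phi> (x(i := y))) (at y)"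
  using smooth_has_partial[OF assms(1,2) fun_upd_in_RN[OF assms(3,2)], of y] by simp

lemma partial_diff:
  assumes "smooth_RN N \<phi>" "smooth_RN N \<psi>" "i < N" "x \<in> {..<N} \<rightarrow>\<^sub>E UNIV"
  shows "partial i (\<lambda>x. \<phi> x - \<psi> x) x = partial i \<phi> x - partial i \<psi> x"
  by (rule partial_eqI) (intro DERIV_diff smooth_has_partial[of N] assms)

lemma partial_mult:
  assumes "smooth_RN N \<phi>" "smooth_RN N \<psi>" "i < N" "x \<in> {..<N} \<rightarrow>\<^sub>E UNIV"
  shows "partial i (\<lambda>x. \<phi> x * \<psi> x) x = partial i \<phi> x * \<psi> x + partial i \<psi> x * \<phi> x"
  using DERIV_mult[OF smooth_has_partial[OF assms(1,3,4)] smooth_has_partial[OF assms(2,3,4)]]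
  by (intro partial_eqI) simp

lemma partial_cmult:
  assumes "smooth_RN N \<phi>" "i < N" "x \<in> {..<N} \<rightarrow>\<^sub>E UNIV"
  shows "partial i (\<lambda>x. c * \<phi> x) x = c * partial i \<phi> x"
  by (rule partial_eqI) (intro DERIV_cmult smooth_has_partial[of N] assms)

lemma partial_comp:
  assumes "smooth_RN N \<phi>" "i < N" "x \<in> {..<N} \<rightarrow>\<^sub>E UNIV"
    "(F has_real_derivative D) (at (\<phi> x))"
  shows "partial i (\<lambda>x. F (\<phi> x)) x = D * partial i \<phi> x"
proof (rule partial_eqI)
  have "((\<lambda>t. \<phi> (x(i := t))) has_real_derivative partial i \<phi> x) (at (x i))"
    by (intro smooth_has_partial[of N] assms)
  moreover have "(F has_real_derivative D) (at (\<phi> (x(i := x i))))"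
    using assms(4) by simp
  ultimately show "((\<lambda>t. F (\<phi> (x(i := t)))) has_real_derivative D * partial i \<phi> x) (at (x i))"
    by (rule DERIV_chain2[rotated])
qed

lemma partial_continuous:
  "smooth_RN N \<phi> \<Longrightarrow> i < N \<Longrightarrow> continuous_map (RN N) euclideanreal (partial i \<phi>)"
  by (intro smooth_continuous smooth_partial)

lemma smooth_measurable [measurable_dest]: "smooth_RN N \<phi> \<Longrightarrow> \<phi> \<in> borel_measurable (PM N)"
  by (intro continuous_measurable_PM smooth_continuous)

lemma partial_measurable: "smooth_RN N \<phi> \<Longrightarrow> i < N \<Longrightarrow> partial i \<phi> \<in> borel_measurable (PM N)"
  by (intro continuous_measurable_PM partial_continuous)

lemma test_smooth: "\<phi> \<in> test_functions N \<Omega> \<Longrightarrow> smooth_RN N \<phi>"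
  by (simp add: test_functions_def)

lemma supp_RN_superset: "x \<in> {..<N} \<rightarrow>\<^sub>E UNIV \<Longrightarrow> x \<notin> supp_RN N \<phi> \<Longrightarrow> \<phi> x = 0"
  using closure_of_subset[of "{x \<in> topspace (RN N). \<phi> x \<noteq> 0}" "RN N"]
  unfolding supp_RN_def by auto

lemma partial_outside_supp:
  assumes "x \<in> {..<N} \<rightarrow>\<^sub>E UNIV" "x \<notin> supp_RN N \<phi>" "i < N"
  shows "partial i \<phi> x = 0"
proof (rule partial_eqI)
  have "openin (RN N) (topspace (RN N) - supp_RN N \<phi>)"
    unfolding supp_RN_def by (intro openin_diff openin_topspace closedin_closure_of)
  then have op: "open {t. x(i := t) \<in> topspace (RN N) - supp_RN N \<phi>}"
    using openin_continuous_map_preimage[OF continuous_map_line[OF assms(1,3)],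
        of "topspace (RN N) - supp_RN N \<phi>"] by simp
  have "((\<lambda>t. 0) has_real_derivative 0) (at (x i))" by simp
  then show "((\<lambda>t. \<phi> (x(i := t))) has_real_derivative 0) (at (x i))"
    by (rule has_field_derivative_transform_within_open[OF _ op])
      (use assms supp_RN_superset[of _ N \<phi>] in auto)
qed

lemma test_outside:
  assumes "\<phi> \<in> test_functions N \<Omega>" "x \<in> {..<N} \<rightarrow>\<^sub>E UNIV" "x \<notin> \<Omega>"
  shows "\<phi> x = 0" "i < N \<Longrightarrow> partial i \<phi> x = 0"
  using assms supp_RN_superset[of x N \<phi>] partial_outside_supp[of x N \<phi> i]
  unfolding test_functions_def by auto

text \<open>Meant for products and for composites \<open>\<theta> (\<phi> x)\<close> with
  \<open>\<theta> 0 = 0\<close>: the support can only shrink, and a closed subset of a compact set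
  is compact.\<close>

lemma test_of_support:
  assumes "\<phi> \<in> test_functions N \<Omega>" "smooth_RN N \<psi>"
    "\<And>x. x \<in> {..<N} \<rightarrow>\<^sub>E UNIV \<Longrightarrow> \<phi> x = 0 \<Longrightarrow> \<psi> x = 0"
  shows "\<psi> \<in> test_functions N \<Omega>"
proof -
  have "{x \<in> topspace (RN N). \<psi> x \<noteq> 0} \<subseteq> {x \<in> topspace (RN N). \<phi> x \<noteq> 0}"
    unfolding topspace_RN using assms(3) by blast
  then have sub: "supp_RN N \<psi> \<subseteq> supp_RN N \<phi>"
    unfolding supp_RN_def by (rule closure_of_mono)
  have "compactin (RN N) (supp_RN N \<phi>)" using assms(1) by (simp add: test_functions_def)
  then have "compactin (RN N) (supp_RN N \<psi>)"
    using sub by (rule closed_compactin) (simp only: supp_RN_def closedin_closure_of)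
  with sub assms(1,2) show ?thesis
    unfolding test_functions_def by blast
qed

lemma test_diff:
  assumes "\<phi> \<in> test_functions N \<Omega>" "\<psi> \<in> test_functions N \<Omega>"
  shows "(\<lambda>x. \<phi> x - \<psi> x) \<in> test_functions N \<Omega>"
proof -
  have "{x \<in> S. \<phi> x - \<psi> x \<noteq> 0} \<subseteq> {x \<in> S. \<phi> x \<noteq> 0} \<union> {x \<in> S. \<psi> x \<noteq> 0}" for S
    by auto
  from closure_of_mono[OF this, of "RN N" "topspace (RN N)"]
  have sub: "supp_RN N (\<lambda>x. \<phi> x - \<psi> x) \<subseteq> supp_RN N \<phi> \<union> supp_RN N \<psi>"
    unfolding supp_RN_def by (simp only: closure_of_Un)
  have "compactin (RN N) (supp_RN N \<phi> \<union> supp_RN N \<psi>)"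
    using assms unfolding test_functions_def by (intro compactin_Un) auto
  then have "compactin (RN N) (supp_RN N (\<lambda>x. \<phi> x - \<psi> x))"
    using sub by (rule closed_compactin) (simp only: supp_RN_def closedin_closure_of)
  with sub assms smooth_diff[of N \<phi> \<psi>] show ?thesis
    unfolding test_functions_def by blast
qed

lemma test_mult:
  assumes "\<phi> \<in> test_functions N \<Omega>" "smooth_RN N \<psi>"
  shows "(\<lambda>x. \<psi> x * \<phi> x) \<in> test_functions N \<Omega>"
  by (rule test_of_support[OF assms(1)]) (simp_all add: smooth_mult test_smooth[OF assms(1)] assms)

lemma test_cmult:
  "\<phi> \<in> test_functions N \<Omega> \<Longrightarrow> (\<lambda>x. c * \<phi> x) \<in> test_functions N \<Omega>"
  using test_mult[OF _ smooth_const] by blast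

lemma test_box:
  assumes "\<phi> \<in> test_functions N \<Omega>"
  obtains R where "0 < R" "\<And>x. x \<in> space (PM N) \<Longrightarrow> x \<notin> box_RN N R \<Longrightarrow> \<phi> x = 0"
    "\<And>x i. x \<in> space (PM N) \<Longrightarrow> x \<notin> box_RN N R \<Longrightarrow> i < N \<Longrightarrow> partial i \<phi> x = 0"
proof -
  have "compactin (RN N) (supp_RN N \<phi>)" using assms by (simp add: test_functions_def)
  then obtain R where R: "0 < R" "\<And>x i. x \<in> supp_RN N \<phi> \<Longrightarrow> i < N \<Longrightarrow> \<bar>x i\<bar> \<le> R"
    by (rule compactin_RN_bounded) blast
  have "x \<notin> supp_RN N \<phi>" if "x \<in> space (PM N)" "x \<notin> box_RN N R" for x
  proof
    assume "x \<in> supp_RN N \<phi>"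
    then have "x i \<in> {-R..R}" if "i < N" for i using R(2)[of x i] that by auto
    then have "x \<in> box_RN N R"
      using \<open>x \<in> space (PM N)\<close> by (auto simp: box_RN_def space_PM PiE_iff)
    with that show False by simp
  qed
  then show ?thesis
    using that[OF R(1)] supp_RN_superset[of _ N \<phi>] partial_outside_supp[of _ N \<phi>] by (simp add: space_PM)
qed

lemma continuous_box_bounded:
  assumes "continuous_map (RN N) euclideanreal f"
  obtains B where "\<And>x. x \<in> box_RN N R \<Longrightarrow> \<bar>f x\<bar> \<le> B"
proof -
  have "compactin (RN N) (box_RN N R)"
    unfolding box_RN_def compactin_PiE by simp
  then have "compact (f ` box_RN N R)"
    using image_compactin[OF _ assms] by simp
  then obtain B where "\<forall>y \<in> f ` box_RN N R. norm y \<le> B"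
    using compact_imp_bounded bounded_iff by blast
  then show ?thesis by (intro that[of B]) auto
qed

lemma continuous_vanishing_integrable:
  assumes "continuous_map (RN N) euclideanreal f"
    "\<And>x. x \<in> space (PM N) \<Longrightarrow> x \<notin> box_RN N R \<Longrightarrow> f x = 0"
  shows "integrable (PM N) f" "\<exists>B. \<forall>x \<in> space (PM N). \<bar>f x\<bar> \<le> B"
proof -
  obtain B where B: "\<And>x. x \<in> box_RN N R \<Longrightarrow> \<bar>f x\<bar> \<le> B"
    using continuous_box_bounded[OF assms(1)] by blast
  have B': "\<bar>f x\<bar> \<le> \<bar>B\<bar>" if "x \<in> space (PM N)" for x
    using B[of x] assms(2)[OF that] by (cases "x \<in> box_RN N R") auto
  then show "\<exists>B. \<forall>x \<in> space (PM N). \<bar>f x\<bar> \<le> B" by blast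
  show "integrable (PM N) f"
    by (rule integrable_box[OF continuous_measurable_PM[OF assms(1)] B']) (use assms(2) in auto)
qed

text \<open>Fubini reduces the claim to lines parallel to axis \<open>i\<close>, where the
  fundamental theorem of calculus is applied on an interval that reaches beyond the support.\<close>

lemma integral_partial_eq_0:
  assumes \<phi>: "\<phi> \<in> test_functions N \<Omega>" and i: "i < N"
  shows "(\<integral>x. partial i \<phi> x \<partial>PM N) = 0"
proof -
  note sm = test_smooth[OF \<phi>]
  obtain R where R: "0 < R" "\<And>x. x \<in> space (PM N) \<Longrightarrow> x \<notin> box_RN N R \<Longrightarrow> \<phi> x = 0"
    "\<And>x i. x \<in> space (PM N) \<Longrightarrow> x \<notin> box_RN N R \<Longrightarrow> i < N \<Longrightarrow> partial i \<phi> x = 0"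
    by (rule test_box[OF \<phi>]) blast
  have int: "integrable (PM N) (partial i \<phi>)"
    using continuous_vanishing_integrable(1)[OF partial_continuous[OF sm i]] R(3) i by blast
  have eq: "insert i ({..<N} - {i}) = {..<N}" using i by auto
  have "(\<integral>x. partial i \<phi> x \<partial>PM N) =
    (\<integral>x. \<integral>y. partial i \<phi> (x(i := y)) \<partial>lborel \<partial>Pi\<^sub>M ({..<N} - {i}) (\<lambda>_. lborel))"
    using lborel_product.product_integral_insert[of "{..<N} - {i}" i "partial i \<phi>", unfolded eq] int by simp
  also have "\<dots> = (\<integral>x. 0 \<partial>Pi\<^sub>M ({..<N} - {i}) (\<lambda>_. lborel :: real measure))"
  proof (rule Bochner_Integration.integral_cong[OF refl])
    fix x assume "x \<in> space (Pi\<^sub>M ({..<N} - {i}) (\<lambda>_. lborel :: real measure))"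
    then have ln: "x(i := y) \<in> {..<N} \<rightarrow>\<^sub>E UNIV" for y
      using i by (rule upd_space_PM)
    have out: "x(i := y) \<notin> box_RN N R" if "R < \<bar>y\<bar>" for y
    proof
      assume "x(i := y) \<in> box_RN N R"
      then have "(x(i := y)) i \<in> {-R..R}" using i unfolding box_RN_def PiE_iff by blast
      with that show False by auto
    qed
    have cont: "isCont (\<lambda>y. partial i \<phi> (x(i := y))) y" for y
      using continuous_on_line[OF partial_continuous[OF sm i] ln[of 0] i]
      by (simp add: continuous_on_eq_continuous_at)
    have der: "((\<lambda>y. \<phi> (x(i := y))) has_real_derivative partial i \<phi> (x(i := y))) (at y)" for y
      using smooth_has_partial_line[OF sm i ln[of 0], of y] by (simp only: fun_upd_upd)
    \<comment> \<open>The margin 1 puts both endpoints strictly outside the box, where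
      \<open>\<phi>\<close> vanishes.\<close>
    have "has_bochner_integral lborel (\<lambda>y. partial i \<phi> (x(i := y)) * indicator {-R-1..R+1} y)
      (\<phi> (x(i := R+1)) - \<phi> (x(i := -R-1)))"
      by (rule has_bochner_integral_FTC_Icc_real[OF _ der cont]) (use R(1) in simp)
    moreover have "\<phi> (x(i := R+1)) = 0" "\<phi> (x(i := -R-1)) = 0"
      using R(1) by (auto intro!: R(2) out ln simp: space_PM)
    moreover have "(\<lambda>y. partial i \<phi> (x(i := y)) * indicator {-R-1..R+1} y) = (\<lambda>y. partial i \<phi> (x(i := y)))"
    proof
      fix y show "partial i \<phi> (x(i := y)) * indicator {-R-1..R+1} y = partial i \<phi> (x(i := y))"
      proof (cases "y \<in> {-R-1..R+1}")
        case False
        then have "R < \<bar>y\<bar>" by auto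
        then show ?thesis using R(3)[OF _ out i, of y] ln[of y] False by (simp add: space_PM)
      qed simp
    qed
    ultimately show "(\<integral>y. partial i \<phi> (x(i := y)) \<partial>lborel) = 0"
      by (simp add: has_bochner_integral_integral_eq)
  qed
  finally show ?thesis by simp
qed

text \<open>The derivative of the product integrates to 0, and the bounded support of
  \<open>\<phi>\<close> makes both terms of the product rule integrable.\<close>

lemma integration_by_parts:
  assumes \<phi>: "\<phi> \<in> test_functions N \<Omega>" and \<psi>: "\<psi> \<in> test_functions N \<Omega>'" and i: "i < N"
  shows "(\<integral>x. \<phi> x * partial i \<psi> x \<partial>PM N) = - (\<integral>x. partial i \<phi> x * \<psi> x \<partial>PM N)"
proof -
  note sm = test_smooth[OF \<phi>] test_smooth[OF \<psi>]
  obtain R where R: "0 < R" "\<And>x. x \<in> space (PM N) \<Longrightarrow> x \<notin> box_RN N R \<Longrightarrow> \<phi> x = 0"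
    "\<And>x i. x \<in> space (PM N) \<Longrightarrow> x \<notin> box_RN N R \<Longrightarrow> i < N \<Longrightarrow> partial i \<phi> x = 0"
    by (rule test_box[OF \<phi>]) blast
  have "(\<lambda>x. \<psi> x * \<phi> x) \<in> test_functions N \<Omega>"
    by (intro test_mult \<phi> sm)
  then have "0 = (\<integral>x. partial i (\<lambda>x. \<psi> x * \<phi> x) x \<partial>PM N)"
    using i by (simp add: integral_partial_eq_0)
  also have "\<dots> = (\<integral>x. partial i \<psi> x * \<phi> x + partial i \<phi> x * \<psi> x \<partial>PM N)"
    by (intro Bochner_Integration.integral_cong refl partial_mult[of N] sm i) (simp add: space_PM)
  also have "\<dots> = (\<integral>x. partial i \<psi> x * \<phi> x \<partial>PM N) + (\<integral>x. partial i \<phi> x * \<psi> x \<partial>PM N)"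
    using R i
    by (intro Bochner_Integration.integral_add continuous_vanishing_integrable(1)[where R=R]
        continuous_map_real_mult partial_continuous sm smooth_continuous) auto
  finally have "(\<integral>x. partial i \<psi> x * \<phi> x \<partial>PM N) = - (\<integral>x. partial i \<phi> x * \<psi> x \<partial>PM N)" by linarith
  then show ?thesis by (subst mult.commute)
qed

subsection \<open>Uniqueness of the weak gradient\<close>

definition open_box :: "nat \<Rightarrow> point \<Rightarrow> point \<Rightarrow> point set" where
  "open_box N a b = Pi\<^sub>E {..<N} (\<lambda>i. {a i<..<b i})"

lemma open_box_sets [measurable]: "open_box N a b \<in> sets (PM N)"
  unfolding open_box_def by (intro sets_PiM_I_finite) auto

lemma open_box_subset: "open_box N a b \<subseteq> {..<N} \<rightarrow>\<^sub>E UNIV"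
  unfolding open_box_def by (intro PiE_mono) simp

lemma sets_PM_open_boxes:
  "sets (PM N) = sigma_sets ({..<N} \<rightarrow>\<^sub>E UNIV) {open_box N a b | a b. True}"
proof -
  define E :: "real set set" where "E = range (\<lambda>(a, b). {a<..<b})"
  have "sets (PM N) = sets (Pi\<^sub>M {..<N} (\<lambda>_. sigma UNIV E))"
    unfolding E_def using borel_eq_box[where 'a=real] by (intro sets_PiM_cong) (simp_all add: box_real)
  also have "\<dots> = sets (sigma ({..<N} \<rightarrow>\<^sub>E UNIV)
      {{f \<in> {..<N} \<rightarrow>\<^sub>E UNIV. \<forall>i\<in>j. f i \<in> A i} | A j. j \<in> {{..<N}} \<and> A \<in> Pi j (\<lambda>_. E)})"
  proof (rule sets_PiM_sigma)
    fix i assume "i \<in> {..<N}"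
    have "(\<Union>n::nat. {- real n<..<real n}) = UNIV"
    proof (intro set_eqI iffI UNIV_I)
      fix x :: real assume "x \<in> UNIV"
      obtain n where "\<bar>x\<bar> < real n" using reals_Archimedean2 by blast
      then show "x \<in> (\<Union>n::nat. {- real n<..<real n})" by (auto intro!: exI[of _ n])
    qed
    moreover have "range (\<lambda>n::nat. {- real n<..<real n}) \<subseteq> E"
      by (auto simp: E_def)
    ultimately show "\<exists>S\<subseteq>E. countable S \<and> UNIV = \<Union> S"
      by (intro exI[of _ "range (\<lambda>n::nat. {- real n<..<real n})"]) auto
  qed auto
  also have "{{f \<in> {..<N} \<rightarrow>\<^sub>E UNIV. \<forall>i\<in>j. f i \<in> A i} | A j. j \<in> {{..<N}} \<and> A \<in> Pi j (\<lambda>_. E)} =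
      {open_box N a b | a b. True}" (is "?L = ?R")
  proof (intro subset_antisym subsetI)
    fix X assume "X \<in> ?L"
    then obtain A where A: "X = {f \<in> {..<N} \<rightarrow>\<^sub>E UNIV. \<forall>i\<in>{..<N}. f i \<in> A i}" "A \<in> {..<N} \<rightarrow> E"
      by blast
    have "\<forall>i\<in>{..<N}. \<exists>c. A i = {fst c<..<snd c}"
      using A(2) by (force simp: E_def Pi_iff)
    then obtain c where c: "\<forall>i\<in>{..<N}. A i = {fst (c i)<..<snd (c i)}" by metis
    have "X = open_box N (\<lambda>i. fst (c i)) (\<lambda>i. snd (c i))"
      unfolding A(1) open_box_def PiE_def Pi_def using c by blast
    then show "X \<in> ?R" by blast
  next
    fix X assume "X \<in> ?R"
    then obtain a b where "X = open_box N a b" by blast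
    then have "X = {f \<in> {..<N} \<rightarrow>\<^sub>E UNIV. \<forall>i\<in>{..<N}. f i \<in> {a i<..<b i}}"
      unfolding open_box_def PiE_def Pi_def by blast
    moreover have "(\<lambda>i. {a i<..<b i}) \<in> {..<N} \<rightarrow> E"
      by (auto simp: E_def)
    ultimately show "X \<in> ?L"
      by (intro CollectI exI[of _ "\<lambda>i. {a i<..<b i}"] exI[of _ "{..<N}"] conjI) (assumption | simp)+
  qed
  also have "sets (sigma ({..<N} \<rightarrow>\<^sub>E UNIV) ?R) = sigma_sets ({..<N} \<rightarrow>\<^sub>E UNIV) ?R"
    by (rule sets_measure_of) (use open_box_subset in blast)
  finally show ?thesis .
qed

text \<open>The positive and the negative part of \<open>H\<close> are densities of two finite
  measures. These agree on open boxes, which are stable under intersection and generate the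
  sigma-algebra, hence they coincide; uniqueness of densities identifies the two parts almost
  everywhere, and they can only be equal where both are 0.\<close>

lemma AE_zero_open_boxes:
  fixes H :: "point \<Rightarrow> real"
  assumes int: "integrable (PM N) H"
    and zero: "\<And>a b. (\<integral>x. H x * indicator (open_box N a b) x \<partial>PM N) = 0"
  shows "AE x in PM N. H x = 0"
proof -
  interpret sigma_finite_measure "PM N" by (rule sigma_finite_PM)
  have [measurable]: "H \<in> borel_measurable (PM N)" using int by simp
  define P where "P \<sigma> = density (PM N) (\<lambda>x. ennreal (max 0 (\<sigma> * H x)))" for \<sigma>
  have intP: "integrable (PM N) (\<lambda>x. max 0 (\<sigma> * H x))" for \<sigma>
    using int by (intro integrable_max) auto
  have intPX: "integrable (PM N) (\<lambda>x. max 0 (\<sigma> * H x) * indicator X x)" if "X \<in> sets (PM N)" for \<sigma> X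
    using integrable_mult_indicator[OF that intP[of \<sigma>]] by (simp add: mult.commute)
  have em: "emeasure (P \<sigma>) X = ennreal (\<integral>x. max 0 (\<sigma> * H x) * indicator X x \<partial>PM N)"
    if X: "X \<in> sets (PM N)" for \<sigma> X
  proof -
    have "emeasure (P \<sigma>) X = (\<integral>\<^sup>+x. ennreal (max 0 (\<sigma> * H x) * indicator X x) \<partial>PM N)"
      unfolding P_def using X
      by (subst emeasure_density) (auto intro!: nn_integral_cong split: split_indicator)
    also have "\<dots> = ennreal (\<integral>x. max 0 (\<sigma> * H x) * indicator X x \<partial>PM N)"
      by (rule nn_integral_eq_integral[OF intPX[OF X]]) auto
    finally show ?thesis .
  qed
  have "P 1 = P (-1)"
  proof (rule measure_eqI_generator_eq[of "{open_box N a b | a b. True}" "{..<N} \<rightarrow>\<^sub>E UNIV" _ _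
      "\<lambda>n. open_box N (\<lambda>_. - real n) (\<lambda>_. real n)"])
    show "Int_stable {open_box N a b | a b. True}"
    proof (rule Int_stableI)
      fix X Y assume "X \<in> {open_box N a b | a b. True}" "Y \<in> {open_box N a b | a b. True}"
      then obtain a b c d where "X = open_box N a b" "Y = open_box N c d" by blast
      then have "X \<inter> Y = open_box N (\<lambda>i. max (a i) (c i)) (\<lambda>i. min (b i) (d i))"
        by (simp add: open_box_def PiE_Int)
      then show "X \<inter> Y \<in> {open_box N a b | a b. True}" by blast
    qed
    show "{open_box N a b | a b. True} \<subseteq> Pow ({..<N} \<rightarrow>\<^sub>E UNIV)"
      using open_box_subset by blast
    fix X assume "X \<in> {open_box N a b | a b. True}"
    then obtain a b where X: "X = open_box N a b" by blast
    have "(\<integral>x. H x * indicator X x \<partial>PM N) =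
        (\<integral>x. max 0 (1 * H x) * indicator X x - max 0 (-1 * H x) * indicator X x \<partial>PM N)"
      by (intro Bochner_Integration.integral_cong) (auto simp: max_def split: split_indicator)
    also have "\<dots> = (\<integral>x. max 0 (1 * H x) * indicator X x \<partial>PM N) - (\<integral>x. max 0 (-1 * H x) * indicator X x \<partial>PM N)"
      unfolding X by (intro Bochner_Integration.integral_diff intPX) auto
    finally show "emeasure (P 1) X = emeasure (P (-1)) X"
      using zero[of a b] by (simp add: em X)
  next
    show "sets (P 1) = sigma_sets ({..<N} \<rightarrow>\<^sub>E UNIV) {open_box N a b | a b. True}"
      "sets (P (-1)) = sigma_sets ({..<N} \<rightarrow>\<^sub>E UNIV) {open_box N a b | a b. True}"
      unfolding P_def by (simp_all add: sets_PM_open_boxes)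
    show "range (\<lambda>n. open_box N (\<lambda>_. - real n) (\<lambda>_. real n)) \<subseteq> {open_box N a b | a b. True}"
      by blast
    show "(\<Union>n. open_box N (\<lambda>_. - real n) (\<lambda>_. real n)) = {..<N} \<rightarrow>\<^sub>E UNIV"
    proof (intro set_eqI iffI)
      fix x :: point assume x: "x \<in> {..<N} \<rightarrow>\<^sub>E UNIV"
      obtain n where n: "(\<Sum>i<N. \<bar>x i\<bar>) < real n" using reals_Archimedean2 by blast
      have "x i \<in> {- real n<..<real n}" if "i < N" for i
      proof -
        have "\<bar>x i\<bar> \<le> (\<Sum>i<N. \<bar>x i\<bar>)" using that by (intro member_le_sum) auto
        then show ?thesis using n by auto
      qed
      then have "x \<in> open_box N (\<lambda>_. - real n) (\<lambda>_. real n)"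
        using x unfolding open_box_def PiE_iff by blast
      then show "x \<in> (\<Union>n. open_box N (\<lambda>_. - real n) (\<lambda>_. real n))" by blast
    qed (use open_box_subset in blast)
    show "emeasure (P 1) (open_box N (\<lambda>_. - real n) (\<lambda>_. real n)) \<noteq> \<infinity>" for n
      by (simp add: em)
  qed
  then have "AE x in PM N. ennreal (max 0 (1 * H x)) = ennreal (max 0 (-1 * H x))"
    unfolding P_def by (intro density_unique) auto
  then show ?thesis
    by eventually_elim (auto simp: max_def split: if_splits)
qed

text \<open>\<open>c\<close> is a sharpness parameter: for each \<open>c > 0\<close> the function is
  positive on the open box and zero at the other carrier points, and it tends to the indicator of
  the box as \<open>c\<close> grows.\<close>

definition box_bump :: "nat \<Rightarrow> real \<Rightarrow> point \<Rightarrow> point \<Rightarrow> point \<Rightarrow> real" where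
  "box_bump N c a b x = (\<Prod>i<N. flat (c * (x i - a i)) * flat (c * (b i - x i)))"

lemma flat_bounds: "0 \<le> flat t" "flat t \<le> 1"
  by (auto simp: flat_def divide_nonpos_pos)

lemma flat_eq_0_iff: "flat t = 0 \<longleftrightarrow> t \<le> 0"
  by (auto simp: flat_def)

lemma smooth_box_bump: "smooth_RN N (box_bump N c a b)"
  unfolding box_bump_def[abs_def]
  by (intro smooth_prod smooth_mult smooth_flat smooth_diff smooth_const smooth_coord) auto

lemma box_bump_bounds: "0 \<le> box_bump N c a b x" "box_bump N c a b x \<le> 1"
  unfolding box_bump_def
  by (auto intro!: prod_nonneg prod_le_1 mult_nonneg_nonneg mult_le_one flat_bounds)

lemma box_bump_eq_0_iff:
  assumes "0 < c" "x \<in> {..<N} \<rightarrow>\<^sub>E UNIV"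
  shows "box_bump N c a b x = 0 \<longleftrightarrow> x \<notin> open_box N a b"
proof -
  have "box_bump N c a b x = 0 \<longleftrightarrow> (\<exists>i<N. \<not> (a i < x i \<and> x i < b i))"
    using assms(1) by (auto simp: box_bump_def flat_eq_0_iff mult_le_0_iff not_less)
  also have "\<dots> \<longleftrightarrow> x \<notin> open_box N a b"
    using assms(2) unfolding open_box_def PiE_iff by force
  finally show ?thesis .
qed

lemma flat_tendsto: "(\<lambda>n. flat (real n * t)) \<longlonglongrightarrow> (if 0 < t then 1 else 0)"
proof (cases "0 < t")
  case True
  have "(\<lambda>n. exp (- 1 / (real n * t))) \<longlonglongrightarrow> exp 0"
    using True by (intro tendsto_exp) real_asymp
  moreover have "\<forall>\<^sub>F n in sequentially. exp (- 1 / (real n * t)) = flat (real n * t)"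
    using eventually_gt_at_top[of 0] by eventually_elim (use True in \<open>auto simp: flat_def\<close>)
  ultimately show ?thesis using True Lim_transform_eventually by fastforce
next
  case False
  then have "flat (real n * t) = 0" for n by (auto simp: flat_eq_0_iff mult_nonneg_nonpos)
  then show ?thesis using False by simp
qed

lemma box_bump_tendsto:
  assumes x: "x \<in> {..<N} \<rightarrow>\<^sub>E UNIV"
  shows "(\<lambda>n. box_bump N (real n) a b x) \<longlonglongrightarrow> indicator (open_box N a b) x"
proof -
  have "(\<lambda>n. box_bump N (real n) a b x) \<longlonglongrightarrow>
      (\<Prod>i<N. (if 0 < x i - a i then 1 else 0) * (if 0 < b i - x i then 1 else 0))"
    unfolding box_bump_def by (intro tendsto_prod tendsto_mult flat_tendsto)
  also have "(\<Prod>i<N. (if 0 < x i - a i then 1 else 0) * (if 0 < b i - x i then 1 else (0::real))) =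
      indicator (open_box N a b) x"
  proof (cases "x \<in> open_box N a b")
    case True
    then have "a i < x i \<and> x i < b i" if "i < N" for i
      using that by (auto simp: open_box_def PiE_iff)
    then show ?thesis using True by simp
  next
    case False
    then obtain i where "i < N" "\<not> (a i < x i \<and> x i < b i)"
      using x unfolding open_box_def PiE_iff by force
    then show ?thesis using False by (auto intro!: prod_zero bexI[of _ i])
  qed
  finally show ?thesis .
qed

lemma AE_zero_smooth:
  assumes int: "integrable (PM N) H"
    and zero: "\<And>\<phi>. smooth_RN N \<phi> \<Longrightarrow> (\<integral>x. H x * \<phi> x \<partial>PM N) = 0"
  shows "AE x in PM N. H x = 0"
proof (rule AE_zero_open_boxes[OF int])
  fix a b
  have [measurable]: "H \<in> borel_measurable (PM N)" using int by simp
  have [measurable]: "box_bump N c a b \<in> borel_measurable (PM N)" for c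
    by (intro smooth_measurable smooth_box_bump)
  have "(\<lambda>n. \<integral>x. H x * box_bump N (real n) a b x \<partial>PM N) \<longlonglongrightarrow> (\<integral>x. H x * indicator (open_box N a b) x \<partial>PM N)"
  proof (rule integral_dominated_convergence[where w="\<lambda>x. \<bar>H x\<bar>"])
    show "AE x in PM N. (\<lambda>n. H x * box_bump N (real n) a b x) \<longlonglongrightarrow> H x * indicator (open_box N a b) x"
      by (intro AE_I2 tendsto_mult tendsto_const box_bump_tendsto) (simp add: space_PM)
    show "AE x in PM N. norm (H x * box_bump N (real n) a b x) \<le> \<bar>H x\<bar>" for n
      using box_bump_bounds[of N "real n" a b]
      by (intro AE_I2) (auto simp: abs_mult intro!: mult_left_le)
  qed (use int in auto)
  then show "(\<integral>x. H x * indicator (open_box N a b) x \<partial>PM N) = 0"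
    by (simp add: zero smooth_box_bump LIMSEQ_const_iff)
qed

lemma box_bump_test:
  assumes "Pi\<^sub>E {..<N} (\<lambda>i. {a i..b i}) \<subseteq> \<Omega>"
  shows "box_bump N 1 a b \<in> test_functions N \<Omega>"
proof -
  let ?K = "Pi\<^sub>E {..<N} (\<lambda>i. {a i..b i})"
  have K: "compactin (RN N) ?K"
    unfolding compactin_PiE by simp
  have cl: "closedin (RN N) ?K"
    unfolding closedin_product_topology by auto
  have "{x \<in> topspace (RN N). box_bump N 1 a b x \<noteq> 0} \<subseteq> open_box N a b"
    unfolding topspace_RN using box_bump_eq_0_iff[of 1 _ N a b] by force
  also have "open_box N a b \<subseteq> ?K"
    unfolding open_box_def by (intro PiE_mono) auto
  finally have sub: "supp_RN N (box_bump N 1 a b) \<subseteq> ?K"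
    unfolding supp_RN_def by (rule closure_of_minimal[OF _ cl])
  then have "compactin (RN N) (supp_RN N (box_bump N 1 a b))"
    by (intro closed_compactin[OF K]) (simp_all only: supp_RN_def closedin_closure_of)
  with sub assms show ?thesis
    unfolding test_functions_def using smooth_box_bump by blast
qed

text \<open>Rational corners, restricted to the first \<open>N\<close> coordinates, leave only
  countably many boxes, so null sets found box by box can be united.\<close>

lemma open_cover_boxes:
  assumes "openin (RN N) \<Omega>" "x \<in> \<Omega>"
  obtains a b where "a \<in> {..<N} \<rightarrow>\<^sub>E \<rat>" "b \<in> {..<N} \<rightarrow>\<^sub>E \<rat>" "x \<in> open_box N a b"
    "Pi\<^sub>E {..<N} (\<lambda>i. {a i..b i}) \<subseteq> \<Omega>"
proof -
  from assms(1)[unfolded openin_product_topology_alt, THEN bspec, OF assms(2)]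
  obtain U where "(\<forall>i\<in>{..<N}. openin euclideanreal (U i)) \<and> x \<in> Pi\<^sub>E {..<N} U \<and> Pi\<^sub>E {..<N} U \<subseteq> \<Omega>"
    by (elim exE conjE) simp
  then have U: "\<And>i. i < N \<Longrightarrow> open (U i)" "x \<in> Pi\<^sub>E {..<N} U" "Pi\<^sub>E {..<N} U \<subseteq> \<Omega>"
    by (simp_all only: open_openin lessThan_iff)
  have "\<exists>r s. r \<in> \<rat> \<and> s \<in> \<rat> \<and> r < x i \<and> x i < s \<and> {r..s} \<subseteq> U i" if i: "i < N" for i
  proof -
    have "x i \<in> U i" using U(2) i by (auto simp: PiE_iff)
    then obtain e where e: "e > 0" "ball (x i) e \<subseteq> U i" using U(1)[OF i] open_contains_ball by blast
    obtain r where r: "r \<in> \<rat>" "x i - e < r" "r < x i" using Rats_dense_in_real[of "x i - e" "x i"] e by auto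
    obtain s where s: "s \<in> \<rat>" "x i < s" "s < x i + e" using Rats_dense_in_real[of "x i" "x i + e"] e by auto
    have "{r..s} \<subseteq> ball (x i) e" using r s by (auto simp: dist_real_def)
    with e r s show ?thesis by blast
  qed
  then obtain r s where rs: "\<And>i. i < N \<Longrightarrow> r i \<in> \<rat> \<and> s i \<in> \<rat> \<and> r i < x i \<and> x i < s i \<and> {r i..s i} \<subseteq> U i"
    by metis
  show ?thesis
  proof (rule that[of "restrict r {..<N}" "restrict s {..<N}"])
    show "restrict r {..<N} \<in> {..<N} \<rightarrow>\<^sub>E \<rat>" "restrict s {..<N} \<in> {..<N} \<rightarrow>\<^sub>E \<rat>"
      using rs by auto
    show "x \<in> open_box N (restrict r {..<N}) (restrict s {..<N})"
      using rs U(2) by (auto simp: open_box_def PiE_iff)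
    have "Pi\<^sub>E {..<N} (\<lambda>i. {restrict r {..<N} i..restrict s {..<N} i}) \<subseteq> Pi\<^sub>E {..<N} U"
      using rs by (intro PiE_mono) auto
    with U(3) show "Pi\<^sub>E {..<N} (\<lambda>i. {restrict r {..<N} i..restrict s {..<N} i}) \<subseteq> \<Omega>" by blast
  qed
qed

section \<open>Euclidean norm in coordinates and inequalities for real powers\<close>

lemma enorm_nonneg [simp]: "0 \<le> enorm N v"
  by (simp add: enorm_def)

lemma enorm_cong: "(\<And>i. i < N \<Longrightarrow> v i = w i) \<Longrightarrow> enorm N v = enorm N w"
  unfolding enorm_def by (rule L2_set_cong) auto

lemma enorm_triangle: "enorm N (\<lambda>i. v i + w i) \<le> enorm N v + enorm N w"
  unfolding enorm_def by (rule L2_set_triangle_ineq)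

lemma enorm_scale: "enorm N (\<lambda>i. c * v i) = \<bar>c\<bar> * enorm N v"
  unfolding enorm_def L2_set_def
  by (simp add: power_mult_distrib sum_distrib_left[symmetric] real_sqrt_mult)

lemma enorm_zero [simp]: "enorm N (\<lambda>i. 0) = 0"
  by (simp add: enorm_def L2_set_def)

lemma enorm_le_sum: "enorm N v \<le> (\<Sum>i<N. \<bar>v i\<bar>)"
  unfolding enorm_def by (rule L2_set_le_sum_abs)

lemma component_le_enorm:
  assumes "i < N"
  shows "\<bar>v i\<bar> \<le> enorm N v"
proof -
  have "\<bar>v i\<bar> \<le> L2_set (\<lambda>i. \<bar>v i\<bar>) {..<N}"
    using assms by (intro member_le_L2_set) auto
  then show ?thesis by (simp add: enorm_def L2_set_def)
qed

lemma abs_einner_le: "\<bar>einner N v w\<bar> \<le> enorm N v * enorm N w"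
proof -
  have "\<bar>einner N v w\<bar> \<le> (\<Sum>i<N. \<bar>v i * w i\<bar>)" unfolding einner_def by (rule sum_abs)
  also have "\<dots> \<le> enorm N v * enorm N w"
    unfolding enorm_def abs_mult by (rule L2_set_mult_ineq)
  finally show ?thesis .
qed

lemma enorm_measurable:
  "(\<And>i. i < N \<Longrightarrow> (\<lambda>x. g x i) \<in> borel_measurable M) \<Longrightarrow> (\<lambda>x. enorm N (g x)) \<in> borel_measurable M"
  unfolding enorm_def L2_set_def by (intro borel_measurable_sqrt[THEN measurable_compose[rotated]] borel_measurable_sum borel_measurable_power) auto

lemma einner_measurable:
  "(\<And>i. i < N \<Longrightarrow> (\<lambda>x. g x i) \<in> borel_measurable M) \<Longrightarrow> (\<And>i. i < N \<Longrightarrow> (\<lambda>x. h x i) \<in> borel_measurable M) \<Longrightarrow>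
    (\<lambda>x. einner N (g x) (h x)) \<in> borel_measurable M"
  unfolding einner_def by (intro borel_measurable_sum borel_measurable_times) auto

lemma powr_add_le:
  fixes a b p :: real
  assumes "0 < p" "0 \<le> a" "0 \<le> b" "c \<le> a + b" "0 \<le> c"
  shows "c powr p \<le> 2 powr p * (a powr p + b powr p)"
proof -
  have "c powr p \<le> (2 * max a b) powr p"
    using assms by (intro powr_mono2) auto
  also have "\<dots> = 2 powr p * max a b powr p"
    using assms by (simp add: powr_mult)
  also have "max a b powr p \<le> a powr p + b powr p"
    by (auto simp: max_def)
  finally show ?thesis by simp
qed

lemma powr_sum_le:
  fixes a :: "nat \<Rightarrow> real"
  assumes "0 < p" "\<And>i. i < n \<Longrightarrow> 0 \<le> a i"
  shows "(\<Sum>i<n. a i) powr p \<le> real n powr p * (\<Sum>i<n. a i powr p)"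
proof (cases "n = 0")
  case False
  define m where "m = Max (a ` {..<n})"
  have "m \<in> a ` {..<n}" unfolding m_def using False by (intro Max_in) auto
  then obtain j where j: "j < n" "m = a j" by auto
  have "(\<Sum>i<n. a i) \<le> (\<Sum>i<n. m)"
    unfolding m_def by (intro sum_mono Max_ge) auto
  then have "(\<Sum>i<n. a i) powr p \<le> (real n * m) powr p"
    using assms by (intro powr_mono2 sum_nonneg) auto
  also have "\<dots> = real n powr p * m powr p"
    using assms(2)[OF j(1)] j by (simp add: powr_mult)
  also have "m powr p \<le> (\<Sum>i<n. a i powr p)"
    unfolding j(2) by (rule member_le_sum[of j "{..<n}" "\<lambda>i. a i powr p"]) (use j in auto)
  finally show ?thesis by (simp add: mult_left_mono)
qed (use assms in simp)

text \<open>The \<open>p\<close>-th power of the Sobolev norm, taken over the whole space and with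
  values in \<open>ennreal\<close>, so that energies can be compared before they are known to be
  finite. \<open>g\<close> is an arbitrary candidate for the gradient.\<close>

definition energy :: "nat \<Rightarrow> real \<Rightarrow> (point \<Rightarrow> real) \<Rightarrow> (point \<Rightarrow> nat \<Rightarrow> real) \<Rightarrow> ennreal" where
  "energy N p v g = (\<integral>\<^sup>+x. ennreal (\<bar>v x\<bar> powr p + enorm N (g x) powr p) \<partial>PM N)"

text \<open>The class \<open>A\<close> is a parameter: membership in the closure of
  \<open>nonneg_tests\<close>, rather than of all test functions, is what later allows a pair to be
  inserted into the weak inequality, which speaks of nonnegative tests only.\<close>

definition approximable ::
    "nat \<Rightarrow> real \<Rightarrow> (point \<Rightarrow> real) set \<Rightarrow> (point \<Rightarrow> real) \<Rightarrow> (point \<Rightarrow> nat \<Rightarrow> real) \<Rightarrow> bool" where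
  "approximable N p A v g \<longleftrightarrow> v \<in> borel_measurable (PM N) \<and>
     (\<forall>i<N. (\<lambda>x. g x i) \<in> borel_measurable (PM N)) \<and>
     (\<forall>\<epsilon>>0. \<exists>\<phi>\<in>A. energy N p (\<lambda>x. v x - \<phi> x) (\<lambda>x i. g x i - gradient \<phi> x i) < ennreal \<epsilon>)"

section \<open>Passage between the completed measure and the product measure\<close>

lemma AE_lebesgue_iff: "(AE x in lebesgue_RN N. P x) \<longleftrightarrow> (AE x in PM N. P x)"
  unfolding lebesgue_RN_def by (rule AE_completion_iff)

lemma space_lebesgue: "space (lebesgue_RN N) = space (PM N)"
  by (simp add: lebesgue_RN_def)

lemma measurable_PM_lebesgue: "f \<in> borel_measurable (PM N) \<Longrightarrow> f \<in> borel_measurable (lebesgue_RN N)"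
  unfolding lebesgue_RN_def by (rule measurable_completion)

lemma integrable_lebesgue_iff:
  fixes f :: "point \<Rightarrow> real"
  assumes "f \<in> borel_measurable (PM N)" "g \<in> borel_measurable (lebesgue_RN N)" "AE x in PM N. g x = f x"
  shows "integrable (lebesgue_RN N) g \<longleftrightarrow> integrable (PM N) f"
    "integral\<^sup>L (lebesgue_RN N) g = integral\<^sup>L (PM N) f"
proof -
  have ae: "AE x in lebesgue_RN N. g x = f x" using assms(3) by (simp add: AE_lebesgue_iff)
  note mf = measurable_PM_lebesgue[OF assms(1)]
  show "integrable (lebesgue_RN N) g \<longleftrightarrow> integrable (PM N) f"
    using integrable_cong_AE[OF assms(2) mf ae] integrable_completion[OF assms(1)]
    by (simp add: lebesgue_RN_def)
  show "integral\<^sup>L (lebesgue_RN N) g = integral\<^sup>L (PM N) f"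
    using integral_cong_AE[OF assms(2) mf ae] integral_completion[OF assms(1)]
    by (simp add: lebesgue_RN_def)
qed

lemma test_gradient_weak:
  assumes \<phi>: "\<phi> \<in> test_functions N \<Omega>" and \<psi>: "\<psi> \<in> test_functions N \<Omega>" and i: "i < N"
  shows "(LINT x:\<Omega>|lebesgue_RN N. \<phi> x * partial i \<psi> x) = - (LINT x:\<Omega>|lebesgue_RN N. partial i \<phi> x * \<psi> x)"
proof -
  note sm = test_smooth[OF \<phi>] test_smooth[OF \<psi>]
  have m: "\<phi> \<in> borel_measurable (PM N)" "\<psi> \<in> borel_measurable (PM N)"
    "partial i \<phi> \<in> borel_measurable (PM N)" "partial i \<psi> \<in> borel_measurable (PM N)"
    using sm i by (auto intro: smooth_measurable partial_measurable)
  have ind: "indicator \<Omega> x *\<^sub>R (\<phi> x * partial i \<psi> x) = \<phi> x * partial i \<psi> x"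
    "indicator \<Omega> x *\<^sub>R (partial i \<phi> x * \<psi> x) = partial i \<phi> x * \<psi> x"
    if "x \<in> space (lebesgue_RN N)" for x
    using that test_outside(1)[OF \<phi>, of x] test_outside(2)[OF \<phi>, of x i] i unfolding space_lebesgue space_PM
    by (auto split: split_indicator)
  have "(LINT x:\<Omega>|lebesgue_RN N. \<phi> x * partial i \<psi> x) = (\<integral>x. \<phi> x * partial i \<psi> x \<partial>lebesgue_RN N)"
    unfolding set_lebesgue_integral_def by (intro Bochner_Integration.integral_cong refl ind)
  also have "\<dots> = (\<integral>x. \<phi> x * partial i \<psi> x \<partial>PM N)"
    unfolding lebesgue_RN_def using m by (intro integral_completion) auto
  also have "\<dots> = - (\<integral>x. partial i \<phi> x * \<psi> x \<partial>PM N)"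
    by (rule integration_by_parts[OF \<phi> \<psi> i])
  also have "(\<integral>x. partial i \<phi> x * \<psi> x \<partial>PM N) = (\<integral>x. partial i \<phi> x * \<psi> x \<partial>lebesgue_RN N)"
    unfolding lebesgue_RN_def using m by (intro integral_completion[symmetric]) auto
  also have "\<dots> = (LINT x:\<Omega>|lebesgue_RN N. partial i \<phi> x * \<psi> x)"
    unfolding set_lebesgue_integral_def by (intro Bochner_Integration.integral_cong refl ind[symmetric])
  finally show ?thesis .
qed

text \<open>\<open>f\<close> is only locally integrable; the product is integrable because
  \<open>h\<close> is bounded on the compact support of \<open>\<psi>\<close> and vanishes off
  it.\<close>

lemma locally_integrable_mult_test:
  assumes li: "locally_integrable N \<Omega> f" and \<psi>: "\<psi> \<in> test_functions N \<Omega>"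
    and h: "continuous_map (RN N) euclideanreal h"
    "\<And>x. x \<in> {..<N} \<rightarrow>\<^sub>E UNIV \<Longrightarrow> x \<notin> supp_RN N \<psi> \<Longrightarrow> h x = 0"
  shows "set_integrable (lebesgue_RN N) \<Omega> (\<lambda>x. f x * h x)"
proof -
  let ?K = "supp_RN N \<psi>"
  have K: "compactin (RN N) ?K" "?K \<subseteq> \<Omega>" using \<psi> by (auto simp: test_functions_def)
  then have "set_integrable (lebesgue_RN N) ?K f"
    using li by (simp add: locally_integrable_def)
  then have fK: "integrable (lebesgue_RN N) (\<lambda>x. indicator ?K x *\<^sub>R f x)"
    by (simp add: set_integrable_def)
  have "compact (h ` ?K)" using image_compactin[OF K(1) h(1)] by simp
  then obtain B where B: "\<forall>y \<in> h ` ?K. norm y \<le> B"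
    using compact_imp_bounded bounded_iff by blast
  have eq: "indicator \<Omega> x *\<^sub>R (f x * h x) = h x * (indicator ?K x *\<^sub>R f x)" if "x \<in> space (lebesgue_RN N)" for x
    using that h(2)[of x] K(2) by (auto simp: space_lebesgue space_PM split: split_indicator)
  have [measurable]: "h \<in> borel_measurable (lebesgue_RN N)"
    by (intro measurable_PM_lebesgue continuous_measurable_PM h)
  have [measurable]: "(\<lambda>x. indicator ?K x *\<^sub>R f x) \<in> borel_measurable (lebesgue_RN N)"
    using fK by simp
  have "integrable (lebesgue_RN N) (\<lambda>x. h x * (indicator ?K x *\<^sub>R f x))"
  proof (rule Bochner_Integration.integrable_bound)
    show "integrable (lebesgue_RN N) (\<lambda>x. \<bar>B\<bar> * norm (indicator ?K x *\<^sub>R f x))"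
      using fK by (intro integrable_mult_right integrable_norm)
    have "norm (h x * (indicator ?K x *\<^sub>R f x)) \<le> norm (\<bar>B\<bar> * norm (indicator ?K x *\<^sub>R f x))" for x
    proof (cases "x \<in> ?K")
      case True
      then have "\<bar>h x\<bar> \<le> \<bar>B\<bar>" using B by force
      then show ?thesis using True by (simp add: abs_mult mult_right_mono)
    qed simp
    then show "AE x in lebesgue_RN N. norm (h x * (indicator ?K x *\<^sub>R f x)) \<le> norm (\<bar>B\<bar> * norm (indicator ?K x *\<^sub>R f x))"
      by simp
  qed measurable
  then show ?thesis
    unfolding set_integrable_def by (subst Bochner_Integration.integrable_cong[OF refl eq])
qed

lemma integrable_mult_test:
  assumes "locally_integrable N \<Omega> f" "\<psi> \<in> test_functions N \<Omega>"
  shows "set_integrable (lebesgue_RN N) \<Omega> (\<lambda>x. f x * \<psi> x)"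
    "i < N \<Longrightarrow> set_integrable (lebesgue_RN N) \<Omega> (\<lambda>x. f x * partial i \<psi> x)"
proof -
  note sm = test_smooth[OF assms(2)]
  show "set_integrable (lebesgue_RN N) \<Omega> (\<lambda>x. f x * \<psi> x)"
    by (intro locally_integrable_mult_test[OF assms] smooth_continuous sm supp_RN_superset)
  show "set_integrable (lebesgue_RN N) \<Omega> (\<lambda>x. f x * partial i \<psi> x)" if "i < N"
    by (intro locally_integrable_mult_test[OF assms] partial_continuous sm that
        partial_outside_supp[OF _ _ that])
qed

lemma continuous_locally_integrable:
  assumes "continuous_map (RN N) euclideanreal f"
  shows "locally_integrable N \<Omega> f"
  unfolding locally_integrable_def
proof (intro allI impI)
  fix K assume K: "compactin (RN N) K \<and> K \<subseteq> \<Omega>"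
  then have "compact (f ` K)" using image_compactin[OF _ assms] by auto
  then obtain B where B: "\<forall>y \<in> f ` K. norm y \<le> B"
    using compact_imp_bounded bounded_iff by blast
  obtain R where R: "\<And>x i. x \<in> K \<Longrightarrow> i < N \<Longrightarrow> \<bar>x i\<bar> \<le> R"
    by (rule compactin_RN_bounded[OF conjunct1[OF K]]) blast
  have Ksub: "K \<subseteq> {..<N} \<rightarrow>\<^sub>E UNIV" using compactin_subset_topspace[OF conjunct1[OF K]] by simp
  have KR: "K \<subseteq> box_RN N R"
  proof
    fix x assume "x \<in> K"
    then have "x \<in> {..<N} \<rightarrow>\<^sub>E UNIV" "\<forall>i\<in>{..<N}. x i \<in> {-R..R}" using Ksub R[of x] by force+
    then show "x \<in> box_RN N R" unfolding box_RN_def PiE_iff by blast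
  qed
  have "Hausdorff_space (RN N)" by (simp add: Hausdorff_space_product_topology)
  then have "closedin (RN N) K" using K compactin_imp_closedin by blast
  then have "openin (RN N) (topspace (RN N) - K)" by (rule openin_diff[OF openin_topspace])
  then have "space (PM N) - (topspace (RN N) - K) \<in> sets (PM N)"
    by (intro sets.compl_sets openin_sets_PM)
  moreover have "space (PM N) - (topspace (RN N) - K) = K"
    using Ksub by (auto simp only: space_PM topspace_RN)
  ultimately have [measurable]: "K \<in> sets (PM N)" by simp
  have [measurable]: "f \<in> borel_measurable (PM N)" by (rule continuous_measurable_PM[OF assms])
  have "integrable (PM N) (\<lambda>x. indicator K x *\<^sub>R f x)"
  proof (rule integrable_box[where B="\<bar>B\<bar>" and R=R])
    show "\<bar>indicator K x *\<^sub>R f x\<bar> \<le> \<bar>B\<bar>" for x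
      using B by (cases "x \<in> K") force+
    show "indicator K x *\<^sub>R f x \<noteq> 0 \<Longrightarrow> x \<in> box_RN N R" for x
      using KR by (cases "x \<in> K") auto
  qed measurable
  then show "set_integrable (lebesgue_RN N) K f"
    unfolding set_integrable_def lebesgue_RN_def by (subst integrable_completion) measurable
qed

lemma has_weak_gradient_diff_test:
  assumes u: "has_weak_gradient N \<Omega> u g" and \<phi>: "\<phi> \<in> test_functions N \<Omega>"
  shows "has_weak_gradient N \<Omega> (\<lambda>x. u x - \<phi> x) (\<lambda>x i. g x i - gradient \<phi> x i)"
proof -
  note sm = test_smooth[OF \<phi>]
  have li\<phi>: "locally_integrable N \<Omega> \<phi>" "\<And>i. i < N \<Longrightarrow> locally_integrable N \<Omega> (partial i \<phi>)"
    using sm by (auto intro: continuous_locally_integrable smooth_continuous partial_continuous)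
  have liu: "locally_integrable N \<Omega> u" "\<And>i. i < N \<Longrightarrow> locally_integrable N \<Omega> (\<lambda>x. g x i)"
    using u by (auto simp: has_weak_gradient_def)
  have diff: "locally_integrable N \<Omega> (\<lambda>x. f x - h x)"
    if "locally_integrable N \<Omega> f" "locally_integrable N \<Omega> h" for f h
    using that unfolding locally_integrable_def by (auto intro: set_integral_diff)
  show ?thesis
    unfolding has_weak_gradient_def
  proof (intro conjI allI impI ballI)
    show "locally_integrable N \<Omega> (\<lambda>x. u x - \<phi> x)" by (intro diff liu li\<phi>)
    fix i assume i: "i < N"
    show "locally_integrable N \<Omega> (\<lambda>x. g x i - gradient \<phi> x i)"
      unfolding gradient_def by (intro diff liu li\<phi> i)
    fix \<psi> assume \<psi>: "\<psi> \<in> test_functions N \<Omega>"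
    have "(LINT x:\<Omega>|lebesgue_RN N. (u x - \<phi> x) * partial i \<psi> x) =
        (LINT x:\<Omega>|lebesgue_RN N. u x * partial i \<psi> x) - (LINT x:\<Omega>|lebesgue_RN N. \<phi> x * partial i \<psi> x)"
      unfolding left_diff_distrib by (intro set_integral_diff integrable_mult_test liu li\<phi> \<psi> i)
    also have "\<dots> = - (LINT x:\<Omega>|lebesgue_RN N. g x i * \<psi> x) + (LINT x:\<Omega>|lebesgue_RN N. partial i \<phi> x * \<psi> x)"
      using u[unfolded has_weak_gradient_def, THEN conjunct2, rule_format, OF i, THEN conjunct2, THEN bspec, OF \<psi>]
        test_gradient_weak[OF \<phi> \<psi> i] by simp
    also have "\<dots> = - (LINT x:\<Omega>|lebesgue_RN N. g x i * \<psi> x - partial i \<phi> x * \<psi> x)"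
      using set_integral_diff(2)[OF integrable_mult_test(1)[OF liu(2)[OF i] \<psi>] integrable_mult_test(1)[OF li\<phi>(2)[OF i] \<psi>]]
      by simp
    finally show "(LINT x:\<Omega>|lebesgue_RN N. (u x - \<phi> x) * partial i \<psi> x) =
        - (LINT x:\<Omega>|lebesgue_RN N. (g x i - gradient \<phi> x i) * \<psi> x)"
      by (simp add: gradient_def left_diff_distrib)
  qed
qed

text \<open>A bump \<open>\<psi>\<close> for a box inside \<open>\<Omega>\<close> localises:
  \<open>(g - g') \<psi>\<close> is integrable and orthogonal to all smooth functions, hence zero,
  and \<open>\<psi>\<close> is positive on the open box. Countably many rational boxes cover
  \<open>\<Omega>\<close>.\<close>

lemma weak_gradient_unique:
  assumes \<Omega>: "openin (RN N) \<Omega>" and g: "has_weak_gradient N \<Omega> u g" and g': "has_weak_gradient N \<Omega> u g'"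
    and i: "i < N"
  shows "AE x in PM N. x \<in> \<Omega> \<longrightarrow> g x i = g' x i"
proof -
  have liu: "locally_integrable N \<Omega> (\<lambda>x. g x i)" "locally_integrable N \<Omega> (\<lambda>x. g' x i)"
    using g g' i by (auto simp: has_weak_gradient_def)
  have box: "AE x in PM N. x \<in> open_box N a b \<longrightarrow> g x i = g' x i"
    if sub: "Pi\<^sub>E {..<N} (\<lambda>i. {a i..b i}) \<subseteq> \<Omega>" for a b
  proof -
    define \<psi> where "\<psi> = box_bump N 1 a b"
    have \<psi>: "\<psi> \<in> test_functions N \<Omega>" unfolding \<psi>_def by (rule box_bump_test[OF sub])
    define H where "H x = indicator \<Omega> x *\<^sub>R (g x i * \<psi> x - g' x i * \<psi> x)" for x
    have intH: "integrable (lebesgue_RN N) H"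
      using set_integral_diff(1)[OF integrable_mult_test(1)[OF liu(1) \<psi>] integrable_mult_test(1)[OF liu(2) \<psi>]]
      unfolding H_def set_integrable_def .
    then have mH [measurable]: "H \<in> borel_measurable (lebesgue_RN N)" by simp
    \<comment> \<open>The criterion \<open>AE_zero_smooth\<close> is stated for the product measure,
      so \<open>H\<close> is replaced by a Borel version, which leaves all integrals
      unchanged.\<close>
    then obtain H' where H' [measurable]: "H' \<in> borel_measurable (PM N)" and HH': "AE x in PM N. H x = H' x"
      unfolding lebesgue_RN_def using completion_ex_borel_measurable_real by blast
    have "integrable (PM N) H'"
      using integrable_lebesgue_iff(1)[OF H' mH HH'] intH by simp
    moreover have "(\<integral>x. H' x * \<phi> x \<partial>PM N) = 0" if sm: "smooth_RN N \<phi>" for \<phi>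
    proof -
      have m [measurable]: "\<phi> \<in> borel_measurable (PM N)" by (rule smooth_measurable[OF sm])
      have t: "(\<lambda>x. \<phi> x * \<psi> x) \<in> test_functions N \<Omega>" by (rule test_mult[OF \<psi> sm])
      have "(\<integral>x. H' x * \<phi> x \<partial>PM N) = (\<integral>x. H x * \<phi> x \<partial>lebesgue_RN N)"
        by (intro integrable_lebesgue_iff(2)[symmetric] borel_measurable_times mH H' m measurable_PM_lebesgue)
          (use HH' in eventually_elim, simp)
      also have "\<dots> = (LINT x:\<Omega>|lebesgue_RN N. g x i * (\<phi> x * \<psi> x) - g' x i * (\<phi> x * \<psi> x))"
        unfolding set_lebesgue_integral_def H_def
        by (intro Bochner_Integration.integral_cong) (auto simp: algebra_simps)
      also have "\<dots> = (LINT x:\<Omega>|lebesgue_RN N. g x i * (\<phi> x * \<psi> x)) - (LINT x:\<Omega>|lebesgue_RN N. g' x i * (\<phi> x * \<psi> x))"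
        by (intro set_integral_diff integrable_mult_test liu t)
      also have "\<dots> = 0"
      proof -
        have "- (LINT x:\<Omega>|lebesgue_RN N. g x i * (\<phi> x * \<psi> x)) = - (LINT x:\<Omega>|lebesgue_RN N. g' x i * (\<phi> x * \<psi> x))"
          using g[unfolded has_weak_gradient_def, THEN conjunct2, rule_format, OF i, THEN conjunct2, THEN bspec, OF t]
            g'[unfolded has_weak_gradient_def, THEN conjunct2, rule_format, OF i, THEN conjunct2, THEN bspec, OF t]
          by simp
        then show ?thesis by simp
      qed
      finally show ?thesis .
    qed
    ultimately have "AE x in PM N. H' x = 0" by (rule AE_zero_smooth)
    with HH' show ?thesis
    proof eventually_elim
      case (elim x)
      show ?case
      proof
        assume xb: "x \<in> open_box N a b"
        then have x: "x \<in> {..<N} \<rightarrow>\<^sub>E UNIV" using open_box_subset by blast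
        have "open_box N a b \<subseteq> Pi\<^sub>E {..<N} (\<lambda>i. {a i..b i})"
          unfolding open_box_def by (intro PiE_mono) auto
        then have "x \<in> \<Omega>" using xb sub by blast
        moreover have "\<psi> x \<noteq> 0"
          unfolding \<psi>_def using box_bump_eq_0_iff[OF zero_less_one x] xb by blast
        moreover have "g x i * \<psi> x - g' x i * \<psi> x = (g x i - g' x i) * \<psi> x" by (simp add: algebra_simps)
        ultimately show "g x i = g' x i" using elim by (simp add: H_def)
      qed
    qed
  qed
  define I where "I = {(a, b). a \<in> {..<N} \<rightarrow>\<^sub>E \<rat> \<and> b \<in> {..<N} \<rightarrow>\<^sub>E \<rat> \<and> Pi\<^sub>E {..<N} (\<lambda>i. {a i..b i}) \<subseteq> \<Omega>}"
  have "countable I"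
    by (rule countable_subset[of _ "({..<N} \<rightarrow>\<^sub>E \<rat>) \<times> ({..<N} \<rightarrow>\<^sub>E \<rat>)"])
      (auto simp: I_def intro!: countable_SIGMA countable_PiE countable_rat)
  moreover have "AE x in PM N. x \<in> open_box N (fst c) (snd c) \<longrightarrow> g x i = g' x i" if "c \<in> I" for c
    using that by (intro box) (auto simp: I_def)
  ultimately have "AE x in PM N. \<forall>c\<in>I. x \<in> open_box N (fst c) (snd c) \<longrightarrow> g x i = g' x i"
    by (subst AE_ball_countable) simp_all
  then show ?thesis
  proof eventually_elim
    case (elim x)
    show ?case
    proof
      assume "x \<in> \<Omega>"
      then obtain a b where "a \<in> {..<N} \<rightarrow>\<^sub>E \<rat>" "b \<in> {..<N} \<rightarrow>\<^sub>E \<rat>" and ab: "x \<in> open_box N a b"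
        and "Pi\<^sub>E {..<N} (\<lambda>i. {a i..b i}) \<subseteq> \<Omega>"
        by (rule open_cover_boxes[OF \<Omega>]) blast
      then have "(a, b) \<in> I" unfolding I_def by blast
      from elim[rule_format, OF this] ab show "g x i = g' x i" by simp
    qed
  qed
qed

lemma enorm_powr_le_sum:
  assumes "0 < p"
  shows "enorm N v powr p \<le> real N powr p * (\<Sum>i<N. \<bar>v i\<bar> powr p)"
proof -
  have "enorm N v powr p \<le> (\<Sum>i<N. \<bar>v i\<bar>) powr p"
    using assms by (intro powr_mono2 enorm_le_sum) auto
  also have "\<dots> \<le> real N powr p * (\<Sum>i<N. \<bar>v i\<bar> powr p)"
    using assms by (intro powr_sum_le) auto
  finally show ?thesis .
qed

text \<open>Completeness of the measure supplies the measurability of \<open>g\<close>, which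
  differs from a Borel function on a null set only.\<close>

lemma integral_lebesgue_cong:
  fixes f g :: "point \<Rightarrow> real"
  assumes f: "f \<in> borel_measurable (PM N)" and ae: "AE x in PM N. g x = f x"
  shows "integral\<^sup>L (lebesgue_RN N) g = integral\<^sup>L (PM N) f"
proof -
  have "g \<in> borel_measurable (completion (PM N))"
  proof (rule measurableI)
    fix A :: "real set" assume A: "A \<in> sets borel"
    show "g -` A \<inter> space (completion (PM N)) \<in> sets (completion (PM N))"
    proof (rule completion.in_sets_AE)
      show "f -` A \<inter> space (completion (PM N)) \<in> sets (completion (PM N))"
        using measurable_sets[OF f A] by simp
      show "AE x in completion (PM N). x \<in> f -` A \<inter> space (completion (PM N)) \<longleftrightarrow> x \<in> g -` A \<inter> space (completion (PM N))"
        using AE_completion[OF ae] by eventually_elim simp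
    qed simp
  qed simp
  then show ?thesis
    by (intro integrable_lebesgue_iff(2)[OF f _ ae]) (simp add: lebesgue_RN_def)
qed

text \<open>A Borel representative that is exactly zero off \<open>\<Omega>\<close> turns integrals
  over \<open>\<Omega>\<close> into integrals over the whole space.\<close>

lemma Lp_borel_version:
  assumes \<Omega>: "\<Omega> \<in> sets (PM N)" and f: "f \<in> Lp N p \<Omega>"
  obtains f' where "f' \<in> borel_measurable (PM N)" "AE x in PM N. x \<in> \<Omega> \<longrightarrow> f x = f' x"
    "\<And>x. x \<notin> \<Omega> \<Longrightarrow> f' x = 0" "integrable (PM N) (\<lambda>x. \<bar>f' x\<bar> powr p)"
proof -
  have m: "(\<lambda>x. indicator \<Omega> x *\<^sub>R f x) \<in> borel_measurable (lebesgue_RN N)"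
    using f by (simp add: Lp_def set_borel_measurable_def)
  have int: "integrable (lebesgue_RN N) (\<lambda>x. indicator \<Omega> x *\<^sub>R \<bar>f x\<bar> powr p)"
    using f by (simp add: Lp_def set_integrable_def)
  from m obtain h where h [measurable]: "h \<in> borel_measurable (PM N)"
    and ae: "AE x in PM N. indicator \<Omega> x *\<^sub>R f x = h x"
    unfolding lebesgue_RN_def using completion_ex_borel_measurable_real by blast
  note \<Omega> [measurable]
  define f' where "f' x = indicator \<Omega> x * h x" for x
  have [measurable]: "f' \<in> borel_measurable (PM N)" unfolding f'_def by measurable
  moreover have ae': "AE x in PM N. x \<in> \<Omega> \<longrightarrow> f x = f' x"
    using ae by eventually_elim (auto simp: f'_def)
  moreover have "f' x = 0" if "x \<notin> \<Omega>" for x using that by (simp add: f'_def)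
  moreover have "integrable (PM N) (\<lambda>x. \<bar>f' x\<bar> powr p)"
  proof -
    have "AE x in PM N. indicator \<Omega> x *\<^sub>R \<bar>f x\<bar> powr p = \<bar>f' x\<bar> powr p"
      using ae' by eventually_elim (auto simp: f'_def split: split_indicator)
    then show ?thesis
      using int by (subst integrable_lebesgue_iff(1)[symmetric]) auto
  qed
  ultimately show ?thesis by (rule that)
qed

lemma test_powr_integrable:
  assumes \<phi>: "\<phi> \<in> test_functions N \<Omega>" and p: "0 < p"
  shows "integrable (PM N) (\<lambda>x. \<bar>\<phi> x\<bar> powr p)"
    "i < N \<Longrightarrow> integrable (PM N) (\<lambda>x. \<bar>partial i \<phi> x\<bar> powr p)"
proof -
  note sm = test_smooth[OF \<phi>]
  obtain R where R: "0 < R" "\<And>x. x \<in> space (PM N) \<Longrightarrow> x \<notin> box_RN N R \<Longrightarrow> \<phi> x = 0"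
    "\<And>x i. x \<in> space (PM N) \<Longrightarrow> x \<notin> box_RN N R \<Longrightarrow> i < N \<Longrightarrow> partial i \<phi> x = 0"
    by (rule test_box[OF \<phi>]) blast
  have gen: "integrable (PM N) (\<lambda>x. \<bar>f x\<bar> powr p)"
    if f: "continuous_map (RN N) euclideanreal f"
      and z: "\<And>x. x \<in> space (PM N) \<Longrightarrow> x \<notin> box_RN N R \<Longrightarrow> f x = 0" for f
  proof -
    obtain B where B: "\<And>x. x \<in> space (PM N) \<Longrightarrow> \<bar>f x\<bar> \<le> B"
      using continuous_vanishing_integrable(2)[OF f z] by blast
    have [measurable]: "f \<in> borel_measurable (PM N)" by (rule continuous_measurable_PM[OF f])
    show ?thesis
    proof (rule integrable_box[where B="B powr p" and R=R])
      fix x assume x: "x \<in> space (PM N)"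
      show "\<bar>\<bar>f x\<bar> powr p\<bar> \<le> B powr p"
        using B[OF x] p by (auto intro!: powr_mono2)
      show "x \<in> box_RN N R" if "\<bar>f x\<bar> powr p \<noteq> 0"
        using z[OF x] that by auto
    qed measurable
  qed
  show "integrable (PM N) (\<lambda>x. \<bar>\<phi> x\<bar> powr p)"
    by (rule gen[OF smooth_continuous[OF sm] R(2)])
  show "integrable (PM N) (\<lambda>x. \<bar>partial i \<phi> x\<bar> powr p)" if "i < N"
    by (rule gen[OF partial_continuous[OF sm that] R(3)[OF _ _ that]])
qed

lemma integrable_powr_diff:
  fixes f g :: "'a \<Rightarrow> real"
  assumes [measurable]: "f \<in> borel_measurable M" "g \<in> borel_measurable M"
    and "0 < p" "integrable M (\<lambda>x. \<bar>f x\<bar> powr p)" "integrable M (\<lambda>x. \<bar>g x\<bar> powr p)"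
  shows "integrable M (\<lambda>x. \<bar>f x - g x\<bar> powr p)"
proof (rule Bochner_Integration.integrable_bound)
  show "integrable M (\<lambda>x. 2 powr p * (\<bar>f x\<bar> powr p + \<bar>g x\<bar> powr p))"
    using assms by (intro integrable_mult_right Bochner_Integration.integrable_add)
  have "\<bar>f x - g x\<bar> powr p \<le> 2 powr p * (\<bar>f x\<bar> powr p + \<bar>g x\<bar> powr p)" for x
    using assms by (intro powr_add_le) auto
  then show "AE x in M. norm (\<bar>f x - g x\<bar> powr p) \<le> norm (2 powr p * (\<bar>f x\<bar> powr p + \<bar>g x\<bar> powr p))"
    by simp
qed measurable

text \<open>
  The gradient in \<open>W1p_norm N p \<Omega> (\<lambda>x. u x - \<phi> x)\<close> is chosen by \<open>SOME\<close> independently of the one of \<open>u\<close>;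
  uniqueness almost everywhere ties the two together.
\<close>

lemma W1p_zero_approximable:
  assumes p: "1 < p" and \<Omega>: "openin (RN N) \<Omega>" and u: "u \<in> W1p_zero N p \<Omega>"
  obtains v g where "approximable N p (test_functions N \<Omega>) v g"
    "AE x in PM N. u x = v x" "AE x in PM N. x \<in> \<Omega> \<longrightarrow> (\<forall>i<N. weak_gradient N \<Omega> u x i = g x i)"
    "\<And>x i. x \<notin> \<Omega> \<Longrightarrow> v x = 0 \<and> g x i = 0"
proof -
  have \<Omega>s [measurable]: "\<Omega> \<in> sets (PM N)" by (rule openin_sets_PM[OF \<Omega>])
  define G where "G = weak_gradient N \<Omega> u"
  from u have uW: "u \<in> W1p N p \<Omega>"
    and dense: "\<And>\<epsilon>. \<epsilon> > 0 \<Longrightarrow> \<exists>\<phi> \<in> test_functions N \<Omega>. W1p_norm N p \<Omega> (\<lambda>x. u x - \<phi> x) < \<epsilon>"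
    and out: "AE x in lebesgue_RN N. x \<notin> \<Omega> \<longrightarrow> u x = 0"
    unfolding W1p_zero_def by simp_all
  have uL: "u \<in> Lp N p \<Omega>" and GL: "\<And>i. i < N \<Longrightarrow> (\<lambda>x. G x i) \<in> Lp N p \<Omega>"
    and ex: "\<exists>g. has_weak_gradient N \<Omega> u g"
    using uW unfolding W1p_def G_def by simp_all
  have hG: "has_weak_gradient N \<Omega> u G"
    unfolding G_def weak_gradient_def using ex by (rule someI_ex)
  obtain v where v [measurable]: "v \<in> borel_measurable (PM N)" and uv: "AE x in PM N. x \<in> \<Omega> \<longrightarrow> u x = v x"
    and v0: "\<And>x. x \<notin> \<Omega> \<Longrightarrow> v x = 0" and vint: "integrable (PM N) (\<lambda>x. \<bar>v x\<bar> powr p)"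
    by (rule Lp_borel_version[OF \<Omega>s uL]) blast
  have "\<exists>f'. f' \<in> borel_measurable (PM N) \<and> (AE x in PM N. x \<in> \<Omega> \<longrightarrow> G x i = f' x) \<and>
      (\<forall>x. x \<notin> \<Omega> \<longrightarrow> f' x = 0) \<and> integrable (PM N) (\<lambda>x. \<bar>f' x\<bar> powr p)" if "i < N" for i
    by (rule Lp_borel_version[OF \<Omega>s GL[OF that]]) blast
  then have "\<forall>i. \<exists>f'. i < N \<longrightarrow> f' \<in> borel_measurable (PM N) \<and> (AE x in PM N. x \<in> \<Omega> \<longrightarrow> G x i = f' x) \<and>
      (\<forall>x. x \<notin> \<Omega> \<longrightarrow> f' x = 0) \<and> integrable (PM N) (\<lambda>x. \<bar>f' x\<bar> powr p)"
    by blast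
  from choice[OF this] obtain f where f: "\<And>i. i < N \<Longrightarrow> f i \<in> borel_measurable (PM N) \<and> (AE x in PM N. x \<in> \<Omega> \<longrightarrow> G x i = f i x) \<and>
      (\<forall>x. x \<notin> \<Omega> \<longrightarrow> f i x = 0) \<and> integrable (PM N) (\<lambda>x. \<bar>f i x\<bar> powr p)"
    by blast
  define g where "g x i = (if i < N then f i x else 0)" for x i
  have gm: "\<And>i. i < N \<Longrightarrow> (\<lambda>x. g x i) \<in> borel_measurable (PM N)"
    and gint: "\<And>i. i < N \<Longrightarrow> integrable (PM N) (\<lambda>x. \<bar>g x i\<bar> powr p)"
    using f by (auto simp: g_def)
  have g0: "g x i = 0" if "x \<notin> \<Omega>" for x i using f[of i] that by (auto simp: g_def)
  have "AE x in PM N. \<forall>i\<in>{..<N}. x \<in> \<Omega> \<longrightarrow> G x i = g x i"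
    using f by (intro AE_finite_allI) (auto simp: g_def)
  then have Gg: "AE x in PM N. x \<in> \<Omega> \<longrightarrow> (\<forall>i<N. G x i = g x i)"
    by eventually_elim auto
  have "\<exists>\<phi>\<in>test_functions N \<Omega>. energy N p (\<lambda>x. v x - \<phi> x) (\<lambda>x i. g x i - gradient \<phi> x i) < ennreal \<epsilon>"
    if \<epsilon>: "\<epsilon> > 0" for \<epsilon>
  proof -
    \<comment> \<open>\<open>W1p_norm\<close> is a \<open>p\<close>-th root, so an energy below
      \<open>\<epsilon>\<close> corresponds to a norm below
      \<open>\<epsilon> powr (1 / p)\<close>.\<close>
    have "\<epsilon> powr (1 / p) > 0" using \<epsilon> by simp
    then obtain \<phi> where \<phi>: "\<phi> \<in> test_functions N \<Omega>" and small: "W1p_norm N p \<Omega> (\<lambda>x. u x - \<phi> x) < \<epsilon> powr (1 / p)"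
      using dense by blast
    note sm = test_smooth[OF \<phi>]
    have \<phi>m [measurable]: "\<phi> \<in> borel_measurable (PM N)" by (rule smooth_measurable[OF sm])
    define D where "D = weak_gradient N \<Omega> (\<lambda>x. u x - \<phi> x)"
    have hw: "has_weak_gradient N \<Omega> (\<lambda>x. u x - \<phi> x) (\<lambda>x i. G x i - gradient \<phi> x i)"
      by (rule has_weak_gradient_diff_test[OF hG \<phi>])
    then have hD: "has_weak_gradient N \<Omega> (\<lambda>x. u x - \<phi> x) D"
      unfolding D_def weak_gradient_def by (rule someI[of "has_weak_gradient N \<Omega> (\<lambda>x. u x - \<phi> x)"])
    have "AE x in PM N. \<forall>i\<in>{..<N}. x \<in> \<Omega> \<longrightarrow> D x i = G x i - gradient \<phi> x i"
      by (intro AE_finite_allI weak_gradient_unique[OF \<Omega> hD hw]) auto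
    with Gg have Dg: "AE x in PM N. x \<in> \<Omega> \<longrightarrow> (\<forall>i<N. D x i = g x i - gradient \<phi> x i)"
      by eventually_elim auto
    define F1 where "F1 x = \<bar>v x - \<phi> x\<bar> powr p" for x
    define F2 where "F2 x = enorm N (\<lambda>i. g x i - gradient \<phi> x i) powr p" for x
    have pm: "(\<lambda>x. gradient \<phi> x i) \<in> borel_measurable (PM N)" if "i < N" for i
      unfolding gradient_def using partial_measurable[OF sm that] by simp
    have F1m [measurable]: "F1 \<in> borel_measurable (PM N)" unfolding F1_def by measurable
    have [measurable]: "(\<lambda>x. enorm N (\<lambda>i. g x i - gradient \<phi> x i)) \<in> borel_measurable (PM N)"
      by (intro enorm_measurable borel_measurable_diff gm pm)
    have F2m [measurable]: "F2 \<in> borel_measurable (PM N)"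
      unfolding F2_def by measurable
    have F1i: "integrable (PM N) F1"
      unfolding F1_def using p by (intro integrable_powr_diff vint test_powr_integrable[OF \<phi>]) auto
    have F2i: "integrable (PM N) F2"
    proof (rule Bochner_Integration.integrable_bound)
      show "integrable (PM N) (\<lambda>x. real N powr p * (\<Sum>i<N. \<bar>g x i - gradient \<phi> x i\<bar> powr p))"
        using p unfolding gradient_def
        by (intro integrable_mult_right Bochner_Integration.integrable_sum integrable_powr_diff gm gint
          test_powr_integrable[OF \<phi>] partial_measurable[OF sm]) auto
      have "F2 x \<le> real N powr p * (\<Sum>i<N. \<bar>g x i - gradient \<phi> x i\<bar> powr p)" for x
        unfolding F2_def using p by (intro enorm_powr_le_sum) auto
      then show "AE x in PM N. norm (F2 x) \<le> norm (real N powr p * (\<Sum>i<N. \<bar>g x i - gradient \<phi> x i\<bar> powr p))"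
        by (intro AE_I2) (smt (verit) F2_def powr_ge_zero real_norm_def)
    qed measurable
    have F0: "F1 x = 0" "F2 x = 0" if "x \<in> space (PM N)" "x \<notin> \<Omega>" for x
    proof -
      have x: "x \<in> {..<N} \<rightarrow>\<^sub>E UNIV" using that by (simp add: space_PM)
      show "F1 x = 0" using v0[OF that(2)] test_outside(1)[OF \<phi> x that(2)] by (simp add: F1_def)
      have "enorm N (\<lambda>i. g x i - gradient \<phi> x i) = enorm N (\<lambda>i. 0)"
        using g0[OF that(2)] test_outside(2)[OF \<phi> x that(2)] by (intro enorm_cong) (simp add: gradient_def)
      then show "F2 x = 0" by (simp add: F2_def)
    qed
    have "AE x in PM N. indicator \<Omega> x *\<^sub>R \<bar>u x - \<phi> x\<bar> powr p = F1 x"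
      using uv AE_space
    proof eventually_elim
      case (elim x)
      then show ?case using F0(1)[of x] by (cases "x \<in> \<Omega>") (auto simp: F1_def)
    qed
    then have I1: "(LINT x:\<Omega>|lebesgue_RN N. \<bar>u x - \<phi> x\<bar> powr p) = (\<integral>x. F1 x \<partial>PM N)"
      unfolding set_lebesgue_integral_def by (rule integral_lebesgue_cong[OF F1m])
    have "AE x in PM N. indicator \<Omega> x *\<^sub>R enorm N (D x) powr p = F2 x"
      using Dg AE_space
    proof eventually_elim
      case (elim x)
      show ?case
      proof (cases "x \<in> \<Omega>")
        case True
        then have "enorm N (D x) = enorm N (\<lambda>i. g x i - gradient \<phi> x i)"
          using elim by (intro enorm_cong) simp
        then show ?thesis using True by (simp add: F2_def)
      qed (use F0(2)[of x] elim in simp)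
    qed
    then have I2: "(LINT x:\<Omega>|lebesgue_RN N. enorm N (D x) powr p) = (\<integral>x. F2 x \<partial>PM N)"
      unfolding set_lebesgue_integral_def by (rule integral_lebesgue_cong[OF F2m])
    have nn: "0 \<le> (\<integral>x. F1 x \<partial>PM N)" "0 \<le> (\<integral>x. F2 x \<partial>PM N)"
      by (auto simp: F1_def F2_def intro!: Bochner_Integration.integral_nonneg)
    have "((\<integral>x. F1 x \<partial>PM N) + (\<integral>x. F2 x \<partial>PM N)) powr (1 / p) < \<epsilon> powr (1 / p)"
      using small unfolding W1p_norm_def D_def[symmetric] I1 I2 .
    then have lt: "(\<integral>x. F1 x \<partial>PM N) + (\<integral>x. F2 x \<partial>PM N) < \<epsilon>"
      using powr_mono2[of "1 / p" \<epsilon> "(\<integral>x. F1 x \<partial>PM N) + (\<integral>x. F2 x \<partial>PM N)"] p \<epsilon> by force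
    have "energy N p (\<lambda>x. v x - \<phi> x) (\<lambda>x i. g x i - gradient \<phi> x i) = (\<integral>\<^sup>+x. ennreal (F1 x + F2 x) \<partial>PM N)"
      by (simp add: energy_def F1_def F2_def)
    also have "\<dots> = ennreal (\<integral>x. F1 x + F2 x \<partial>PM N)"
      by (intro nn_integral_eq_integral Bochner_Integration.integrable_add F1i F2i AE_I2)
        (simp add: F1_def F2_def)
    also have "\<dots> < ennreal \<epsilon>"
      using lt nn F1i F2i \<epsilon> by (simp add: ennreal_plus[symmetric] ennreal_less_iff del: ennreal_plus)
    finally show ?thesis using \<phi> by blast
  qed
  then have "approximable N p (test_functions N \<Omega>) v g"
    unfolding approximable_def using v gm by blast
  moreover have "AE x in PM N. u x = v x"
    using uv out[unfolded AE_lebesgue_iff] by eventually_elim (use v0 in auto)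
  moreover have "AE x in PM N. x \<in> \<Omega> \<longrightarrow> (\<forall>i<N. weak_gradient N \<Omega> u x i = g x i)"
    using Gg by (simp add: G_def)
  moreover have "v x = 0 \<and> g x i = 0" if "x \<notin> \<Omega>" for x i
    using v0 g0 that by blast
  ultimately show ?thesis by (rule that)
qed

subsection \<open>Pairs approximable by test functions\<close>

definition pair_measurable :: "nat \<Rightarrow> (point \<Rightarrow> real) \<Rightarrow> (point \<Rightarrow> nat \<Rightarrow> real) \<Rightarrow> bool" where
  "pair_measurable N v g \<longleftrightarrow> v \<in> borel_measurable (PM N) \<and> (\<forall>i<N. (\<lambda>x. g x i) \<in> borel_measurable (PM N))"

lemma pair_measurableD [measurable_dest]:
  "pair_measurable N v g \<Longrightarrow> v \<in> borel_measurable (PM N)"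
  "pair_measurable N v g \<Longrightarrow> (\<lambda>x. enorm N (g x)) \<in> borel_measurable (PM N)"
  by (auto simp: pair_measurable_def intro: enorm_measurable)

lemma pair_measurable_comp: "pair_measurable N v g \<Longrightarrow> i < N \<Longrightarrow> (\<lambda>x. g x i) \<in> borel_measurable (PM N)"
  by (auto simp: pair_measurable_def)

lemma approximable_measurable: "approximable N p A v g \<Longrightarrow> pair_measurable N v g"
  by (auto simp: approximable_def pair_measurable_def)

lemma smooth_pair_measurable: "smooth_RN N \<phi> \<Longrightarrow> pair_measurable N \<phi> (gradient \<phi>)"
  unfolding pair_measurable_def gradient_def by (auto intro: smooth_measurable partial_measurable)

lemma pair_measurable_diff:
  "pair_measurable N v g \<Longrightarrow> pair_measurable N v' g' \<Longrightarrow> pair_measurable N (\<lambda>x. v x - v' x) (\<lambda>x i. g x i - g' x i)"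
  unfolding pair_measurable_def by (intro conjI allI impI borel_measurable_diff) auto

lemma approximableI:
  assumes "pair_measurable N v g"
    "\<And>\<epsilon>. \<epsilon> > 0 \<Longrightarrow> \<exists>\<phi>\<in>A. energy N p (\<lambda>x. v x - \<phi> x) (\<lambda>x i. g x i - gradient \<phi> x i) < ennreal \<epsilon>"
  shows "approximable N p A v g"
  using assms unfolding approximable_def pair_measurable_def by blast

lemma approximableD:
  assumes "approximable N p A v g" "\<epsilon> > 0"
  obtains \<phi> where "\<phi> \<in> A" "energy N p (\<lambda>x. v x - \<phi> x) (\<lambda>x i. g x i - gradient \<phi> x i) < ennreal \<epsilon>"
  using assms unfolding approximable_def by blast

lemma approximable_mono: "approximable N p A v g \<Longrightarrow> A \<subseteq> B \<Longrightarrow> approximable N p B v g"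
  unfolding approximable_def by blast

lemma energy_le:
  assumes [measurable]: "pair_measurable N v' g'" and "0 \<le> K"
    and le: "\<And>x. x \<in> space (PM N) \<Longrightarrow>
      \<bar>v x\<bar> powr p + enorm N (g x) powr p \<le> K * (\<bar>v' x\<bar> powr p + enorm N (g' x) powr p)"
  shows "energy N p v g \<le> ennreal K * energy N p v' g'"
proof -
  have "energy N p v g \<le> (\<integral>\<^sup>+x. ennreal K * ennreal (\<bar>v' x\<bar> powr p + enorm N (g' x) powr p) \<partial>PM N)"
    unfolding energy_def
    by (intro nn_integral_mono) (use le assms(2) in \<open>simp add: ennreal_mult'[symmetric] ennreal_leI del: ennreal_plus\<close>)
  also have "\<dots> = ennreal K * energy N p v' g'"
    unfolding energy_def by (rule nn_integral_cmult) measurable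
  finally show ?thesis .
qed

lemma energy_le_add:
  assumes [measurable]: "pair_measurable N v' g'" "pair_measurable N v'' g''" and K: "0 \<le> K"
    and le: "\<And>x. x \<in> space (PM N) \<Longrightarrow> \<bar>v x\<bar> powr p + enorm N (g x) powr p \<le>
      K * ((\<bar>v' x\<bar> powr p + enorm N (g' x) powr p) + (\<bar>v'' x\<bar> powr p + enorm N (g'' x) powr p))"
  shows "energy N p v g \<le> ennreal K * (energy N p v' g' + energy N p v'' g'')"
proof -
  have "energy N p v g \<le> (\<integral>\<^sup>+x. ennreal K * (ennreal (\<bar>v' x\<bar> powr p + enorm N (g' x) powr p) +
      ennreal (\<bar>v'' x\<bar> powr p + enorm N (g'' x) powr p)) \<partial>PM N)"
    unfolding energy_def
    by (intro nn_integral_mono)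
      (use le K in \<open>simp add: ennreal_mult'[symmetric] ennreal_plus[symmetric] ennreal_leI del: ennreal_plus\<close>)
  also have "\<dots> = ennreal K * (\<integral>\<^sup>+x. (ennreal (\<bar>v' x\<bar> powr p + enorm N (g' x) powr p) +
      ennreal (\<bar>v'' x\<bar> powr p + enorm N (g'' x) powr p)) \<partial>PM N)"
    by (rule nn_integral_cmult) measurable
  also have "(\<integral>\<^sup>+x. (ennreal (\<bar>v' x\<bar> powr p + enorm N (g' x) powr p) +
      ennreal (\<bar>v'' x\<bar> powr p + enorm N (g'' x) powr p)) \<partial>PM N) = energy N p v' g' + energy N p v'' g''"
    unfolding energy_def by (rule nn_integral_add) measurable
  finally show ?thesis .
qed

lemma energy_triangle:
  assumes "0 < p" "pair_measurable N v w" "pair_measurable N v' w'"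
    "\<And>x. x \<in> space (PM N) \<Longrightarrow> f x = v x + v' x" "\<And>x i. x \<in> space (PM N) \<Longrightarrow> i < N \<Longrightarrow> h x i = w x i + w' x i"
  shows "energy N p f h \<le> ennreal (2 powr p) * (energy N p v w + energy N p v' w')"
proof (rule energy_le_add[OF assms(2,3)])
  fix x assume x: "x \<in> space (PM N)"
  have "\<bar>f x\<bar> powr p \<le> 2 powr p * (\<bar>v x\<bar> powr p + \<bar>v' x\<bar> powr p)"
    using assms(1,4) x by (intro powr_add_le) auto
  moreover have "enorm N (h x) = enorm N (\<lambda>i. w x i + w' x i)"
    using assms(5) x by (intro enorm_cong)
  then have "enorm N (h x) powr p \<le> 2 powr p * (enorm N (w x) powr p + enorm N (w' x) powr p)"
    using assms(1) by (intro powr_add_le) (auto simp: enorm_triangle)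
  ultimately show "\<bar>f x\<bar> powr p + enorm N (h x) powr p \<le>
      2 powr p * ((\<bar>v x\<bar> powr p + enorm N (w x) powr p) + (\<bar>v' x\<bar> powr p + enorm N (w' x) powr p))"
    by (simp add: algebra_simps)
qed simp

lemma approximable_closed:
  assumes p: "0 < p" and A: "\<And>\<phi>. \<phi> \<in> A \<Longrightarrow> smooth_RN N \<phi>" and m: "pair_measurable N v g"
    and lim: "\<And>\<epsilon>. \<epsilon> > 0 \<Longrightarrow> \<exists>v' g'. approximable N p A v' g' \<and>
      energy N p (\<lambda>x. v x - v' x) (\<lambda>x i. g x i - g' x i) < ennreal \<epsilon>"
  shows "approximable N p A v g"
proof (rule approximableI[OF m])
  fix \<epsilon> :: real assume \<epsilon>: "\<epsilon> > 0"
  \<comment> \<open>Each of the two errors contributes \<open>2 powr p * \<delta>\<close> in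
    \<open>energy_triangle\<close>, in total \<open>\<epsilon>\<close>.\<close>
  define \<delta> where "\<delta> = \<epsilon> / 2 / 2 powr p"
  have \<delta>: "\<delta> > 0" using \<epsilon> by (simp add: \<delta>_def)
  from lim[OF this] obtain v' g' where ap: "approximable N p A v' g'"
    and e1: "energy N p (\<lambda>x. v x - v' x) (\<lambda>x i. g x i - g' x i) < ennreal \<delta>" by blast
  from approximableD[OF ap \<delta>] obtain \<phi> where \<phi>: "\<phi> \<in> A"
    and e2: "energy N p (\<lambda>x. v' x - \<phi> x) (\<lambda>x i. g' x i - gradient \<phi> x i) < ennreal \<delta>" .
  have "energy N p (\<lambda>x. v x - \<phi> x) (\<lambda>x i. g x i - gradient \<phi> x i) \<le> ennreal (2 powr p) *
      (energy N p (\<lambda>x. v x - v' x) (\<lambda>x i. g x i - g' x i) + energy N p (\<lambda>x. v' x - \<phi> x) (\<lambda>x i. g' x i - gradient \<phi> x i))"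
    using approximable_measurable[OF ap] smooth_pair_measurable[OF A[OF \<phi>]]
    by (intro energy_triangle p pair_measurable_diff m) auto
  also have "\<dots> < ennreal (2 powr p) * (ennreal \<delta> + ennreal \<delta>)"
    using e1 e2 by (intro ennreal_mult_strict_left_mono add_strict_mono) auto
  also have "\<dots> = ennreal \<epsilon>"
    using \<delta> by (simp add: ennreal_plus[symmetric] ennreal_mult'[symmetric] del: ennreal_plus) (simp add: \<delta>_def)
  finally show "\<exists>\<phi>\<in>A. energy N p (\<lambda>x. v x - \<phi> x) (\<lambda>x i. g x i - gradient \<phi> x i) < ennreal \<epsilon>"
    using \<phi> by blast
qed

lemma energy_test_finite:
  assumes \<phi>: "\<phi> \<in> test_functions N \<Omega>" and p: "0 < p"
  shows "energy N p \<phi> (gradient \<phi>) < \<infinity>"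
proof -
  note sm = test_smooth[OF \<phi>]
  have [measurable]: "pair_measurable N \<phi> (gradient \<phi>)" by (rule smooth_pair_measurable[OF sm])
  have int: "integrable (PM N) (\<lambda>x. \<bar>\<phi> x\<bar> powr p + real N powr p * (\<Sum>i<N. \<bar>partial i \<phi> x\<bar> powr p))"
    using p by (intro Bochner_Integration.integrable_add integrable_mult_right Bochner_Integration.integrable_sum
        test_powr_integrable[OF \<phi>]) auto
  have "energy N p \<phi> (gradient \<phi>) \<le> (\<integral>\<^sup>+x. ennreal (\<bar>\<phi> x\<bar> powr p + real N powr p * (\<Sum>i<N. \<bar>partial i \<phi> x\<bar> powr p)) \<partial>PM N)"
    unfolding energy_def using enorm_powr_le_sum[OF p, of N "gradient \<phi> _"]
    by (intro nn_integral_mono ennreal_leI add_left_mono) (simp add: gradient_def)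
  also have "\<dots> = ennreal (\<integral>x. \<bar>\<phi> x\<bar> powr p + real N powr p * (\<Sum>i<N. \<bar>partial i \<phi> x\<bar> powr p) \<partial>PM N)"
    by (intro nn_integral_eq_integral int AE_I2 add_nonneg_nonneg mult_nonneg_nonneg sum_nonneg powr_ge_zero)
  also have "\<dots> < \<infinity>" by simp
  finally show ?thesis .
qed

lemma approximable_energy_finite:
  assumes ap: "approximable N p A v g" and A: "A \<subseteq> test_functions N \<Omega>" and p: "0 < p"
  shows "energy N p v g < \<infinity>"
proof -
  from approximableD[OF ap zero_less_one] obtain \<phi> where \<phi>: "\<phi> \<in> A"
    and e: "energy N p (\<lambda>x. v x - \<phi> x) (\<lambda>x i. g x i - gradient \<phi> x i) < ennreal 1" .
  have t: "\<phi> \<in> test_functions N \<Omega>" using \<phi> A by blast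
  have "energy N p v g \<le> ennreal (2 powr p) *
      (energy N p (\<lambda>x. v x - \<phi> x) (\<lambda>x i. g x i - gradient \<phi> x i) + energy N p \<phi> (gradient \<phi>))"
    using smooth_pair_measurable[OF test_smooth[OF t]] approximable_measurable[OF ap]
    by (intro energy_triangle p pair_measurable_diff) auto
  also have "\<dots> < \<infinity>"
    using less_trans[OF e ennreal_less_top] energy_test_finite[OF t p] by (simp add: ennreal_mult_less_top)
  finally show ?thesis .
qed

lemma energy_component_le:
  "(\<integral>\<^sup>+x. ennreal (\<bar>v x\<bar> powr p) \<partial>PM N) \<le> energy N p v g"
  "(\<integral>\<^sup>+x. ennreal (enorm N (g x) powr p) \<partial>PM N) \<le> energy N p v g"
  unfolding energy_def by (intro nn_integral_mono ennreal_leI; simp)+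

text \<open>Errors bounded by \<open>(1/2) ^ n\<close> are summable, so the sum of the
  \<open>p\<close>-th powers has a finite integral and is finite almost everywhere; thus the whole
  sequence converges, without passing to a subsequence.\<close>

lemma approximable_sequence:
  assumes ap: "approximable N p A v g" and A: "\<And>\<phi>. \<phi> \<in> A \<Longrightarrow> smooth_RN N \<phi>" and p: "0 < p"
  obtains \<phi> where "\<And>n::nat. \<phi> n \<in> A"
    "\<And>n. energy N p (\<lambda>x. v x - \<phi> n x) (\<lambda>x i. g x i - gradient (\<phi> n) x i) < ennreal ((1/2) ^ n)"
    "AE x in PM N. (\<lambda>n. \<phi> n x) \<longlonglongrightarrow> v x"
proof -
  have "\<forall>n::nat. \<exists>\<phi>. \<phi> \<in> A \<and> energy N p (\<lambda>x. v x - \<phi> x) (\<lambda>x i. g x i - gradient \<phi> x i) < ennreal ((1/2) ^ n)"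
    using ap unfolding approximable_def by (meson zero_less_power half_gt_zero_iff zero_less_one)
  from choice[OF this] obtain \<phi> where \<phi>: "\<And>n. \<phi> n \<in> A"
    "\<And>n. energy N p (\<lambda>x. v x - \<phi> n x) (\<lambda>x i. g x i - gradient (\<phi> n) x i) < ennreal ((1/2) ^ n)"
    by blast
  have [measurable]: "pair_measurable N v g" by (rule approximable_measurable[OF ap])
  have [measurable]: "\<phi> n \<in> borel_measurable (PM N)" for n by (rule smooth_measurable[OF A[OF \<phi>(1)]])
  have "(\<integral>\<^sup>+x. (\<Sum>n. ennreal (\<bar>v x - \<phi> n x\<bar> powr p)) \<partial>PM N) = (\<Sum>n. \<integral>\<^sup>+x. ennreal (\<bar>v x - \<phi> n x\<bar> powr p) \<partial>PM N)"
    by (rule nn_integral_suminf) measurable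
  also have "\<dots> \<le> (\<Sum>n. ennreal ((1/2) ^ n))"
  proof (intro suminf_le summableI)
    show "(\<integral>\<^sup>+x. ennreal (\<bar>v x - \<phi> n x\<bar> powr p) \<partial>PM N) \<le> ennreal ((1/2) ^ n)" for n
      using order_trans[OF energy_component_le(1) less_imp_le[OF \<phi>(2)[of n]]] .
  qed
  also have "\<dots> = ennreal (\<Sum>n. (1/2) ^ n)"
    by (intro suminf_ennreal2 summable_geometric) auto
  finally have "(\<integral>\<^sup>+x. (\<Sum>n. ennreal (\<bar>v x - \<phi> n x\<bar> powr p)) \<partial>PM N) \<noteq> \<infinity>"
    by (auto simp: top_unique)
  then have "AE x in PM N. (\<Sum>n. ennreal (\<bar>v x - \<phi> n x\<bar> powr p)) \<noteq> \<infinity>"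
    by (intro nn_integral_PInf_AE) measurable
  then have "AE x in PM N. (\<lambda>n. \<phi> n x) \<longlonglongrightarrow> v x"
  proof eventually_elim
    case (elim x)
    have "summable (\<lambda>n. \<bar>v x - \<phi> n x\<bar> powr p)"
      using elim by (intro summable_suminf_not_top) auto
    then have "(\<lambda>n. \<bar>v x - \<phi> n x\<bar> powr p) \<longlonglongrightarrow> 0" by (rule summable_LIMSEQ_zero)
    then have "(\<lambda>n. (\<bar>v x - \<phi> n x\<bar> powr p) powr (1 / p)) \<longlonglongrightarrow> 0"
      by (rule tendsto_zero_powrI[OF _ tendsto_const]) (use p in auto)
    then have "(\<lambda>n. \<bar>v x - \<phi> n x\<bar>) \<longlonglongrightarrow> 0" using p by (simp add: powr_powr)
    then have "(\<lambda>n. v x - \<phi> n x) \<longlonglongrightarrow> 0" by (simp add: tendsto_rabs_zero_iff)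
    from tendsto_diff[OF tendsto_const[of "v x"] this] show ?case by simp
  qed
  with \<phi> show ?thesis by (rule that)
qed

text \<open>The gradient error splits into \<open>(d\<theta> v - d\<theta> \<phi>) g\<close> and
  \<open>d\<theta> \<phi> (g - \<nabla>\<phi>)\<close>. The second part is controlled by the energy
  of the approximation error. The first has no rate and vanishes by dominated convergence, which is
  why approximants converging almost everywhere are taken. The class may change from
  \<open>A\<close> to \<open>B\<close>, so that composition can land among nonnegative
  tests.\<close>

lemma approximable_compose:
  assumes ap: "approximable N p A v g" and A: "\<And>\<phi>. \<phi> \<in> A \<Longrightarrow> smooth_RN N \<phi>" and p: "0 < p"
    and fin: "energy N p v g < \<infinity>"
    and der: "\<And>t. (\<theta> has_real_derivative d\<theta> t) (at t)" and bd: "\<And>t. \<bar>d\<theta> t\<bar> \<le> 1"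
    and cont: "continuous_on UNIV d\<theta>"
    and B: "\<And>\<phi>. \<phi> \<in> A \<Longrightarrow> (\<lambda>x. \<theta> (\<phi> x)) \<in> B"
  shows "approximable N p B (\<lambda>x. \<theta> (v x)) (\<lambda>x i. d\<theta> (v x) * g x i)"
proof -
  have [measurable]: "d\<theta> \<in> borel_measurable borel" by (rule borel_measurable_continuous_onI[OF cont])
  have [measurable]: "\<theta> \<in> borel_measurable borel"
    by (rule borel_measurable_continuous_onI) (use der in \<open>meson DERIV_continuous continuous_at_imp_continuous_on\<close>)
  have m [measurable]: "pair_measurable N v g" by (rule approximable_measurable[OF ap])
  have gm: "\<And>i. i < N \<Longrightarrow> (\<lambda>x. g x i) \<in> borel_measurable (PM N)" by (rule pair_measurable_comp[OF m])
  have lip: "\<bar>\<theta> a - \<theta> b\<bar> \<le> \<bar>a - b\<bar>" for a b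
    using field_differentiable_bound[of UNIV \<theta> d\<theta> 1 a b] der bd by simp
  show ?thesis
  proof (rule approximableI)
    show "pair_measurable N (\<lambda>x. \<theta> (v x)) (\<lambda>x i. d\<theta> (v x) * g x i)"
      unfolding pair_measurable_def
      by (intro conjI allI impI borel_measurable_times gm) measurable
    fix \<epsilon> :: real assume \<epsilon>: "\<epsilon> > 0"
    obtain \<phi> where \<phi>: "\<And>n::nat. \<phi> n \<in> A"
      "\<And>n. energy N p (\<lambda>x. v x - \<phi> n x) (\<lambda>x i. g x i - gradient (\<phi> n) x i) < ennreal ((1/2) ^ n)"
      "AE x in PM N. (\<lambda>n. \<phi> n x) \<longlonglongrightarrow> v x"
      by (rule approximable_sequence[OF ap A p], assumption) (rule that)
    note sm = A[OF \<phi>(1)]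
    have [measurable]: "\<phi> n \<in> borel_measurable (PM N)" for n by (rule smooth_measurable[OF sm])
    define b where "b n x = \<bar>d\<theta> (v x) - d\<theta> (\<phi> n x)\<bar> powr p * enorm N (g x) powr p" for n x
    have [measurable]: "b n \<in> borel_measurable (PM N)" for n unfolding b_def by measurable
    have "(\<lambda>n. \<integral>\<^sup>+x. ennreal (b n x) \<partial>PM N) \<longlonglongrightarrow> (\<integral>\<^sup>+x. 0 \<partial>PM N)"
    proof (rule nn_integral_dominated_convergence[where w="\<lambda>x. ennreal (2 powr p) * ennreal (enorm N (g x) powr p)"])
      have "\<bar>d\<theta> s - d\<theta> t\<bar> \<le> 2" for s t using bd[of s] bd[of t] by linarith
      then show "AE x in PM N. ennreal (b n x) \<le> ennreal (2 powr p) * ennreal (enorm N (g x) powr p)" for n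
        unfolding b_def using p
        by (intro AE_I2) (auto simp: ennreal_mult'[symmetric] intro!: ennreal_leI mult_right_mono powr_mono2)
      have "(\<integral>\<^sup>+x. ennreal (2 powr p) * ennreal (enorm N (g x) powr p) \<partial>PM N) \<le> ennreal (2 powr p) * energy N p v g"
        by (subst nn_integral_cmult) (auto intro!: mult_left_mono energy_component_le)
      also have "\<dots> < \<infinity>" using fin by (auto simp: ennreal_mult_less_top)
      finally show "(\<integral>\<^sup>+x. ennreal (2 powr p) * ennreal (enorm N (g x) powr p) \<partial>PM N) < \<infinity>" .
      show "AE x in PM N. (\<lambda>n. ennreal (b n x)) \<longlonglongrightarrow> 0"
        using \<phi>(3)
      proof eventually_elim
        case (elim x)
        have "(\<lambda>n. d\<theta> (\<phi> n x)) \<longlonglongrightarrow> d\<theta> (v x)"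
          using cont elim by (auto simp: continuous_on_eq_continuous_at intro: isCont_tendsto_compose)
        from tendsto_rabs_zero[OF LIM_zero[OF this]]
        have "(\<lambda>n. \<bar>d\<theta> (v x) - d\<theta> (\<phi> n x)\<bar>) \<longlonglongrightarrow> 0" by (simp add: abs_minus_commute)
        then have "(\<lambda>n. \<bar>d\<theta> (v x) - d\<theta> (\<phi> n x)\<bar> powr p) \<longlonglongrightarrow> 0"
          by (rule tendsto_zero_powrI[OF _ tendsto_const]) (use p in auto)
        from tendsto_mult_left_zero[OF this] have "(\<lambda>n. b n x) \<longlonglongrightarrow> 0" unfolding b_def .
        then show ?case by (metis ennreal_0 tendsto_ennrealI)
      qed
    qed measurable
    then have b0: "(\<lambda>n. \<integral>\<^sup>+x. ennreal (b n x) \<partial>PM N) \<longlonglongrightarrow> 0" by simp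
    define \<delta> where "\<delta> = \<epsilon> / 2 / 2 powr p"
    have \<delta>: "\<delta> > 0" using \<epsilon> by (simp add: \<delta>_def)
    have "\<forall>\<^sub>F n in sequentially. (\<integral>\<^sup>+x. ennreal (b n x) \<partial>PM N) < ennreal \<delta>"
      using order_tendstoD(2)[OF b0] \<delta> by simp
    moreover have "\<forall>\<^sub>F n in sequentially. (1/2::real) ^ n < \<delta>"
      by (rule order_tendstoD(2)[OF LIMSEQ_power_zero \<delta>]) simp
    ultimately have "\<exists>n. (\<integral>\<^sup>+x. ennreal (b n x) \<partial>PM N) < ennreal \<delta> \<and> (1/2::real) ^ n < \<delta>"
      by (rule eventually_happens'[OF sequentially_bot eventually_conj])
    then obtain n where n: "(\<integral>\<^sup>+x. ennreal (b n x) \<partial>PM N) < ennreal \<delta>" "(1/2::real) ^ n < \<delta>"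
      by blast
    have m2 [measurable]: "pair_measurable N (\<lambda>x. v x - \<phi> n x) (\<lambda>x i. g x i - gradient (\<phi> n) x i)"
      by (intro pair_measurable_diff m smooth_pair_measurable sm)
    have pw: "\<bar>\<theta> (v x) - \<theta> (\<phi> n x)\<bar> powr p + enorm N (\<lambda>i. d\<theta> (v x) * g x i - gradient (\<lambda>x. \<theta> (\<phi> n x)) x i) powr p \<le>
        2 powr p * (\<bar>v x - \<phi> n x\<bar> powr p + enorm N (\<lambda>i. g x i - gradient (\<phi> n) x i) powr p + b n x)"
      if x: "x \<in> space (PM N)" for x
    proof -
      let ?h = "\<lambda>i. g x i - gradient (\<phi> n) x i"
      have "\<bar>\<theta> (v x) - \<theta> (\<phi> n x)\<bar> powr p \<le> 1 * \<bar>v x - \<phi> n x\<bar> powr p"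
        using lip p by (simp add: powr_mono2)
      also have "\<dots> \<le> 2 powr p * \<bar>v x - \<phi> n x\<bar> powr p"
        using p by (intro mult_right_mono) (auto simp: ge_one_powr_ge_zero)
      finally have 1: "\<bar>\<theta> (v x) - \<theta> (\<phi> n x)\<bar> powr p \<le> 2 powr p * \<bar>v x - \<phi> n x\<bar> powr p" .
      have "enorm N (\<lambda>i. d\<theta> (v x) * g x i - gradient (\<lambda>x. \<theta> (\<phi> n x)) x i) =
          enorm N (\<lambda>i. (d\<theta> (v x) - d\<theta> (\<phi> n x)) * g x i + d\<theta> (\<phi> n x) * ?h i)"
        using x partial_comp[OF sm _ _ der]
        by (intro enorm_cong) (simp add: gradient_def space_PM algebra_simps)
      also have "\<dots> \<le> \<bar>d\<theta> (v x) - d\<theta> (\<phi> n x)\<bar> * enorm N (g x) + \<bar>d\<theta> (\<phi> n x)\<bar> * enorm N ?h"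
        using enorm_triangle[of N "\<lambda>i. (d\<theta> (v x) - d\<theta> (\<phi> n x)) * g x i" "\<lambda>i. d\<theta> (\<phi> n x) * ?h i"]
        unfolding enorm_scale .
      also have "\<dots> \<le> \<bar>d\<theta> (v x) - d\<theta> (\<phi> n x)\<bar> * enorm N (g x) + 1 * enorm N ?h"
        using bd by (intro add_left_mono mult_right_mono) auto
      finally have "enorm N (\<lambda>i. d\<theta> (v x) * g x i - gradient (\<lambda>x. \<theta> (\<phi> n x)) x i) powr p \<le>
          2 powr p * ((\<bar>d\<theta> (v x) - d\<theta> (\<phi> n x)\<bar> * enorm N (g x)) powr p + enorm N ?h powr p)"
        using p by (intro powr_add_le) auto
      also have "(\<bar>d\<theta> (v x) - d\<theta> (\<phi> n x)\<bar> * enorm N (g x)) powr p = b n x"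
        unfolding b_def by (simp add: powr_mult)
      finally show ?thesis using 1 by (simp add: algebra_simps)
    qed
    have "energy N p (\<lambda>x. \<theta> (v x) - \<theta> (\<phi> n x)) (\<lambda>x i. d\<theta> (v x) * g x i - gradient (\<lambda>x. \<theta> (\<phi> n x)) x i) \<le>
      (\<integral>\<^sup>+x. ennreal (2 powr p) * (ennreal (\<bar>v x - \<phi> n x\<bar> powr p + enorm N (\<lambda>i. g x i - gradient (\<phi> n) x i) powr p) + ennreal (b n x)) \<partial>PM N)"
      unfolding energy_def
      by (intro nn_integral_mono)
        (use pw in \<open>simp add: ennreal_mult'[symmetric] ennreal_plus[symmetric] ennreal_leI b_def del: ennreal_plus\<close>)
    also have "\<dots> = ennreal (2 powr p) * (\<integral>\<^sup>+x. (ennreal (\<bar>v x - \<phi> n x\<bar> powr p + enorm N (\<lambda>i. g x i - gradient (\<phi> n) x i) powr p) + ennreal (b n x)) \<partial>PM N)"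
      by (rule nn_integral_cmult) measurable
    also have "(\<integral>\<^sup>+x. (ennreal (\<bar>v x - \<phi> n x\<bar> powr p + enorm N (\<lambda>i. g x i - gradient (\<phi> n) x i) powr p) + ennreal (b n x)) \<partial>PM N) =
        energy N p (\<lambda>x. v x - \<phi> n x) (\<lambda>x i. g x i - gradient (\<phi> n) x i) + (\<integral>\<^sup>+x. ennreal (b n x) \<partial>PM N)"
      unfolding energy_def by (rule nn_integral_add) measurable
    also have "ennreal (2 powr p) * \<dots> < ennreal (2 powr p) * (ennreal \<delta> + ennreal \<delta>)"
    proof (intro ennreal_mult_strict_left_mono add_strict_mono n(1))
      show "energy N p (\<lambda>x. v x - \<phi> n x) (\<lambda>x i. g x i - gradient (\<phi> n) x i) < ennreal \<delta>"
        using \<phi>(2)[of n] n(2) by (meson ennreal_leI less_imp_le less_le_trans)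
    qed auto
    also have "\<dots> = ennreal \<epsilon>"
      using \<delta> by (simp add: ennreal_plus[symmetric] ennreal_mult'[symmetric] del: ennreal_plus) (simp add: \<delta>_def)
    finally show "\<exists>\<phi>\<in>B. energy N p (\<lambda>x. \<theta> (v x) - \<phi> x) (\<lambda>x i. d\<theta> (v x) * g x i - gradient \<phi> x i) < ennreal \<epsilon>"
      using B[OF \<phi>(1)[of n]] by (rule bexI[where x="\<lambda>x. \<theta> (\<phi> n x)"])
  qed
qed

lemma energy_cong:
  assumes "\<And>x. x \<in> space (PM N) \<Longrightarrow> v x = v' x" "\<And>x i. x \<in> space (PM N) \<Longrightarrow> i < N \<Longrightarrow> g x i = g' x i"
  shows "energy N p v g = energy N p v' g'"
  unfolding energy_def
proof (rule nn_integral_cong)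
  fix x assume x: "x \<in> space (PM N)"
  then have "enorm N (g x) = enorm N (g' x)" by (intro enorm_cong assms(2))
  with assms(1)[OF x] show "ennreal (\<bar>v x\<bar> powr p + enorm N (g x) powr p) = ennreal (\<bar>v' x\<bar> powr p + enorm N (g' x) powr p)"
    by simp
qed

lemma approximable_weight:
  assumes ap: "approximable N p A v g" and p: "0 < p" and A: "\<And>\<phi>. \<phi> \<in> A \<Longrightarrow> smooth_RN N \<phi>"
    and \<psi>: "smooth_RN N \<psi>" and bd: "\<And>x. x \<in> space (PM N) \<Longrightarrow> \<bar>\<psi> x\<bar> \<le> B"
      "\<And>x. x \<in> space (PM N) \<Longrightarrow> enorm N (gradient \<psi> x) \<le> B"
    and A': "\<And>\<phi>. \<phi> \<in> A \<Longrightarrow> (\<lambda>x. \<psi> x * \<phi> x) \<in> A'"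
  shows "approximable N p A' (\<lambda>x. \<psi> x * v x) (\<lambda>x i. \<psi> x * g x i + gradient \<psi> x i * v x)"
proof (rule approximableI)
  have m: "pair_measurable N v g" by (rule approximable_measurable[OF ap])
  have m\<psi>: "pair_measurable N \<psi> (gradient \<psi>)" by (rule smooth_pair_measurable[OF \<psi>])
  show "pair_measurable N (\<lambda>x. \<psi> x * v x) (\<lambda>x i. \<psi> x * g x i + gradient \<psi> x i * v x)"
    unfolding pair_measurable_def
    by (intro conjI allI impI borel_measurable_times borel_measurable_add pair_measurable_comp[OF m]
      pair_measurable_comp[OF m\<psi>] pair_measurableD(1)[OF m] pair_measurableD(1)[OF m\<psi>])
  fix \<epsilon> :: real assume \<epsilon>: "\<epsilon> > 0"
  \<comment> \<open>The values cost \<open>\<bar>B\<bar> powr p\<close> and the product rule costs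
    \<open>2 powr p * \<bar>B\<bar> powr p\<close>; the summand 1 keeps \<open>K\<close> positive
    when \<open>B = 0\<close>.\<close>
  define K where "K = (1 + 2 powr p) * \<bar>B\<bar> powr p + 1"
  have K: "K > 0" unfolding K_def by (intro add_nonneg_pos mult_nonneg_nonneg) auto
  have "\<epsilon> / K > 0" using \<epsilon> K by simp
  from approximableD[OF ap this] obtain \<phi> where \<phi>: "\<phi> \<in> A"
    and e: "energy N p (\<lambda>x. v x - \<phi> x) (\<lambda>x i. g x i - gradient \<phi> x i) < ennreal (\<epsilon> / K)" .
  note sm = A[OF \<phi>]
  have "energy N p (\<lambda>x. \<psi> x * v x - \<psi> x * \<phi> x)
      (\<lambda>x i. \<psi> x * g x i + gradient \<psi> x i * v x - gradient (\<lambda>x. \<psi> x * \<phi> x) x i) \<le>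
      ennreal K * energy N p (\<lambda>x. v x - \<phi> x) (\<lambda>x i. g x i - gradient \<phi> x i)"
  proof (rule energy_le)
    show "pair_measurable N (\<lambda>x. v x - \<phi> x) (\<lambda>x i. g x i - gradient \<phi> x i)"
      by (intro pair_measurable_diff m smooth_pair_measurable sm)
    fix x assume x: "x \<in> space (PM N)"
    let ?h = "\<lambda>i. g x i - gradient \<phi> x i" and ?w = "v x - \<phi> x"
    have b: "\<bar>\<psi> x\<bar> \<le> \<bar>B\<bar>" "enorm N (gradient \<psi> x) \<le> \<bar>B\<bar>"
      using bd[OF x] by linarith+
    have "\<bar>\<psi> x * v x - \<psi> x * \<phi> x\<bar> = \<bar>\<psi> x\<bar> * \<bar>?w\<bar>"
      by (simp add: abs_mult[symmetric] algebra_simps)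
    also have "\<dots> \<le> \<bar>B\<bar> * \<bar>?w\<bar>" using b by (intro mult_right_mono) auto
    finally have 1: "\<bar>\<psi> x * v x - \<psi> x * \<phi> x\<bar> powr p \<le> \<bar>B\<bar> powr p * \<bar>?w\<bar> powr p"
      using p by (subst powr_mult[symmetric]) (auto intro!: powr_mono2)
    have "enorm N (\<lambda>i. \<psi> x * g x i + gradient \<psi> x i * v x - gradient (\<lambda>x. \<psi> x * \<phi> x) x i) =
        enorm N (\<lambda>i. \<psi> x * ?h i + ?w * gradient \<psi> x i)"
      using x partial_mult[OF \<psi> sm] by (intro enorm_cong) (simp add: gradient_def space_PM algebra_simps)
    also have "\<dots> \<le> \<bar>\<psi> x\<bar> * enorm N ?h + \<bar>?w\<bar> * enorm N (gradient \<psi> x)"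
      using enorm_triangle[of N "\<lambda>i. \<psi> x * ?h i" "\<lambda>i. ?w * gradient \<psi> x i"] unfolding enorm_scale .
    also have "\<dots> \<le> \<bar>B\<bar> * enorm N ?h + \<bar>?w\<bar> * \<bar>B\<bar>"
      using b by (intro add_mono mult_right_mono mult_left_mono) auto
    finally have "enorm N (\<lambda>i. \<psi> x * g x i + gradient \<psi> x i * v x - gradient (\<lambda>x. \<psi> x * \<phi> x) x i) powr p \<le>
        2 powr p * ((\<bar>B\<bar> * enorm N ?h) powr p + (\<bar>?w\<bar> * \<bar>B\<bar>) powr p)"
      using p by (intro powr_add_le) auto
    also have "\<dots> = 2 powr p * \<bar>B\<bar> powr p * (\<bar>?w\<bar> powr p + enorm N ?h powr p)"
      by (simp add: powr_mult algebra_simps)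
    finally have "\<bar>\<psi> x * v x - \<psi> x * \<phi> x\<bar> powr p +
        enorm N (\<lambda>i. \<psi> x * g x i + gradient \<psi> x i * v x - gradient (\<lambda>x. \<psi> x * \<phi> x) x i) powr p \<le>
        \<bar>B\<bar> powr p * \<bar>?w\<bar> powr p + 2 powr p * \<bar>B\<bar> powr p * (\<bar>?w\<bar> powr p + enorm N ?h powr p)"
      using 1 by linarith
    also have "\<dots> \<le> K * (\<bar>?w\<bar> powr p + enorm N ?h powr p)"
      by (simp add: K_def algebra_simps)
    finally show "\<bar>\<psi> x * v x - \<psi> x * \<phi> x\<bar> powr p +
        enorm N (\<lambda>i. \<psi> x * g x i + gradient \<psi> x i * v x - gradient (\<lambda>x. \<psi> x * \<phi> x) x i) powr p \<le>
        K * (\<bar>?w\<bar> powr p + enorm N ?h powr p)" .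
  qed (use K in simp)
  also have "\<dots> < ennreal K * ennreal (\<epsilon> / K)"
    using e K by (intro ennreal_mult_strict_left_mono) auto
  also have "\<dots> = ennreal \<epsilon>"
    using K \<epsilon> by (simp add: ennreal_mult'[symmetric])
  finally show "\<exists>\<phi>\<in>A'. energy N p (\<lambda>x. \<psi> x * v x - \<phi> x)
      (\<lambda>x i. \<psi> x * g x i + gradient \<psi> x i * v x - gradient \<phi> x i) < ennreal \<epsilon>"
    using A'[OF \<phi>] by (rule bexI[where x="\<lambda>x. \<psi> x * \<phi> x"])
qed

lemma approximable_scale:
  assumes ap: "approximable N p (test_functions N \<Omega>) v g" and p: "0 < p"
  shows "approximable N p (test_functions N \<Omega>) (\<lambda>x. c * v x) (\<lambda>x i. c * g x i)"
proof -
  have "gradient (\<lambda>x. c) x = (\<lambda>i. 0)" for x :: point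
    by (simp add: gradient_def partial_def)
  then have "approximable N p (test_functions N \<Omega>) (\<lambda>x. c * v x) (\<lambda>x i. c * g x i + gradient (\<lambda>x. c) x i * v x)"
    by (intro approximable_weight[OF ap p test_smooth smooth_const, where B="\<bar>c\<bar>"]) (simp_all add: test_cmult)
  with \<open>\<And>x. gradient (\<lambda>x. c) x = (\<lambda>i. 0)\<close> show ?thesis by simp
qed

lemma approximable_diff_test:
  assumes ap: "approximable N p (test_functions N \<Omega>) v g" and \<rho>: "\<rho> \<in> test_functions N \<Omega>"
  shows "approximable N p (test_functions N \<Omega>) (\<lambda>x. v x - \<rho> x) (\<lambda>x i. g x i - gradient \<rho> x i)"
proof (rule approximableI)
  note sm = test_smooth[OF \<rho>]
  show "pair_measurable N (\<lambda>x. v x - \<rho> x) (\<lambda>x i. g x i - gradient \<rho> x i)"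
    by (intro pair_measurable_diff approximable_measurable[OF ap] smooth_pair_measurable sm)
  fix \<epsilon> :: real assume "\<epsilon> > 0"
  from approximableD[OF ap this] obtain \<phi> where \<phi>: "\<phi> \<in> test_functions N \<Omega>"
    and e: "energy N p (\<lambda>x. v x - \<phi> x) (\<lambda>x i. g x i - gradient \<phi> x i) < ennreal \<epsilon>" .
  have "energy N p (\<lambda>x. v x - \<rho> x - (\<phi> x - \<rho> x)) (\<lambda>x i. g x i - gradient \<rho> x i - gradient (\<lambda>x. \<phi> x - \<rho> x) x i) =
    energy N p (\<lambda>x. v x - \<phi> x) (\<lambda>x i. g x i - gradient \<phi> x i)"
    using partial_diff[OF test_smooth[OF \<phi>] sm]
    by (intro energy_cong) (simp_all add: gradient_def space_PM)
  also note e
  finally show "\<exists>\<phi>\<in>test_functions N \<Omega>. energy N p (\<lambda>x. v x - \<rho> x - \<phi> x)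
      (\<lambda>x i. g x i - gradient \<rho> x i - gradient \<phi> x i) < ennreal \<epsilon>"
    using test_diff[OF \<phi> \<rho>] by (rule bexI[where x="\<lambda>x. \<phi> x - \<rho> x"])
qed

text \<open>
  The slope of \<open>s * flat s\<close> lies in \<open>[0, 1]\<close>, so the smooth functions \<open>(t - k) * flat (c * (t - k))\<close>
  approximate \<open>max (t - k) 0\<close> with uniformly bounded derivatives as \<open>c\<close> tends to infinity.
\<close>

definition flat_slope :: "real \<Rightarrow> real" where
  "flat_slope s = (if 0 < s then (1 + 1 / s) * exp (- 1 / s) else 0)"

lemma flat_slope_bounds: "0 \<le> flat_slope s" "flat_slope s \<le> 1"
proof -
  show "0 \<le> flat_slope s" by (simp add: flat_slope_def)
  show "flat_slope s \<le> 1"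
  proof (cases "0 < s")
    case True
    have "(1 + 1 / s) * exp (- (1 / s)) \<le> exp (1 / s) * exp (- (1 / s))"
      by (intro mult_right_mono exp_ge_add_one_self) auto
    also have "\<dots> = 1" by (simp add: exp_minus)
    finally show ?thesis using True by (simp add: flat_slope_def)
  qed (simp add: flat_slope_def)
qed

lemma flat_tendsto_0: "(flat \<longlongrightarrow> 0) (at 0)"
proof -
  have "((\<lambda>s::real. exp (- 1 / s)) \<longlongrightarrow> 0) (at_right 0)" by real_asymp
  then have "(flat \<longlongrightarrow> 0) (at_right 0)"
    by (rule Lim_transform_eventually) (auto simp: flat_def eventually_at_right_field intro!: exI[of _ 1])
  moreover have "(flat \<longlongrightarrow> 0) (at_left 0)"
    by (rule tendsto_eventually) (auto simp: flat_def eventually_at_left_field intro!: exI[of _ "-1"])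
  ultimately show ?thesis by (simp add: filterlim_split_at)
qed

lemma flat_slope_deriv: "((\<lambda>s. s * flat s) has_real_derivative flat_slope s) (at s)"
proof -
  consider "0 < s" | "s < 0" | "s = 0" by linarith
  then show ?thesis
  proof cases
    case 1
    have minv: "((\<lambda>t. - 1 / t) has_real_derivative (1 / s)\<^sup>2) (at s)"
      using 1 by (auto intro!: derivative_eq_intros simp: power2_eq_square)
    have "((\<lambda>t. t * exp (- 1 / t)) has_real_derivative 1 * exp (- 1 / s) + exp (- 1 / s) * (1 / s)\<^sup>2 * s) (at s)"
      by (intro DERIV_mult DERIV_ident DERIV_chain2[OF DERIV_exp minv])
    also have "1 * exp (- 1 / s) + exp (- 1 / s) * (1 / s)\<^sup>2 * s = flat_slope s"
      using 1 by (simp add: flat_slope_def power2_eq_square field_simps)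
    finally show ?thesis
      by (rule has_field_derivative_transform_within_open[of _ _ _ "{0<..}"]) (use 1 in \<open>auto simp: flat_def\<close>)
  next
    case 2
    have "((\<lambda>t. 0) has_real_derivative flat_slope s) (at s)" using 2 by (simp add: flat_slope_def)
    then show ?thesis
      by (rule has_field_derivative_transform_within_open[of _ _ _ "{..<0}"]) (use 2 in \<open>auto simp: flat_def\<close>)
  next
    case 3
    have "((\<lambda>h. h * flat h / h) \<longlongrightarrow> 0) (at 0)"
      by (rule Lim_transform_eventually[OF flat_tendsto_0]) (simp add: eventually_at_filter)
    then show ?thesis using 3 by (simp add: has_field_derivative_iff flat_slope_def)
  qed
qed

lemma flat_slope_continuous: "continuous_on UNIV flat_slope"
proof -
  have "isCont flat_slope s" for s
  proof -
    consider "0 < s" | "s < 0" | "s = 0" by linarith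
    then show ?thesis
    proof cases
      case 1
      have "continuous_on {0<..} (\<lambda>s::real. (1 + 1 / s) * exp (- 1 / s))"
        by (intro continuous_intros) auto
      then have "continuous_on {0<..} flat_slope"
        by (rule continuous_on_eq) (simp add: flat_slope_def)
      then show ?thesis using 1 by (simp add: continuous_on_eq_continuous_at)
    next
      case 2
      have "continuous_on {..<0} (\<lambda>s::real. 0::real)" by simp
      then have "continuous_on {..<0} flat_slope"
        by (rule continuous_on_eq) (simp add: flat_slope_def)
      then show ?thesis using 2 by (simp add: continuous_on_eq_continuous_at)
    next
      case 3
      have "((\<lambda>s::real. (1 + 1 / s) * exp (- 1 / s)) \<longlongrightarrow> 0) (at_right 0)" by real_asymp
      then have "(flat_slope \<longlongrightarrow> 0) (at_right 0)"
        by (rule Lim_transform_eventually) (auto simp: flat_slope_def eventually_at_right_field intro!: exI[of _ 1])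
      moreover have "(flat_slope \<longlongrightarrow> 0) (at_left 0)"
        by (rule tendsto_eventually) (auto simp: flat_slope_def eventually_at_left_field intro!: exI[of _ "-1"])
      ultimately show ?thesis using 3 by (simp add: isCont_def filterlim_split_at flat_slope_def)
    qed
  qed
  then show ?thesis by (simp add: continuous_at_imp_continuous_on)
qed

lemma flat_slope_tendsto: "(\<lambda>n. flat_slope (real n * t)) \<longlonglongrightarrow> (if 0 < t then 1 else 0)"
proof (cases "0 < t")
  case True
  have "(\<lambda>n. (1 + 1 / (real n * t)) * exp (- 1 / (real n * t))) \<longlonglongrightarrow> 1"
    using True by real_asymp
  moreover have "\<forall>\<^sub>F n in sequentially. (1 + 1 / (real n * t)) * exp (- 1 / (real n * t)) = flat_slope (real n * t)"
    using eventually_gt_at_top[of 0] by eventually_elim (use True in \<open>auto simp: flat_slope_def\<close>)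
  ultimately show ?thesis using True by (simp add: Lim_transform_eventually)
next
  case False
  then have "flat_slope (real n * t) = 0" for n
    by (auto simp: flat_slope_def zero_less_mult_iff)
  then show ?thesis using False by simp
qed

definition nonneg_tests :: "nat \<Rightarrow> point set \<Rightarrow> (point \<Rightarrow> real) set" where
  "nonneg_tests N \<Omega> = {\<phi> \<in> test_functions N \<Omega>. \<forall>x \<in> topspace (RN N). 0 \<le> \<phi> x}"

text \<open>Because \<open>0 \<le> k\<close>, the smoothed truncations vanish at 0 and so map test
  functions to test functions; as they are nonnegative, the limit lies in the closure of
  \<open>nonneg_tests\<close>. On the set where \<open>v = k\<close> the limiting gradient is 0, in
  accordance with \<open>flat_slope 0 = 0\<close>.\<close>

lemma approximable_truncate:
  assumes ap: "approximable N p (test_functions N \<Omega>) v g" and p: "0 < p" and k: "0 \<le> k"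
  shows "approximable N p (nonneg_tests N \<Omega>) (\<lambda>x. max (v x - k) 0) (\<lambda>x i. of_bool (k < v x) * g x i)"
proof -
  \<comment> \<open>\<open>Suc\<close> excludes the degenerate sharpness 0.\<close>
  define c where "c n = real (Suc n)" for n
  have c: "0 < c n" for n by (simp add: c_def)
  define \<theta> where "\<theta> n t = (t - k) * flat (c n * (t - k))" for n t
  define d\<theta> where "d\<theta> n t = flat_slope (c n * (t - k))" for n t
  have der: "(\<theta> n has_real_derivative d\<theta> n t) (at t)" for n t
  proof -
    have "((\<lambda>t. c n * (t - k)) has_real_derivative c n) (at t)"
      by (auto intro!: derivative_eq_intros)
    from DERIV_cmult[OF DERIV_chain2[OF flat_slope_deriv this], of "1 / c n"]
    show ?thesis using c[of n] by (simp add: \<theta>_def[abs_def] d\<theta>_def)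
  qed
  have cont: "continuous_on UNIV (d\<theta> n)" for n
    unfolding d\<theta>_def by (intro continuous_on_compose2[OF flat_slope_continuous] continuous_intros) auto
  have fin: "energy N p v g < \<infinity>" by (rule approximable_energy_finite[OF ap order_refl p])
  have m [measurable]: "pair_measurable N v g" by (rule approximable_measurable[OF ap])
  have apn: "approximable N p (nonneg_tests N \<Omega>) (\<lambda>x. \<theta> n (v x)) (\<lambda>x i. d\<theta> n (v x) * g x i)" for n
  proof (rule approximable_compose[OF ap test_smooth p fin der _ cont])
    show "\<bar>d\<theta> n t\<bar> \<le> 1" for t using flat_slope_bounds[of "c n * (t - k)"] by (simp add: d\<theta>_def)
    fix \<phi> assume \<phi>: "\<phi> \<in> test_functions N \<Omega>"
    have "(\<lambda>x. \<theta> n (\<phi> x)) \<in> test_functions N \<Omega>"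
    proof (rule test_of_support[OF \<phi>])
      show "smooth_RN N (\<lambda>x. \<theta> n (\<phi> x))"
        unfolding \<theta>_def by (intro smooth_mult smooth_flat smooth_diff smooth_const test_smooth[OF \<phi>])
      show "\<phi> x = 0 \<Longrightarrow> \<theta> n (\<phi> x) = 0" for x
        using k c[of n] by (simp add: \<theta>_def flat_eq_0_iff)
    qed
    moreover have "0 \<le> \<theta> n t" for t
      using flat_bounds[of "c n * (t - k)"] flat_eq_0_iff[of "c n * (t - k)"] c[of n]
      by (cases "k \<le> t") (auto simp: \<theta>_def mult_le_0_iff)
    ultimately show "(\<lambda>x. \<theta> n (\<phi> x)) \<in> nonneg_tests N \<Omega>"
      by (simp add: nonneg_tests_def)
  qed
  \<comment> \<open>Together with \<open>dbd\<close> this gives the majorant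
    \<open>\<bar>v x\<bar> powr p + enorm N (g x) powr p\<close>, independent of \<open>n\<close>,
    for the dominated convergence below.\<close>
  have \<theta>bd: "\<bar>max (t - k) 0 - \<theta> n t\<bar> \<le> \<bar>t\<bar>" for n t
  proof (cases "k < t")
    case True
    have "0 \<le> \<theta> n t" "\<theta> n t \<le> (t - k)"
      using True flat_bounds[of "c n * (t - k)"] by (auto simp: \<theta>_def mult_left_le)
    then show ?thesis using True k by auto
  next
    case False
    then have "flat (c n * (t - k)) = 0" using c[of n] by (simp add: flat_eq_0_iff mult_le_0_iff)
    then show ?thesis using False by (simp add: \<theta>_def)
  qed
  have \<theta>lim: "(\<lambda>n. max (t - k) 0 - \<theta> n t) \<longlonglongrightarrow> 0" for t
  proof -
    have "(\<lambda>n. max (t - k) 0 - (t - k) * flat (real (Suc n) * (t - k))) \<longlonglongrightarrow>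
        max (t - k) 0 - (t - k) * (if 0 < t - k then 1 else 0)"
      by (intro tendsto_intros LIMSEQ_Suc flat_tendsto)
    also have "max (t - k) 0 - (t - k) * (if 0 < t - k then 1 else 0) = 0" by auto
    finally show ?thesis by (simp add: \<theta>_def c_def)
  qed
  have dlim: "(\<lambda>n. of_bool (k < t) - d\<theta> n t) \<longlonglongrightarrow> 0" for t
  proof -
    have "(\<lambda>n. of_bool (k < t) - flat_slope (real (Suc n) * (t - k))) \<longlonglongrightarrow>
        of_bool (k < t) - (if 0 < t - k then 1 else 0)"
      by (intro tendsto_intros LIMSEQ_Suc flat_slope_tendsto)
    also have "of_bool (k < t) - (if 0 < t - k then 1 else (0::real)) = 0" by auto
    finally show ?thesis by (simp add: d\<theta>_def c_def)
  qed
  have dbd: "\<bar>of_bool (k < t) - d\<theta> n t\<bar> \<le> 1" for n t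
    using flat_slope_bounds[of "c n * (t - k)"] by (auto simp: d\<theta>_def of_bool_def)
  have [measurable]: "\<theta> n \<in> borel_measurable borel" for n
    by (rule borel_measurable_continuous_onI) (use der in \<open>meson DERIV_continuous continuous_at_imp_continuous_on\<close>)
  have [measurable]: "d\<theta> n \<in> borel_measurable borel" for n
    by (rule borel_measurable_continuous_onI[OF cont])
  have mt: "pair_measurable N (\<lambda>x. max (v x - k) 0) (\<lambda>x i. of_bool (k < v x) * g x i)"
    unfolding pair_measurable_def
    by (intro conjI allI impI borel_measurable_times pair_measurable_comp[OF m]) measurable
  let ?F = "\<lambda>n x. \<bar>max (v x - k) 0 - \<theta> n (v x)\<bar> powr p + (\<bar>of_bool (k < v x) - d\<theta> n (v x)\<bar> * enorm N (g x)) powr p"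
  have en: "energy N p (\<lambda>x. max (v x - k) 0 - \<theta> n (v x)) (\<lambda>x i. of_bool (k < v x) * g x i - d\<theta> n (v x) * g x i) =
      (\<integral>\<^sup>+x. ennreal (?F n x) \<partial>PM N)" for n
    unfolding energy_def left_diff_distrib[symmetric] enorm_scale ..
  have "(\<lambda>n. \<integral>\<^sup>+x. ennreal (?F n x) \<partial>PM N) \<longlonglongrightarrow> (\<integral>\<^sup>+x. 0 \<partial>PM N)"
  proof (rule nn_integral_dominated_convergence[where w="\<lambda>x. ennreal (\<bar>v x\<bar> powr p + enorm N (g x) powr p)"])
    show "AE x in PM N. ennreal (?F n x) \<le> ennreal (\<bar>v x\<bar> powr p + enorm N (g x) powr p)" for n
    proof (intro AE_I2 ennreal_leI add_mono powr_mono2)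
      fix x
      show "\<bar>of_bool (k < v x) - d\<theta> n (v x)\<bar> * enorm N (g x) \<le> enorm N (g x)"
        using mult_right_mono[OF dbd[of "v x" n] enorm_nonneg[of N "g x"]] by simp
    qed (use p \<theta>bd in auto)
    show "(\<integral>\<^sup>+x. ennreal (\<bar>v x\<bar> powr p + enorm N (g x) powr p) \<partial>PM N) < \<infinity>"
      using fin by (simp add: energy_def)
    show "AE x in PM N. (\<lambda>n. ennreal (?F n x)) \<longlonglongrightarrow> 0"
    proof (rule AE_I2)
      fix x
      have "(\<lambda>n. \<bar>max (v x - k) 0 - \<theta> n (v x)\<bar> powr p) \<longlonglongrightarrow> 0"
        by (rule tendsto_zero_powrI[OF tendsto_rabs_zero[OF \<theta>lim] tendsto_const]) (use p in auto)
      moreover have "(\<lambda>n. (\<bar>of_bool (k < v x) - d\<theta> n (v x)\<bar> * enorm N (g x)) powr p) \<longlonglongrightarrow> 0"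
        by (rule tendsto_zero_powrI[OF tendsto_mult_left_zero[OF tendsto_rabs_zero[OF dlim]] tendsto_const]) (use p in auto)
      ultimately have "(\<lambda>n. ?F n x) \<longlonglongrightarrow> 0 + 0" by (rule tendsto_add)
      then have "(\<lambda>n. ?F n x) \<longlonglongrightarrow> 0" by simp
      from tendsto_ennrealI[OF this] show "(\<lambda>n. ennreal (?F n x)) \<longlonglongrightarrow> 0" by (simp only: ennreal_0)
    qed
  qed measurable
  then have lim: "(\<lambda>n. \<integral>\<^sup>+x. ennreal (?F n x) \<partial>PM N) \<longlonglongrightarrow> 0" by simp
  show ?thesis
  proof (rule approximable_closed[OF p _ mt])
    show "\<phi> \<in> nonneg_tests N \<Omega> \<Longrightarrow> smooth_RN N \<phi>" for \<phi>
      unfolding nonneg_tests_def by (blast intro: test_smooth)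
    fix \<epsilon> :: real assume "\<epsilon> > 0"
    then have "\<forall>\<^sub>F n in sequentially. (\<integral>\<^sup>+x. ennreal (?F n x) \<partial>PM N) < ennreal \<epsilon>"
      using order_tendstoD(2)[OF lim] by simp
    then obtain n where "(\<integral>\<^sup>+x. ennreal (?F n x) \<partial>PM N) < ennreal \<epsilon>"
      using eventually_happens'[OF sequentially_bot] by blast
    then have "energy N p (\<lambda>x. max (v x - k) 0 - \<theta> n (v x)) (\<lambda>x i. of_bool (k < v x) * g x i - d\<theta> n (v x) * g x i) < ennreal \<epsilon>"
      unfolding en .
    with apn[of n] show "\<exists>v' g'. approximable N p (nonneg_tests N \<Omega>) v' g' \<and>
        energy N p (\<lambda>x. max (v x - k) 0 - v' x) (\<lambda>x i. of_bool (k < v x) * g x i - g' x i) < ennreal \<epsilon>"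
      by (intro exI[of _ "\<lambda>x. \<theta> n (v x)"] exI[of _ "\<lambda>x i. d\<theta> n (v x) * g x i"] conjI)
  qed
qed

lemma nonneg_tests_subset: "nonneg_tests N \<Omega> \<subseteq> test_functions N \<Omega>"
  by (simp add: nonneg_tests_def)

subsection \<open>Translations and the Faber-Krahn inequality\<close>

lemma line_powr_increment:
  fixes f f' :: "real \<Rightarrow> real"
  assumes der: "\<And>y. (f has_real_derivative f' y) (at y)" and cont: "continuous_on UNIV f'"
    and s: "0 \<le> s" and p: "1 < p"
  shows "ennreal (\<bar>f (y + s) - f y\<bar> powr p) \<le>
    ennreal (2 powr p * s powr (p - 1)) * (\<integral>\<^sup>+r. indicator {0..s} r * ennreal (\<bar>f' (y + r)\<bar> powr p) \<partial>lborel)"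
proof (cases "f (y + s) = f y")
  case False
  then have s0: "s > 0" using s by (cases "s = 0") auto
  define \<Delta> where "\<Delta> = \<bar>f (y + s) - f y\<bar>"
  have \<Delta>: "\<Delta> > 0" using False by (simp add: \<Delta>_def)
  \<comment> \<open>With half the mean slope as \<open>b\<close>, the bound \<open>z \<le> b + b powr (1 - p) * z powr p\<close> replaces Jensen's inequality.\<close>
  define b where "b = \<Delta> / s / 2"
  have b: "b > 0" using \<Delta> s0 by (simp add: b_def)
  have cont': "continuous_on {0..s} (\<lambda>r. f' (y + r))"
    by (intro continuous_on_compose2[OF cont] continuous_intros) auto
  have der': "((\<lambda>r. f (y + r)) has_real_derivative f' (y + r)) (at r)" for r
  proof -
    have "((\<lambda>r. y + r) has_real_derivative 1) (at r)" by (auto intro!: derivative_eq_intros)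
    from DERIV_chain2[OF der this] show ?thesis by simp
  qed
  have "has_bochner_integral lborel (\<lambda>r. f' (y + r) * indicator {0..s} r) (f (y + s) - f (y + 0))"
  proof (rule has_bochner_integral_FTC_Icc_real[OF s der'])
    have "continuous_on UNIV (\<lambda>r. f' (y + r))"
      by (intro continuous_on_compose2[OF cont] continuous_intros) auto
    then show "isCont (\<lambda>r. f' (y + r)) r" for r by (simp add: continuous_on_eq_continuous_at)
  qed
  then have ftc: "integrable lborel (\<lambda>r. f' (y + r) * indicator {0..s} r)"
    "(\<integral>r. f' (y + r) * indicator {0..s} r \<partial>lborel) = f (y + s) - f y"
    by (auto simp: has_bochner_integral_iff)
  have contp: "continuous_on {0..s} (\<lambda>r. \<bar>f' (y + r)\<bar> powr p)"
    using p by (intro continuous_on_powr' continuous_intros cont') auto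
  have intp: "integrable lborel (\<lambda>r. indicator {0..s} r *\<^sub>R \<bar>f' (y + r)\<bar> powr p)"
    using borel_integrable_atLeastAtMost'[OF contp] by (simp add: set_integrable_def)
  have intb: "integrable lborel (\<lambda>r. indicator {0..s} r *\<^sub>R b)"
  proof -
    have "integrable lborel (indicator {0..s} :: real \<Rightarrow> real)"
      by (rule integrable_real_indicator) (use s in simp_all)
    then show ?thesis by simp
  qed
  define J where "J = (\<integral>r. indicator {0..s} r *\<^sub>R \<bar>f' (y + r)\<bar> powr p \<partial>lborel)"
  have "\<Delta> \<le> (\<integral>r. \<bar>f' (y + r) * indicator {0..s} r\<bar> \<partial>lborel)"
    unfolding \<Delta>_def ftc(2)[symmetric] by (rule integral_abs_bound)
  also have "\<dots> \<le> (\<integral>r. indicator {0..s} r *\<^sub>R b + b powr (1 - p) * (indicator {0..s} r *\<^sub>R \<bar>f' (y + r)\<bar> powr p) \<partial>lborel)"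
  proof (rule integral_mono)
    show "integrable lborel (\<lambda>r. \<bar>f' (y + r) * indicator {0..s} r\<bar>)" using ftc(1) by simp
    show "integrable lborel (\<lambda>r. indicator {0..s} r *\<^sub>R b + b powr (1 - p) * (indicator {0..s} r *\<^sub>R \<bar>f' (y + r)\<bar> powr p))"
      by (intro Bochner_Integration.integrable_add integrable_mult_right intb intp)
    fix r
    have "z \<le> b + b powr (1 - p) * z powr p" if "z \<ge> 0" for z
    proof (cases "z \<le> b")
      case True
      then show ?thesis by (smt (verit) mult_nonneg_nonneg powr_ge_zero)
    next
      case zb: False
      then have "z = z powr (1 - p) * z powr p" using b by (simp add: powr_add[symmetric])
      also have "\<dots> \<le> b powr (1 - p) * z powr p"
        using zb b p by (intro mult_right_mono powr_mono2') auto
      finally show ?thesis using b by linarith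
    qed
    from this[of "\<bar>f' (y + r)\<bar>"]
    show "\<bar>f' (y + r) * indicator {0..s} r\<bar> \<le>
        indicator {0..s} r *\<^sub>R b + b powr (1 - p) * (indicator {0..s} r *\<^sub>R \<bar>f' (y + r)\<bar> powr p)"
      by (auto split: split_indicator)
  qed
  also have "\<dots> = (\<integral>r. indicator {0..s} r *\<^sub>R b \<partial>lborel) + b powr (1 - p) * J"
    unfolding J_def
    by (subst Bochner_Integration.integral_add[OF intb integrable_mult_right[OF intp]]) (rule arg_cong2[where f="(+)"], simp_all)
  also have "(\<integral>r. indicator {0..s} r *\<^sub>R b \<partial>lborel) = s * b"
    using s by simp
  finally have "\<Delta> \<le> s * b + b powr (1 - p) * J" .
  moreover have "\<Delta> = 2 * (s * b)" using s0 by (simp add: b_def)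
  ultimately have "s * b \<le> b powr (1 - p) * J" by linarith
  then have "b powr (p - 1) * (s * b) \<le> b powr (p - 1) * (b powr (1 - p) * J)"
    by (intro mult_left_mono) auto
  also have "\<dots> = J" using b by (simp add: powr_add[symmetric] mult.assoc[symmetric])
  finally have "s * (b powr (p - 1) * b powr 1) \<le> J" using b by (simp add: mult_ac)
  then have sb: "s * b powr p \<le> J" using b by (simp only: powr_add[symmetric]) simp
  have "\<Delta> powr p = (2 * s * b) powr p" using \<open>\<Delta> = 2 * (s * b)\<close> by (simp add: mult.assoc)
  also have "\<dots> = 2 powr p * (s powr (p - 1) * s powr 1) * b powr p"
    using s0 b by (simp only: powr_add[symmetric]) (simp add: powr_mult)
  also have "\<dots> = 2 powr p * s powr (p - 1) * (s * b powr p)"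
    using s0 by simp
  also have "\<dots> \<le> 2 powr p * s powr (p - 1) * J"
    using sb by (intro mult_left_mono) auto
  finally have "\<Delta> powr p \<le> 2 powr p * s powr (p - 1) * J" .
  moreover have "ennreal J = (\<integral>\<^sup>+r. indicator {0..s} r * ennreal (\<bar>f' (y + r)\<bar> powr p) \<partial>lborel)"
    unfolding J_def
    by (subst nn_integral_eq_integral[OF intp, symmetric])
      (auto intro!: nn_integral_cong split: split_indicator)
  moreover have "J \<ge> 0" unfolding J_def by (intro Bochner_Integration.integral_nonneg) auto
  ultimately show ?thesis
    unfolding \<Delta>_def by (metis ennreal_leI ennreal_mult' mult_nonneg_nonneg powr_ge_zero)
qed simp

text \<open>The pointwise increment bound is integrated over \<open>y\<close> and the integrals are
  exchanged. By translation invariance the inner integral does not depend on \<open>r\<close>, so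
  the interval \<open>{0..s}\<close> contributes one more factor \<open>s\<close> to
  \<open>s powr (p - 1)\<close>.\<close>

lemma line_translation:
  fixes f f' :: "real \<Rightarrow> real"
  assumes der: "\<And>y. (f has_real_derivative f' y) (at y)" and cont: "continuous_on UNIV f'"
    and s: "0 \<le> s" and p: "1 < p"
  shows "(\<integral>\<^sup>+y. ennreal (\<bar>f (y + s) - f y\<bar> powr p) \<partial>lborel) \<le>
    ennreal (2 powr p * s powr p) * (\<integral>\<^sup>+y. ennreal (\<bar>f' y\<bar> powr p) \<partial>lborel)"
proof -
  have [measurable]: "f' \<in> borel_measurable borel" by (rule borel_measurable_continuous_onI[OF cont])
  let ?c = "ennreal (2 powr p * s powr (p - 1))"
  have "(\<integral>\<^sup>+y. ennreal (\<bar>f (y + s) - f y\<bar> powr p) \<partial>lborel) \<le>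
    (\<integral>\<^sup>+y. ?c * (\<integral>\<^sup>+r. indicator {0..s} r * ennreal (\<bar>f' (y + r)\<bar> powr p) \<partial>lborel) \<partial>lborel)"
    by (intro nn_integral_mono line_powr_increment assms)
  also have "\<dots> = ?c * (\<integral>\<^sup>+y. \<integral>\<^sup>+r. indicator {0..s} r * ennreal (\<bar>f' (y + r)\<bar> powr p) \<partial>lborel \<partial>lborel)"
    by (rule nn_integral_cmult) measurable
  also have "(\<integral>\<^sup>+y. \<integral>\<^sup>+r. indicator {0..s} r * ennreal (\<bar>f' (y + r)\<bar> powr p) \<partial>lborel \<partial>lborel) =
      (\<integral>\<^sup>+r. \<integral>\<^sup>+y. indicator {0..s} r * ennreal (\<bar>f' (y + r)\<bar> powr p) \<partial>lborel \<partial>lborel)"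
    by (rule lborel_pair.Fubini'[symmetric]) measurable
  also have "\<dots> = (\<integral>\<^sup>+r. indicator {0..s} r * (\<integral>\<^sup>+y. ennreal (\<bar>f' y\<bar> powr p) \<partial>lborel) \<partial>lborel)"
  proof (rule nn_integral_cong)
    fix r :: real
    have "(\<integral>\<^sup>+y. indicator {0..s} r * ennreal (\<bar>f' (y + r)\<bar> powr p) \<partial>lborel) =
        indicator {0..s} r * (\<integral>\<^sup>+y. ennreal (\<bar>f' (y + r)\<bar> powr p) \<partial>lborel)"
      by (rule nn_integral_cmult) measurable
    also have "(\<integral>\<^sup>+y. ennreal (\<bar>f' (y + r)\<bar> powr p) \<partial>lborel) = (\<integral>\<^sup>+y. ennreal (\<bar>f' y\<bar> powr p) \<partial>distr lborel lborel (\<lambda>y. y + r))"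
      by (rule nn_integral_distr[symmetric]) measurable
    finally show "(\<integral>\<^sup>+y. indicator {0..s} r * ennreal (\<bar>f' (y + r)\<bar> powr p) \<partial>lborel) =
        indicator {0..s} r * (\<integral>\<^sup>+y. ennreal (\<bar>f' y\<bar> powr p) \<partial>lborel)"
      by (simp add: distr_lborel_plus)
  qed
  also have "\<dots> = ennreal s * (\<integral>\<^sup>+y. ennreal (\<bar>f' y\<bar> powr p) \<partial>lborel)"
    using s by (subst nn_integral_multc) auto
  also have "?c * \<dots> = ennreal (2 powr p * s powr p) * (\<integral>\<^sup>+y. ennreal (\<bar>f' y\<bar> powr p) \<partial>lborel)"
  proof -
    have "2 powr p * s powr (p - 1) * s = 2 powr p * s powr p"
      using s by (cases "s = 0") (auto simp: powr_diff)
    then have "?c * ennreal s = ennreal (2 powr p * s powr p)"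
      using s by (simp add: ennreal_mult'[symmetric])
    then show ?thesis by (simp only: mult.assoc[symmetric])
  qed
  finally show ?thesis .
qed

lemma coordinate_translation:
  assumes \<phi>: "smooth_RN N \<phi>" and i: "i < N" and s: "0 \<le> s" and p: "1 < p"
  shows "(\<integral>\<^sup>+x. ennreal (\<bar>\<phi> (shift_RN N (\<lambda>j. if j = i then s else 0) x) - \<phi> x\<bar> powr p) \<partial>PM N) \<le>
    ennreal (2 powr p * s powr p) * (\<integral>\<^sup>+x. ennreal (enorm N (gradient \<phi> x) powr p) \<partial>PM N)"
proof -
  let ?S = "shift_RN N (\<lambda>j. if j = i then s else 0)"
  have [measurable]: "\<phi> \<in> borel_measurable (PM N)" by (rule smooth_measurable[OF \<phi>])
  have [measurable]: "partial i \<phi> \<in> borel_measurable (PM N)" by (rule partial_measurable[OF \<phi> i])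
  have [measurable]: "(\<lambda>x. enorm N (gradient \<phi> x)) \<in> borel_measurable (PM N)"
    by (rule pair_measurableD(2)[OF smooth_pair_measurable[OF \<phi>]])
  let ?P = "Pi\<^sub>M ({..<N} - {i}) (\<lambda>_. lborel :: real measure)"
  have "(\<integral>\<^sup>+x. ennreal (\<bar>\<phi> (?S x) - \<phi> x\<bar> powr p) \<partial>PM N) =
      (\<integral>\<^sup>+x. \<integral>\<^sup>+y. ennreal (\<bar>\<phi> (?S (x(i := y))) - \<phi> (x(i := y))\<bar> powr p) \<partial>lborel \<partial>?P)"
    by (rule nn_integral_PM_coord[OF _ i]) measurable
  also have "\<dots> \<le> (\<integral>\<^sup>+x. ennreal (2 powr p * s powr p) * (\<integral>\<^sup>+y. ennreal (\<bar>partial i \<phi> (x(i := y))\<bar> powr p) \<partial>lborel) \<partial>?P)"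
  proof (rule nn_integral_mono)
    fix x assume "x \<in> space ?P"
    then have ln: "x(i := y) \<in> {..<N} \<rightarrow>\<^sub>E UNIV" for y using i by (rule upd_space_PM)
    have sh: "?S (x(i := y)) = x(i := y + s)" for y
    proof
      fix j show "?S (x(i := y)) j = (x(i := y + s)) j"
        using PiE_arb[OF ln[of y], of j] i by (auto simp: shift_RN_def)
    qed
    have "((\<lambda>t. \<phi> (x(i := t))) has_real_derivative partial i \<phi> (x(i := y))) (at y)" for y
      using smooth_has_partial_line[OF \<phi> i ln[of 0], of y] by (simp only: fun_upd_upd)
    moreover have "continuous_on UNIV (\<lambda>y. partial i \<phi> (x(i := y)))"
      using continuous_on_line[OF partial_continuous[OF \<phi> i] ln[of 0] i] by (simp only: fun_upd_upd)
    ultimately show "(\<integral>\<^sup>+y. ennreal (\<bar>\<phi> (?S (x(i := y))) - \<phi> (x(i := y))\<bar> powr p) \<partial>lborel) \<le>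
        ennreal (2 powr p * s powr p) * (\<integral>\<^sup>+y. ennreal (\<bar>partial i \<phi> (x(i := y))\<bar> powr p) \<partial>lborel)"
      unfolding sh using s p by (rule line_translation)
  qed
  also have "\<dots> = (\<integral>\<^sup>+x. \<integral>\<^sup>+y. ennreal (2 powr p * s powr p) * ennreal (\<bar>partial i \<phi> (x(i := y))\<bar> powr p) \<partial>lborel \<partial>?P)"
  proof (rule nn_integral_cong)
    fix x assume x: "x \<in> space ?P"
    have "continuous_on UNIV (\<lambda>y. partial i \<phi> (x(i := y)))"
      using continuous_on_line[OF partial_continuous[OF \<phi> i] upd_space_PM[OF x i, of 0] i] by (simp only: fun_upd_upd)
    then have [measurable]: "(\<lambda>y. partial i \<phi> (x(i := y))) \<in> borel_measurable borel"
      by (rule borel_measurable_continuous_onI)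
    show "ennreal (2 powr p * s powr p) * (\<integral>\<^sup>+y. ennreal (\<bar>partial i \<phi> (x(i := y))\<bar> powr p) \<partial>lborel) =
      (\<integral>\<^sup>+y. ennreal (2 powr p * s powr p) * ennreal (\<bar>partial i \<phi> (x(i := y))\<bar> powr p) \<partial>lborel)"
      by (rule nn_integral_cmult[symmetric]) measurable
  qed
  also have "\<dots> = (\<integral>\<^sup>+x. ennreal (2 powr p * s powr p) * ennreal (\<bar>partial i \<phi> x\<bar> powr p) \<partial>PM N)"
    by (rule nn_integral_PM_coord[OF _ i, symmetric]) measurable
  also have "\<dots> \<le> (\<integral>\<^sup>+x. ennreal (2 powr p * s powr p) * ennreal (enorm N (gradient \<phi> x) powr p) \<partial>PM N)"
    using p component_le_enorm[OF i]
    by (intro nn_integral_mono mult_left_mono ennreal_leI powr_mono2) (simp_all add: gradient_def)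
  also have "\<dots> = ennreal (2 powr p * s powr p) * (\<integral>\<^sup>+x. ennreal (enorm N (gradient \<phi> x) powr p) \<partial>PM N)"
    by (rule nn_integral_cmult) measurable
  finally show ?thesis .
qed

lemma nn_integral_powr_add_le:
  fixes f g :: "'a \<Rightarrow> real"
  assumes [measurable]: "f \<in> borel_measurable M" "g \<in> borel_measurable M" and p: "0 < p"
    and h: "\<And>x. x \<in> space M \<Longrightarrow> \<bar>h x\<bar> \<le> \<bar>f x\<bar> + \<bar>g x\<bar>"
  shows "(\<integral>\<^sup>+x. ennreal (\<bar>h x\<bar> powr p) \<partial>M) \<le>
    ennreal (2 powr p) * ((\<integral>\<^sup>+x. ennreal (\<bar>f x\<bar> powr p) \<partial>M) + (\<integral>\<^sup>+x. ennreal (\<bar>g x\<bar> powr p) \<partial>M))"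
proof -
  have "(\<integral>\<^sup>+x. ennreal (\<bar>h x\<bar> powr p) \<partial>M) \<le>
      (\<integral>\<^sup>+x. ennreal (2 powr p) * (ennreal (\<bar>f x\<bar> powr p) + ennreal (\<bar>g x\<bar> powr p)) \<partial>M)"
  proof (rule nn_integral_mono)
    fix x assume "x \<in> space M"
    then have "\<bar>h x\<bar> powr p \<le> 2 powr p * (\<bar>f x\<bar> powr p + \<bar>g x\<bar> powr p)"
      using p h by (intro powr_add_le) auto
    then show "ennreal (\<bar>h x\<bar> powr p) \<le> ennreal (2 powr p) * (ennreal (\<bar>f x\<bar> powr p) + ennreal (\<bar>g x\<bar> powr p))"
      by (simp add: ennreal_mult'[symmetric] ennreal_plus[symmetric] ennreal_leI del: ennreal_plus)
  qed
  also have "\<dots> = ennreal (2 powr p) * (\<integral>\<^sup>+x. (ennreal (\<bar>f x\<bar> powr p) + ennreal (\<bar>g x\<bar> powr p)) \<partial>M)"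
    by (rule nn_integral_cmult) measurable
  also have "(\<integral>\<^sup>+x. (ennreal (\<bar>f x\<bar> powr p) + ennreal (\<bar>g x\<bar> powr p)) \<partial>M) =
      (\<integral>\<^sup>+x. ennreal (\<bar>f x\<bar> powr p) \<partial>M) + (\<integral>\<^sup>+x. ennreal (\<bar>g x\<bar> powr p) \<partial>M)"
    by (rule nn_integral_add) measurable
  finally show ?thesis .
qed

text \<open>Coordinates are moved one at a time. Each further move costs a factor
  \<open>2 powr p\<close> for splitting the increment; the new move itself is bounded with constant
  \<open>2 powr p\<close>, the earlier ones with the previous value.\<close>

fun translation_const :: "real \<Rightarrow> nat \<Rightarrow> real" where
  "translation_const p 0 = 0"
| "translation_const p (Suc k) = 2 powr p * (2 powr p + translation_const p k)"

lemma translation_const_nonneg: "0 \<le> translation_const p k"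
  by (induction k) auto

lemma smooth_translation:
  assumes \<phi>: "smooth_RN N \<phi>" and p: "1 < p" and h: "\<And>i. i < N \<Longrightarrow> 0 \<le> h i \<and> h i \<le> t" and k: "k \<le> N"
  shows "(\<integral>\<^sup>+x. ennreal (\<bar>\<phi> (shift_RN N (\<lambda>j. if j < k then h j else 0) x) - \<phi> x\<bar> powr p) \<partial>PM N) \<le>
    ennreal (translation_const p k * t powr p) * (\<integral>\<^sup>+x. ennreal (enorm N (gradient \<phi> x) powr p) \<partial>PM N)"
  using k
proof (induction k)
  case 0
  have "shift_RN N (\<lambda>j. if j < 0 then h j else 0) x = x" if "x \<in> space (PM N)" for x
    using that PiE_arb[of x "{..<N}" "\<lambda>_. UNIV"] by (auto simp: shift_RN_def space_PM restrict_def fun_eq_iff)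
  then have "(\<integral>\<^sup>+x. ennreal (\<bar>\<phi> (shift_RN N (\<lambda>j. if j < 0 then h j else 0) x) - \<phi> x\<bar> powr p) \<partial>PM N) =
      (\<integral>\<^sup>+x. 0 \<partial>PM N)"
    by (intro nn_integral_cong) simp
  then show ?case by simp
next
  case (Suc k)
  then have k: "k < N" by simp
  let ?T = "shift_RN N (\<lambda>j. if j < k then h j else 0)"
  let ?T' = "shift_RN N (\<lambda>j. if j < Suc k then h j else 0)"
  let ?S = "shift_RN N (\<lambda>j. if j = k then h k else 0)"
  let ?G = "\<integral>\<^sup>+x. ennreal (enorm N (gradient \<phi> x) powr p) \<partial>PM N"
  have [measurable]: "\<phi> \<in> borel_measurable (PM N)" by (rule smooth_measurable[OF \<phi>])
  have TS: "?T' x = ?S (?T x)" for x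
    by (auto simp: shift_RN_def fun_eq_iff less_Suc_eq)
  have "(\<integral>\<^sup>+x. ennreal (\<bar>\<phi> (?T' x) - \<phi> x\<bar> powr p) \<partial>PM N) \<le> ennreal (2 powr p) *
     ((\<integral>\<^sup>+x. ennreal (\<bar>\<phi> (?S (?T x)) - \<phi> (?T x)\<bar> powr p) \<partial>PM N) +
      (\<integral>\<^sup>+x. ennreal (\<bar>\<phi> (?T x) - \<phi> x\<bar> powr p) \<partial>PM N))"
    unfolding TS
  proof (rule nn_integral_powr_add_le)
    show "\<bar>\<phi> (?S (?T x)) - \<phi> x\<bar> \<le> \<bar>\<phi> (?S (?T x)) - \<phi> (?T x)\<bar> + \<bar>\<phi> (?T x) - \<phi> x\<bar>" for x by linarith
    show "0 < p" using p by simp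
  qed measurable
  \<comment> \<open>The new one-coordinate shift acts after \<open>?T\<close>, and \<open>?T\<close>
    is removed by translation invariance of the integral.\<close>
  also have "(\<integral>\<^sup>+x. ennreal (\<bar>\<phi> (?S (?T x)) - \<phi> (?T x)\<bar> powr p) \<partial>PM N) =
      (\<integral>\<^sup>+x. ennreal (\<bar>\<phi> (?S x) - \<phi> x\<bar> powr p) \<partial>PM N)"
    by (rule nn_integral_shift_RN) measurable
  also have "\<dots> \<le> ennreal (2 powr p * h k powr p) * ?G"
    using h[OF k] by (intro coordinate_translation \<phi> k p) auto
  also have "\<dots> \<le> ennreal (2 powr p * t powr p) * ?G"
    using h[OF k] p by (intro mult_right_mono ennreal_leI mult_left_mono powr_mono2) auto
  also have "(\<integral>\<^sup>+x. ennreal (\<bar>\<phi> (?T x) - \<phi> x\<bar> powr p) \<partial>PM N) \<le> ennreal (translation_const p k * t powr p) * ?G"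
    using Suc by simp
  also have "ennreal (2 powr p) * (ennreal (2 powr p * t powr p) * ?G + ennreal (translation_const p k * t powr p) * ?G) =
      ennreal (translation_const p (Suc k) * t powr p) * ?G"
    using translation_const_nonneg[of p k]
    by (simp add: ennreal_mult'[symmetric] ennreal_plus[symmetric] distrib_right[symmetric] mult.assoc[symmetric] del: ennreal_plus)
  finally show ?case
    by (simp add: add_left_mono add_right_mono mult_left_mono)
qed

text \<open>Carries a gradient inequality from tests to their limits. One factor
  \<open>2 powr p\<close> is lost in passing from \<open>v\<close> to \<open>\<phi>\<close>, another
  in passing from the gradient of \<open>\<phi>\<close> back to \<open>g\<close>, so
  \<open>K\<close> becomes \<open>4 powr p * K\<close>. Used with translation increments and with
  the Poincare inequality.\<close>

lemma approximable_transfer: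
  fixes L :: "(point \<Rightarrow> real) \<Rightarrow> ennreal"
  assumes ap: "approximable N p A v g" and p: "0 < p" and A: "\<And>\<phi>. \<phi> \<in> A \<Longrightarrow> smooth_RN N \<phi>"
    and K: "0 \<le> K"
    and sub: "\<And>f w. f \<in> borel_measurable (PM N) \<Longrightarrow> w \<in> borel_measurable (PM N) \<Longrightarrow>
      L f \<le> ennreal (2 powr p) * (L (\<lambda>x. f x - w x) + L w)"
    and bd: "\<And>f. f \<in> borel_measurable (PM N) \<Longrightarrow> L f \<le> ennreal (4 powr p) * (\<integral>\<^sup>+x. ennreal (\<bar>f x\<bar> powr p) \<partial>PM N)"
    and test: "\<And>\<phi>. \<phi> \<in> A \<Longrightarrow> L \<phi> \<le> ennreal K * (\<integral>\<^sup>+x. ennreal (enorm N (gradient \<phi> x) powr p) \<partial>PM N)"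
  shows "L v \<le> ennreal (4 powr p * K) * (\<integral>\<^sup>+x. ennreal (enorm N (g x) powr p) \<partial>PM N)"
proof (rule ennreal_le_epsilon)
  fix e :: real assume e: "e > 0"
  let ?I = "\<lambda>g. \<integral>\<^sup>+x. ennreal (enorm N (g x) powr p) \<partial>PM N"
  \<comment> \<open>Total coefficient of the error: \<open>4 powr p\<close> from \<open>L\<close>
    applied to \<open>v - \<phi>\<close> and \<open>K * 2 powr p\<close> from the gradient of
    \<open>\<phi>\<close>, both times the outer \<open>2 powr p\<close>.\<close>
  define C where "C = 2 powr p * (4 powr p + K * 2 powr p)"
  have C: "C > 0" unfolding C_def using K by (intro mult_pos_pos add_pos_nonneg) auto
  have m: "pair_measurable N v g" by (rule approximable_measurable[OF ap])
  note [measurable] = m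
  have "e / C > 0" using e C by simp
  from approximableD[OF ap this] obtain \<phi> where \<phi>: "\<phi> \<in> A"
    and en: "energy N p (\<lambda>x. v x - \<phi> x) (\<lambda>x i. g x i - gradient \<phi> x i) < ennreal (e / C)" .
  have m\<phi> [measurable]: "pair_measurable N \<phi> (gradient \<phi>)" by (rule smooth_pair_measurable[OF A[OF \<phi>]])
  have md [measurable]: "pair_measurable N (\<lambda>x. v x - \<phi> x) (\<lambda>x i. g x i - gradient \<phi> x i)"
    by (rule pair_measurable_diff[OF m m\<phi>])
  have "(\<integral>\<^sup>+x. ennreal (\<bar>enorm N (gradient \<phi> x)\<bar> powr p) \<partial>PM N) \<le> ennreal (2 powr p) *
      ((\<integral>\<^sup>+x. ennreal (\<bar>enorm N (g x)\<bar> powr p) \<partial>PM N) + (\<integral>\<^sup>+x. ennreal (\<bar>enorm N (\<lambda>i. g x i - gradient \<phi> x i)\<bar> powr p) \<partial>PM N))"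
  proof (intro nn_integral_powr_add_le p)
    fix x
    have "enorm N (gradient \<phi> x) = enorm N (\<lambda>i. g x i + (-1) * (g x i - gradient \<phi> x i))" by simp
    also have "\<dots> \<le> enorm N (g x) + \<bar>-1\<bar> * enorm N (\<lambda>i. g x i - gradient \<phi> x i)"
      using enorm_triangle[of N "g x" "\<lambda>i. (-1) * (g x i - gradient \<phi> x i)"] unfolding enorm_scale .
    finally show "\<bar>enorm N (gradient \<phi> x)\<bar> \<le> \<bar>enorm N (g x)\<bar> + \<bar>enorm N (\<lambda>i. g x i - gradient \<phi> x i)\<bar>" by simp
  qed measurable
  then have grad: "?I (gradient \<phi>) \<le> ennreal (2 powr p) * (?I g + ennreal (e / C))"
    using order_trans[OF energy_component_le(2) less_imp_le[OF en]]
    by (simp add: order_trans[OF _ mult_left_mono[OF add_left_mono]])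
  have "L v \<le> ennreal (2 powr p) * (L (\<lambda>x. v x - \<phi> x) + L \<phi>)"
    by (rule sub) measurable
  also have "L (\<lambda>x. v x - \<phi> x) \<le> ennreal (4 powr p) * (\<integral>\<^sup>+x. ennreal (\<bar>v x - \<phi> x\<bar> powr p) \<partial>PM N)"
    by (rule bd) measurable
  also have "(\<integral>\<^sup>+x. ennreal (\<bar>v x - \<phi> x\<bar> powr p) \<partial>PM N) \<le> ennreal (e / C)"
    using order_trans[OF energy_component_le(1) less_imp_le[OF en]] .
  also have "L \<phi> \<le> ennreal K * ?I (gradient \<phi>)" by (rule test[OF \<phi>])
  also note grad
  also have "ennreal (2 powr p) * (ennreal (4 powr p) * ennreal (e / C) +
      ennreal K * (ennreal (2 powr p) * (?I g + ennreal (e / C)))) =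
      ennreal (2 powr p) * ennreal K * ennreal (2 powr p) * ?I g +
      ennreal (2 powr p) * (ennreal (4 powr p) + ennreal K * ennreal (2 powr p)) * ennreal (e / C)"
    by (simp add: algebra_simps)
  also have "ennreal (2 powr p) * ennreal K * ennreal (2 powr p) = ennreal (4 powr p * K)"
  proof -
    have "2 powr p * K * 2 powr p = 4 powr p * K"
      using powr_mult[of 2 2 p] by simp
    then show ?thesis using K by (simp add: ennreal_mult'[symmetric])
  qed
  also have "ennreal (2 powr p) * (ennreal (4 powr p) + ennreal K * ennreal (2 powr p)) * ennreal (e / C) = ennreal e"
    using K C e by (simp add: ennreal_mult'[symmetric] ennreal_plus[symmetric] C_def[symmetric] del: ennreal_plus)
  finally show "L v \<le> ennreal (4 powr p * K) * ?I g + ennreal e"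
    by (simp add: add_left_mono add_right_mono mult_left_mono)
qed

lemma approximable_translation:
  assumes ap: "approximable N p (test_functions N \<Omega>) v g" and p: "1 < p"
    and h: "\<And>i. i < N \<Longrightarrow> 0 \<le> h i \<and> h i \<le> t"
  shows "(\<integral>\<^sup>+x. ennreal (\<bar>v (shift_RN N h x) - v x\<bar> powr p) \<partial>PM N) \<le>
    ennreal (4 powr p * (translation_const p N * t powr p)) * (\<integral>\<^sup>+x. ennreal (enorm N (g x) powr p) \<partial>PM N)"
proof (rule approximable_transfer[OF ap, where L="\<lambda>v. \<integral>\<^sup>+x. ennreal (\<bar>v (shift_RN N h x) - v x\<bar> powr p) \<partial>PM N"])
  show "0 < p" using p by simp
  show "0 \<le> translation_const p N * t powr p"
    by (intro mult_nonneg_nonneg translation_const_nonneg) simp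
  show "\<phi> \<in> test_functions N \<Omega> \<Longrightarrow> smooth_RN N \<phi>" for \<phi> by (rule test_smooth)
  show "(\<integral>\<^sup>+x. ennreal (\<bar>f (shift_RN N h x) - f x\<bar> powr p) \<partial>PM N) \<le> ennreal (2 powr p) *
      ((\<integral>\<^sup>+x. ennreal (\<bar>f (shift_RN N h x) - w (shift_RN N h x) - (f x - w x)\<bar> powr p) \<partial>PM N) +
       (\<integral>\<^sup>+x. ennreal (\<bar>w (shift_RN N h x) - w x\<bar> powr p) \<partial>PM N))"
    if [measurable]: "f \<in> borel_measurable (PM N)" "w \<in> borel_measurable (PM N)" for f w
  proof (rule nn_integral_powr_add_le)
    show "0 < p" using p by simp
    show "\<bar>f (shift_RN N h x) - f x\<bar> \<le> \<bar>f (shift_RN N h x) - w (shift_RN N h x) - (f x - w x)\<bar> +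
        \<bar>w (shift_RN N h x) - w x\<bar>" for x by linarith
  qed measurable
  show "(\<integral>\<^sup>+x. ennreal (\<bar>f (shift_RN N h x) - f x\<bar> powr p) \<partial>PM N) \<le>
      ennreal (4 powr p) * (\<integral>\<^sup>+x. ennreal (\<bar>f x\<bar> powr p) \<partial>PM N)"
    if [measurable]: "f \<in> borel_measurable (PM N)" for f
  proof -
    have "(\<integral>\<^sup>+x. ennreal (\<bar>f (shift_RN N h x) - f x\<bar> powr p) \<partial>PM N) \<le> ennreal (2 powr p) *
      ((\<integral>\<^sup>+x. ennreal (\<bar>f (shift_RN N h x)\<bar> powr p) \<partial>PM N) + (\<integral>\<^sup>+x. ennreal (\<bar>f x\<bar> powr p) \<partial>PM N))"
    proof (rule nn_integral_powr_add_le)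
      show "0 < p" using p by simp
      show "\<bar>f (shift_RN N h x) - f x\<bar> \<le> \<bar>f (shift_RN N h x)\<bar> + \<bar>f x\<bar>" for x by linarith
    qed measurable
    also have "(\<integral>\<^sup>+x. ennreal (\<bar>f (shift_RN N h x)\<bar> powr p) \<partial>PM N) = (\<integral>\<^sup>+x. ennreal (\<bar>f x\<bar> powr p) \<partial>PM N)"
      by (rule nn_integral_shift_RN) measurable
    also have "ennreal (2 powr p) * ((\<integral>\<^sup>+x. ennreal (\<bar>f x\<bar> powr p) \<partial>PM N) + (\<integral>\<^sup>+x. ennreal (\<bar>f x\<bar> powr p) \<partial>PM N)) =
      ennreal (2 powr p * 2) * (\<integral>\<^sup>+x. ennreal (\<bar>f x\<bar> powr p) \<partial>PM N)"
      by (simp add: ennreal_mult' mult.assoc mult_2)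
    also have "\<dots> \<le> ennreal (4 powr p) * (\<integral>\<^sup>+x. ennreal (\<bar>f x\<bar> powr p) \<partial>PM N)"
    proof (intro mult_right_mono ennreal_leI)
      have "(2::real) powr 1 \<le> 2 powr p" using p by (intro powr_mono) auto
      then have "2 powr p * 2 \<le> 2 powr p * (2::real) powr p" by (intro mult_left_mono) auto
      then show "2 powr p * 2 \<le> (4::real) powr p" using powr_mult[of 2 2 p] by simp
    qed simp
    finally show ?thesis .
  qed
  show "(\<integral>\<^sup>+x. ennreal (\<bar>\<phi> (shift_RN N h x) - \<phi> x\<bar> powr p) \<partial>PM N) \<le>
      ennreal (translation_const p N * t powr p) * (\<integral>\<^sup>+x. ennreal (enorm N (gradient \<phi> x) powr p) \<partial>PM N)"
    if "\<phi> \<in> test_functions N \<Omega>" for \<phi>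
  proof -
    have "shift_RN N (\<lambda>j. if j < N then h j else 0) = shift_RN N h"
      by (auto simp: shift_RN_def restrict_def fun_eq_iff)
    then show ?thesis
      using smooth_translation[where h=h and t=t and k=N, OF test_smooth[OF that] p h order_refl] by simp
  qed
qed

lemma shift_RN_pair_measurable [measurable]:
  "(\<lambda>z. shift_RN N (fst z) (snd z)) \<in> measurable (PM N \<Otimes>\<^sub>M PM N) (PM N)"
  unfolding shift_RN_def by measurable

text \<open>
  Half of the cube of volume \<open>2 m\<close> based at \<open>x\<close> lies outside the support of \<open>v\<close>, so averaging the
  translation estimate over that cube controls \<open>\<bar>v x\<bar>\<close> itself.
\<close>

lemma faber_krahn:
  assumes ap: "approximable N p (test_functions N \<Omega>) v g" and p: "1 < p" and N: "1 \<le> N"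
    and m: "0 < m" "emeasure (PM N) {x \<in> space (PM N). v x \<noteq> 0} \<le> ennreal m"
  shows "(\<integral>\<^sup>+x. ennreal (\<bar>v x\<bar> powr p) \<partial>PM N) \<le>
    ennreal (2 * 4 powr p * translation_const p N * (2 * m) powr (p / N)) *
      (\<integral>\<^sup>+x. ennreal (enorm N (g x) powr p) \<partial>PM N)"
proof -
  let ?G = "\<integral>\<^sup>+x. ennreal (enorm N (g x) powr p) \<partial>PM N"
  have [measurable]: "v \<in> borel_measurable (PM N)"
    using pair_measurableD(1)[OF approximable_measurable[OF ap]] .
  define S where "S = {x \<in> space (PM N). v x \<noteq> 0}"
  have S [measurable]: "S \<in> sets (PM N)" unfolding S_def by measurable
  define t where "t = (2 * m) powr (1 / N)"
  have t: "t > 0" using m by (simp add: t_def)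
  define Q where "Q = Pi\<^sub>E {..<N} (\<lambda>i. {0..t})"
  have Q [measurable]: "Q \<in> sets (PM N)" unfolding Q_def by (intro sets_PiM_I_finite) auto
  have "t ^ N = 2 * m"
    using m N t by (simp add: powr_realpow[symmetric] t_def powr_powr)
  then have emQ: "emeasure (PM N) Q = ennreal (2 * m)"
    unfolding Q_def using emeasure_PM_box[of N "\<lambda>_. 0" "\<lambda>_. t"] t by simp
  define F where "F h x = ennreal (\<bar>v (shift_RN N h x) - v x\<bar> powr p)" for h x
  have [measurable]: "(\<lambda>z. F (fst z) (snd z)) \<in> borel_measurable (PM N \<Otimes>\<^sub>M PM N)"
    unfolding F_def by measurable
  have sw: "shift_RN N h x = shift_RN N x h" for h x by (simp add: shift_RN_def add.commute)
  have "(\<lambda>h. F h x) = (\<lambda>h. ennreal (\<bar>v (shift_RN N x h) - v x\<bar> powr p))" for x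
    by (rule ext, unfold F_def, subst sw, rule refl)
  then have [measurable]: "(\<lambda>h. F h x) \<in> borel_measurable (PM N)" for x by simp
  define c where "c = 4 powr p * (translation_const p N * t powr p)"
  have c0: "0 \<le> c" unfolding c_def by (intro mult_nonneg_nonneg translation_const_nonneg) auto
  have low: "ennreal m * ennreal (\<bar>v x\<bar> powr p) \<le> (\<integral>\<^sup>+h. indicator Q h * F h x \<partial>PM N)"
    if x: "x \<in> space (PM N)" for x
  proof -
    \<comment> \<open>The displacements that lead from \<open>x\<close> into the support. This is a
      translate of \<open>S\<close>, hence has measure at most \<open>m\<close>, and leaves at least
      \<open>m\<close> of the cube \<open>Q\<close>.\<close>
    define T where "T = shift_RN N x -` S \<inter> space (PM N)"
    have T [measurable]: "T \<in> sets (PM N)" unfolding T_def by measurable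
    have "emeasure (PM N) T = emeasure (distr (PM N) (PM N) (shift_RN N x)) S"
      unfolding T_def by (rule emeasure_distr[symmetric]) measurable
    then have emT: "emeasure (PM N) T \<le> ennreal m"
      using m(2) by (simp add: distr_shift_RN S_def)
    have "ennreal m \<le> emeasure (PM N) (Q - T)"
    proof (rule ccontr)
      assume "\<not> ennreal m \<le> emeasure (PM N) (Q - T)"
      then have lt: "emeasure (PM N) (Q - T) < ennreal m" by simp
      have "ennreal (2 * m) \<le> emeasure (PM N) ((Q - T) \<union> T)"
        unfolding emQ[symmetric] by (intro emeasure_mono) auto
      also have "\<dots> \<le> emeasure (PM N) (Q - T) + emeasure (PM N) T"
        by (intro emeasure_subadditive) measurable
      also have "\<dots> \<le> emeasure (PM N) (Q - T) + ennreal m"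
        by (rule add_left_mono[OF emT])
      also have "\<dots> < ennreal m + ennreal m"
        unfolding add.commute[of "emeasure (PM N) (Q - T)"] using lt by (simp add: ennreal_add_left_cancel_less)
      also have "\<dots> = ennreal (2 * m)" using m by (simp add: ennreal_plus[symmetric] del: ennreal_plus)
      finally show False by simp
    qed
    then have "ennreal m * ennreal (\<bar>v x\<bar> powr p) \<le> ennreal (\<bar>v x\<bar> powr p) * emeasure (PM N) (Q - T)"
      by (subst mult.commute) (intro mult_left_mono, auto)
    also have "\<dots> = (\<integral>\<^sup>+h. ennreal (\<bar>v x\<bar> powr p) * indicator (Q - T) h \<partial>PM N)"
      by (rule nn_integral_cmult_indicator[symmetric]) measurable
    also have "\<dots> \<le> (\<integral>\<^sup>+h. indicator Q h * F h x \<partial>PM N)"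
    proof (rule nn_integral_mono)
      fix h assume h: "h \<in> space (PM N)"
      show "ennreal (\<bar>v x\<bar> powr p) * indicator (Q - T) h \<le> indicator Q h * F h x"
      proof (cases "h \<in> Q - T")
        case True
        then have "shift_RN N x h \<notin> S" using h by (simp add: T_def)
        moreover have "shift_RN N x h \<in> space (PM N)" using measurable_space[OF shift_RN_measurable h] .
        ultimately have "v (shift_RN N h x) = 0" by (simp add: S_def sw[of h x])
        then show ?thesis using True by (simp add: F_def)
      qed simp
    qed
    finally show ?thesis .
  qed
  have "ennreal m * (\<integral>\<^sup>+x. ennreal (\<bar>v x\<bar> powr p) \<partial>PM N) = (\<integral>\<^sup>+x. ennreal m * ennreal (\<bar>v x\<bar> powr p) \<partial>PM N)"
    by (rule nn_integral_cmult[symmetric]) measurable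
  also have "\<dots> \<le> (\<integral>\<^sup>+x. \<integral>\<^sup>+h. indicator Q h * F h x \<partial>PM N \<partial>PM N)"
    by (intro nn_integral_mono low)
  also have "\<dots> = (\<integral>\<^sup>+h. \<integral>\<^sup>+x. indicator Q h * F h x \<partial>PM N \<partial>PM N)"
  proof -
    interpret pair_sigma_finite "PM N" "PM N"
      unfolding pair_sigma_finite_def using sigma_finite_PM by simp
    show ?thesis by (rule Fubini') measurable
  qed
  also have "\<dots> \<le> (\<integral>\<^sup>+h. (ennreal c * ?G) * indicator Q h \<partial>PM N)"
  proof (rule nn_integral_mono)
    fix h assume h: "h \<in> space (PM N)"
    show "(\<integral>\<^sup>+x. indicator Q h * F h x \<partial>PM N) \<le> (ennreal c * ?G) * indicator Q h"
    proof (cases "h \<in> Q")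
      case True
      then have "0 \<le> h i \<and> h i \<le> t" if "i < N" for i
        using that by (auto simp: Q_def PiE_iff)
      then have "(\<integral>\<^sup>+x. F h x \<partial>PM N) \<le> ennreal c * ?G"
        unfolding F_def c_def by (intro approximable_translation[OF ap p]) auto
      then show ?thesis using True by simp
    qed simp
  qed
  also have "\<dots> = (ennreal c * ?G) * ennreal (2 * m)"
    by (subst nn_integral_cmult_indicator) (simp_all add: emQ)
  finally have "ennreal m * (\<integral>\<^sup>+x. ennreal (\<bar>v x\<bar> powr p) \<partial>PM N) \<le> ennreal c * ?G * ennreal (2 * m)" .
  then have "ennreal (1 / m) * (ennreal m * (\<integral>\<^sup>+x. ennreal (\<bar>v x\<bar> powr p) \<partial>PM N)) \<le>
      ennreal (1 / m) * (ennreal c * ?G * ennreal (2 * m))"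
    by (rule mult_left_mono) simp
  moreover have "ennreal (1 / m) * (ennreal m * X) = X" for X
    using m by (simp add: mult.assoc[symmetric] ennreal_mult'[symmetric])
  moreover have "ennreal (1 / m) * (ennreal c * ?G * ennreal (2 * m)) = ennreal (2 * c) * ?G"
  proof -
    have "ennreal (1 / m) * (ennreal c * ?G * ennreal (2 * m)) = ennreal (1 / m) * ennreal c * ennreal (2 * m) * ?G"
      by (simp only: mult_ac)
    also have "ennreal (1 / m) * ennreal c * ennreal (2 * m) = ennreal (2 * c)"
      using m c0 by (simp add: ennreal_mult'[symmetric])
    finally show ?thesis .
  qed
  moreover have "2 * c = 2 * 4 powr p * translation_const p N * (2 * m) powr (p / N)"
    by (simp add: c_def t_def powr_powr)
  ultimately show ?thesis by simp
qed

subsection \<open>The subcritical embedding\<close>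

lemma markov_powr:
  assumes [measurable]: "f \<in> borel_measurable M" and "0 < k" "0 < p"
  shows "emeasure M {x \<in> space M. k < f x} \<le> ennreal (k powr - p) * (\<integral>\<^sup>+x. ennreal (\<bar>f x\<bar> powr p) \<partial>M)"
proof -
  have "emeasure M {x \<in> space M. k < f x} = (\<integral>\<^sup>+x. indicator {x \<in> space M. k < f x} x \<partial>M)"
    by (rule nn_integral_indicator[symmetric]) measurable
  also have "\<dots> \<le> (\<integral>\<^sup>+x. ennreal (k powr - p) * ennreal (\<bar>f x\<bar> powr p) \<partial>M)"
  proof (rule nn_integral_mono)
    fix x
    show "indicator {x \<in> space M. k < f x} x \<le> ennreal (k powr - p) * ennreal (\<bar>f x\<bar> powr p)"
    proof (cases "k < f x")
      case True
      have "1 = k powr - p * k powr p" using assms by (simp add: powr_add[symmetric])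
      also have "\<dots> \<le> k powr - p * \<bar>f x\<bar> powr p"
        using assms True by (intro mult_left_mono powr_mono2) auto
      finally have "ennreal 1 \<le> ennreal (k powr - p * \<bar>f x\<bar> powr p)" by (rule ennreal_leI)
      then show ?thesis by (simp add: ennreal_mult'[symmetric] indicator_def)
    qed simp
  qed
  also have "\<dots> = ennreal (k powr - p) * (\<integral>\<^sup>+x. ennreal (\<bar>f x\<bar> powr p) \<partial>M)"
    by (rule nn_integral_cmult) measurable
  finally show ?thesis .
qed

definition faber_krahn_const :: "real \<Rightarrow> nat \<Rightarrow> real" where
  "faber_krahn_const p N = 2 * 4 powr p * translation_const p N * 2 powr (p / N)"

lemma faber_krahn_const_nonneg: "0 \<le> faber_krahn_const p N"
  unfolding faber_krahn_const_def by (intro mult_nonneg_nonneg translation_const_nonneg) auto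

text \<open>Faber-Krahn is applied to the truncation at \<open>k\<close>, which is nonzero exactly
  where \<open>v > k\<close>. Where \<open>v > 2 * k\<close> this truncation exceeds
  \<open>k\<close>, so Markov's inequality bounds the next superlevel set.\<close>

lemma level_set_step:
  assumes ap: "approximable N p (test_functions N \<Omega>) v g" and p: "1 < p" and N: "1 \<le> N"
    and k: "0 < k" and m: "0 < m" "emeasure (PM N) {x \<in> space (PM N). k < v x} \<le> ennreal m"
    and G: "energy N p v g \<le> 1"
  shows "emeasure (PM N) {x \<in> space (PM N). 2 * k < v x} \<le> ennreal (k powr - p * (faber_krahn_const p N * m powr (p / N)))"
proof -
  have [measurable]: "v \<in> borel_measurable (PM N)"
    using pair_measurableD(1)[OF approximable_measurable[OF ap]] .
  let ?w = "\<lambda>x. max (v x - k) 0" and ?h = "\<lambda>x i. of_bool (k < v x) * g x i"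
  have apw: "approximable N p (test_functions N \<Omega>) ?w ?h"
    using approximable_mono[OF approximable_truncate[OF ap, of k] nonneg_tests_subset] p k by simp
  have "{x \<in> space (PM N). ?w x \<noteq> 0} = {x \<in> space (PM N). k < v x}" by auto
  then have "(\<integral>\<^sup>+x. ennreal (\<bar>?w x\<bar> powr p) \<partial>PM N) \<le>
      ennreal (2 * 4 powr p * translation_const p N * (2 * m) powr (p / N)) *
      (\<integral>\<^sup>+x. ennreal (enorm N (?h x) powr p) \<partial>PM N)"
    using faber_krahn[OF apw p N m(1)] m(2) by simp
  also have "(\<integral>\<^sup>+x. ennreal (enorm N (?h x) powr p) \<partial>PM N) \<le> (\<integral>\<^sup>+x. ennreal (enorm N (g x) powr p) \<partial>PM N)"
    using p unfolding enorm_scale by (intro nn_integral_mono ennreal_leI powr_mono2) (auto simp: of_bool_def)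
  also have "\<dots> \<le> 1" by (rule order_trans[OF energy_component_le(2) G])
  also have "2 * 4 powr p * translation_const p N * (2 * m) powr (p / N) = faber_krahn_const p N * m powr (p / N)"
    using m by (simp add: faber_krahn_const_def powr_mult)
  finally have w: "(\<integral>\<^sup>+x. ennreal (\<bar>?w x\<bar> powr p) \<partial>PM N) \<le> ennreal (faber_krahn_const p N * m powr (p / N))"
    by (simp add: mult_left_mono)
  have "{x \<in> space (PM N). 2 * k < v x} = {x \<in> space (PM N). k < ?w x}" using k by auto
  then have "emeasure (PM N) {x \<in> space (PM N). 2 * k < v x} \<le>
      ennreal (k powr - p) * (\<integral>\<^sup>+x. ennreal (\<bar>?w x\<bar> powr p) \<partial>PM N)"
    using markov_powr[of ?w "PM N" k p] k p by simp
  also have "\<dots> \<le> ennreal (k powr - p) * ennreal (faber_krahn_const p N * m powr (p / N))"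
    using w by (rule mult_left_mono) simp
  finally show ?thesis using faber_krahn_const_nonneg[of p N] by (simp add: ennreal_mult')
qed

text \<open>A weak-type estimate of exponent \<open>\<alpha>\<close> on the dyadic levels from 1 on.
  The constant is uniform over all domains and all pairs of energy at most 1, so it can later be
  applied to every truncation after normalising the energy.\<close>

definition weak_bound :: "nat \<Rightarrow> real \<Rightarrow> real \<Rightarrow> bool" where
  "weak_bound N p \<alpha> \<longleftrightarrow> (\<exists>C>0. \<forall>\<Omega> v g j. approximable N p (test_functions N \<Omega>) v g \<longrightarrow> energy N p v g \<le> 1 \<longrightarrow>
     emeasure (PM N) {x \<in> space (PM N). 2 ^ j < v x} \<le> ennreal (C * 2 powr (- (real j * \<alpha>))))"

lemma weak_bound_p:
  assumes "1 < p"
  shows "weak_bound N p p"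
  unfolding weak_bound_def
proof (intro exI[of _ 1] conjI allI impI)
  fix \<Omega> v g and j :: nat
  assume ap: "approximable N p (test_functions N \<Omega>) v g" and G: "energy N p v g \<le> 1"
  have [measurable]: "v \<in> borel_measurable (PM N)"
    using pair_measurableD(1)[OF approximable_measurable[OF ap]] .
  have "emeasure (PM N) {x \<in> space (PM N). 2 ^ j < v x} \<le>
      ennreal ((2 ^ j) powr - p) * (\<integral>\<^sup>+x. ennreal (\<bar>v x\<bar> powr p) \<partial>PM N)"
    using assms by (intro markov_powr) auto
  also have "\<dots> \<le> ennreal ((2 ^ j) powr - p) * 1"
    using order_trans[OF energy_component_le(1) G] by (rule mult_left_mono) simp
  also have "(2 ^ j) powr - p = 1 * 2 powr (- (real j * p))"
    by (simp add: powr_realpow[symmetric] powr_powr)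
  finally show "emeasure (PM N) {x \<in> space (PM N). 2 ^ j < v x} \<le> ennreal (1 * 2 powr (- (real j * p)))"
    by simp
qed simp

text \<open>\<open>level_set_step\<close> at \<open>k = 2 ^ i\<close>, with the assumed bound as
  \<open>m\<close>, contributes \<open>2 powr (- (i * p))\<close> from Markov's inequality and
  \<open>2 powr (- (i * \<alpha> * p / N))\<close> from the small support.\<close>

lemma weak_bound_step:
  assumes "weak_bound N p \<alpha>" and p: "1 < p" and N: "1 \<le> N"
  shows "weak_bound N p (p + \<alpha> * p / N)"
proof -
  from assms(1) obtain C where C: "C > 0" and wb: "\<And>\<Omega> v g j. approximable N p (test_functions N \<Omega>) v g \<Longrightarrow>
      energy N p v g \<le> 1 \<Longrightarrow>
      emeasure (PM N) {x \<in> space (PM N). 2 ^ j < v x} \<le> ennreal (C * 2 powr (- (real j * \<alpha>)))"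
    unfolding weak_bound_def by blast
  from weak_bound_p[OF p, of N] obtain C1 where C1: "C1 > 0" and wb1: "\<And>\<Omega> v g j. approximable N p (test_functions N \<Omega>) v g \<Longrightarrow>
      energy N p v g \<le> 1 \<Longrightarrow>
      emeasure (PM N) {x \<in> space (PM N). 2 ^ j < v x} \<le> ennreal (C1 * 2 powr (- (real j * p)))"
    unfolding weak_bound_def by blast
  let ?\<beta> = "p + \<alpha> * p / N"
  \<comment> \<open>\<open>C1\<close> handles the level \<open>j = 0\<close>, which has no
    predecessor; the factor \<open>2 powr ?\<beta>\<close> pays for passing from \<open>i\<close> to
    \<open>j = Suc i\<close>.\<close>
  define C' where "C' = C1 + faber_krahn_const p N * C powr (p / N) * 2 powr ?\<beta>"
  have C': "C' > 0" "C1 \<le> C'" "faber_krahn_const p N * C powr (p / N) * 2 powr ?\<beta> \<le> C'"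
    unfolding C'_def using C1 faber_krahn_const_nonneg[of p N] by (auto intro!: add_pos_nonneg mult_nonneg_nonneg)
  show ?thesis
    unfolding weak_bound_def
  proof (intro exI[of _ C'] conjI allI impI C'(1))
    fix \<Omega> v g and j :: nat
    assume ap: "approximable N p (test_functions N \<Omega>) v g" and G: "energy N p v g \<le> 1"
    show "emeasure (PM N) {x \<in> space (PM N). 2 ^ j < v x} \<le> ennreal (C' * 2 powr (- (real j * ?\<beta>)))"
    proof (cases j)
      case 0
      have "emeasure (PM N) {x \<in> space (PM N). 2 ^ j < v x} \<le> ennreal C1"
        using wb1[OF ap G, of 0] 0 by simp
      also have "\<dots> \<le> ennreal (C' * 2 powr (- (real j * ?\<beta>)))"
        using C'(2) 0 by (intro ennreal_leI) simp
      finally show ?thesis .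
    next
      case (Suc i)
      have m: "0 < C * 2 powr (- (real i * \<alpha>))" using C by simp
      have "emeasure (PM N) {x \<in> space (PM N). 2 * 2 ^ i < v x} \<le>
          ennreal ((2 ^ i) powr - p * (faber_krahn_const p N * (C * 2 powr (- (real i * \<alpha>))) powr (p / N)))"
        by (rule level_set_step[OF ap p N _ m wb[OF ap G] G]) simp
      also have "(2 ^ i) powr - p * (faber_krahn_const p N * (C * 2 powr (- (real i * \<alpha>))) powr (p / N)) =
          faber_krahn_const p N * C powr (p / N) * (2 powr (- (real i * p)) * 2 powr (- (real i * \<alpha>) * (p / N)))"
        using C by (simp add: powr_realpow[symmetric] powr_powr powr_mult)
      also have "2 powr (- (real i * p)) * 2 powr (- (real i * \<alpha>) * (p / N)) = 2 powr ?\<beta> * 2 powr (- (real j * ?\<beta>))"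
        unfolding powr_add[symmetric] Suc
          by (simp add: algebra_simps add_divide_distrib diff_divide_distrib)
      also have "faber_krahn_const p N * C powr (p / N) * (2 powr ?\<beta> * 2 powr (- (real j * ?\<beta>))) \<le> C' * 2 powr (- (real j * ?\<beta>))"
        using mult_right_mono[OF C'(3), of "2 powr (- (real j * ?\<beta>))"] by (simp add: mult.assoc)
      finally show ?thesis using Suc by (simp add: ennreal_leI)
    qed
  qed
qed

text \<open>
  The map \<open>\<alpha> \<mapsto> p + \<alpha> p / N\<close> has the critical exponent \<open>N p / (N - p)\<close> as its fixed point (none if
  \<open>p \<ge> N\<close>), so its iterates from \<open>p\<close> exceed every subcritical \<open>q\<close>.
\<close>

lemma weak_bound_supercritical:
  assumes p: "1 < p" and q: "p < q" and N: "1 \<le> N" and sub: "p < real N \<longrightarrow> q < real N * p / (real N - p)"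
  shows "\<exists>\<alpha>>q. weak_bound N p \<alpha>"
proof (rule ccontr)
  assume neg: "\<not> (\<exists>\<alpha>>q. weak_bound N p \<alpha>)"
  \<comment> \<open>A lower bound for the gain \<open>p - \<alpha> * (1 - p / N)\<close> of one
    iteration as long as \<open>\<alpha> \<le> q\<close>. For \<open>p < N\<close> its positivity is
    precisely the subcriticality of \<open>q\<close>.\<close>
  define \<delta> where "\<delta> = (if p < N then p - q * (1 - p / N) else p)"
  have \<delta>: "\<delta> > 0"
  proof (cases "p < N")
    case True
    then have "q * (N - p) < N * p" using sub by (simp add: pos_less_divide_eq)
    then have "q * (1 - p / N) < p" using True p by (simp add: field_simps)
    then show ?thesis using True by (simp add: \<delta>_def)
  qed (use p in \<open>simp add: \<delta>_def\<close>)
  have "\<exists>\<alpha>\<ge>p + real n * \<delta>. weak_bound N p \<alpha>" for n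
  proof (induction n)
    case 0
    then show ?case using weak_bound_p[OF p, of N] by auto
  next
    case (Suc n)
    then obtain \<alpha> where \<alpha>: "\<alpha> \<ge> p + real n * \<delta>" "weak_bound N p \<alpha>" by blast
    have "\<alpha> \<le> q" using neg \<alpha>(2) by force
    have "\<alpha> \<ge> 0" using \<alpha>(1) p \<delta> by (smt (verit) mult_nonneg_nonneg of_nat_0_le_iff)
    have "p + \<alpha> * p / N - \<alpha> = p - \<alpha> * (1 - p / N)" using N by (simp add: field_simps)
    also have "\<dots> \<ge> \<delta>"
    proof (cases "p < N")
      case True
      then have "\<alpha> * (1 - p / N) \<le> q * (1 - p / N)"
        using \<open>\<alpha> \<le> q\<close> p by (intro mult_right_mono) (auto simp: field_simps)
      then show ?thesis using True by (simp add: \<delta>_def)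
    next
      case False
      then have "\<alpha> * (1 - p / N) \<le> 0"
        using \<open>\<alpha> \<ge> 0\<close> N by (intro mult_nonneg_nonpos) (auto simp: field_simps)
      then show ?thesis using False by (simp add: \<delta>_def)
    qed
    finally have "p + \<alpha> * p / N \<ge> p + real (Suc n) * \<delta>" using \<alpha>(1) by (simp add: algebra_simps)
    then show ?case using weak_bound_step[OF \<alpha>(2) p N] by blast
  qed
  moreover obtain n where "q < real n * \<delta>" using reals_Archimedean3[OF \<delta>] by blast
  ultimately obtain \<alpha> where "\<alpha> \<ge> p + real n * \<delta>" "weak_bound N p \<alpha>" by blast
  with \<open>q < real n * \<delta>\<close> p neg show False by force
qed

lemma dyadic_level:
  fixes z :: real
  assumes "1 < z"
  obtains j where "2 ^ j < z" "z \<le> 2 ^ Suc j"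
proof -
  define n where "n = (LEAST n. z \<le> 2 ^ n)"
  have "\<exists>n. z \<le> 2 ^ n" using real_arch_pow[of 2 z] by (auto intro: less_imp_le)
  then have n: "z \<le> 2 ^ n" unfolding n_def by (rule LeastI_ex)
  have "n \<noteq> 0" using n assms by (intro notI) simp
  then obtain j where j: "n = Suc j" using not0_implies_Suc by blast
  have "\<not> z \<le> 2 ^ j" using not_less_Least[of j "\<lambda>n. z \<le> 2 ^ n"] j by (simp add: n_def)
  then show ?thesis using that[of j] n j by simp
qed

text \<open>Dyadic decomposition of the values: where \<open>\<bar>v\<bar> \<le> 1\<close> the
  exponent \<open>p\<close> suffices, and the level \<open>2 ^ j\<close> contributes a multiple of
  \<open>2 powr (j * (q - \<alpha>))\<close>, a convergent geometric series since
  \<open>\<alpha> > q\<close>.\<close>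

lemma embedding_unit:
  assumes p: "1 < p" and q: "p < q" and N: "1 \<le> N" and sub: "p < real N \<longrightarrow> q < real N * p / (real N - p)"
  obtains C where "C > 0" "\<And>\<Omega> v g. approximable N p (test_functions N \<Omega>) v g \<Longrightarrow> energy N p v g \<le> 1 \<Longrightarrow>
    (\<integral>\<^sup>+x. ennreal (\<bar>v x\<bar> powr q) \<partial>PM N) \<le> ennreal C"
proof -
  obtain \<alpha> where \<alpha>: "\<alpha> > q" "weak_bound N p \<alpha>" using weak_bound_supercritical[OF assms] by blast
  then obtain B where B: "B > 0" and wb: "\<And>\<Omega> v g j. approximable N p (test_functions N \<Omega>) v g \<Longrightarrow>
      energy N p v g \<le> 1 \<Longrightarrow>
      emeasure (PM N) {x \<in> space (PM N). 2 ^ j < v x} \<le> ennreal (B * 2 powr (- (real j * \<alpha>)))"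
    unfolding weak_bound_def by blast
  define r where "r = 2 powr (q - \<alpha>)"
  have r: "0 < r" "r < 1" using \<alpha>(1) by (auto simp: r_def powr_less_one)
  define C where "C = 1 + (\<Sum>j. 2 * 2 powr q * B * r ^ j)"
  have summ: "summable (\<lambda>j. 2 * 2 powr q * B * r ^ j)" using r by (intro summable_mult summable_geometric) simp
  have C: "C > 0" unfolding C_def using r B by (intro add_pos_nonneg suminf_nonneg summ) auto
  show ?thesis
  proof (rule that[OF C])
    fix \<Omega> v g assume ap: "approximable N p (test_functions N \<Omega>) v g" and G: "energy N p v g \<le> 1"
    have [measurable]: "v \<in> borel_measurable (PM N)"
      using pair_measurableD(1)[OF approximable_measurable[OF ap]] .
    \<comment> \<open>\<open>weak_bound\<close> sees upper level sets only; the negative part of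
      \<open>v\<close> is reached through \<open>- v\<close>.\<close>
    have apm: "approximable N p (test_functions N \<Omega>) (\<lambda>x. (-1) * v x) (\<lambda>x i. (-1) * g x i)"
      using p by (intro approximable_scale ap) simp
    have Gm: "energy N p (\<lambda>x. (-1) * v x) (\<lambda>x i. (-1) * g x i) \<le> 1"
      using G unfolding energy_def enorm_scale by simp
    let ?T = "\<lambda>j. {x \<in> space (PM N). 2 ^ j < v x}" and ?T' = "\<lambda>j. {x \<in> space (PM N). 2 ^ j < (-1) * v x}"
    let ?w = "\<lambda>j x. ennreal (2 powr (real (Suc j) * q)) * (indicator (?T j) x + indicator (?T' j) x)"
    have pw: "ennreal (\<bar>v x\<bar> powr q) \<le> ennreal (\<bar>v x\<bar> powr p) + (\<Sum>j. ?w j x)" if x: "x \<in> space (PM N)" for x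
    proof (cases "\<bar>v x\<bar> \<le> 1")
      case True
      have "\<bar>v x\<bar> powr q \<le> \<bar>v x\<bar> powr p" using True q by (intro powr_mono') auto
      then show ?thesis by (intro add_increasing2 ennreal_leI) auto
    next
      case False
      then obtain j where j: "2 ^ j < \<bar>v x\<bar>" "\<bar>v x\<bar> \<le> 2 ^ Suc j" using dyadic_level[of "\<bar>v x\<bar>"] by auto
      have "\<bar>v x\<bar> powr q \<le> (2 ^ Suc j) powr q" using j p q by (intro powr_mono2) auto
      also have "\<dots> = 2 powr (real (Suc j) * q)" unfolding powr_realpow[symmetric, OF zero_less_numeral] powr_powr ..
      finally have "ennreal (\<bar>v x\<bar> powr q) \<le> ennreal (2 powr (real (Suc j) * q)) * 1"
        by (simp add: ennreal_leI)
      also have "\<dots> \<le> ?w j x"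
        using j x by (intro mult_left_mono) (auto simp: indicator_def)
      also have "\<dots> = (\<Sum>i\<in>{j}. ?w i x)" by simp
      also have "\<dots> \<le> (\<Sum>j. ?w j x)" by (intro sum_le_suminf summableI) auto
      finally show ?thesis by (intro add_increasing) auto
    qed
    have "(\<integral>\<^sup>+x. ennreal (\<bar>v x\<bar> powr q) \<partial>PM N) \<le> (\<integral>\<^sup>+x. (ennreal (\<bar>v x\<bar> powr p) + (\<Sum>j. ?w j x)) \<partial>PM N)"
      by (intro nn_integral_mono pw)
    also have "\<dots> = (\<integral>\<^sup>+x. ennreal (\<bar>v x\<bar> powr p) \<partial>PM N) + (\<integral>\<^sup>+x. (\<Sum>j. ?w j x) \<partial>PM N)"
      by (rule nn_integral_add) measurable
    also have "(\<integral>\<^sup>+x. (\<Sum>j. ?w j x) \<partial>PM N) = (\<Sum>j. \<integral>\<^sup>+x. ?w j x \<partial>PM N)"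
      by (rule nn_integral_suminf) measurable
    also have "\<dots> \<le> (\<Sum>j. ennreal (2 * 2 powr q * B * r ^ j))"
    proof (intro suminf_le summableI)
      fix j
      have sT: "?T j \<in> sets (PM N)" "?T' j \<in> sets (PM N)" by measurable
      have "(\<integral>\<^sup>+x. ?w j x \<partial>PM N) = ennreal (2 powr (real (Suc j) * q)) *
          (\<integral>\<^sup>+x. (indicator (?T j) x + indicator (?T' j) x) \<partial>PM N)"
        by (rule nn_integral_cmult) measurable
      also have "(\<integral>\<^sup>+x. (indicator (?T j) x + indicator (?T' j) x) \<partial>PM N) =
          (\<integral>\<^sup>+x. indicator (?T j) x \<partial>PM N) + (\<integral>\<^sup>+x. indicator (?T' j) x \<partial>PM N)"
        by (rule nn_integral_add) measurable
      also have "\<dots> = emeasure (PM N) (?T j) + emeasure (PM N) (?T' j)"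
        by (simp only: nn_integral_indicator[OF sT(1)] nn_integral_indicator[OF sT(2)])
      also have "ennreal (2 powr (real (Suc j) * q)) * (emeasure (PM N) (?T j) + emeasure (PM N) (?T' j)) \<le>
          ennreal (2 powr (real (Suc j) * q)) * (ennreal (B * 2 powr (- (real j * \<alpha>))) + ennreal (B * 2 powr (- (real j * \<alpha>))))"
        by (intro mult_left_mono add_mono wb[OF ap G] wb[OF apm Gm]) simp
      also have "\<dots> = ennreal (2 * B * (2 powr (real (Suc j) * q) * 2 powr (- (real j * \<alpha>))))"
        using B by (simp add: ennreal_plus[symmetric] ennreal_mult'[symmetric] mult_ac del: ennreal_plus)
      also have "2 powr (real (Suc j) * q) * 2 powr (- (real j * \<alpha>)) = 2 powr q * r ^ j"
      proof -
        have "r ^ j = 2 powr ((q - \<alpha>) * real j)"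
          using r(1) by (simp add: powr_realpow[symmetric] r_def powr_powr)
        then show ?thesis by (simp add: powr_add[symmetric] algebra_simps)
      qed
      finally show "(\<integral>\<^sup>+x. ?w j x \<partial>PM N) \<le> ennreal (2 * 2 powr q * B * r ^ j)" by (simp add: mult_ac)
    qed
    also have "\<dots> = ennreal (\<Sum>j. 2 * 2 powr q * B * r ^ j)"
      using r B by (intro suminf_ennreal2 summ) auto
    also have "(\<integral>\<^sup>+x. ennreal (\<bar>v x\<bar> powr p) \<partial>PM N) \<le> ennreal 1"
      using order_trans[OF energy_component_le(1) G] by simp
    also have "ennreal 1 + ennreal (\<Sum>j. 2 * 2 powr q * B * r ^ j) = ennreal C"
      unfolding C_def using r B by (intro ennreal_plus[symmetric] suminf_nonneg summ) auto
    finally show "(\<integral>\<^sup>+x. ennreal (\<bar>v x\<bar> powr q) \<partial>PM N) \<le> ennreal C"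
      by (simp add: add_left_mono add_right_mono)
  qed
qed

text \<open>Multiplying the pair by \<open>e powr (- (1 / p))\<close> brings the energy down to at
  most 1; scaling back produces the power \<open>q / p\<close>, whose being larger than 1 drives the
  iteration later.\<close>

lemma embedding:
  assumes p: "1 < p" and q: "p < q" and N: "1 \<le> N" and sub: "p < real N \<longrightarrow> q < real N * p / (real N - p)"
  obtains C where "C > 0" "\<And>\<Omega> v g e. approximable N p (test_functions N \<Omega>) v g \<Longrightarrow> 0 < e \<Longrightarrow>
    energy N p v g \<le> ennreal e \<Longrightarrow>
    (\<integral>\<^sup>+x. ennreal (\<bar>v x\<bar> powr q) \<partial>PM N) \<le> ennreal (C * e powr (q / p))"
proof -
  obtain C where C: "C > 0" and emb: "\<And>\<Omega> v g. approximable N p (test_functions N \<Omega>) v g \<Longrightarrow> energy N p v g \<le> 1 \<Longrightarrow>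
    (\<integral>\<^sup>+x. ennreal (\<bar>v x\<bar> powr q) \<partial>PM N) \<le> ennreal C"
    by (rule embedding_unit[OF assms]) (rule that)
  show ?thesis
  proof (rule that[OF C])
    fix \<Omega> v g and e :: real
    assume ap: "approximable N p (test_functions N \<Omega>) v g" and e: "0 < e" and en: "energy N p v g \<le> ennreal e"
    have m [measurable]: "pair_measurable N v g" by (rule approximable_measurable[OF ap])
    define c where "c = e powr (- (1 / p))"
    have c: "c > 0" using e by (simp add: c_def)
    have ap': "approximable N p (test_functions N \<Omega>) (\<lambda>x. c * v x) (\<lambda>x i. c * g x i)"
      using p by (intro approximable_scale ap) simp
    have "energy N p (\<lambda>x. c * v x) (\<lambda>x i. c * g x i) \<le> ennreal (c powr p) * energy N p v g"
      using c by (intro energy_le m) (simp_all add: enorm_scale abs_mult powr_mult algebra_simps)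
    also have "\<dots> \<le> ennreal (c powr p) * ennreal e" by (intro mult_left_mono en) simp
    also have "\<dots> = 1"
    proof -
      have "c powr p = e powr (-1)" using p by (simp add: c_def powr_powr)
      then have "c powr p * e = 1" using e by (simp add: powr_minus)
      then show ?thesis by (simp add: ennreal_mult'[symmetric])
    qed
    finally have "(\<integral>\<^sup>+x. ennreal (\<bar>c * v x\<bar> powr q) \<partial>PM N) \<le> ennreal C" by (rule emb[OF ap'])
    moreover have "(\<integral>\<^sup>+x. ennreal (\<bar>v x\<bar> powr q) \<partial>PM N) = (\<integral>\<^sup>+x. ennreal (e powr (q / p)) * ennreal (\<bar>c * v x\<bar> powr q) \<partial>PM N)"
    proof (rule nn_integral_cong)
      fix x
      have "\<bar>v x\<bar> powr q = e powr (q / p) * (c powr q * \<bar>v x\<bar> powr q)"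
        using e by (simp add: c_def powr_powr mult.assoc[symmetric] powr_add[symmetric])
      also have "c powr q * \<bar>v x\<bar> powr q = \<bar>c * v x\<bar> powr q"
        using c by (simp add: abs_mult powr_mult)
      finally show "ennreal (\<bar>v x\<bar> powr q) = ennreal (e powr (q / p)) * ennreal (\<bar>c * v x\<bar> powr q)"
        by (simp add: ennreal_mult'[symmetric])
    qed
    moreover have "\<dots> = ennreal (e powr (q / p)) * (\<integral>\<^sup>+x. ennreal (\<bar>c * v x\<bar> powr q) \<partial>PM N)"
      by (rule nn_integral_cmult) measurable
    ultimately have "(\<integral>\<^sup>+x. ennreal (\<bar>v x\<bar> powr q) \<partial>PM N) \<le> ennreal (e powr (q / p)) * ennreal C"
      by (simp add: mult_left_mono)
    then show "(\<integral>\<^sup>+x. ennreal (\<bar>v x\<bar> powr q) \<partial>PM N) \<le> ennreal (C * e powr (q / p))"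
      using C by (simp add: ennreal_mult'[symmetric] mult.commute)
  qed
qed

subsection \<open>Subsolutions and admissible test functions\<close>

lemma integrable_nn_bound:
  fixes f :: "'a \<Rightarrow> real"
  assumes "f \<in> borel_measurable M" "\<And>x. 0 \<le> f x" "(\<integral>\<^sup>+x. ennreal (f x) \<partial>M) \<le> ennreal c" "0 \<le> c"
  shows "integrable M f" "(\<integral>x. f x \<partial>M) \<le> c"
proof -
  show i: "integrable M f"
    using assms le_less_trans[OF assms(3) ennreal_less_top] by (intro integrableI_nonneg) auto
  have "ennreal (\<integral>x. f x \<partial>M) \<le> ennreal c"
    using assms(3) nn_integral_eq_integral[OF i] assms(2) by simp
  then show "(\<integral>x. f x \<partial>M) \<le> c" using assms(4) by simp
qed

text \<open>Young's inequality by cases: if \<open>a \<le> \<eta> * b\<close> the first term on the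
  right dominates, otherwise the second. The constants are not optimal, but \<open>\<eta>\<close> is
  free.\<close>

lemma young_eta:
  fixes a b r \<eta> :: real
  assumes "0 \<le> a" "0 \<le> b" "0 < \<eta>" "1 < r"
  shows "a * b powr (r - 1) \<le> \<eta> * b powr r + \<eta> powr (1 - r) * a powr r"
proof (cases "a \<le> \<eta> * b")
  case True
  then have "a * b powr (r - 1) \<le> (\<eta> * b) * b powr (r - 1)" by (intro mult_right_mono) auto
  also have "\<dots> = \<eta> * (b powr 1 * b powr (r - 1))" using assms by simp
  also have "\<dots> = \<eta> * b powr r" by (simp only: powr_add[symmetric]) simp
  also have "\<dots> \<le> \<eta> * b powr r + \<eta> powr (1 - r) * a powr r" by simp
  finally show ?thesis .
next
  case False
  then have a: "a > 0" using assms by (smt (verit) mult_nonneg_nonneg)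
  have "b \<le> a / \<eta>" using False assms by (simp add: field_simps)
  then have "a * b powr (r - 1) \<le> a * (a / \<eta>) powr (r - 1)"
    using assms by (intro mult_left_mono powr_mono2) auto
  also have "\<dots> = \<eta> powr (1 - r) * (a powr 1 * a powr (r - 1))"
    using assms a by (simp add: powr_divide powr_minus_divide[of \<eta> "r - 1", simplified])
  also have "\<dots> = \<eta> powr (1 - r) * a powr r" by (simp only: powr_add[symmetric]) simp
  also have "\<dots> \<le> \<eta> * b powr r + \<eta> powr (1 - r) * a powr r" using assms by simp
  finally show ?thesis .
qed

definition flux :: "nat \<Rightarrow> real \<Rightarrow> (nat \<Rightarrow> real) \<Rightarrow> nat \<Rightarrow> real" where
  "flux N p v i = enorm N v powr (p - 2) * v i"

lemma enorm_flux:
  assumes "1 < p"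
  shows "enorm N (flux N p v) = enorm N v powr (p - 1)"
proof (cases "enorm N v = 0")
  case False
  then have pos: "0 < enorm N v" using enorm_nonneg[of N v] by linarith
  have "enorm N (flux N p v) = enorm N v powr (p - 2) * enorm N v powr 1"
    using pos unfolding flux_def[abs_def] enorm_scale by simp
  also have "\<dots> = enorm N v powr (p - 1)" by (simp only: powr_add[symmetric]) simp
  finally show ?thesis .
qed (use assms in \<open>simp add: flux_def[abs_def] enorm_scale\<close>)

lemma einner_flux_self:
  assumes "1 < p"
  shows "einner N (flux N p v) v = enorm N v powr p"
proof (cases "enorm N v = 0")
  case False
  then have pos: "0 < enorm N v" using enorm_nonneg[of N v] by linarith
  have "einner N (flux N p v) v = enorm N v powr (p - 2) * (\<Sum>i<N. (v i)\<^sup>2)"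
    by (simp add: einner_def flux_def sum_distrib_left power2_eq_square mult.assoc)
  also have "(\<Sum>i<N. (v i)\<^sup>2) = (enorm N v)\<^sup>2"
    unfolding enorm_def L2_set_def by (simp add: sum_nonneg)
  also have "\<dots> = enorm N v powr 2" using pos by (simp add: powr_numeral)
  also have "enorm N v powr (p - 2) * enorm N v powr 2 = enorm N v powr p"
    by (simp only: powr_add[symmetric]) simp
  finally show ?thesis .
next
  case True
  then have "v i = 0" if "i < N" for i using component_le_enorm[OF that, of v] by simp
  then show ?thesis using True assms by (simp add: einner_def)
qed

lemma einner_add_right: "einner N e (\<lambda>i. v i + w i) = einner N e v + einner N e w"
  by (simp add: einner_def distrib_left sum.distrib)

lemma einner_diff_right: "einner N e (\<lambda>i. v i - w i) = einner N e v - einner N e w"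
  by (simp add: einner_def right_diff_distrib sum_subtractf)

lemma einner_scale_right: "einner N e (\<lambda>i. c * v i) = c * einner N e v"
  by (simp add: einner_def sum_distrib_left mult_ac)

lemma approximable_self:
  assumes "\<phi> \<in> test_functions N \<Omega>" "1 < p"
  shows "approximable N p (test_functions N \<Omega>) \<phi> (gradient \<phi>)"
proof (rule approximableI)
  show "pair_measurable N \<phi> (gradient \<phi>)" by (rule smooth_pair_measurable[OF test_smooth[OF assms(1)]])
  have "energy N p (\<lambda>x. \<phi> x - \<phi> x) (\<lambda>x i. gradient \<phi> x i - gradient \<phi> x i) = 0"
    by (simp add: energy_def)
  then show "\<exists>\<rho>\<in>test_functions N \<Omega>. energy N p (\<lambda>x. \<phi> x - \<rho> x) (\<lambda>x i. gradient \<phi> x i - gradient \<rho> x i) < ennreal \<epsilon>"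
    if "\<epsilon> > 0" for \<epsilon>
    using that assms(1) by (intro bexI[of _ \<phi>]) simp_all
qed

text \<open>A Borel representative that is nonnegative everywhere, with all integrals over the whole
  space. The eigenvalue is kept out: boundedness and decay to 0 at infinity rest on the weak
  inequality and the embedding, and the Poincare inequality enters in
  \<open>exponential_decay\<close> only.\<close>

locale subsolution =
  fixes N :: nat and p q lam :: real and \<Omega> :: "point set" and u :: "point \<Rightarrow> real" and g :: "point \<Rightarrow> nat \<Rightarrow> real"
  assumes p: "1 < p" and q: "p < q" and N: "1 \<le> N"
    and subcritical: "p < real N \<longrightarrow> q < real N * p / (real N - p)"
    and lam: "0 < lam"
    and ap: "approximable N p (test_functions N \<Omega>) u g"
    and u_nonneg: "\<And>x. 0 \<le> u x"
    and weak: "\<And>\<phi>. \<phi> \<in> nonneg_tests N \<Omega> \<Longrightarrow>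
      (\<integral>x. einner N (flux N p (g x)) (gradient \<phi> x) \<partial>PM N) \<le> lam * (\<integral>x. u x powr (q - 1) * \<phi> x \<partial>PM N)"
begin

lemma p0: "0 < p" and q1: "1 < q" and q0: "0 < q"
  using p q by auto

text \<open>One choice of the embedding constant, determined by \<open>N\<close>, \<open>p\<close>
  and \<open>q\<close>, shared by all weights, truncations and levels.\<close>

definition Cemb :: real where
  "Cemb = (SOME C. C > 0 \<and> (\<forall>\<Omega> v g e. approximable N p (test_functions N \<Omega>) v g \<longrightarrow> 0 < e \<longrightarrow>
    energy N p v g \<le> ennreal e \<longrightarrow> (\<integral>\<^sup>+x. ennreal (\<bar>v x\<bar> powr q) \<partial>PM N) \<le> ennreal (C * e powr (q / p))))"

lemma Cemb_pos: "0 < Cemb"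
  and embedding_bound: "approximable N p (test_functions N \<Omega>') v h \<Longrightarrow> 0 < e \<Longrightarrow> energy N p v h \<le> ennreal e \<Longrightarrow>
    (\<integral>\<^sup>+x. ennreal (\<bar>v x\<bar> powr q) \<partial>PM N) \<le> ennreal (Cemb * e powr (q / p))"
proof -
  have "\<exists>C>0. \<forall>\<Omega> v g e. approximable N p (test_functions N \<Omega>) v g \<longrightarrow> 0 < e \<longrightarrow>
    energy N p v g \<le> ennreal e \<longrightarrow> (\<integral>\<^sup>+x. ennreal (\<bar>v x\<bar> powr q) \<partial>PM N) \<le> ennreal (C * e powr (q / p))"
    by (rule embedding[OF p q N subcritical]) blast
  from someI_ex[OF this] show "0 < Cemb"
    and "approximable N p (test_functions N \<Omega>') v h \<Longrightarrow> 0 < e \<Longrightarrow> energy N p v h \<le> ennreal e \<Longrightarrow>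
    (\<integral>\<^sup>+x. ennreal (\<bar>v x\<bar> powr q) \<partial>PM N) \<le> ennreal (Cemb * e powr (q / p))"
    unfolding Cemb_def[symmetric] by blast+
qed

lemma pm: "pair_measurable N u g"
  by (rule approximable_measurable[OF ap])

lemma u_measurable [measurable]: "u \<in> borel_measurable (PM N)"
  and g_measurable [measurable]: "(\<lambda>x. enorm N (g x)) \<in> borel_measurable (PM N)"
  using pair_measurableD[OF pm] by auto

lemma flux_measurable: "i < N \<Longrightarrow> (\<lambda>x. flux N p (g x) i) \<in> borel_measurable (PM N)"
  unfolding flux_def using pair_measurable_comp[OF pm] by measurable

lemma approximable_integrable:
  assumes av: "approximable N p (test_functions N \<Omega>) v h"
  shows "integrable (PM N) (\<lambda>x. \<bar>v x\<bar> powr p)" "integrable (PM N) (\<lambda>x. enorm N (h x) powr p)"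
    "integrable (PM N) (\<lambda>x. \<bar>v x\<bar> powr q)"
proof -
  have [measurable]: "pair_measurable N v h" by (rule approximable_measurable[OF av])
  have "energy N p v h < \<infinity>" by (rule approximable_energy_finite[OF av order_refl p0])
  then obtain r where r: "r \<ge> 0" "energy N p v h = ennreal r" by (cases "energy N p v h") auto
  \<comment> \<open>\<open>embedding_bound\<close> asks for a positive energy bound, hence
    \<open>r + 1\<close>.\<close>
  have en: "energy N p v h \<le> ennreal (r + 1)" unfolding r using r by (intro ennreal_leI) simp
  show "integrable (PM N) (\<lambda>x. \<bar>v x\<bar> powr p)"
    by (rule integrable_nn_bound[OF _ _ order_trans[OF energy_component_le(1) en]]) (use r in \<open>measurable, simp_all\<close>)
  show "integrable (PM N) (\<lambda>x. enorm N (h x) powr p)"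
    by (rule integrable_nn_bound[OF _ _ order_trans[OF energy_component_le(2) en]]) (use r in \<open>measurable, simp_all\<close>)
  show "integrable (PM N) (\<lambda>x. \<bar>v x\<bar> powr q)"
    by (rule integrable_nn_bound[OF _ _ embedding_bound[OF av _ en]]) (use r Cemb_pos in \<open>measurable, simp_all\<close>)
qed

lemma u_integrable:
  "integrable (PM N) (\<lambda>x. u x powr p)" "integrable (PM N) (\<lambda>x. enorm N (g x) powr p)"
  "integrable (PM N) (\<lambda>x. u x powr q)"
  using approximable_integrable[OF ap] u_nonneg by simp_all

text \<open>The free \<open>\<eta>\<close> separates the fixed energy of \<open>u\<close> from that
  of \<open>h\<close>; in \<open>testing\<close> the latter is an approximation error that is sent
  to 0 first.\<close>

lemma flux_integrable:
  assumes h: "\<And>i. i < N \<Longrightarrow> (\<lambda>x. h x i) \<in> borel_measurable (PM N)" "integrable (PM N) (\<lambda>x. enorm N (h x) powr p)"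
    and \<eta>: "0 < \<eta>"
  shows "integrable (PM N) (\<lambda>x. einner N (flux N p (g x)) (h x))"
    "(\<integral>x. einner N (flux N p (g x)) (h x) \<partial>PM N) \<le>
      \<eta> * (\<integral>x. enorm N (g x) powr p \<partial>PM N) + \<eta> powr (1 - p) * (\<integral>x. enorm N (h x) powr p \<partial>PM N)"
proof -
  let ?R = "\<lambda>x. \<eta> * enorm N (g x) powr p + \<eta> powr (1 - p) * enorm N (h x) powr p"
  have R: "integrable (PM N) ?R"
    by (intro Bochner_Integration.integrable_add integrable_mult_right u_integrable h)
  have bd: "\<bar>einner N (flux N p (g x)) (h x)\<bar> \<le> ?R x" for x
  proof -
    have "\<bar>einner N (flux N p (g x)) (h x)\<bar> \<le> enorm N (h x) * enorm N (g x) powr (p - 1)"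
      using abs_einner_le[of N "flux N p (g x)" "h x"] unfolding enorm_flux[OF p] by (simp only: mult.commute)
    also have "\<dots> \<le> ?R x" by (intro young_eta p \<eta>) auto
    finally show ?thesis .
  qed
  show i: "integrable (PM N) (\<lambda>x. einner N (flux N p (g x)) (h x))"
  proof (rule Bochner_Integration.integrable_bound[OF R])
    show "(\<lambda>x. einner N (flux N p (g x)) (h x)) \<in> borel_measurable (PM N)"
      by (intro einner_measurable flux_measurable h)
    show "AE x in PM N. norm (einner N (flux N p (g x)) (h x)) \<le> norm (?R x)"
      by (intro AE_I2) (use bd in \<open>auto intro: order_trans[OF _ abs_ge_self]\<close>)
  qed
  have "(\<integral>x. einner N (flux N p (g x)) (h x) \<partial>PM N) \<le> (\<integral>x. ?R x \<partial>PM N)"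
    using bd by (intro integral_mono i R) (meson abs_le_D1)
  also have "\<dots> = \<eta> * (\<integral>x. enorm N (g x) powr p \<partial>PM N) + \<eta> powr (1 - p) * (\<integral>x. enorm N (h x) powr p \<partial>PM N)"
    by (subst Bochner_Integration.integral_add) (auto intro!: integrable_mult_right u_integrable h)
  finally show "(\<integral>x. einner N (flux N p (g x)) (h x) \<partial>PM N) \<le>
      \<eta> * (\<integral>x. enorm N (g x) powr p \<partial>PM N) + \<eta> powr (1 - p) * (\<integral>x. enorm N (h x) powr p \<partial>PM N)" .
qed

lemma source_integrable:
  assumes v: "v \<in> borel_measurable (PM N)" "integrable (PM N) (\<lambda>x. \<bar>v x\<bar> powr q)" and \<eta>: "0 < \<eta>"
  shows "integrable (PM N) (\<lambda>x. u x powr (q - 1) * v x)"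
    "(\<integral>x. u x powr (q - 1) * v x \<partial>PM N) \<le>
      \<eta> * (\<integral>x. u x powr q \<partial>PM N) + \<eta> powr (1 - q) * (\<integral>x. \<bar>v x\<bar> powr q \<partial>PM N)"
proof -
  note [measurable] = v(1)
  let ?R = "\<lambda>x. \<eta> * u x powr q + \<eta> powr (1 - q) * \<bar>v x\<bar> powr q"
  have R: "integrable (PM N) ?R"
    by (intro Bochner_Integration.integrable_add integrable_mult_right u_integrable v)
  have bd: "\<bar>u x powr (q - 1) * v x\<bar> \<le> ?R x" for x
  proof -
    have "\<bar>u x powr (q - 1) * v x\<bar> = \<bar>v x\<bar> * u x powr (q - 1)" by (simp add: abs_mult)
    also have "\<dots> \<le> ?R x" by (intro young_eta q1 \<eta> u_nonneg) auto
    finally show ?thesis .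
  qed
  show i: "integrable (PM N) (\<lambda>x. u x powr (q - 1) * v x)"
  proof (rule Bochner_Integration.integrable_bound[OF R])
    show "AE x in PM N. norm (u x powr (q - 1) * v x) \<le> norm (?R x)"
      by (intro AE_I2) (use bd in \<open>auto intro: order_trans[OF _ abs_ge_self]\<close>)
  qed measurable
  have "(\<integral>x. u x powr (q - 1) * v x \<partial>PM N) \<le> (\<integral>x. ?R x \<partial>PM N)"
    using bd by (intro integral_mono i R) (meson abs_le_D1)
  also have "\<dots> = \<eta> * (\<integral>x. u x powr q \<partial>PM N) + \<eta> powr (1 - q) * (\<integral>x. \<bar>v x\<bar> powr q \<partial>PM N)"
    by (subst Bochner_Integration.integral_add) (auto intro!: integrable_mult_right u_integrable v)
  finally show "(\<integral>x. u x powr (q - 1) * v x \<partial>PM N) \<le>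
      \<eta> * (\<integral>x. u x powr q \<partial>PM N) + \<eta> powr (1 - q) * (\<integral>x. \<bar>v x\<bar> powr q \<partial>PM N)" .
qed

text \<open>Replacing \<open>\<Phi>\<close> by a test function costs \<open>\<eta>\<close> times
  fixed quantities plus an \<open>\<eta>\<close>-dependent multiple of quantities that vanish with
  \<open>\<delta>\<close>. Letting \<open>\<delta>\<close> tend to 0 before \<open>\<eta>\<close>
  removes both. The source term requires convergence in the exponent \<open>q\<close>, which the
  embedding provides.\<close>

lemma testing:
  assumes av: "approximable N p (nonneg_tests N \<Omega>) \<Phi> G"
  shows "(\<integral>x. einner N (flux N p (g x)) (G x) \<partial>PM N) \<le> lam * (\<integral>x. u x powr (q - 1) * \<Phi> x \<partial>PM N)"
proof -
  have avt: "approximable N p (test_functions N \<Omega>) \<Phi> G"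
    by (rule approximable_mono[OF av nonneg_tests_subset])
  note av_int = approximable_integrable[OF avt]
  have mG: "pair_measurable N \<Phi> G" by (rule approximable_measurable[OF av])
  let ?A = "\<integral>x. enorm N (g x) powr p \<partial>PM N" and ?U = "\<integral>x. u x powr q \<partial>PM N"
  define L where "L = (\<integral>x. einner N (flux N p (g x)) (G x) \<partial>PM N) - lam * (\<integral>x. u x powr (q - 1) * \<Phi> x \<partial>PM N)"
  have est: "L \<le> \<eta> * (?A + lam * ?U) + \<eta> powr (1 - p) * \<delta> + lam * \<eta> powr (1 - q) * (Cemb * \<delta> powr (q / p))"
    if \<eta>: "\<eta> > 0" and \<delta>: "\<delta> > 0" for \<eta> \<delta>
  proof -
    from approximableD[OF av \<delta>] obtain \<phi> where \<phi>: "\<phi> \<in> nonneg_tests N \<Omega>"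
      and en: "energy N p (\<lambda>x. \<Phi> x - \<phi> x) (\<lambda>x i. G x i - gradient \<phi> x i) < ennreal \<delta>" .
    have t: "\<phi> \<in> test_functions N \<Omega>" using \<phi> nonneg_tests_subset by blast
    have ad: "approximable N p (test_functions N \<Omega>) (\<lambda>x. \<Phi> x - \<phi> x) (\<lambda>x i. G x i - gradient \<phi> x i)"
      by (rule approximable_diff_test[OF avt t])
    have md [measurable]: "pair_measurable N (\<lambda>x. \<Phi> x - \<phi> x) (\<lambda>x i. G x i - gradient \<phi> x i)"
      by (rule approximable_measurable[OF ad])
    note ad_int = approximable_integrable[OF ad]
    note as_int = approximable_integrable[OF approximable_self[OF t p]]
    have m\<phi>: "pair_measurable N \<phi> (gradient \<phi>)" by (rule smooth_pair_measurable[OF test_smooth[OF t]])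
    have "(\<integral>x. enorm N (\<lambda>i. G x i - gradient \<phi> x i) powr p \<partial>PM N) \<le> \<delta>"
      by (rule integrable_nn_bound[OF _ _ order_trans[OF energy_component_le(2) less_imp_le[OF en]]])
        (use \<delta> in \<open>measurable, simp_all\<close>)
    then have 1: "(\<integral>x. einner N (flux N p (g x)) (\<lambda>i. G x i - gradient \<phi> x i) \<partial>PM N) \<le> \<eta> * ?A + \<eta> powr (1 - p) * \<delta>"
      using flux_integrable(2)[OF pair_measurable_comp[OF md] ad_int(2) \<eta>]
      by (smt (verit) mult_left_mono powr_ge_zero)
    have cm: "\<bar>\<phi> x - \<Phi> x\<bar> = \<bar>\<Phi> x - \<phi> x\<bar>" for x by (rule abs_minus_commute)
    have "(\<integral>x. \<bar>\<phi> x - \<Phi> x\<bar> powr q \<partial>PM N) \<le> Cemb * \<delta> powr (q / p)"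
      unfolding cm
      by (rule integrable_nn_bound[OF _ _ embedding_bound[OF ad \<delta> less_imp_le[OF en]]])
        (use \<delta> Cemb_pos in \<open>measurable, simp_all\<close>)
    then have "\<eta> * ?U + \<eta> powr (1 - q) * (\<integral>x. \<bar>\<phi> x - \<Phi> x\<bar> powr q \<partial>PM N) \<le>
        \<eta> * ?U + \<eta> powr (1 - q) * (Cemb * \<delta> powr (q / p))"
      by (intro add_left_mono mult_left_mono) auto
    moreover have "(\<integral>x. u x powr (q - 1) * (\<phi> x - \<Phi> x) \<partial>PM N) \<le>
        \<eta> * ?U + \<eta> powr (1 - q) * (\<integral>x. \<bar>\<phi> x - \<Phi> x\<bar> powr q \<partial>PM N)"
      by (rule source_integrable(2)[OF borel_measurable_diff[OF pair_measurableD(1)[OF m\<phi>] pair_measurableD(1)[OF mG]] _ \<eta>])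
        (simp only: cm ad_int(3))
    ultimately have 2: "(\<integral>x. u x powr (q - 1) * (\<phi> x - \<Phi> x) \<partial>PM N) \<le> \<eta> * ?U + \<eta> powr (1 - q) * (Cemb * \<delta> powr (q / p))"
      by linarith
    have "(\<integral>x. einner N (flux N p (g x)) (\<lambda>i. G x i - gradient \<phi> x i) \<partial>PM N) =
        (\<integral>x. einner N (flux N p (g x)) (G x) \<partial>PM N) - (\<integral>x. einner N (flux N p (g x)) (gradient \<phi> x) \<partial>PM N)"
      unfolding einner_diff_right
      by (intro Bochner_Integration.integral_diff flux_integrable(1)[OF pair_measurable_comp[OF mG] av_int(2) \<eta>]
        flux_integrable(1)[OF pair_measurable_comp[OF m\<phi>] as_int(2) \<eta>])
    moreover have "(\<integral>x. u x powr (q - 1) * (\<phi> x - \<Phi> x) \<partial>PM N) =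
        (\<integral>x. u x powr (q - 1) * \<phi> x \<partial>PM N) - (\<integral>x. u x powr (q - 1) * \<Phi> x \<partial>PM N)"
      unfolding right_diff_distrib
      by (intro Bochner_Integration.integral_diff source_integrable(1)[OF pair_measurableD(1)[OF mG] av_int(3) \<eta>]
        source_integrable(1)[OF pair_measurableD(1)[OF m\<phi>] as_int(3) \<eta>])
    moreover note weak[OF \<phi>]
    ultimately have "L \<le> \<eta> * ?A + \<eta> powr (1 - p) * \<delta> + lam * (\<integral>x. u x powr (q - 1) * (\<phi> x - \<Phi> x) \<partial>PM N)"
      unfolding L_def using 1 by (simp add: right_diff_distrib)
    also have "\<dots> \<le> \<eta> * ?A + \<eta> powr (1 - p) * \<delta> + lam * (\<eta> * ?U + \<eta> powr (1 - q) * (Cemb * \<delta> powr (q / p)))"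
      using 2 lam by (intro add_left_mono mult_left_mono) auto
    finally show ?thesis by (simp add: algebra_simps)
  qed
  have est2: "L \<le> \<eta> * (?A + lam * ?U)" if \<eta>: "\<eta> > 0" for \<eta>
  proof (rule tendsto_lowerbound)
    have "((\<lambda>\<delta>. \<eta> * (?A + lam * ?U) + \<eta> powr (1 - p) * \<delta> + lam * \<eta> powr (1 - q) * (Cemb * \<delta> powr (q / p))) \<longlongrightarrow>
        \<eta> * (?A + lam * ?U) + \<eta> powr (1 - p) * 0 + lam * \<eta> powr (1 - q) * (Cemb * 0)) (at_right 0)"
    proof (intro tendsto_intros)
      show "((\<lambda>\<delta>. \<delta> powr (q / p)) \<longlongrightarrow> 0) (at_right 0)"
        by (rule tendsto_zero_powrI[OF tendsto_ident_at tendsto_const])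
          (use p0 q0 in \<open>auto simp: eventually_at_filter\<close>)
    qed
    then show "((\<lambda>\<delta>. \<eta> * (?A + lam * ?U) + \<eta> powr (1 - p) * \<delta> + lam * \<eta> powr (1 - q) * (Cemb * \<delta> powr (q / p))) \<longlongrightarrow>
        \<eta> * (?A + lam * ?U)) (at_right 0)" by simp
    show "\<forall>\<^sub>F \<delta> in at_right 0. L \<le> \<eta> * (?A + lam * ?U) + \<eta> powr (1 - p) * \<delta> + lam * \<eta> powr (1 - q) * (Cemb * \<delta> powr (q / p))"
      by (rule eventually_at_rightI[of 0 1]) (use est[OF \<eta>] in auto)
  qed simp
  have "L \<le> 0"
  proof (rule tendsto_lowerbound)
    have "((\<lambda>\<eta>. \<eta> * (?A + lam * ?U)) \<longlongrightarrow> 0 * (?A + lam * ?U)) (at_right 0)" by (intro tendsto_intros)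
    then show "((\<lambda>\<eta>. \<eta> * (?A + lam * ?U)) \<longlongrightarrow> 0) (at_right 0)" by simp
    show "\<forall>\<^sub>F \<eta> in at_right 0. L \<le> \<eta> * (?A + lam * ?U)"
      by (rule eventually_at_rightI[of 0 1]) (use est2 in auto)
  qed simp
  then show ?thesis by (simp add: L_def)
qed

end

subsection \<open>The weighted Caccioppoli estimate\<close>

lemma nonneg_tests_mult:
  assumes "\<phi> \<in> nonneg_tests N \<Omega>" "smooth_RN N \<psi>" "\<And>x. x \<in> space (PM N) \<Longrightarrow> 0 \<le> \<psi> x"
  shows "(\<lambda>x. \<psi> x * \<phi> x) \<in> nonneg_tests N \<Omega>"
  using assms test_mult[of \<phi> N \<Omega> \<psi>] by (simp add: nonneg_tests_def space_PM)

lemma nonneg_tests_smooth: "\<phi> \<in> nonneg_tests N \<Omega> \<Longrightarrow> smooth_RN N \<phi>"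
  using nonneg_tests_subset test_smooth by blast

lemma integrable_dominated:
  fixes f h :: "'a \<Rightarrow> real"
  assumes "integrable M f" "h \<in> borel_measurable M" "\<And>x. x \<in> space M \<Longrightarrow> \<bar>h x\<bar> \<le> c * f x"
  shows "integrable M h"
proof (rule Bochner_Integration.integrable_bound)
  show "integrable M (\<lambda>x. c * f x)" using assms by (intro integrable_mult_right)
  show "AE x in M. norm (h x) \<le> norm (c * f x)"
    using assms(3) by (intro AE_I2) (auto intro: order_trans[OF _ abs_ge_self])
qed fact

text \<open>The bound \<open>B\<close> serves integrability only and does not appear in the
  resulting estimates. These use the logarithmic gradient bound \<open>\<psi>_grad\<close>, and
  \<open>pa\<close> keeps at least half of the gradient term in the Caccioppoli estimate.\<close>

locale weighted_subsolution = subsolution +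
  fixes \<psi> :: "point \<Rightarrow> real" and B a :: real
  assumes \<psi>: "smooth_RN N \<psi>"
    and \<psi>_pos: "\<And>x. x \<in> space (PM N) \<Longrightarrow> 0 < \<psi> x"
    and \<psi>_le: "\<And>x. x \<in> space (PM N) \<Longrightarrow> \<psi> x \<le> B"
    and \<psi>_grad: "\<And>x. x \<in> space (PM N) \<Longrightarrow> enorm N (gradient \<psi> x) \<le> a * \<psi> x"
    and a0: "0 \<le> a" and pa: "p * a \<le> 1 / 2"
begin

definition w :: "point \<Rightarrow> real" where "w x = \<psi> x * u x"
definition dw :: "point \<Rightarrow> nat \<Rightarrow> real" where "dw x i = \<psi> x * g x i + gradient \<psi> x i * u x"
text \<open>The derivative of the weight is left out here: the Caccioppoli estimate controls
  \<open>X\<close>, and \<open>dw_bound\<close> recovers the full gradient \<open>dw\<close> from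
  \<open>X\<close> and \<open>w\<close>.\<close>

definition X :: "point \<Rightarrow> real" where "X x = \<psi> x * enorm N (g x)"

definition Yint :: "real \<Rightarrow> real" where "Yint k = (\<integral>x. of_bool (k < w x) * w x powr p \<partial>PM N)"
definition Xint :: "real \<Rightarrow> real" where "Xint k = (\<integral>x. of_bool (k < w x) * X x powr p \<partial>PM N)"
text \<open>The source term after testing: the weight carries the power \<open>p\<close>, namely
  \<open>p - 1\<close> from the weight in the test function and 1 from \<open>w\<close>, while
  \<open>u\<close> carries \<open>q\<close>.\<close>

definition Rint :: "real \<Rightarrow> real" where "Rint k = (\<integral>x. of_bool (k < w x) * (u x powr q * \<psi> x powr p) \<partial>PM N)"

lemma \<psi>_measurable [measurable]: "\<psi> \<in> borel_measurable (PM N)"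
  by (rule smooth_measurable[OF \<psi>])

lemma w_measurable [measurable]: "w \<in> borel_measurable (PM N)" and X_measurable [measurable]: "X \<in> borel_measurable (PM N)"
  unfolding w_def X_def by measurable

lemma w_nonneg: "x \<in> space (PM N) \<Longrightarrow> 0 \<le> w x"
  using \<psi>_pos[of x] u_nonneg[of x] by (simp add: w_def)

lemma X_nonneg: "x \<in> space (PM N) \<Longrightarrow> 0 \<le> X x"
  using \<psi>_pos[of x] by (simp add: X_def)

lemma a1: "a \<le> 1"
proof -
  have "1 * a \<le> p * a" using p a0 by (intro mult_right_mono) auto
  then show ?thesis using pa by simp
qed

lemma \<psi>_powr_le: "x \<in> space (PM N) \<Longrightarrow> 0 \<le> r \<Longrightarrow> \<psi> x powr r \<le> B powr r"
  using \<psi>_pos[of x] \<psi>_le[of x] by (intro powr_mono2) auto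

lemma weighted_integrable:
  "integrable (PM N) (\<lambda>x. w x powr p)" "integrable (PM N) (\<lambda>x. X x powr p)"
  "integrable (PM N) (\<lambda>x. u x powr q * \<psi> x powr p)"
proof -
  show "integrable (PM N) (\<lambda>x. w x powr p)"
  proof (rule integrable_dominated[OF u_integrable(1), where c="B powr p"])
    fix x assume x: "x \<in> space (PM N)"
    have "w x powr p = \<psi> x powr p * u x powr p"
      using \<psi>_pos[OF x] u_nonneg[of x] by (simp add: w_def powr_mult)
    then show "\<bar>w x powr p\<bar> \<le> B powr p * u x powr p"
      using mult_right_mono[OF \<psi>_powr_le[OF x, of p], of "u x powr p"] p0 by simp
  qed measurable
  show "integrable (PM N) (\<lambda>x. X x powr p)"
  proof (rule integrable_dominated[OF u_integrable(2), where c="B powr p"])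
    fix x assume x: "x \<in> space (PM N)"
    have "X x powr p = \<psi> x powr p * enorm N (g x) powr p"
      using \<psi>_pos[OF x] by (simp add: X_def powr_mult)
    then show "\<bar>X x powr p\<bar> \<le> B powr p * enorm N (g x) powr p"
      using mult_right_mono[OF \<psi>_powr_le[OF x, of p], of "enorm N (g x) powr p"] p0 by simp
  qed measurable
  show "integrable (PM N) (\<lambda>x. u x powr q * \<psi> x powr p)"
  proof (rule integrable_dominated[OF u_integrable(3), where c="B powr p"])
    fix x assume x: "x \<in> space (PM N)"
    show "\<bar>u x powr q * \<psi> x powr p\<bar> \<le> B powr p * u x powr q"
      using mult_right_mono[OF \<psi>_powr_le[OF x, of p], of "u x powr q"] p0 by (simp add: mult.commute)
  qed measurable
qed

lemma level_integrable:
  fixes f :: "point \<Rightarrow> real"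
  assumes "integrable (PM N) f"
  shows "integrable (PM N) (\<lambda>x. of_bool (k < w x) * f x)"
proof -
  have "{x \<in> space (PM N). k < w x} \<in> sets (PM N)"
    by (rule borel_measurable_less[OF borel_measurable_const w_measurable])
  from integrable_mult_indicator[OF this assms]
  show ?thesis by (rule Bochner_Integration.integrable_cong[OF refl, THEN iffD1, rotated]) simp
qed

lemma w_approximable: "approximable N p (test_functions N \<Omega>) w dw"
  unfolding w_def dw_def
proof (rule approximable_weight[OF ap p0 test_smooth \<psi>, where B="max B (a * B)"])
  fix x assume x: "x \<in> space (PM N)"
  show "\<bar>\<psi> x\<bar> \<le> max B (a * B)" using \<psi>_pos[OF x] \<psi>_le[OF x] by simp
  have "a * \<psi> x \<le> a * B" using \<psi>_le[OF x] a0 by (rule mult_left_mono)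
  then show "enorm N (gradient \<psi> x) \<le> max B (a * B)" using \<psi>_grad[OF x] by simp
next
  show "\<phi> \<in> test_functions N \<Omega> \<Longrightarrow> (\<lambda>x. \<psi> x * \<phi> x) \<in> test_functions N \<Omega>" for \<phi>
    using \<psi> by (rule test_mult[rotated])
qed

lemma truncation_approximable:
  assumes "0 \<le> k"
  shows "approximable N p (nonneg_tests N \<Omega>) (\<lambda>x. max (w x - k) 0) (\<lambda>x i. of_bool (k < w x) * dw x i)"
  by (rule approximable_truncate[OF w_approximable p0 assms])

lemma gradient_weight_powr:
  assumes "x \<in> space (PM N)" "i < N"
  shows "gradient (\<lambda>x. \<psi> x powr (p - 1)) x i = (p - 1) * \<psi> x powr (p - 2) * gradient \<psi> x i"
  using partial_comp[OF \<psi> assms(2) _ has_real_derivative_powr[OF \<psi>_pos[OF assms(1)], of "p - 1"]] assms(1)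
  by (simp add: gradient_def space_PM)

text \<open>With the power \<open>p - 1\<close> of the weight in the test function, the principal
  term becomes exactly \<open>X powr p\<close>. All other terms contain the gradient of
  \<open>\<psi>\<close>, hence a factor \<open>a\<close>, and Young's inequality distributes them
  over \<open>X powr p\<close> and \<open>w powr p\<close>.\<close>

lemma caccioppoli:
  assumes k: "0 \<le> k"
  shows "(1 - p * a) * Xint k \<le> p * a * Yint k + lam * Rint k"
proof -
  define T where "T x = max (w x - k) 0" for x
  define \<Phi> where "\<Phi> x = \<psi> x powr (p - 1) * T x" for x
  define G where "G x i = \<psi> x powr (p - 1) * (of_bool (k < w x) * dw x i) + gradient (\<lambda>x. \<psi> x powr (p - 1)) x i * T x" for x i
  have apG: "approximable N p (nonneg_tests N \<Omega>) \<Phi> G"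
    unfolding \<Phi>_def G_def T_def
  proof (rule approximable_weight[OF truncation_approximable[OF k] p0 nonneg_tests_smooth,
        where B="max (B powr (p - 1)) ((p - 1) * a * B powr (p - 1))"])
    show sm: "smooth_RN N (\<lambda>x. \<psi> x powr (p - 1))"
      by (rule smooth_powr[OF \<psi>]) (rule \<psi>_pos, simp add: space_PM)
    fix x assume x: "x \<in> space (PM N)"
    have le: "\<psi> x powr (p - 1) \<le> B powr (p - 1)" using p by (intro \<psi>_powr_le[OF x]) simp
    then show "\<bar>\<psi> x powr (p - 1)\<bar> \<le> max (B powr (p - 1)) ((p - 1) * a * B powr (p - 1))" by simp
    have "enorm N (gradient (\<lambda>x. \<psi> x powr (p - 1)) x) = enorm N (\<lambda>i. (p - 1) * \<psi> x powr (p - 2) * gradient \<psi> x i)"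
      by (intro enorm_cong gradient_weight_powr x)
    also have "\<dots> = (p - 1) * \<psi> x powr (p - 2) * enorm N (gradient \<psi> x)"
      unfolding enorm_scale using p by (simp add: abs_mult)
    also have "\<dots> \<le> (p - 1) * \<psi> x powr (p - 2) * (a * \<psi> x)"
      using p by (intro mult_left_mono \<psi>_grad x) auto
    also have "\<dots> = (p - 1) * a * (\<psi> x powr (p - 2) * \<psi> x powr 1)" using \<psi>_pos[OF x] by simp
    also have "\<dots> = (p - 1) * a * \<psi> x powr (p - 1)" by (simp only: powr_add[symmetric]) simp
    also have "\<dots> \<le> (p - 1) * a * B powr (p - 1)" using p a0 le by (intro mult_left_mono) auto
    finally show "enorm N (gradient (\<lambda>x. \<psi> x powr (p - 1)) x) \<le> max (B powr (p - 1)) ((p - 1) * a * B powr (p - 1))"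
      by simp
  next
    fix \<phi> assume \<phi>: "\<phi> \<in> nonneg_tests N \<Omega>"
    show "(\<lambda>x. \<psi> x powr (p - 1) * \<phi> x) \<in> nonneg_tests N \<Omega>"
      by (rule nonneg_tests_mult[OF \<phi> smooth_powr[OF \<psi>]]) (rule \<psi>_pos, simp_all add: space_PM)
  qed
  have mG: "pair_measurable N \<Phi> G" by (rule approximable_measurable[OF apG])
  note apGt = approximable_mono[OF apG nonneg_tests_subset]
  note intG = approximable_integrable[OF apGt]
  have low: "of_bool (k < w x) * (X x powr p - p * a * (w x powr p + X x powr p)) \<le> einner N (flux N p (g x)) (G x)"
    if x: "x \<in> space (PM N)" for x
  proof (cases "k < w x")
    case True
    define E where "E = einner N (flux N p (g x)) (gradient \<psi> x)"
    let ?n = "enorm N (g x)"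
    have \<psi>p: "0 < \<psi> x" by (rule \<psi>_pos[OF x])
    have T: "0 \<le> T x" "T x \<le> w x" using True k by (auto simp: T_def)
    have "einner N (flux N p (g x)) (G x) = einner N (flux N p (g x))
        (\<lambda>i. \<psi> x powr (p - 1) * (\<psi> x * g x i + u x * gradient \<psi> x i) + (p - 1) * \<psi> x powr (p - 2) * T x * gradient \<psi> x i)"
      unfolding einner_def
      by (intro sum.cong refl) (use True x gradient_weight_powr in \<open>simp add: G_def dw_def mult_ac\<close>)
    also have "\<dots> = \<psi> x powr (p - 1) * (\<psi> x * ?n powr p + u x * E) + (p - 1) * \<psi> x powr (p - 2) * T x * E"
      unfolding einner_add_right einner_scale_right E_def einner_flux_self[OF p] ..
    also have "\<dots> = (\<psi> x powr (p - 1) * \<psi> x) * ?n powr p + (\<psi> x powr (p - 1) * u x + (p - 1) * \<psi> x powr (p - 2) * T x) * E"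
      by (simp add: algebra_simps)
    also have "\<psi> x powr (p - 1) * \<psi> x = \<psi> x powr p"
      using \<psi>p powr_add[of "\<psi> x" "p - 1" 1] by simp
    finally have eq: "einner N (flux N p (g x)) (G x) = X x powr p +
        (\<psi> x powr (p - 1) * u x + (p - 1) * \<psi> x powr (p - 2) * T x) * E"
      using \<psi>p by (simp add: X_def powr_mult)
    \<comment> \<open>Collects the two occurrences of the gradient of the weight: one from
      differentiating \<open>\<psi> u\<close>, one from \<open>\<psi> powr (p - 1)\<close>. As
      \<open>T \<le> w\<close>, the coefficients add up to at most \<open>1 + (p - 1) = p\<close>
      times \<open>\<psi> powr (p - 1) * u\<close>.\<close>
    define c where "c = \<psi> x powr (p - 1) * u x + (p - 1) * \<psi> x powr (p - 2) * T x"
    have "\<bar>E\<bar> \<le> ?n powr (p - 1) * (a * \<psi> x)"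
      using abs_einner_le[of N "flux N p (g x)" "gradient \<psi> x"] \<psi>_grad[OF x]
      unfolding E_def enorm_flux[OF p] by (meson mult_left_mono order_trans powr_ge_zero)
    moreover have c0: "0 \<le> c"
      unfolding c_def using p T u_nonneg[of x] by (intro add_nonneg_nonneg mult_nonneg_nonneg) auto
    moreover have "c \<le> p * (\<psi> x powr (p - 1) * u x)"
    proof -
      have "\<psi> x powr (p - 2) * T x \<le> \<psi> x powr (p - 2) * w x" using T by (intro mult_left_mono) auto
      also have "\<dots> = (\<psi> x powr (p - 2) * \<psi> x powr 1) * u x" using \<psi>p by (simp add: w_def)
      also have "\<dots> = \<psi> x powr (p - 1) * u x" by (simp only: powr_add[symmetric]) simp
      finally have "(p - 1) * (\<psi> x powr (p - 2) * T x) \<le> (p - 1) * (\<psi> x powr (p - 1) * u x)"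
        using p by (intro mult_left_mono) auto
      then show ?thesis by (simp add: c_def algebra_simps)
    qed
    ultimately have "c * \<bar>E\<bar> \<le> p * (\<psi> x powr (p - 1) * u x) * (?n powr (p - 1) * (a * \<psi> x))"
      by (intro mult_mono) auto
    also have "\<dots> = p * a * (w x * X x powr (p - 1))"
      using \<psi>p by (simp add: w_def X_def powr_mult mult_ac)
    also have "\<dots> \<le> p * a * (1 * X x powr p + 1 powr (1 - p) * w x powr p)"
      using p a0 X_nonneg[OF x] w_nonneg[OF x] by (intro mult_left_mono young_eta) auto
    finally have "c * \<bar>E\<bar> \<le> p * a * (w x powr p + X x powr p)" by (simp add: add.commute)
    moreover have "c * (- E) \<le> c * \<bar>E\<bar>" using c0 by (intro mult_left_mono) auto
    ultimately have "- (c * E) \<le> p * a * (w x powr p + X x powr p)" by simp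
    then show ?thesis using True eq by (simp add: c_def)
  next
    case False
    then have "T x = 0" by (simp add: T_def)
    then have "G x i = 0" for i using False by (simp add: G_def)
    then show ?thesis using False by (simp add: einner_def)
  qed
  have up: "u x powr (q - 1) * \<Phi> x \<le> of_bool (k < w x) * (u x powr q * \<psi> x powr p)" if x: "x \<in> space (PM N)" for x
  proof (cases "k < w x")
    case True
    have \<psi>p: "0 < \<psi> x" by (rule \<psi>_pos[OF x])
    have "0 < u x" using True k \<psi>p u_nonneg[of x] by (cases "u x = 0") (auto simp: w_def)
    have "u x powr (q - 1) * \<Phi> x \<le> u x powr (q - 1) * (\<psi> x powr (p - 1) * w x)"
      unfolding \<Phi>_def using True k by (intro mult_left_mono) (auto simp: T_def)
    also have "\<dots> = (u x powr (q - 1) * u x powr 1) * (\<psi> x powr (p - 1) * \<psi> x powr 1)"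
      using \<psi>p \<open>0 < u x\<close> by (simp add: w_def)
    also have "\<dots> = u x powr q * \<psi> x powr p" by (simp only: powr_add[symmetric]) simp
    finally show ?thesis using True by simp
  next
    case False
    then show ?thesis by (simp add: \<Phi>_def T_def)
  qed
  have i1: "integrable (PM N) (\<lambda>x. of_bool (k < w x) * (X x powr p - p * a * (w x powr p + X x powr p)))"
    by (intro level_integrable Bochner_Integration.integrable_diff integrable_mult_right
        Bochner_Integration.integrable_add weighted_integrable)
  have "Xint k - p * a * (Yint k + Xint k) =
      (\<integral>x. of_bool (k < w x) * X x powr p - p * a * (of_bool (k < w x) * w x powr p + of_bool (k < w x) * X x powr p) \<partial>PM N)"
    unfolding Xint_def Yint_def using level_integrable[OF weighted_integrable(1), of k] level_integrable[OF weighted_integrable(2), of k]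
    by simp
  also have "\<dots> = (\<integral>x. of_bool (k < w x) * (X x powr p - p * a * (w x powr p + X x powr p)) \<partial>PM N)"
    by (intro Bochner_Integration.integral_cong refl) (simp add: algebra_simps)
  also have "\<dots> \<le> (\<integral>x. einner N (flux N p (g x)) (G x) \<partial>PM N)"
    by (intro integral_mono i1 low flux_integrable(1)[OF pair_measurable_comp[OF mG] intG(2) zero_less_one])
  also have "\<dots> \<le> lam * (\<integral>x. u x powr (q - 1) * \<Phi> x \<partial>PM N)"
    by (rule testing[OF apG])
  also have "\<dots> \<le> lam * Rint k"
    unfolding Rint_def using lam
    by (intro mult_left_mono integral_mono up level_integrable weighted_integrable
        source_integrable(1)[OF pair_measurableD(1)[OF mG] intG(3) zero_less_one]) auto
  finally show ?thesis by (simp add: algebra_simps)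
qed

lemma level_nonneg: "0 \<le> Yint k" "0 \<le> Xint k" "0 \<le> Rint k"
  unfolding Yint_def Xint_def Rint_def by (auto intro!: Bochner_Integration.integral_nonneg)

lemma dw_bound:
  assumes x: "x \<in> space (PM N)"
  shows "enorm N (dw x) powr p \<le> 2 powr p * (X x powr p + a powr p * w x powr p)"
proof -
  have "enorm N (dw x) = enorm N (\<lambda>i. \<psi> x * g x i + u x * gradient \<psi> x i)"
    by (simp add: dw_def[abs_def] mult.commute)
  also have "\<dots> \<le> \<bar>\<psi> x\<bar> * enorm N (g x) + \<bar>u x\<bar> * enorm N (gradient \<psi> x)"
    using enorm_triangle[of N "\<lambda>i. \<psi> x * g x i" "\<lambda>i. u x * gradient \<psi> x i"] unfolding enorm_scale .
  also have "\<dots> \<le> X x + u x * (a * \<psi> x)"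
    using \<psi>_pos[OF x] u_nonneg[of x] \<psi>_grad[OF x] by (auto simp: X_def intro!: mult_left_mono)
  finally have "enorm N (dw x) powr p \<le> 2 powr p * (X x powr p + (a * w x) powr p)"
    using p0 X_nonneg[OF x] w_nonneg[OF x] a0 by (intro powr_add_le) (auto simp: w_def mult_ac)
  then show ?thesis using a0 w_nonneg[OF x] by (simp add: powr_mult)
qed

text \<open>By \<open>p * a \<le> 1 / 2\<close> the Caccioppoli estimate yields
  \<open>Xint k \<le> Yint k + 2 * (lam * Rint k)\<close>, so the energy of the truncation is
  bounded by integrals free of gradients. This is the form in which the embedding can be
  applied.\<close>

lemma truncation_energy:
  assumes k: "0 \<le> k"
  shows "energy N p (\<lambda>x. max (w x - k) 0) (\<lambda>x i. of_bool (k < w x) * dw x i) \<le>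
    ennreal ((1 + 2 * 2 powr p) * (Yint k + lam * Rint k))"
proof -
  let ?f = "\<lambda>x. of_bool (k < w x) * w x powr p + 2 powr p * (of_bool (k < w x) * X x powr p + of_bool (k < w x) * w x powr p)"
  note li = level_integrable[OF weighted_integrable(1), of k] level_integrable[OF weighted_integrable(2), of k]
  have i: "integrable (PM N) ?f"
    by (intro Bochner_Integration.integrable_add integrable_mult_right li)
  have "energy N p (\<lambda>x. max (w x - k) 0) (\<lambda>x i. of_bool (k < w x) * dw x i) \<le> (\<integral>\<^sup>+x. ennreal (?f x) \<partial>PM N)"
    unfolding energy_def
  proof (intro nn_integral_mono ennreal_leI)
    fix x assume x: "x \<in> space (PM N)"
    have e: "enorm N (dw x) powr p \<le> 2 powr p * (X x powr p + w x powr p)"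
    proof -
      have "a powr p \<le> 1 powr p" using a0 a1 p0 by (intro powr_mono2) auto
      then have "a powr p * w x powr p \<le> 1 * w x powr p" by (intro mult_right_mono) auto
      then have "2 powr p * (X x powr p + a powr p * w x powr p) \<le> 2 powr p * (X x powr p + w x powr p)"
        by (intro mult_left_mono) auto
      then show ?thesis using dw_bound[OF x] by linarith
    qed
    show "\<bar>max (w x - k) 0\<bar> powr p + enorm N (\<lambda>i. of_bool (k < w x) * dw x i) powr p \<le> ?f x"
    proof (cases "k < w x")
      case True
      have "\<bar>max (w x - k) 0\<bar> powr p \<le> w x powr p" using True k p0 by (intro powr_mono2) auto
      then show ?thesis using e True by simp
    qed simp
  qed
  also have "\<dots> = ennreal (\<integral>x. ?f x \<partial>PM N)"
    by (intro nn_integral_eq_integral i) simp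
  also have "(\<integral>x. ?f x \<partial>PM N) = Yint k + 2 powr p * (Xint k + Yint k)"
    unfolding Yint_def Xint_def using li by simp
  also have "\<dots> \<le> (1 + 2 * 2 powr p) * (Yint k + lam * Rint k)"
  proof -
    have "(1 / 2) * Xint k \<le> (1 - p * a) * Xint k" using pa level_nonneg by (intro mult_right_mono) auto
    also have "\<dots> \<le> p * a * Yint k + lam * Rint k" by (rule caccioppoli[OF k])
    also have "\<dots> \<le> (1 / 2) * Yint k + lam * Rint k"
      using pa level_nonneg by (intro add_right_mono mult_right_mono) auto
    finally have "Xint k \<le> Yint k + 2 * (lam * Rint k)" by simp
    then have "2 powr p * (Xint k + Yint k) \<le> 2 powr p * (2 * Yint k + 2 * (lam * Rint k))"
      by (intro mult_left_mono) auto
    moreover have "0 \<le> lam * Rint k" using lam level_nonneg by (intro mult_nonneg_nonneg) auto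
    ultimately show ?thesis by (simp add: algebra_simps)
  qed
  finally show ?thesis by (simp add: ennreal_leI)
qed

end

subsection \<open>De Giorgi iteration\<close>

text \<open>An explicit geometric solution of the recursion
  \<open>Y (Suc j) = A * 2 powr (j * \<beta>) * Y j powr r\<close>: \<open>\<sigma>\<close> is
  chosen so that \<open>(\<sigma> ^ j) powr (r - 1)\<close> cancels the growing factor, and then
  \<open>\<epsilon>\<close> so that \<open>A * \<epsilon> powr (r - 1) = \<sigma>\<close>.\<close>

lemma de_giorgi_numbers:
  fixes A \<beta> r :: real
  assumes "0 < A" "0 < \<beta>" "1 < r"
  obtains \<epsilon> \<sigma> where "0 < \<epsilon>" "0 < \<sigma>" "\<sigma> < 1"
    "\<And>j::nat. A * 2 powr (real j * \<beta>) * (\<epsilon> * \<sigma> ^ j) powr r \<le> \<epsilon> * \<sigma> ^ Suc j"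
proof -
  define \<kappa> where "\<kappa> = r - 1"
  have \<kappa>: "\<kappa> > 0" using assms by (simp add: \<kappa>_def)
  define \<sigma> where "\<sigma> = 2 powr (- (\<beta> / \<kappa>))"
  define \<epsilon> where "\<epsilon> = (\<sigma> / A) powr (1 / \<kappa>)"
  have \<sigma>: "0 < \<sigma>" "\<sigma> < 1" using assms \<kappa> by (auto simp: \<sigma>_def powr_less_one)
  have \<epsilon>: "0 < \<epsilon>" using \<sigma> assms by (simp add: \<epsilon>_def)
  have "A * 2 powr (real j * \<beta>) * (\<epsilon> * \<sigma> ^ j) powr r = \<epsilon> * \<sigma> ^ Suc j" for j :: nat
  proof -
    have 1: "\<epsilon> powr r = \<epsilon> * (\<sigma> / A)"
    proof -
      have "\<epsilon> powr r = \<epsilon> powr 1 * \<epsilon> powr \<kappa>" unfolding powr_add[symmetric] by (simp add: \<kappa>_def)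
      also have "\<epsilon> powr \<kappa> = \<sigma> / A" using \<kappa> \<sigma> assms by (simp add: \<epsilon>_def powr_powr)
      finally show ?thesis using \<epsilon> by simp
    qed
    have 2: "(\<sigma> ^ j) powr r = \<sigma> ^ j * 2 powr (- (real j * \<beta>))"
    proof -
      have "(\<sigma> ^ j) powr r = (\<sigma> ^ j) powr 1 * (\<sigma> ^ j) powr \<kappa>" unfolding powr_add[symmetric] by (simp add: \<kappa>_def)
      also have "(\<sigma> ^ j) powr \<kappa> = 2 powr (- (real j * \<beta>))"
        using \<sigma> \<kappa> by (simp add: powr_realpow[symmetric] powr_powr) (simp add: \<sigma>_def powr_powr mult.commute)
      finally show ?thesis using \<sigma> by simp
    qed
    have "A * 2 powr (real j * \<beta>) * (\<epsilon> * \<sigma> ^ j) powr r =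
        A * 2 powr (real j * \<beta>) * (\<epsilon> * (\<sigma> / A) * (\<sigma> ^ j * 2 powr (- (real j * \<beta>))))"
      using \<epsilon> \<sigma> 1 2 by (simp add: powr_mult)
    also have "\<dots> = \<epsilon> * \<sigma> ^ Suc j * (2 powr (real j * \<beta>) * 2 powr (- (real j * \<beta>)))"
      using assms by (simp add: field_simps)
    also have "2 powr (real j * \<beta>) * 2 powr (- (real j * \<beta>)) = 1" unfolding powr_add[symmetric] by simp
    finally show ?thesis by simp
  qed
  then show ?thesis using that[OF \<epsilon> \<sigma>] by simp
qed

text \<open>Truncation heights that grow from \<open>M\<close> towards \<open>2 * M\<close>;
  consecutive ones differ by \<open>M / 2 ^ (j + 1)\<close>.\<close>

definition level :: "real \<Rightarrow> nat \<Rightarrow> real" where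
  "level M j = M * (2 - (1 / 2) ^ j)"

text \<open>Beyond the next level the excess over \<open>level M j\<close> is at least one gap, and
  \<open>2 ^ (j + 2)\<close> gaps make \<open>2 * M\<close>. In this way powers of \<open>w\<close>
  are traded for powers of its truncation, at the price of a factor growing geometrically in
  \<open>j\<close>.\<close>

lemma level_props:
  assumes "0 < M"
  shows "M \<le> level M j" "level M j \<le> 2 * M" "level M 0 = M"
    "level M (Suc j) < z \<Longrightarrow> z \<le> 2 ^ (j + 2) * (z - level M j)"
    "level M (Suc j) < z \<Longrightarrow> M / 2 ^ (j + 1) \<le> z - level M j"
proof -
  have h: "0 < (1 / 2 :: real) ^ j" "(1 / 2 :: real) ^ j \<le> 1" by (auto simp: power_le_one)
  show "M \<le> level M j" "level M j \<le> 2 * M" "level M 0 = M"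
    using assms h by (auto simp: level_def algebra_simps)
  assume z: "level M (Suc j) < z"
  have d: "level M (Suc j) - level M j = M / 2 ^ (j + 1)"
    by (simp add: level_def field_simps)
  then show d2: "M / 2 ^ (j + 1) \<le> z - level M j" using z by linarith
  have l2: "level M j \<le> 2 ^ (j + 2) * (M / 2 ^ (j + 1))"
    using \<open>level M j \<le> 2 * M\<close> by simp
  have "1 * (z - level M j - M / 2 ^ (j + 1)) \<le> 2 ^ (j + 2) * (z - level M j - M / 2 ^ (j + 1))"
    using d2 one_le_power[of "2::real" "j + 2"] by (intro mult_right_mono) auto
  moreover have "level M j + M / 2 ^ (j + 1) \<le> 2 ^ (j + 2) * (M / 2 ^ (j + 1))"
    using z d h assms by (simp add: level_def field_simps)
  ultimately show "z \<le> 2 ^ (j + 2) * (z - level M j)"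
    by (simp add: right_diff_distrib)
qed

lemma AE_le_of_integral:
  fixes f h :: "'a \<Rightarrow> real"
  assumes "integrable M (\<lambda>x. of_bool (k < f x) * h x)" "(\<integral>x. of_bool (k < f x) * h x \<partial>M) \<le> 0"
    "\<And>x. x \<in> space M \<Longrightarrow> 0 \<le> h x" "\<And>x. x \<in> space M \<Longrightarrow> k < f x \<Longrightarrow> 0 < h x"
  shows "AE x in M. f x \<le> k"
proof -
  have nn: "AE x in M. 0 \<le> of_bool (k < f x) * h x" using assms(3) by (intro AE_I2) (simp add: of_bool_def)
  then have "(\<integral>x. of_bool (k < f x) * h x \<partial>M) = 0"
    using assms(2) integral_nonneg_AE[OF nn] by simp
  then have "AE x in M. of_bool (k < f x) * h x = 0"
    using integral_nonneg_eq_0_iff_AE[OF assms(1) nn] by simp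
  then show ?thesis
    using AE_space by eventually_elim (use assms(4) in force)
qed

context weighted_subsolution
begin

text \<open>The embedding controls the truncation at level \<open>j\<close> in the exponent
  \<open>q\<close>, so \<open>e\<close> reappears with the power \<open>q / p > 1\<close>. The
  integrand \<open>h\<close> is left open because the iteration is run for \<open>u powr q\<close>
  and for \<open>w powr p\<close>.\<close>

lemma de_giorgi_step:
  assumes M: "0 < M" and e: "0 < e" "Yint (level M j) + lam * Rint (level M j) \<le> e"
    and h: "integrable (PM N) h" "\<And>x. 0 \<le> h x"
      "\<And>x. x \<in> space (PM N) \<Longrightarrow> level M (Suc j) < w x \<Longrightarrow> h x \<le> D * (w x - level M j) powr q" and D: "0 \<le> D"
  shows "(\<integral>x. of_bool (level M (Suc j) < w x) * h x \<partial>PM N) \<le> D * (Cemb * ((1 + 2 * 2 powr p) * e) powr (q / p))"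
proof (rule integrable_nn_bound(2))
  let ?T = "\<lambda>x. max (w x - level M j) 0"
  have k: "0 \<le> level M j" using level_props(1)[OF M, of j] M by linarith
  have mono: "level M j \<le> level M (Suc j)"
    using M by (simp add: level_def)
  have apT: "approximable N p (test_functions N \<Omega>) ?T (\<lambda>x i. of_bool (level M j < w x) * dw x i)"
    by (rule approximable_mono[OF truncation_approximable[OF k] nonneg_tests_subset])
  have "energy N p ?T (\<lambda>x i. of_bool (level M j < w x) * dw x i) \<le> ennreal ((1 + 2 * 2 powr p) * (Yint (level M j) + lam * Rint (level M j)))"
    by (rule truncation_energy[OF k])
  also have "\<dots> \<le> ennreal ((1 + 2 * 2 powr p) * e)"
    using e by (intro ennreal_leI mult_left_mono) auto
  finally have Tq: "(\<integral>\<^sup>+x. ennreal (\<bar>?T x\<bar> powr q) \<partial>PM N) \<le> ennreal (Cemb * ((1 + 2 * 2 powr p) * e) powr (q / p))"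
    using e by (intro embedding_bound[OF apT]) (auto intro!: mult_pos_pos add_pos_pos)
  show "(\<lambda>x. of_bool (level M (Suc j) < w x) * h x) \<in> borel_measurable (PM N)"
    using level_integrable[OF h(1)] by simp
  show "0 \<le> of_bool (level M (Suc j) < w x) * h x" for x
    using h(2) by (intro mult_nonneg_nonneg) auto
  show "0 \<le> D * (Cemb * ((1 + 2 * 2 powr p) * e) powr (q / p))"
    using D Cemb_pos by (intro mult_nonneg_nonneg) auto
  have [measurable]: "?T \<in> borel_measurable (PM N)"
    by (rule pair_measurableD(1)[OF approximable_measurable[OF apT]])
  have "(\<integral>\<^sup>+x. ennreal (of_bool (level M (Suc j) < w x) * h x) \<partial>PM N) \<le>
      (\<integral>\<^sup>+x. ennreal D * ennreal (\<bar>?T x\<bar> powr q) \<partial>PM N)"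
  proof (rule nn_integral_mono)
    fix x assume x: "x \<in> space (PM N)"
    show "ennreal (of_bool (level M (Suc j) < w x) * h x) \<le> ennreal D * ennreal (\<bar>?T x\<bar> powr q)"
    proof (cases "level M (Suc j) < w x")
      case True
      then have "\<bar>?T x\<bar> = w x - level M j" using mono by simp
      then have "ennreal (h x) \<le> ennreal (D * \<bar>?T x\<bar> powr q)" using h(3)[OF x True] by (intro ennreal_leI) simp
      then show ?thesis using True D by (simp add: ennreal_mult')
    qed simp
  qed
  also have "\<dots> = ennreal D * (\<integral>\<^sup>+x. ennreal (\<bar>?T x\<bar> powr q) \<partial>PM N)"
    by (rule nn_integral_cmult) measurable
  also have "\<dots> \<le> ennreal D * ennreal (Cemb * ((1 + 2 * 2 powr p) * e) powr (q / p))"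
    by (rule mult_left_mono[OF Tq]) simp
  finally show "(\<integral>\<^sup>+x. ennreal (of_bool (level M (Suc j) < w x) * h x) \<partial>PM N) \<le>
      ennreal (D * (Cemb * ((1 + 2 * 2 powr p) * e) powr (q / p)))"
    using D by (simp add: ennreal_mult')
qed

text \<open>The set where \<open>w > 2 * M\<close> lies in all superlevel sets of the iteration,
  over which the integrals of \<open>h\<close> tend to 0; as \<open>h\<close> is positive where
  \<open>w\<close> is, that set is null.\<close>

lemma AE_le_of_levels:
  fixes h :: "point \<Rightarrow> real"
  assumes M: "0 < M" and \<sigma>: "0 < \<sigma>" "\<sigma> < 1" and h: "integrable (PM N) h" "\<And>x. 0 \<le> h x"
    "\<And>x. x \<in> space (PM N) \<Longrightarrow> 0 < w x \<Longrightarrow> 0 < h x"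
    and small: "\<And>j. (\<integral>x. of_bool (level M j < w x) * h x \<partial>PM N) \<le> c * \<sigma> ^ j"
  shows "AE x in PM N. w x \<le> 2 * M"
proof (rule AE_le_of_integral[OF level_integrable[OF h(1)]])
  have "(\<integral>x. of_bool (2 * M < w x) * h x \<partial>PM N) \<le> c * \<sigma> ^ j" for j
  proof (rule order_trans[OF integral_mono small])
    show "integrable (PM N) (\<lambda>x. of_bool (2 * M < w x) * h x)" "integrable (PM N) (\<lambda>x. of_bool (level M j < w x) * h x)"
      by (rule level_integrable[OF h(1)])+
    show "of_bool (2 * M < w x) * h x \<le> of_bool (level M j < w x) * h x" for x
      using level_props(2)[OF M, of j] h(2)[of x] by (intro mult_right_mono) auto
  qed
  moreover have "(\<lambda>j. c * \<sigma> ^ j) \<longlonglongrightarrow> c * 0"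
    using \<sigma> by (intro tendsto_intros LIMSEQ_power_zero) auto
  ultimately show "(\<integral>x. of_bool (2 * M < w x) * h x \<partial>PM N) \<le> 0"
    by (intro LIMSEQ_le_const[of "\<lambda>j. c * \<sigma> ^ j"]) auto
  show "x \<in> space (PM N) \<Longrightarrow> 2 * M < w x \<Longrightarrow> 0 < h x" for x
    using h(3)[of x] M by simp
qed (use h in auto)

text \<open>The bound \<open>U\<close> makes the source homogeneous:
  \<open>u powr q * \<psi> powr p \<le> U powr (q - p) * w powr p\<close>. Therefore the smallness
  that starts the iteration is relative to \<open>M powr p\<close>, and the condition on
  \<open>\<epsilon>\<close> involves neither the weight nor its bound.\<close>

lemma sup_bound_of_small:
  assumes U: "AE x in PM N. u x \<le> U" "0 \<le> U"
    and \<epsilon>: "0 < \<epsilon>" "0 < \<sigma>" "\<sigma> < 1"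
      "\<And>j::nat. 2 powr (2 * q) * (Cemb * ((1 + 2 * 2 powr p) * (1 + lam * U powr (q - p))) powr (q / p)) *
        2 powr (real j * q) * (\<epsilon> * \<sigma> ^ j) powr (q / p) \<le> \<epsilon> * \<sigma> ^ Suc j"
    and M: "0 < M" "(\<integral>x. w x powr p \<partial>PM N) \<le> \<epsilon> * M powr p"
  shows "AE x in PM N. w x \<le> 2 * M"
proof -
  define c where "c = 1 + lam * U powr (q - p)"
  have c: "0 < c" unfolding c_def using lam by (intro add_pos_nonneg) auto
  define K where "K = 1 + 2 * 2 powr p"
  have K: "0 < K" unfolding K_def by (intro add_pos_pos) auto
  have R: "Yint k + lam * Rint k \<le> c * Yint k" for k
  proof -
    have "Rint k \<le> (\<integral>x. U powr (q - p) * (of_bool (k < w x) * w x powr p) \<partial>PM N)"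
      unfolding Rint_def
    proof (rule integral_mono_AE[OF level_integrable[OF weighted_integrable(3)] integrable_mult_right[OF level_integrable[OF weighted_integrable(1)]]])
      show "AE x in PM N. of_bool (k < w x) * (u x powr q * \<psi> x powr p) \<le> U powr (q - p) * (of_bool (k < w x) * w x powr p)"
        using U(1) AE_space
      proof eventually_elim
        case (elim x)
        have "u x powr q * \<psi> x powr p = u x powr (q - p) * w x powr p"
          using u_nonneg[of x] \<psi>_pos[OF elim(2)] by (simp add: w_def powr_mult powr_add[symmetric] mult.assoc[symmetric] mult.commute[of "\<psi> x powr p"])
        also have "\<dots> \<le> U powr (q - p) * w x powr p"
          using elim(1) u_nonneg[of x] q by (intro mult_right_mono powr_mono2) auto
        finally show ?case by simp
      qed
    qed
    also have "\<dots> = U powr (q - p) * Yint k" by (simp add: Yint_def)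
    finally have "lam * Rint k \<le> lam * (U powr (q - p) * Yint k)" using lam by (intro mult_left_mono) auto
    then show ?thesis by (simp add: c_def algebra_simps)
  qed
  have small: "Yint (level M j) \<le> M powr p * (\<epsilon> * \<sigma> ^ j)" for j
  proof (induction j)
    case 0
    have "Yint (level M 0) \<le> (\<integral>x. w x powr p \<partial>PM N)"
      unfolding Yint_def by (intro integral_mono level_integrable weighted_integrable) auto
    then show ?case using M(2) by (simp add: mult.commute)
  next
    case (Suc j)
    define e where "e = c * (M powr p * (\<epsilon> * \<sigma> ^ j))"
    have e: "0 < e" unfolding e_def using c M \<epsilon> by simp
    have "Yint (level M j) + lam * Rint (level M j) \<le> e"
      using order_trans[OF R mult_left_mono[OF Suc less_imp_le[OF c]]] by (simp add: e_def)
    \<comment> \<open>With \<open>t\<close> the excess of \<open>w\<close> over level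
      \<open>j\<close>, \<open>w \<le> 2 ^ (j + 2) * t\<close> and
      \<open>t \<ge> M / 2 ^ (j + 1)\<close>; since \<open>p < q\<close>, the surplus
      \<open>t powr (p - q)\<close> is bounded by its value at the gap. The resulting
      \<open>M powr (p - q)\<close> meets the \<open>M powr q\<close> contained in
      \<open>e powr (q / p)\<close> and restores \<open>M powr p\<close>.\<close>
    define D where "D = M powr (p - q) * 2 powr ((real j + 2) * q)"
    have "Yint (level M (Suc j)) \<le> D * (Cemb * (K * e) powr (q / p))"
      unfolding Yint_def K_def
    proof (rule de_giorgi_step[OF M(1) e \<open>Yint (level M j) + lam * Rint (level M j) \<le> e\<close> weighted_integrable(1)])
      show "0 \<le> D" by (simp add: D_def)
      fix x assume x: "x \<in> space (PM N)" and lt: "level M (Suc j) < w x"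
      define t where "t = w x - level M j"
      have t1: "w x \<le> 2 ^ (j + 2) * t" and t2: "M / 2 ^ (j + 1) \<le> t"
        using level_props(4,5)[OF M(1) lt] by (auto simp: t_def)
      have t0: "0 < t" using t2 M(1) by (smt (verit) divide_pos_pos zero_less_power)
      have pow2: "(2::real) ^ n = 2 powr real n" for n by (simp add: powr_realpow)
      have "w x powr p \<le> (2 ^ (j + 2) * t) powr p"
        using t1 w_nonneg[OF x] p0 by (intro powr_mono2) auto
      also have "\<dots> = 2 powr ((real j + 2) * p) * (t powr q * t powr (p - q))"
      proof -
        have "(2::real) ^ (j + 2) = 2 powr (real j + 2)" unfolding pow2 by (simp add: add.commute)
        then have "(2 ^ (j + 2) * t) powr p = (2 powr (real j + 2)) powr p * t powr p"
          using t0 by (simp only: powr_mult)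
        then show ?thesis unfolding powr_add[symmetric] by (simp add: powr_powr)
      qed
      also have "t powr (p - q) \<le> (M / 2 ^ (j + 1)) powr (p - q)"
        using t2 M(1) q by (intro powr_mono2') auto
      also have "(M / 2 ^ (j + 1)) powr (p - q) = M powr (p - q) * 2 powr ((real j + 1) * (q - p))"
      proof -
        have "M / 2 ^ (j + 1) = M * 2 powr (- (real j + 1))"
          by (simp only: pow2 powr_minus divide_inverse of_nat_add of_nat_1)
        then have "(M / 2 ^ (j + 1)) powr (p - q) = M powr (p - q) * (2 powr (- (real j + 1))) powr (p - q)"
          using M(1) by (simp only: powr_mult)
        also have "(2 powr (- (real j + 1))) powr (p - q) = (2::real) powr ((real j + 1) * (q - p))"
          unfolding powr_powr by (simp add: algebra_simps)
        finally show ?thesis .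
      qed
      also have "2 powr ((real j + 2) * p) * (t powr q * (M powr (p - q) * 2 powr ((real j + 1) * (q - p)))) =
          M powr (p - q) * (2 powr ((real j + 2) * p) * 2 powr ((real j + 1) * (q - p))) * t powr q"
        by (simp add: mult_ac)
      also have "2 powr ((real j + 2) * p) * 2 powr ((real j + 1) * (q - p)) \<le> (2::real) powr ((real j + 2) * q)"
        unfolding powr_add[symmetric] using q by (intro powr_mono) (auto simp: algebra_simps)
      finally show "w x powr p \<le> D * (w x - level M j) powr q"
        by (simp add: D_def t_def mult_left_mono mult_right_mono)
    next
      show "0 \<le> w x powr p" for x by simp
    qed
    also have "\<dots> = M powr (p - q) * 2 powr ((real j + 2) * q) * (Cemb * ((K * c) powr (q / p) * (M powr q * (\<epsilon> * \<sigma> ^ j) powr (q / p))))"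
      using c K M \<epsilon> p0 by (simp add: e_def D_def powr_mult powr_powr mult_ac)
    also have "\<dots> = (M powr (p - q) * M powr q) * (2 powr (2 * q) * (Cemb * (K * c) powr (q / p)) * 2 powr (real j * q) * (\<epsilon> * \<sigma> ^ j) powr (q / p))"
    proof -
      have "2 powr ((real j + 2) * q) = 2 powr (2 * q) * 2 powr (real j * q)"
        unfolding powr_add[symmetric] by (simp add: algebra_simps)
      then show ?thesis by (simp only: mult_ac)
    qed
    also have "\<dots> \<le> (M powr (p - q) * M powr q) * (\<epsilon> * \<sigma> ^ Suc j)"
      using \<epsilon>(4)[of j] unfolding c_def K_def by (intro mult_left_mono) auto
    also have "M powr (p - q) * M powr q = M powr p" unfolding powr_add[symmetric] by simp
    finally show ?case .
  qed
  show ?thesis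
  proof (rule AE_le_of_levels[OF M(1) \<epsilon>(2,3) weighted_integrable(1)])
    show "(\<integral>x. of_bool (level M j < w x) * w x powr p \<partial>PM N) \<le> (M powr p * \<epsilon>) * \<sigma> ^ j" for j
      using small[of j] by (simp add: Yint_def mult.assoc)
  qed auto
qed

end

context subsolution
begin

lemma trivial_weight: "weighted_subsolution N p q lam \<Omega> u g (\<lambda>_. 1) 1 0"
proof unfold_locales
  show "smooth_RN N (\<lambda>_. 1)" by (rule smooth_const)
  have "gradient (\<lambda>_. 1) x = (\<lambda>i. 0)" for x :: point by (simp add: gradient_def partial_def)
  then show "enorm N (gradient (\<lambda>_. 1) x) \<le> 0 * 1" for x by simp
qed auto

text \<open>No bound is available yet, so \<open>Rint\<close> itself is iterated: at levels at least
  1 it dominates \<open>Yint\<close>, because \<open>u powr p \<le> u powr q\<close> there. The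
  initial smallness comes from integrability of \<open>u powr q\<close>, so the starting level
  depends on \<open>u\<close>.\<close>

lemma bounded: "\<exists>U>0. AE x in PM N. u x \<le> U"
proof -
  interpret W: weighted_subsolution N p q lam \<Omega> u g "\<lambda>_. 1" 1 0 by (rule trivial_weight)
  have wu: "W.w x = u x" for x by (simp add: W.w_def)
  define K where "K = 1 + 2 * 2 powr p"
  have K: "0 < K" unfolding K_def by (intro add_pos_pos) auto
  define A where "A = 2 powr (2 * q) * (Cemb * (K * (1 + lam)) powr (q / p))"
  have A: "0 < A" unfolding A_def using Cemb_pos K lam by simp
  have r: "1 < q / p" using p0 q by simp
  obtain \<epsilon> \<sigma> where \<epsilon>: "0 < \<epsilon>" "0 < \<sigma>" "\<sigma> < 1"
    "\<And>j::nat. A * 2 powr (real j * q) * (\<epsilon> * \<sigma> ^ j) powr (q / p) \<le> \<epsilon> * \<sigma> ^ Suc j"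
    by (rule de_giorgi_numbers[OF A q0 r]) (rule that)
  have Rle: "W.Yint k + lam * W.Rint k \<le> (1 + lam) * W.Rint k" if k: "1 \<le> k" for k
  proof -
    have "W.Yint k \<le> W.Rint k"
      unfolding W.Yint_def W.Rint_def
    proof (intro integral_mono W.level_integrable W.weighted_integrable)
      fix x
      show "of_bool (k < W.w x) * W.w x powr p \<le> of_bool (k < W.w x) * (u x powr q * 1 powr p)"
        using k q by (cases "k < W.w x") (auto simp: wu intro!: powr_mono)
    qed
    then show ?thesis by (simp add: algebra_simps)
  qed
  have "(\<lambda>n. W.Rint (real n)) \<longlonglongrightarrow> (\<integral>x. 0 \<partial>PM N)"
    unfolding W.Rint_def
  proof (rule integral_dominated_convergence[where w="\<lambda>x. u x powr q"])
    show "AE x in PM N. (\<lambda>n. of_bool (real n < W.w x) * (u x powr q * 1 powr p)) \<longlonglongrightarrow> 0"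
    proof (rule AE_I2)
      fix x
      obtain m where m: "W.w x < real m" using reals_Archimedean2 by blast
      show "(\<lambda>n. of_bool (real n < W.w x) * (u x powr q * 1 powr p)) \<longlonglongrightarrow> 0"
      proof (rule tendsto_eventually)
        show "\<forall>\<^sub>F n in sequentially. of_bool (real n < W.w x) * (u x powr q * 1 powr p) = 0"
          using eventually_ge_at_top[of m] by eventually_elim (use m in auto)
      qed
    qed
    show "(\<lambda>x. of_bool (real n < W.w x) * (u x powr q * 1 powr p)) \<in> borel_measurable (PM N)" for n
      using W.level_integrable[OF W.weighted_integrable(3)] by simp
  qed (use u_integrable(3) in auto)
  then have "(\<lambda>n. W.Rint (real n)) \<longlonglongrightarrow> 0" by simp
  then have "\<forall>\<^sub>F n in sequentially. W.Rint (real n) < \<epsilon>" using \<epsilon>(1) by (rule order_tendstoD(2))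
  then have "\<exists>n. W.Rint (real n) < \<epsilon> \<and> 1 \<le> n"
    by (intro eventually_happens'[OF sequentially_bot] eventually_conj eventually_ge_at_top)
  then obtain n where n: "W.Rint (real n) < \<epsilon>" "1 \<le> n" by blast
  define M where "M = real n"
  have M: "1 \<le> M" "0 < M" using n by (auto simp: M_def)
  have small: "W.Rint (level M j) \<le> \<epsilon> * \<sigma> ^ j" for j
  proof (induction j)
    case 0
    then show ?case using n level_props(3)[OF M(2)] by (simp add: M_def)
  next
    case (Suc j)
    define e where "e = (1 + lam) * (\<epsilon> * \<sigma> ^ j)"
    have e: "0 < e" unfolding e_def using lam \<epsilon> by simp
    have "1 \<le> level M j" using level_props(1)[OF M(2), of j] M by linarith
    then have le: "W.Yint (level M j) + lam * W.Rint (level M j) \<le> e"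
      using order_trans[OF Rle mult_left_mono[OF Suc, of "1 + lam"]] lam by (simp add: e_def)
    define D where "D = 2 powr ((real j + 2) * q)"
    have "W.Rint (level M (Suc j)) \<le> D * (Cemb * (K * e) powr (q / p))"
      unfolding W.Rint_def K_def
    proof (rule W.de_giorgi_step[OF M(2) e le W.weighted_integrable(3)])
      show "0 \<le> D" by (simp add: D_def)
      fix x assume x: "x \<in> space (PM N)" and lt: "level M (Suc j) < W.w x"
      have "u x \<le> 2 ^ (j + 2) * (W.w x - level M j)"
        using level_props(4)[OF M(2) lt] by (simp add: wu)
      moreover have "0 \<le> W.w x - level M j" using level_props(5)[OF M(2) lt] M by (smt (verit) divide_pos_pos zero_less_power)
      ultimately have "u x powr q \<le> (2 ^ (j + 2)) powr q * (W.w x - level M j) powr q"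
        using u_nonneg[of x] q0 by (subst powr_mult[symmetric]) (auto intro!: powr_mono2)
      also have "2 ^ (j + 2) = (2::real) powr (real (j + 2))" by (rule powr_realpow[symmetric]) simp
      finally show "u x powr q * 1 powr p \<le> D * (W.w x - level M j) powr q"
        by (simp add: D_def powr_powr add.commute)
    next
      show "0 \<le> u x powr q * 1 powr p" for x by simp
    qed
    also have "\<dots> = A * 2 powr (real j * q) * (\<epsilon> * \<sigma> ^ j) powr (q / p)"
    proof -
      have "2 powr ((real j + 2) * q) = 2 powr (2 * q) * 2 powr (real j * q)"
        unfolding powr_add[symmetric] by (simp add: algebra_simps)
      moreover have "(K * e) powr (q / p) = (K * (1 + lam)) powr (q / p) * (\<epsilon> * \<sigma> ^ j) powr (q / p)"
        using K lam \<epsilon> unfolding e_def by (subst powr_mult[symmetric]) (auto simp: mult.assoc)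
      ultimately show ?thesis unfolding D_def A_def by (simp only: mult_ac)
    qed
    also have "\<dots> \<le> \<epsilon> * \<sigma> ^ Suc j" by (rule \<epsilon>(4))
    finally show ?case .
  qed
  have "AE x in PM N. W.w x \<le> 2 * M"
  proof (rule W.AE_le_of_levels[OF M(2) \<epsilon>(2,3) W.weighted_integrable(3)])
    show "(\<integral>x. of_bool (level M j < W.w x) * (u x powr q * 1 powr p) \<partial>PM N) \<le> \<epsilon> * \<sigma> ^ j" for j
      using small[of j] by (simp add: W.Rint_def)
    show "0 < W.w x \<Longrightarrow> 0 < u x powr q * 1 powr p" for x by (simp add: wu)
  qed (intro mult_nonneg_nonneg powr_ge_zero)
  then show ?thesis using M by (intro exI[of _ "2 * M"]) (simp add: wu)
qed

text \<open>The order of quantifiers matters: \<open>\<epsilon>\<close> is fixed before the weight,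
  so one constant serves a whole family of bounded weights approaching an exponential.\<close>

lemma sup_bound:
  assumes U: "AE x in PM N. u x \<le> U" "0 \<le> U"
  obtains \<epsilon> where "0 < \<epsilon>" "\<And>\<psi> B a M. weighted_subsolution N p q lam \<Omega> u g \<psi> B a \<Longrightarrow> 0 < M \<Longrightarrow>
    (\<integral>x. (\<psi> x * u x) powr p \<partial>PM N) \<le> \<epsilon> * M powr p \<Longrightarrow> AE x in PM N. \<psi> x * u x \<le> 2 * M"
proof -
  define A where "A = 2 powr (2 * q) * (Cemb * ((1 + 2 * 2 powr p) * (1 + lam * U powr (q - p))) powr (q / p))"
  have "0 < (1 + 2 * 2 powr p) * (1 + lam * U powr (q - p))"
    using lam by (intro mult_pos_pos add_pos_nonneg) auto
  then have A: "0 < A" unfolding A_def using Cemb_pos by (intro mult_pos_pos) auto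
  have r: "1 < q / p" using p0 q by simp
  obtain \<epsilon> \<sigma> where \<epsilon>: "0 < \<epsilon>" "0 < \<sigma>" "\<sigma> < 1"
    "\<And>j::nat. A * 2 powr (real j * q) * (\<epsilon> * \<sigma> ^ j) powr (q / p) \<le> \<epsilon> * \<sigma> ^ Suc j"
    by (rule de_giorgi_numbers[OF A q0 r]) (rule that)
  show ?thesis
  proof (rule that[OF \<epsilon>(1)])
    fix \<psi> B a and M :: real
    assume "weighted_subsolution N p q lam \<Omega> u g \<psi> B a" and M: "0 < M"
      and le: "(\<integral>x. (\<psi> x * u x) powr p \<partial>PM N) \<le> \<epsilon> * M powr p"
    then interpret W: weighted_subsolution N p q lam \<Omega> u g \<psi> B a by simp
    have "AE x in PM N. W.w x \<le> 2 * M"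
      by (rule W.sup_bound_of_small[OF U \<epsilon>[unfolded A_def] M]) (simp_all add: W.w_def le)
    then show "AE x in PM N. \<psi> x * u x \<le> 2 * M" by (simp add: W.w_def)
  qed
qed

end

subsection \<open>Exponential decay\<close>

text \<open>The Japanese bracket, the square root of \<open>1 + \<bar>x\<bar>\<^sup>2\<close>: it
  dominates the Euclidean norm, is smooth also at the origin, and its gradient has norm at most 1.
  The \<open>powr\<close> form matches \<open>smooth_powr\<close>.\<close>

definition japanese :: "nat \<Rightarrow> point \<Rightarrow> real" where
  "japanese N x = (1 + (\<Sum>i<N. (x i)\<^sup>2)) powr (1 / 2)"

lemma japanese_sqrt: "japanese N x = sqrt (1 + (\<Sum>i<N. (x i)\<^sup>2))"
  unfolding japanese_def by (rule powr_half_sqrt) (simp add: sum_nonneg add_nonneg_nonneg)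

lemma japanese_pos: "0 < japanese N x"
  unfolding japanese_sqrt by (simp add: sum_nonneg add_pos_nonneg)

lemma enorm_le_japanese: "enorm N x \<le> japanese N x"
  unfolding japanese_sqrt enorm_def L2_set_def by simp

lemma smooth_japanese: "smooth_RN N (japanese N)"
proof -
  have "0 < 1 + (\<Sum>i<N. x i * x i)" for x :: point
    by (intro add_pos_nonneg sum_nonneg) auto
  then show ?thesis
    unfolding japanese_def[abs_def] power2_eq_square
    by (intro smooth_powr smooth_add smooth_const smooth_sum smooth_mult smooth_coord) simp_all
qed

lemma partial_japanese:
  assumes "x \<in> {..<N} \<rightarrow>\<^sub>E UNIV" "i < N"
  shows "partial i (japanese N) x = x i / japanese N x"
proof (rule partial_eqI)
  define s where "s = 1 + (\<Sum>j\<in>{..<N} - {i}. (x j)\<^sup>2)"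
  have eq: "japanese N (x(i := t)) = sqrt (t\<^sup>2 + s)" for t
  proof -
    have "(\<Sum>j<N. ((x(i := t)) j)\<^sup>2) = t\<^sup>2 + (\<Sum>j\<in>{..<N} - {i}. ((x(i := t)) j)\<^sup>2)"
      using assms(2) by (subst sum.remove[of _ i]) auto
    also have "(\<Sum>j\<in>{..<N} - {i}. ((x(i := t)) j)\<^sup>2) = (\<Sum>j\<in>{..<N} - {i}. (x j)\<^sup>2)"
      by (intro sum.cong) auto
    finally show ?thesis by (simp add: japanese_sqrt s_def add_ac)
  qed
  have s: "0 < s" unfolding s_def by (intro add_pos_nonneg sum_nonneg) auto
  have "((\<lambda>t. sqrt (t\<^sup>2 + s)) has_real_derivative (2 * x i) * (inverse (sqrt ((x i)\<^sup>2 + s)) / 2)) (at (x i))"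
  proof -
    have "0 < (x i)\<^sup>2 + s" using s by (simp add: add_nonneg_pos)
    then show ?thesis by (auto intro!: derivative_eq_intros)
  qed
  also have "(2 * x i) * (inverse (sqrt ((x i)\<^sup>2 + s)) / 2) = x i / japanese N x"
  proof -
    have "japanese N x = sqrt ((x i)\<^sup>2 + s)" using eq[of "x i"] by (simp only: fun_upd_triv)
    moreover have "(2 * y) * (inverse z / 2) = y / z" for y z :: real
      by (cases "z = 0") (simp_all add: field_simps)
    ultimately show ?thesis by (simp only:)
  qed
  finally show "((\<lambda>t. japanese N (x(i := t))) has_real_derivative x i / japanese N x) (at (x i))"
    unfolding eq .
qed

text \<open>
  As \<open>b\<close> tends to \<open>0\<close> these bounded weights increase to \<open>exp (a * japanese N x)\<close>, while \<open>b\<close> times the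
  weight tends to \<open>0\<close> pointwise and stays at least \<open>1/2\<close> where \<open>exp (- a * japanese N x) \<le> b\<close>.
\<close>

definition exp_weight :: "nat \<Rightarrow> real \<Rightarrow> real \<Rightarrow> point \<Rightarrow> real" where
  "exp_weight N a b x = (b + exp (- a * japanese N x)) powr - 1"

lemma exp_weight_eq: "0 < b \<Longrightarrow> exp_weight N a b x = 1 / (b + exp (- a * japanese N x))"
  unfolding exp_weight_def by (rule powr_neg_one) (simp add: add_pos_pos)

lemma exp_weight_bounds:
  assumes "0 < b"
  shows "0 < exp_weight N a b x" "exp_weight N a b x \<le> 1 / b" "exp_weight N a b x \<le> exp (a * japanese N x)"
proof -
  have e: "0 < exp (- a * japanese N x)" by simp
  show "0 < exp_weight N a b x" using assms e by (simp add: exp_weight_eq add_pos_pos)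
  show "exp_weight N a b x \<le> 1 / b"
    unfolding exp_weight_eq[OF assms] using assms e by (intro divide_left_mono) (auto intro!: add_pos_pos mult_pos_pos)
  have "exp_weight N a b x \<le> 1 / exp (- a * japanese N x)"
    unfolding exp_weight_eq[OF assms] using assms e by (intro divide_left_mono) (auto intro!: add_pos_pos mult_pos_pos)
  then show "exp_weight N a b x \<le> exp (a * japanese N x)" by (simp add: exp_minus divide_inverse)
qed

lemma smooth_exp_weight:
  assumes "0 < b"
  shows "smooth_RN N (exp_weight N a b)"
  unfolding exp_weight_def[abs_def]
  using assms by (intro smooth_powr smooth_add smooth_const smooth_exp smooth_mult smooth_japanese add_pos_pos) simp_all

text \<open>With \<open>e\<close> for the exponential, the gradient is \<open>a\<close> times the
  weight times \<open>e / (b + e)\<close> times the vector \<open>x / japanese N x\<close>; the last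
  two have size at most 1.\<close>

lemma exp_weight_gradient:
  assumes x: "x \<in> space (PM N)" and a: "0 \<le> a" and b: "0 < b"
  shows "enorm N (gradient (exp_weight N a b) x) \<le> a * exp_weight N a b x"
proof -
  have xE: "x \<in> {..<N} \<rightarrow>\<^sub>E UNIV" using x by (simp add: space_PM)
  define e where "e = exp (- a * japanese N x)"
  have e: "0 < e" by (simp add: e_def)
  have der: "((\<lambda>t. (b + exp (- a * t)) powr - 1) has_real_derivative
      (- 1 * (b + e) powr (- 1 - 1)) * (e * - a)) (at (japanese N x))"
  proof -
    have "((\<lambda>t. b + exp (- a * t)) has_real_derivative e * - a) (at (japanese N x))"
      unfolding e_def by (auto intro!: derivative_eq_intros)
    moreover have "((\<lambda>z. z powr - 1) has_real_derivative - 1 * (b + e) powr (- 1 - 1)) (at (b + exp (- a * japanese N x)))"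
      unfolding e_def using b by (intro has_real_derivative_powr) (simp add: add_pos_pos)
    ultimately show ?thesis by (rule DERIV_chain2[rotated])
  qed
  define D where "D = (- 1 * (b + e) powr (- 1 - 1)) * (e * - a)"
  have "(b + e) powr (- 1 - 1) = (b + e) powr - 1 * (b + e) powr - 1"
    unfolding powr_add[symmetric] by simp
  also have "\<dots> = exp_weight N a b x * (1 / (b + e))"
    using exp_weight_eq[OF b, of N a x] b e by (simp add: exp_weight_def e_def)
  finally have D: "D = a * exp_weight N a b x * (e / (b + e))" by (simp add: D_def)
  have "enorm N (gradient (exp_weight N a b) x) = enorm N (\<lambda>i. D / japanese N x * x i)"
  proof (rule enorm_cong)
    fix i assume i: "i < N"
    show "gradient (exp_weight N a b) x i = D / japanese N x * x i"
      using partial_comp[OF smooth_japanese i xE der] partial_japanese[OF xE i]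
      unfolding gradient_def exp_weight_def[abs_def] D_def by simp
  qed
  also have "\<dots> = \<bar>D\<bar> * (enorm N x / japanese N x)"
    unfolding enorm_scale using japanese_pos[of N x] by (simp add: abs_mult)
  also have "\<dots> \<le> \<bar>D\<bar> * 1"
    using enorm_le_japanese[of N x] japanese_pos[of N x] by (intro mult_left_mono) auto
  also have "\<bar>D\<bar> = a * exp_weight N a b x * (e / (b + e))"
    unfolding D using a b e exp_weight_bounds(1)[OF b, of N a x] by (intro abs_of_nonneg mult_nonneg_nonneg) auto
  also have "\<dots> \<le> a * exp_weight N a b x * 1"
    using a b e exp_weight_bounds(1)[OF b, of N a x] by (intro mult_left_mono mult_nonneg_nonneg) auto
  finally show ?thesis by simp
qed

lemma approximable_poincare:
  assumes ap: "approximable N p (test_functions N \<Omega>) v h" and p: "0 < p" and l: "0 < l"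
    and poincare: "\<And>\<phi>. \<phi> \<in> test_functions N \<Omega> \<Longrightarrow> ennreal l * (\<integral>\<^sup>+x. ennreal (\<bar>\<phi> x\<bar> powr p) \<partial>PM N) \<le>
      (\<integral>\<^sup>+x. ennreal (enorm N (gradient \<phi> x) powr p) \<partial>PM N)"
  shows "(\<integral>\<^sup>+x. ennreal (\<bar>v x\<bar> powr p) \<partial>PM N) \<le> ennreal (4 powr p * (1 / l)) * (\<integral>\<^sup>+x. ennreal (enorm N (h x) powr p) \<partial>PM N)"
proof (rule approximable_transfer[OF ap p, where L="\<lambda>v. \<integral>\<^sup>+x. ennreal (\<bar>v x\<bar> powr p) \<partial>PM N"])
  show "\<phi> \<in> test_functions N \<Omega> \<Longrightarrow> smooth_RN N \<phi>" for \<phi> by (rule test_smooth)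
  show "0 \<le> 1 / l" using l by simp
  show "(\<integral>\<^sup>+x. ennreal (\<bar>f x\<bar> powr p) \<partial>PM N) \<le> ennreal (2 powr p) *
      ((\<integral>\<^sup>+x. ennreal (\<bar>f x - w x\<bar> powr p) \<partial>PM N) + (\<integral>\<^sup>+x. ennreal (\<bar>w x\<bar> powr p) \<partial>PM N))"
    if [measurable]: "f \<in> borel_measurable (PM N)" "w \<in> borel_measurable (PM N)" for f w
  proof (rule nn_integral_powr_add_le)
    show "\<bar>f x\<bar> \<le> \<bar>f x - w x\<bar> + \<bar>w x\<bar>" for x by linarith
  qed (use p in measurable)
  show "(\<integral>\<^sup>+x. ennreal (\<bar>f x\<bar> powr p) \<partial>PM N) \<le> ennreal (4 powr p) * (\<integral>\<^sup>+x. ennreal (\<bar>f x\<bar> powr p) \<partial>PM N)" for f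
  proof -
    have "ennreal 1 \<le> ennreal (4 powr p)" using p by (intro ennreal_leI ge_one_powr_ge_zero) auto
    from mult_right_mono[OF this] show ?thesis by simp
  qed
  fix \<phi> assume \<phi>: "\<phi> \<in> test_functions N \<Omega>"
  have "(\<integral>\<^sup>+x. ennreal (\<bar>\<phi> x\<bar> powr p) \<partial>PM N) = ennreal (1 / l) * (ennreal l * (\<integral>\<^sup>+x. ennreal (\<bar>\<phi> x\<bar> powr p) \<partial>PM N))"
    using l by (simp add: mult.assoc[symmetric] ennreal_mult'[symmetric])
  also have "\<dots> \<le> ennreal (1 / l) * (\<integral>\<^sup>+x. ennreal (enorm N (gradient \<phi> x) powr p) \<partial>PM N)"
    by (rule mult_left_mono[OF poincare[OF \<phi>]]) simp
  finally show "(\<integral>\<^sup>+x. ennreal (\<bar>\<phi> x\<bar> powr p) \<partial>PM N) \<le> ennreal (1 / l) * (\<integral>\<^sup>+x. ennreal (enorm N (gradient \<phi> x) powr p) \<partial>PM N)" .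
qed

context subsolution
begin

lemma exp_weighted:
  assumes "0 \<le> a" "p * a \<le> 1 / 2" "0 < b"
  shows "weighted_subsolution N p q lam \<Omega> u g (exp_weight N a b) (1 / b) a"
  by unfold_locales (use assms in \<open>simp_all add: smooth_exp_weight exp_weight_bounds exp_weight_gradient\<close>)

text \<open>The integral of the \<open>p\<close>-th power of \<open>b\<close> times weight times
  \<open>u\<close> tends to 0 by dominated convergence, with majorant \<open>u powr p\<close>. The
  supremum estimate makes the product itself small, and far from the origin \<open>b\<close> times
  the weight is at least \<open>1 / 2\<close>.\<close>

lemma decay_at_infinity:
  assumes U: "AE x in PM N. u x \<le> U" "0 \<le> U" and a: "0 < a" "p * a \<le> 1 / 2" and \<eta>: "0 < \<eta>"
  shows "\<exists>R. AE x in PM N. R \<le> japanese N x \<longrightarrow> u x \<le> \<eta>"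
proof -
  obtain \<epsilon> where \<epsilon>: "0 < \<epsilon>" and sup: "\<And>\<psi> B a M. weighted_subsolution N p q lam \<Omega> u g \<psi> B a \<Longrightarrow> 0 < M \<Longrightarrow>
    (\<integral>x. (\<psi> x * u x) powr p \<partial>PM N) \<le> \<epsilon> * M powr p \<Longrightarrow> AE x in PM N. \<psi> x * u x \<le> 2 * M"
    by (rule sup_bound[OF U]) (rule that)
  define b where "b n = 1 / real (Suc n)" for n
  have b: "0 < b n" for n by (simp add: b_def)
  have blim: "b \<longlonglongrightarrow> 0" unfolding b_def by (rule LIMSEQ_Suc) (rule lim_1_over_n)
  have [measurable]: "exp_weight N a (b n) \<in> borel_measurable (PM N)" for n
    by (intro smooth_measurable smooth_exp_weight b)
  have "(\<lambda>n. \<integral>x. (b n * exp_weight N a (b n) x * u x) powr p \<partial>PM N) \<longlonglongrightarrow> (\<integral>x. 0 \<partial>PM N)"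
  proof (rule integral_dominated_convergence[where w="\<lambda>x. u x powr p"])
    show "AE x in PM N. norm ((b n * exp_weight N a (b n) x * u x) powr p) \<le> u x powr p" for n
    proof (rule AE_I2)
      fix x
      have "b n * exp_weight N a (b n) x \<le> 1"
        using exp_weight_bounds(2)[OF b, of N a n x] b[of n] by (simp add: field_simps)
      then have "b n * exp_weight N a (b n) x * u x \<le> 1 * u x" using u_nonneg[of x] by (rule mult_right_mono)
      then show "norm ((b n * exp_weight N a (b n) x * u x) powr p) \<le> u x powr p"
        using b[of n] exp_weight_bounds(1)[OF b, of N a n x] u_nonneg[of x] p0 by (simp add: powr_mono2)
    qed
    show "AE x in PM N. (\<lambda>n. (b n * exp_weight N a (b n) x * u x) powr p) \<longlonglongrightarrow> 0"
    proof (rule AE_I2)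
      fix x
      have lim: "(\<lambda>n. b n * (exp (a * japanese N x) * u x)) \<longlonglongrightarrow> 0"
        using tendsto_mult_left_zero[OF blim] .
      have le: "b n * exp_weight N a (b n) x * u x \<le> b n * (exp (a * japanese N x) * u x)" for n
        using exp_weight_bounds(3)[OF b, of N a n x] b[of n] u_nonneg[of x]
        by (simp add: mult.assoc mult_left_mono mult_right_mono)
      have nn: "0 \<le> b n * exp_weight N a (b n) x * u x" for n
        using b[of n] exp_weight_bounds(1)[OF b, of N a n x] u_nonneg[of x] by simp
      have "(\<lambda>n. b n * exp_weight N a (b n) x * u x) \<longlonglongrightarrow> 0"
        by (rule tendsto_sandwich[OF always_eventually always_eventually tendsto_const lim]) (use nn le in blast)+
      then show "(\<lambda>n. (b n * exp_weight N a (b n) x * u x) powr p) \<longlonglongrightarrow> 0"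
        by (rule tendsto_zero_powrI[OF _ tendsto_const]) (use nn p0 in auto)
    qed
    show "(\<lambda>x. (b n * exp_weight N a (b n) x * u x) powr p) \<in> borel_measurable (PM N)" for n by measurable
  qed (simp_all add: u_integrable(1))
  then have "(\<lambda>n. \<integral>x. (b n * exp_weight N a (b n) x * u x) powr p \<partial>PM N) \<longlonglongrightarrow> 0" by simp
  moreover have "0 < \<epsilon> * (\<eta> / 4) powr p" using \<epsilon> \<eta> by simp
  ultimately have "\<forall>\<^sub>F n in sequentially. (\<integral>x. (b n * exp_weight N a (b n) x * u x) powr p \<partial>PM N) < \<epsilon> * (\<eta> / 4) powr p"
    by (rule order_tendstoD(2))
  then obtain n where n: "(\<integral>x. (b n * exp_weight N a (b n) x * u x) powr p \<partial>PM N) < \<epsilon> * (\<eta> / 4) powr p"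
    using eventually_happens'[OF sequentially_bot] by blast
  define \<beta> where "\<beta> = b n"
  have \<beta>: "0 < \<beta>" using b by (simp add: \<beta>_def)
  \<comment> \<open>Chosen so that the final inequality
    \<open>u x / (2 * \<beta>) \<le> 2 * M\<close> reads \<open>u x \<le> \<eta>\<close>.\<close>
  define M where "M = \<eta> / 4 / \<beta>"
  have M: "0 < M" using \<eta> \<beta> by (simp add: M_def)
  have "(\<integral>x. (\<beta> * exp_weight N a \<beta> x * u x) powr p \<partial>PM N) = (\<integral>x. \<beta> powr p * (exp_weight N a \<beta> x * u x) powr p \<partial>PM N)"
    using \<beta> exp_weight_bounds(1)[OF \<beta>, of N a] u_nonneg
    by (intro Bochner_Integration.integral_cong refl) (simp add: powr_mult[symmetric] mult.assoc)
  also have "\<dots> = \<beta> powr p * (\<integral>x. (exp_weight N a \<beta> x * u x) powr p \<partial>PM N)" by simp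
  finally have "\<beta> powr p * (\<integral>x. (exp_weight N a \<beta> x * u x) powr p \<partial>PM N) \<le> \<epsilon> * (M * \<beta>) powr p"
    using n \<beta> by (simp add: M_def \<beta>_def[symmetric])
  also have "\<dots> = \<beta> powr p * (\<epsilon> * M powr p)" using M \<beta> by (simp add: powr_mult)
  finally have "(\<integral>x. (exp_weight N a \<beta> x * u x) powr p \<partial>PM N) \<le> \<epsilon> * M powr p"
    using \<beta> by simp
  from sup[OF exp_weighted[OF less_imp_le[OF a(1)] a(2) \<beta>] M this]
  have "AE x in PM N. - ln \<beta> / a \<le> japanese N x \<longrightarrow> u x \<le> \<eta>"
  proof eventually_elim
    case (elim x)
    show ?case
    proof
      assume R: "- ln \<beta> / a \<le> japanese N x"
      then have "- a * japanese N x \<le> ln \<beta>" using a by (simp add: field_simps)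
      then have "exp (- a * japanese N x) \<le> \<beta>" using \<beta> by (metis exp_le_cancel_iff exp_ln)
      then have "u x / (2 * \<beta>) \<le> u x / (\<beta> + exp (- a * japanese N x))"
        using \<beta> u_nonneg[of x] by (intro divide_left_mono mult_pos_pos add_pos_pos) auto
      also have "\<dots> = exp_weight N a \<beta> x * u x" by (simp add: exp_weight_eq[OF \<beta>])
      also have "\<dots> \<le> 2 * M" by (rule elim)
      finally show "u x \<le> \<eta>" using \<beta> by (simp add: M_def field_simps)
    qed
  qed
  then show ?thesis by blast
qed

text \<open>Let \<open>X\<close>, \<open>Y\<close> be the integrals at level 0 for one bounded
  weight. Poincare gives \<open>Y \<le> 2 * \<kappa> * X\<close>, and Caccioppoli with the source
  split at radius \<open>R\<close> gives
  \<open>\<kappa> * X \<le> Y / 4 + 2 * \<kappa> * lam * D\<close>. As \<open>Y\<close> is finite,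
  \<open>Y \<le> 8 * \<kappa> * lam * D\<close> follows, and this right-hand side is free of
  \<open>b\<close>.\<close>

lemma exponential_decay:
  assumes l: "0 < l" and poincare: "\<And>\<phi>. \<phi> \<in> test_functions N \<Omega> \<Longrightarrow> ennreal l * (\<integral>\<^sup>+x. ennreal (\<bar>\<phi> x\<bar> powr p) \<partial>PM N) \<le>
      (\<integral>\<^sup>+x. ennreal (enorm N (gradient \<phi> x) powr p) \<partial>PM N)"
    and a: "0 < a" "p * a \<le> 1 / 2" "16 * p * (8 powr p / l) * a \<le> 1"
  shows "\<exists>M>0. AE x in PM N. u x \<le> M * exp (- a * japanese N x)"
proof -
  obtain U where U: "0 < U" "AE x in PM N. u x \<le> U" using bounded by blast
  obtain \<epsilon> where \<epsilon>: "0 < \<epsilon>" and sup: "\<And>\<psi> B a M. weighted_subsolution N p q lam \<Omega> u g \<psi> B a \<Longrightarrow> 0 < M \<Longrightarrow>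
    (\<integral>x. (\<psi> x * u x) powr p \<partial>PM N) \<le> \<epsilon> * M powr p \<Longrightarrow> AE x in PM N. \<psi> x * u x \<le> 2 * M"
    by (rule sup_bound[OF U(2) less_imp_le[OF U(1)]]) (rule that)
  \<comment> \<open>\<open>4 powr p / l\<close> from \<open>approximable_poincare\<close>, times
    \<open>2 powr p\<close> from \<open>dw_bound\<close>.\<close>
  define \<kappa> where "\<kappa> = 8 powr p / l"
  have \<kappa>: "0 < \<kappa>" using l by (simp add: \<kappa>_def)
  \<comment> \<open>Makes \<open>lam * \<eta> powr (q - p) = 1 / (16 * \<kappa>)\<close>, so that
    the source far out costs only \<open>Yint 0 / (16 * \<kappa>)\<close>.\<close>
  define \<eta> where "\<eta> = (1 / (16 * \<kappa> * lam)) powr (1 / (q - p))"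
  have \<eta>: "0 < \<eta>" "\<eta> powr (q - p) = 1 / (16 * \<kappa> * lam)"
    using \<kappa> lam q by (auto simp: \<eta>_def powr_powr)
  obtain R where R: "AE x in PM N. R \<le> japanese N x \<longrightarrow> u x \<le> \<eta>"
    using decay_at_infinity[OF U(2) less_imp_le[OF U(1)] a(1,2) \<eta>(1)] by blast
  \<comment> \<open>Where \<open>japanese N x \<le> R\<close>, every weight of the family is at most
    \<open>exp (a * R)\<close>, whatever \<open>b\<close> is.\<close>
  define D where "D = exp (a * R) powr p * (\<integral>x. u x powr q \<partial>PM N)"
  have D: "0 \<le> D" unfolding D_def by (intro mult_nonneg_nonneg Bochner_Integration.integral_nonneg) auto
  have Ybound: "(\<integral>x. (exp_weight N a b x * u x) powr p \<partial>PM N) \<le> 8 * \<kappa> * (lam * D)" if b: "0 < b" for b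
  proof -
    interpret W: weighted_subsolution N p q lam \<Omega> u g "exp_weight N a b" "1 / b" a
      by (rule exp_weighted[OF less_imp_le[OF a(1)] a(2) b])
    have Yeq: "of_bool (0 < W.w x) * W.w x powr p = W.w x powr p" if "x \<in> space (PM N)" for x
      using W.w_nonneg[OF that] by (cases "0 < W.w x") auto
    have Y: "W.Yint 0 = (\<integral>x. (exp_weight N a b x * u x) powr p \<partial>PM N)"
      unfolding W.Yint_def by (intro Bochner_Integration.integral_cong refl) (simp add: Yeq, simp add: W.w_def)
    have apT: "approximable N p (test_functions N \<Omega>) (\<lambda>x. max (W.w x - 0) 0) (\<lambda>x i. of_bool (0 < W.w x) * W.dw x i)"
      by (rule approximable_mono[OF W.truncation_approximable[OF order_refl] nonneg_tests_subset])
    let ?f = "\<lambda>x. 2 powr p * (of_bool (0 < W.w x) * W.X x powr p + a powr p * (of_bool (0 < W.w x) * W.w x powr p))"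
    note li = W.level_integrable[OF W.weighted_integrable(1), of 0] W.level_integrable[OF W.weighted_integrable(2), of 0]
    have "ennreal (W.Yint 0) = (\<integral>\<^sup>+x. ennreal (of_bool (0 < W.w x) * W.w x powr p) \<partial>PM N)"
      unfolding W.Yint_def by (intro nn_integral_eq_integral[symmetric] li) simp
    also have "\<dots> = (\<integral>\<^sup>+x. ennreal (\<bar>max (W.w x - 0) 0\<bar> powr p) \<partial>PM N)"
      using W.w_nonneg by (intro nn_integral_cong) (simp add: Yeq)
    also have "\<dots> \<le> ennreal (4 powr p * (1 / l)) * (\<integral>\<^sup>+x. ennreal (enorm N (\<lambda>i. of_bool (0 < W.w x) * W.dw x i) powr p) \<partial>PM N)"
      by (rule approximable_poincare[OF apT p0 l poincare])
    also have "\<dots> \<le> ennreal (4 powr p * (1 / l)) * (\<integral>\<^sup>+x. ennreal (?f x) \<partial>PM N)"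
    proof (intro mult_left_mono nn_integral_mono ennreal_leI)
      fix x assume x: "x \<in> space (PM N)"
      show "enorm N (\<lambda>i. of_bool (0 < W.w x) * W.dw x i) powr p \<le> ?f x"
        using W.dw_bound[OF x] by (cases "0 < W.w x") auto
    qed simp
    also have "(\<integral>\<^sup>+x. ennreal (?f x) \<partial>PM N) = ennreal (\<integral>x. ?f x \<partial>PM N)"
      by (intro nn_integral_eq_integral integrable_mult_right Bochner_Integration.integrable_add li) simp
    also have "(\<integral>x. ?f x \<partial>PM N) = 2 powr p * (W.Xint 0 + a powr p * W.Yint 0)"
      unfolding W.Yint_def W.Xint_def using li by simp
    also have "ennreal (4 powr p * (1 / l)) * ennreal (2 powr p * (W.Xint 0 + a powr p * W.Yint 0)) =
        ennreal (\<kappa> * (W.Xint 0 + a powr p * W.Yint 0))"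
    proof -
      have "4 powr p * (1 / l) * (2 powr p * Z) = \<kappa> * Z" for Z
        using powr_mult[of 4 2 p] by (simp add: \<kappa>_def)
      then show ?thesis using l by (simp add: ennreal_mult'[symmetric])
    qed
    finally have 1: "W.Yint 0 \<le> \<kappa> * (W.Xint 0 + a powr p * W.Yint 0)"
      using \<kappa> W.level_nonneg by (subst (asm) ennreal_le_iff) (auto intro!: mult_nonneg_nonneg add_nonneg_nonneg)
    \<comment> \<open>Since \<open>a \<le> 1\<close>, the power \<open>a powr p\<close> is replaced
      by \<open>a\<close>, so that the linear smallness condition on \<open>a\<close>
      applies.\<close>
    have "a powr p \<le> a powr 1" using a W.a1 p by (intro powr_mono') auto
    then have "\<kappa> * (a powr p * W.Yint 0) \<le> \<kappa> * (a * W.Yint 0)"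
      using \<kappa> a W.level_nonneg by (intro mult_left_mono mult_right_mono) auto
    moreover have "(\<kappa> * a) * W.Yint 0 \<le> (1 / 16) * W.Yint 0"
    proof (rule mult_right_mono[OF _ W.level_nonneg(1)])
      have "1 * (\<kappa> * a) \<le> p * (\<kappa> * a)" using p \<kappa> a by (intro mult_right_mono) auto
      also have "\<dots> \<le> 1 / 16" using a(3)[folded \<kappa>_def] by (simp add: mult.assoc)
      finally show "\<kappa> * a \<le> 1 / 16" by simp
    qed
    \<comment> \<open>At most \<open>1 / 16\<close> of \<open>Yint 0\<close> is moved to the left;
      the resulting factor \<open>16 / 15\<close> is rounded up to 2.\<close>
    ultimately have Y1: "W.Yint 0 \<le> 2 * (\<kappa> * W.Xint 0)"
      using 1 W.level_nonneg(1)[of 0] by (simp add: algebra_simps)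
    have "(1 / 2) * W.Xint 0 \<le> (1 - p * a) * W.Xint 0" using a W.level_nonneg by (intro mult_right_mono) auto
    also have "\<dots> \<le> p * a * W.Yint 0 + lam * W.Rint 0" by (rule W.caccioppoli) simp
    finally have X1: "W.Xint 0 \<le> 2 * (p * a * W.Yint 0 + lam * W.Rint 0)" by simp
    \<comment> \<open>Far out, \<open>u \<le> \<eta>\<close> turns the integrand into a small
      multiple of \<open>w powr p\<close>; near the origin the weight is bounded and the integral of
      \<open>u powr q\<close> remains.\<close>
    have "W.Rint 0 \<le> (\<integral>x. \<eta> powr (q - p) * (of_bool (0 < W.w x) * W.w x powr p) + exp (a * R) powr p * u x powr q \<partial>PM N)"
      unfolding W.Rint_def
    proof (rule integral_mono_AE[OF W.level_integrable[OF W.weighted_integrable(3)]])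
      show "integrable (PM N) (\<lambda>x. \<eta> powr (q - p) * (of_bool (0 < W.w x) * W.w x powr p) + exp (a * R) powr p * u x powr q)"
        by (intro Bochner_Integration.integrable_add integrable_mult_right li u_integrable)
      show "AE x in PM N. of_bool (0 < W.w x) * (u x powr q * exp_weight N a b x powr p) \<le>
          \<eta> powr (q - p) * (of_bool (0 < W.w x) * W.w x powr p) + exp (a * R) powr p * u x powr q"
        using R AE_space
      proof eventually_elim
        case (elim x)
        note pos = exp_weight_bounds(1)[OF b, of N a x]
        show ?case
        proof (cases "0 < W.w x \<and> R \<le> japanese N x")
          case True
          have "u x powr q * exp_weight N a b x powr p = u x powr (q - p) * W.w x powr p"
            using u_nonneg[of x] pos by (simp add: W.w_def powr_mult powr_add[symmetric] mult.assoc[symmetric] mult.commute[of "exp_weight N a b x powr p"])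
          also have "\<dots> \<le> \<eta> powr (q - p) * W.w x powr p"
            using elim(1) True u_nonneg[of x] q by (intro mult_right_mono powr_mono2) auto
          finally show ?thesis using True by (simp add: add_increasing2)
        next
          case False
          show ?thesis
          proof (cases "0 < W.w x")
            case True
            then have "japanese N x \<le> R" using False by simp
            then have "exp (a * japanese N x) \<le> exp (a * R)" using a by simp
            then have "exp_weight N a b x \<le> exp (a * R)"
              using exp_weight_bounds(3)[OF b, of N a x] by linarith
            then have "exp_weight N a b x powr p \<le> exp (a * R) powr p"
              using pos p0 by (intro powr_mono2) auto
            then have "u x powr q * exp_weight N a b x powr p \<le> exp (a * R) powr p * u x powr q"
              by (subst mult.commute) (intro mult_right_mono, auto)
            then show ?thesis using True by (simp add: add_increasing)
          qed simp
        qed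
      qed
    qed
    also have "\<dots> = \<eta> powr (q - p) * W.Yint 0 + D"
      unfolding W.Yint_def D_def using li u_integrable by simp
    finally have "lam * W.Rint 0 \<le> lam * (\<eta> powr (q - p) * W.Yint 0 + D)" using lam by (intro mult_left_mono) auto
    then have "lam * W.Rint 0 \<le> W.Yint 0 / (16 * \<kappa>) + lam * D"
      using lam unfolding \<eta>(2) by (simp add: field_simps)
    with X1 have "W.Xint 0 \<le> 2 * (p * a * W.Yint 0 + W.Yint 0 / (16 * \<kappa>) + lam * D)" by simp
    then have "\<kappa> * W.Xint 0 \<le> \<kappa> * (2 * (p * a * W.Yint 0 + W.Yint 0 / (16 * \<kappa>) + lam * D))"
      using \<kappa> by (intro mult_left_mono) auto
    also have "\<dots> = 2 * (p * \<kappa> * a) * W.Yint 0 + W.Yint 0 / 8 + 2 * \<kappa> * (lam * D)"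
      using \<kappa> by (simp add: field_simps)
    also have "2 * (p * \<kappa> * a) * W.Yint 0 \<le> (1 / 8) * W.Yint 0"
      using a(3)[folded \<kappa>_def] by (intro mult_right_mono[OF _ W.level_nonneg(1)]) (simp add: mult.assoc)
    finally have "\<kappa> * W.Xint 0 \<le> W.Yint 0 / 4 + 2 * \<kappa> * (lam * D)" by simp
    then have "W.Yint 0 \<le> 8 * \<kappa> * (lam * D)" using Y1 by simp
    then show ?thesis by (simp add: Y)
  qed
  \<comment> \<open>Solves \<open>\<epsilon> * M powr p = 8 * \<kappa> * (lam * D) + 1\<close>; the
    summand 1 keeps \<open>M\<close> positive when \<open>D = 0\<close>.\<close>
  define M where "M = ((8 * \<kappa> * (lam * D) + 1) / \<epsilon>) powr (1 / p)"
  have nn: "0 \<le> 8 * \<kappa> * (lam * D)" using \<kappa> lam D by (intro mult_nonneg_nonneg) auto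
  have pos: "0 < (8 * \<kappa> * (lam * D) + 1) / \<epsilon>" using nn \<epsilon> by (intro divide_pos_pos) linarith+
  have M: "0 < M" unfolding M_def powr_gt_zero using less_imp_neq[OF pos] by (rule not_sym)
  have MD: "\<epsilon> * M powr p = 8 * \<kappa> * (lam * D) + 1"
  proof -
    have "(z powr (1 / p)) powr p = z" if "0 < z" for z
      using that p0 by (simp add: powr_powr)
    from this[OF pos] have "M powr p = (8 * \<kappa> * (lam * D) + 1) / \<epsilon>" unfolding M_def .
    then have "\<epsilon> * M powr p = \<epsilon> * ((8 * \<kappa> * (lam * D) + 1) / \<epsilon>)" by (simp only:)
    then show ?thesis using \<epsilon> by simp
  qed
  have "AE x in PM N. exp_weight N a (1 / real (Suc n)) x * u x \<le> 2 * M" for n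
    by (rule sup[OF exp_weighted[OF less_imp_le[OF a(1)] a(2)] M])
      (use Ybound[of "1 / real (Suc n)"] MD in auto)
  \<comment> \<open>A sequence of parameters \<open>b\<close> admits a single exceptional null set,
    so the limit \<open>b\<close> to 0 can be taken pointwise.\<close>
  then have "AE x in PM N. \<forall>n. exp_weight N a (1 / real (Suc n)) x * u x \<le> 2 * M"
    by (simp only: AE_all_countable) simp
  then have "AE x in PM N. u x \<le> 2 * M * exp (- a * japanese N x)"
  proof eventually_elim
    case (elim x)
    have "u x \<le> 2 * M * (1 / real (Suc n) + exp (- a * japanese N x))" for n
    proof -
      have "0 < 1 / real (Suc n) + exp (- a * japanese N x)" by (intro add_pos_pos) auto
      then show ?thesis
        using elim[rule_format, of n] by (simp add: exp_weight_eq pos_divide_le_eq)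
    qed
    moreover have "(\<lambda>n. 2 * M * (1 / real (Suc n) + exp (- a * japanese N x))) \<longlonglongrightarrow> 2 * M * (0 + exp (- a * japanese N x))"
      by (intro tendsto_intros LIMSEQ_Suc lim_1_over_n)
    ultimately show ?case by (intro LIMSEQ_le_const[of _ _ "u x"]) auto
  qed
  then show ?thesis using M by (intro exI[of _ "2 * M"]) simp
qed

end

section \<open>From the definitions of the statement to the locale, and conclusion\<close>

lemma approximable_cong_AE:
  assumes ap: "approximable N p A v g" and m: "v' \<in> borel_measurable (PM N)" and ae: "AE x in PM N. v x = v' x"
  shows "approximable N p A v' g"
proof (rule approximableI)
  show "pair_measurable N v' g"
    using approximable_measurable[OF ap] m by (simp add: pair_measurable_def)
  fix \<epsilon> :: real assume "\<epsilon> > 0"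
  from approximableD[OF ap this] obtain \<phi> where \<phi>: "\<phi> \<in> A"
    and e: "energy N p (\<lambda>x. v x - \<phi> x) (\<lambda>x i. g x i - gradient \<phi> x i) < ennreal \<epsilon>" .
  have "energy N p (\<lambda>x. v' x - \<phi> x) (\<lambda>x i. g x i - gradient \<phi> x i) =
      energy N p (\<lambda>x. v x - \<phi> x) (\<lambda>x i. g x i - gradient \<phi> x i)"
    unfolding energy_def by (rule nn_integral_cong_AE) (use ae in eventually_elim, simp)
  with \<phi> e show "\<exists>\<phi>\<in>A. energy N p (\<lambda>x. v' x - \<phi> x) (\<lambda>x i. g x i - gradient \<phi> x i) < ennreal \<epsilon>"
    by (intro bexI[of _ \<phi>]) simp_all
qed

lemma subsolution_of_weak_subsolution:
  assumes p: "1 < p" and q: "p < q" and N: "1 \<le> N" and sub: "p < real N \<longrightarrow> q < real N * p / (real N - p)"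
    and lam: "0 < lam" and \<Omega>: "openin (RN N) \<Omega>" and weak: "weak_subsolution N p q lam \<Omega> u"
  obtains v g where "subsolution N p q lam \<Omega> v g" "AE x in PM N. u x = v x"
proof -
  have uW: "u \<in> W1p_zero N p \<Omega>" and u0: "AE x in PM N. 0 \<le> u x"
    and ineq: "\<And>\<phi>. \<phi> \<in> nonneg_tests N \<Omega> \<Longrightarrow> (LINT x:\<Omega>|lebesgue_RN N.
          einner N (\<lambda>i. enorm N (weak_gradient N \<Omega> u x) powr (p - 2) * weak_gradient N \<Omega> u x i) (gradient \<phi> x))
       \<le> lam * (LINT x:\<Omega>|lebesgue_RN N. u x powr (q - 1) * \<phi> x)"
    using weak unfolding weak_subsolution_def nonneg_tests_def by (simp_all add: AE_lebesgue_iff)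
  obtain v0 g where ap0: "approximable N p (test_functions N \<Omega>) v0 g" and uv0: "AE x in PM N. u x = v0 x"
    and wg: "AE x in PM N. x \<in> \<Omega> \<longrightarrow> (\<forall>i<N. weak_gradient N \<Omega> u x i = g x i)"
    and out: "\<And>x i. x \<notin> \<Omega> \<Longrightarrow> v0 x = 0 \<and> g x i = 0"
    by (rule W1p_zero_approximable[OF p \<Omega> uW]) (rule that)
  \<comment> \<open>\<open>u\<close> is nonnegative almost everywhere, the locale asks for it
    everywhere; changing the representative on a null set leaves the approximating tests and
    \<open>g\<close> as they are.\<close>
  define v where "v x = max (v0 x) 0" for x
  have [measurable]: "v0 \<in> borel_measurable (PM N)"
    by (rule pair_measurableD(1)[OF approximable_measurable[OF ap0]])
  have vm [measurable]: "v \<in> borel_measurable (PM N)" unfolding v_def by measurable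
  have uv: "AE x in PM N. u x = v x" using uv0 u0 by eventually_elim (simp add: v_def)
  have "AE x in PM N. v0 x = v x" using uv0 u0 by eventually_elim (simp add: v_def)
  from approximable_cong_AE[OF ap0 vm this] have ap: "approximable N p (test_functions N \<Omega>) v g" .
  note mg = pair_measurable_comp[OF approximable_measurable[OF ap]]
  note me [measurable] = pair_measurableD(2)[OF approximable_measurable[OF ap]]
  have "subsolution N p q lam \<Omega> v g"
  proof
    show "0 \<le> v x" for x by (simp add: v_def)
    fix \<phi> assume \<phi>: "\<phi> \<in> nonneg_tests N \<Omega>"
    then have t: "\<phi> \<in> test_functions N \<Omega>" using nonneg_tests_subset by blast
    have [measurable]: "\<phi> \<in> borel_measurable (PM N)" by (rule smooth_measurable[OF test_smooth[OF t]])
    note m\<phi> = pair_measurable_comp[OF smooth_pair_measurable[OF test_smooth[OF t]]]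
    have "AE x in PM N. indicator \<Omega> x *\<^sub>R einner N (\<lambda>i. enorm N (weak_gradient N \<Omega> u x) powr (p - 2) * weak_gradient N \<Omega> u x i) (gradient \<phi> x) =
        einner N (flux N p (g x)) (gradient \<phi> x)"
      using wg AE_space
    proof eventually_elim
      case (elim x)
      show ?case
      proof (cases "x \<in> \<Omega>")
        case True
        then have eq: "weak_gradient N \<Omega> u x i = g x i" if "i < N" for i using elim that by blast
        have "enorm N (weak_gradient N \<Omega> u x) = enorm N (g x)" by (intro enorm_cong eq)
        then show ?thesis using True eq unfolding einner_def flux_def by (simp cong: sum.cong_simp)
      next
        case False
        have "gradient \<phi> x i = 0" if "i < N" for i
          unfolding gradient_def using test_outside(2)[OF t _ False that] elim(2) by (simp add: space_PM)
        then show ?thesis using False by (simp add: einner_def)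
      qed
    qed
    then have L: "(LINT x:\<Omega>|lebesgue_RN N.
        einner N (\<lambda>i. enorm N (weak_gradient N \<Omega> u x) powr (p - 2) * weak_gradient N \<Omega> u x i) (gradient \<phi> x)) =
        (\<integral>x. einner N (flux N p (g x)) (gradient \<phi> x) \<partial>PM N)"
      unfolding set_lebesgue_integral_def
    proof (rule integral_lebesgue_cong[rotated])
      have fm: "(\<lambda>x. flux N p (g x) i) \<in> borel_measurable (PM N)" if "i < N" for i
        unfolding flux_def using mg[OF that] by measurable
      show "(\<lambda>x. einner N (flux N p (g x)) (gradient \<phi> x)) \<in> borel_measurable (PM N)"
        by (rule einner_measurable[OF fm m\<phi>])
    qed
    have "AE x in PM N. indicator \<Omega> x *\<^sub>R (u x powr (q - 1) * \<phi> x) = v x powr (q - 1) * \<phi> x"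
      using uv AE_space
    proof eventually_elim
      case (elim x)
      then show ?case using test_outside(1)[OF t, of x] by (cases "x \<in> \<Omega>") (simp_all add: space_PM)
    qed
    then have R: "(LINT x:\<Omega>|lebesgue_RN N. u x powr (q - 1) * \<phi> x) = (\<integral>x. v x powr (q - 1) * \<phi> x \<partial>PM N)"
      unfolding set_lebesgue_integral_def by (rule integral_lebesgue_cong[rotated]) measurable
    show "(\<integral>x. einner N (flux N p (g x)) (gradient \<phi> x) \<partial>PM N) \<le> lam * (\<integral>x. v x powr (q - 1) * \<phi> x \<partial>PM N)"
      using ineq[OF \<phi>] unfolding L R .
  qed (use p q N sub lam ap in auto)
  with uv show ?thesis by (intro that)
qed

text \<open>Scaling \<open>\<phi>\<close> to unit norm makes it admissible in the infimum; if its
  norm is 0, the left-hand side is 0. A real \<open>l\<close> below the eigenvalue is used because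
  the eigenvalue itself may be infinite.\<close>

lemma poincare_of_lambda_p:
  assumes p: "1 < p" and l: "ennreal l \<le> lambda_p N p \<Omega>" and \<phi>: "\<phi> \<in> test_functions N \<Omega>"
  shows "ennreal l * (\<integral>\<^sup>+x. ennreal (\<bar>\<phi> x\<bar> powr p) \<partial>PM N) \<le> (\<integral>\<^sup>+x. ennreal (enorm N (gradient \<phi> x) powr p) \<partial>PM N)"
proof -
  define s where "s = (\<integral>x. \<bar>\<phi> x\<bar> powr p \<partial>PM N)"
  have int: "integrable (PM N) (\<lambda>x. \<bar>\<phi> x\<bar> powr p)" using test_powr_integrable(1)[OF \<phi>] p by simp
  have nn: "(\<integral>\<^sup>+x. ennreal (\<bar>\<phi> x\<bar> powr p) \<partial>PM N) = ennreal s"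
    unfolding s_def by (rule nn_integral_eq_integral[OF int]) simp
  have s0: "0 \<le> s" unfolding s_def by (intro Bochner_Integration.integral_nonneg) simp
  have sm: "smooth_RN N \<phi>" by (rule test_smooth[OF \<phi>])
  have [measurable]: "\<phi> \<in> borel_measurable (PM N)" by (rule smooth_measurable[OF sm])
  have me [measurable]: "(\<lambda>x. enorm N (gradient \<phi> x)) \<in> borel_measurable (PM N)"
    by (rule pair_measurableD(2)[OF smooth_pair_measurable[OF sm]])
  show ?thesis
  proof (cases "s = 0")
    case False
    then have s: "0 < s" using s0 by simp
    define c where "c = s powr (- (1 / p))"
    have c: "0 < c" using s by (simp add: c_def)
    have cp: "c powr p * s = 1"
    proof -
      have "c powr p = s powr (-1)" using p by (simp add: c_def powr_powr)
      then show ?thesis using s by (simp add: powr_minus)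
    qed
    have t: "(\<lambda>x. c * \<phi> x) \<in> test_functions N \<Omega>" by (rule test_cmult[OF \<phi>])
    have "(LINT x:\<Omega>|lebesgue_RN N. \<bar>c * \<phi> x\<bar> powr p) = (\<integral>x. c powr p * \<bar>\<phi> x\<bar> powr p \<partial>PM N)"
      unfolding set_lebesgue_integral_def
    proof (rule integral_lebesgue_cong)
      show "AE x in PM N. indicator \<Omega> x *\<^sub>R \<bar>c * \<phi> x\<bar> powr p = c powr p * \<bar>\<phi> x\<bar> powr p"
      proof (rule AE_I2)
        fix x assume "x \<in> space (PM N)"
        then show "indicator \<Omega> x *\<^sub>R \<bar>c * \<phi> x\<bar> powr p = c powr p * \<bar>\<phi> x\<bar> powr p"
          using test_outside(1)[OF \<phi>, of x] c by (cases "x \<in> \<Omega>") (simp_all add: space_PM abs_mult powr_mult)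
      qed
    qed measurable
    also have "\<dots> = 1" using cp by (simp add: s_def)
    finally have "Lp_norm N p \<Omega> (\<lambda>x. c * \<phi> x) = 1" by (simp add: Lp_norm_def)
    then have "lambda_p N p \<Omega> \<le> (\<integral>\<^sup>+x\<in>\<Omega>. ennreal (enorm N (gradient (\<lambda>x. c * \<phi> x) x) powr p) \<partial>lebesgue_RN N)"
      unfolding lambda_p_def using t by (intro INF_lower) simp
    also have "\<dots> = (\<integral>\<^sup>+x\<in>\<Omega>. ennreal (enorm N (gradient (\<lambda>x. c * \<phi> x) x) powr p) \<partial>PM N)"
      unfolding lebesgue_RN_def by (rule nn_integral_completion)
    also have "\<dots> \<le> (\<integral>\<^sup>+x. ennreal (c powr p) * ennreal (enorm N (gradient \<phi> x) powr p) \<partial>PM N)"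
    proof (rule nn_integral_mono)
      fix x assume "x \<in> space (PM N)"
      then have "enorm N (gradient (\<lambda>x. c * \<phi> x) x) = enorm N (\<lambda>i. c * gradient \<phi> x i)"
        using partial_cmult[OF sm] by (intro enorm_cong) (simp add: gradient_def space_PM)
      then have "enorm N (gradient (\<lambda>x. c * \<phi> x) x) powr p = c powr p * enorm N (gradient \<phi> x) powr p"
        unfolding enorm_scale using c by (simp add: powr_mult)
      then show "ennreal (enorm N (gradient (\<lambda>x. c * \<phi> x) x) powr p) * indicator \<Omega> x \<le>
          ennreal (c powr p) * ennreal (enorm N (gradient \<phi> x) powr p)"
        by (simp add: ennreal_mult' indicator_def)
    qed
    also have "\<dots> = ennreal (c powr p) * (\<integral>\<^sup>+x. ennreal (enorm N (gradient \<phi> x) powr p) \<partial>PM N)"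
      by (rule nn_integral_cmult) measurable
    finally have "ennreal s * ennreal l \<le> ennreal s * (ennreal (c powr p) * (\<integral>\<^sup>+x. ennreal (enorm N (gradient \<phi> x) powr p) \<partial>PM N))"
      using l by (intro mult_left_mono) auto
    also have "\<dots> = (\<integral>\<^sup>+x. ennreal (enorm N (gradient \<phi> x) powr p) \<partial>PM N)"
      using cp s by (simp add: mult.assoc[symmetric] ennreal_mult'[symmetric] mult.commute[of s])
    finally show ?thesis by (simp add: nn mult.commute)
  qed (simp add: nn)
qed

lemma Lp_norm_AE:
  assumes v: "v \<in> borel_measurable (PM N)" "\<And>x. 0 \<le> v x" "AE x in PM N. u x = v x"
    and out: "AE x in PM N. x \<notin> \<Omega> \<longrightarrow> u x = 0"
  shows "Lp_norm N q \<Omega> u = (\<integral>x. v x powr q \<partial>PM N) powr (1 / q)"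
proof -
  note [measurable] = v(1)
  have "AE x in PM N. indicator \<Omega> x *\<^sub>R \<bar>u x\<bar> powr q = v x powr q"
    using v(3) out
  proof eventually_elim
    case (elim x)
    then show ?case using v(2)[of x] by (cases "x \<in> \<Omega>") auto
  qed
  then have "(LINT x:\<Omega>|lebesgue_RN N. \<bar>u x\<bar> powr q) = (\<integral>x. v x powr q \<partial>PM N)"
    unfolding set_lebesgue_integral_def by (rule integral_lebesgue_cong[rotated]) measurable
  then show ?thesis by (simp add: Lp_norm_def)
qed

theorem theorem7p3:
  fixes p q :: real and l :: ennreal
  assumes "1 < p" and "p < q" and "0 < l"
  shows "\<exists>a::real. 0 < a \<and>
    (\<forall>(N::nat) (lam::real) (u :: point \<Rightarrow> real).
       1 \<le> N \<longrightarrow> (p < real N \<longrightarrow> q < real N * p / (real N - p)) \<longrightarrow> 0 < lam \<longrightarrow>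
       (\<exists>C::real. 0 < C \<and>
         (\<forall>\<Omega>. openin (RN N) \<Omega> \<longrightarrow> lambda_p N p \<Omega> = l \<longrightarrow> weak_subsolution N p q lam \<Omega> u \<longrightarrow>
           (AE x in lebesgue_RN N. \<bar>u x\<bar> \<le> C * Lp_norm N q \<Omega> u * exp (- a * enorm N x)))))"
proof -
  \<comment> \<open>\<open>l\<close> may be infinite, as for the empty domain. A positive real below
    it, chosen from \<open>l\<close> alone, keeps the rate independent of everything else.\<close>
  obtain l0 where l0: "0 < l0" "ennreal l0 \<le> l"
  proof (cases l)
    case (real r)
    then show ?thesis using assms(3) that[of r] by simp
  next
    case top
    then show ?thesis using that[of 1] by simp
  qed
  \<comment> \<open>Built from \<open>p\<close> and \<open>l0\<close> before \<open>N\<close>,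
    \<open>lam\<close> and \<open>u\<close> are introduced; the two arguments of \<open>min\<close>
    are the two smallness conditions of \<open>exponential_decay\<close>.\<close>
  define a where "a = min (1 / (2 * p)) (1 / (16 * p * (8 powr p / l0)))"
  have pos: "0 < 16 * p * (8 powr p / l0)" using assms l0 by simp
  have a: "0 < a" "p * a \<le> 1 / 2" "16 * p * (8 powr p / l0) * a \<le> 1"
  proof -
    show "0 < a" unfolding a_def using pos assms l0 by simp
    have "p * a \<le> p * (1 / (2 * p))" unfolding a_def using assms by (intro mult_left_mono) auto
    then show "p * a \<le> 1 / 2" using assms by simp
    have "16 * p * (8 powr p / l0) * a \<le> 16 * p * (8 powr p / l0) * (1 / (16 * p * (8 powr p / l0)))"
      unfolding a_def using pos by (intro mult_left_mono) auto
    also have "\<dots> = 1" using pos l0 assms by simp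
    finally show "16 * p * (8 powr p / l0) * a \<le> 1" .
  qed
  show ?thesis
  proof (rule exI[of _ a], intro conjI a(1) allI impI)
    fix N :: nat and lam :: real and u :: "point \<Rightarrow> real"
    assume N: "1 \<le> N" and sub: "p < real N \<longrightarrow> q < real N * p / (real N - p)" and lam: "0 < lam"
    show "\<exists>C>0. \<forall>\<Omega>. openin (RN N) \<Omega> \<longrightarrow> lambda_p N p \<Omega> = l \<longrightarrow> weak_subsolution N p q lam \<Omega> u \<longrightarrow>
           (AE x in lebesgue_RN N. \<bar>u x\<bar> \<le> C * Lp_norm N q \<Omega> u * exp (- a * enorm N x))"
    proof (cases "\<exists>\<Omega>. openin (RN N) \<Omega> \<and> lambda_p N p \<Omega> = l \<and> weak_subsolution N p q lam \<Omega> u")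
      case False
      then show ?thesis by (intro exI[of _ 1]) simp
    next
      case True
      \<comment> \<open>As \<open>u\<close> vanishes a.e. outside every admissible \<open>\<Omega>\<close>, its norm is the same on all of them and one bound serves them all.\<close>
      then obtain \<Omega>0 where \<Omega>0: "openin (RN N) \<Omega>0" "lambda_p N p \<Omega>0 = l" "weak_subsolution N p q lam \<Omega>0 u"
        by blast
      obtain v g where "subsolution N p q lam \<Omega>0 v g" and uv: "AE x in PM N. u x = v x"
        by (rule subsolution_of_weak_subsolution[OF assms(1,2) N sub lam \<Omega>0(1,3)]) (rule that)
      then interpret subsolution N p q lam \<Omega>0 v g by simp
      have poinc: "ennreal l0 * (\<integral>\<^sup>+x. ennreal (\<bar>\<phi> x\<bar> powr p) \<partial>PM N) \<le>
          (\<integral>\<^sup>+x. ennreal (enorm N (gradient \<phi> x) powr p) \<partial>PM N)" if "\<phi> \<in> test_functions N \<Omega>0" for \<phi>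
        by (rule poincare_of_lambda_p[OF assms(1) _ that]) (simp add: \<Omega>0(2) l0(2))
      obtain M where M: "0 < M" "AE x in PM N. v x \<le> M * exp (- a * japanese N x)"
        using exponential_decay[OF l0(1) poinc a] by blast
      define I where "I = (\<integral>x. v x powr q \<partial>PM N)"
      have I0: "0 \<le> I" unfolding I_def by (intro Bochner_Integration.integral_nonneg) simp
      have norm: "Lp_norm N q \<Omega> u = I powr (1 / q)" if "weak_subsolution N p q lam \<Omega> u" for \<Omega>
        unfolding I_def
      proof (rule Lp_norm_AE[OF u_measurable u_nonneg uv])
        show "AE x in PM N. x \<notin> \<Omega> \<longrightarrow> u x = 0"
          using that unfolding weak_subsolution_def W1p_zero_def by (simp add: AE_lebesgue_iff)
      qed
      have decay: "AE x in PM N. \<bar>u x\<bar> \<le> M * exp (- a * enorm N x)"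
        using M(2) uv
      proof eventually_elim
        case (elim x)
        have "a * enorm N x \<le> a * japanese N x"
          using enorm_le_japanese a(1) by (intro mult_left_mono) auto
        then have "M * exp (- a * japanese N x) \<le> M * exp (- a * enorm N x)"
          using M(1) by (intro mult_left_mono) auto
        then show ?case using elim u_nonneg[of x] by simp
      qed
      show ?thesis
      \<comment> \<open>If the norm is 0, then \<open>u\<close> vanishes almost everywhere and the
        constant 1 serves. Otherwise the norm is divided out of \<open>M\<close>, which is
        legitimate because \<open>C\<close> may depend on \<open>u\<close>.\<close>
      proof (cases "I = 0")
        case True
        have "AE x in PM N. v x powr q = 0"
          using integral_nonneg_eq_0_iff_AE[OF u_integrable(3)] True by (simp add: I_def)
        then have "AE x in PM N. \<bar>u x\<bar> \<le> 0" using uv by eventually_elim simp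
        then show ?thesis
          using True norm by (intro exI[of _ 1]) (simp add: AE_lebesgue_iff)
      next
        case False
        then have "0 < I powr (1 / q)" using I0 by simp
        then have C: "0 < M / I powr (1 / q)" "M / I powr (1 / q) * I powr (1 / q) = M" using M(1) by simp_all
        show ?thesis
        proof (intro exI[of _ "M / I powr (1 / q)"] conjI C(1) allI impI)
          fix \<Omega> assume "weak_subsolution N p q lam \<Omega> u"
          then show "AE x in lebesgue_RN N. \<bar>u x\<bar> \<le> M / I powr (1 / q) * Lp_norm N q \<Omega> u * exp (- a * enorm N x)"
            unfolding norm[OF \<open>weak_subsolution N p q lam \<Omega> u\<close>] C(2) using decay by (simp add: AE_lebesgue_iff)
        qed
      qed
    qed
  qed
qed

end
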